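(* Let $N=2^{\alpha_1}3^{\alpha_2}\cdots p_k^{\alpha_k}$ (with $\alpha_1\ge\cdots\ge\alpha_k\ge1$) be a $K$-champion number. (1) For $N$ sufficiently large, $\alpha_k=1$. (2) Let $j\ge1$ be a fixed integer and let $P_j$ be the largest prime such that $P_j^{\,j}$ divides $N$ (in particular $P_1=p_k$). As $N\to\infty$ through $K$-champion numbers, $$P_j\sim\left(\frac{a\log N}{j}\right)^{1/\rho}\sim j^{-1/\rho}P_1 .$$ (3) As $N\to\infty$ through $K$-champion numbers, $$\omega(N)\sim\rho\,a^{1/\rho}\,\frac{(\log N)^{1/\rho}}{\log\log N}.$$
   Context: $K$ is the Kalmár function: $K(1)=1$ and, for $n\ge 2$, $K(n)$ is the number of ordered factorizations $n=x_1x_2\cdots x_r$ ($r\ge1$ arbitrary) into integers $x_i\ge 2$. A positive integer $N$ is a $K$-champion if $K(M)<K(N)$ for every positive integer $M<N$; since $K(n)$ depends only on the multiset of exponents in the prime factorization of $n$, every $K$-champion has the form $2^{\alpha_1}3^{\alpha_2}\cdots p_k^{\alpha_k}$ with $\alpha_1\ge\cdots\ge\alpha_k\ge1$, where $p_i$ is the $i$-th prime. $\omega(N)$ is the number of distinct prime factors of $N$. $\rho=1.7286\ldots$ is the unique real number $>1$ with $\zeta(\rho)=2$ ($\zeta$ the Riemann zeta function); $a=1.10002\ldots$ is defined by $\frac1a=\sum_{i=1}^{\infty}\frac{\log p_i}{p_i^{\rho}-1}$. *)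

theory Defs
  imports
    "HOL-Analysis.Analysis"
    "HOL-Computational_Algebra.Primes"
    "HOL-Library.Infinite_Set"
    "HOL-Library.Landau_Symbols"
begin

definition Kalmar :: "nat \<Rightarrow> nat" where
  "Kalmar n =
     (if n = 1 then 1
      else card {xs :: nat list. xs \<noteq> [] \<and> (\<forall>x\<in>set xs. 2 \<le> x) \<and> prod_list xs = n})"

definition K_champion :: "nat \<Rightarrow> bool" where
  "K_champion N \<longleftrightarrow> 0 < N \<and> (\<forall>M. 0 < M \<and> M < N \<longrightarrow> Kalmar M < Kalmar N)"

definition champions_at_top :: "nat filter" where
  "champions_at_top = inf at_top (principal {N. K_champion N})"

text \<open>Indexed from 1, so that \<open>nth_prime 1 = 2\<close>; the value at 0 is never used.\<close>

definition nth_prime :: "nat \<Rightarrow> nat" where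
  "nth_prime i = enumerate {p :: nat. prime p} (i - 1)"

definition distinct_prime_count :: "nat \<Rightarrow> nat" where
  "distinct_prime_count N = card (prime_factors N)"

text \<open>The Riemann zeta function as its Dirichlet series, meaningful only for real \<open>s > 1\<close>.\<close>

definition real_zeta :: "real \<Rightarrow> real" where
  "real_zeta s = (\<Sum>n. 1 / real (Suc n) powr s)"

definition rho :: real where
  "rho = (THE s. 1 < s \<and> real_zeta s = 2)"

definition a_const :: real where
  "a_const =
     1 / (\<Sum>i. ln (real (nth_prime (Suc i))) / (real (nth_prime (Suc i)) powr rho - 1))"

text \<open>For a fixed \<open>j \<ge> 1\<close> and \<open>N > 0\<close> the set below is finite. It is empty when no \<open>j\<close>-th power
  of a prime divides \<open>N\<close>, and then the value is the unspecified constant \<open>Max {}\<close>.\<close>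

definition largest_prime_pow :: "nat \<Rightarrow> nat \<Rightarrow> nat" where
  "largest_prime_pow j N = Max {p. prime p \<and> p ^ j dvd N}"

end

theory Submission
  imports Defs "HOL-Complex_Analysis.Complex_Analysis" "HOL-Number_Theory.Number_Theory" "HOL-Real_Asymp.Real_Asymp"
begin

text \<open>
  Since \<open>2 K(n) = \<Sum>d | d dvd n. K(d)\<close> for \<open>n \<ge> 2\<close>, one has
  \<open>K(n) = 1/4 \<Sum>t. 2^(-t) \<Prod>p. (t + \<alpha>\<^sub>p choose \<alpha>\<^sub>p)\<close>, where \<open>\<alpha>\<^sub>p\<close> is the exponent of \<open>p\<close> in \<open>n\<close>.
  With \<open>\<tau>\<close> the mean of \<open>t\<close> under these weights, \<open>K(n p) / K(n)\<close> equals \<open>1 + \<tau> / (\<alpha>\<^sub>p + 1)\<close>, and \<open>\<tau>\<close> is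
  within \<open>O(sqrt M)\<close> of the point \<open>M\<close> with \<open>\<Prod>p. (1 + \<alpha>\<^sub>p / M) = 2\<close>. In a champion no odd primes can be
  profitably exchanged against a power of 2 of nearly the same size; exchanging many primes at once
  makes the rounding to a power of 2 negligible and forces \<open>1 + M / \<alpha>\<^sub>p\<close> to be close to \<open>p powr \<lambda>\<close> for a
  common exponent \<open>\<lambda>\<close>. Then \<open>\<Prod>p. (1 + \<alpha>\<^sub>p / M) = 2\<close> turns into \<open>\<zeta>(\<lambda>) = 2\<close> up to an error \<open>o(1 / ln M)\<close>,
  so \<open>\<lambda> - \<rho> = o(1 / ln M)\<close> and \<open>M powr (1 / \<lambda>)\<close> may be replaced by \<open>M powr (1 / \<rho>)\<close>. This gives
  \<open>P\<^sub>j \<sim> (M / j) powr (1 / \<rho>)\<close> and \<open>ln N \<sim> M / a\<close>. The prime number theorem (by Newman's Tauberian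
  argument) supplies the primes in short intervals for the exchanges, and \<open>\<omega>(N) = \<pi>(P\<^sub>1)\<close>.
\<close>

section \<open>Complex powers and the zeta function\<close>

text \<open>Trading odd primes with product m for 2^x rounds by up to one factor 2. This costs a
  bounded factor only because the exponent of 2 is comparable to M, which must be proved before the
  sizes of the other exponents can be estimated. One exchange thus determines
  \<open>1 + M / \<alpha>\<^sub>p\<close> at best up to a constant factor. Two refinements remove
  the loss. For small p, about (ln M)^2 copies of the same prime are moved, leaving a relative error
  O(1 / (ln M)^2) per copy; this works for p up to exp(sqrt(ln M)), and larger primes contribute a
  negligible tail. Near the threshold where the exponent is a fixed j, no such copies are available,
  and a fixed number of distinct primes of nearly equal size is moved instead; here primes in short
  intervals enter. The rate o(1 / ln M) is needed because an error d in \<lambda> changes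
  M^(1/\<lambda>) by a factor exp(O(d ln M)), which has to tend to 1. As long as at most sqrt M
  primes are moved, M and the mean \<tau> change by O(sqrt M) only, so all factors of an exchange
  are computed with the same M. The constants 600, 2000 and 3000 are merely convenient.\<close>

definition npow :: "nat \<Rightarrow> complex \<Rightarrow> complex" where
  "npow n s = exp (- s * of_real (ln (real n)))"

lemma norm_npow: "n > 0 \<Longrightarrow> norm (npow n s) = real n powr (- Re s)"
  by (simp add: npow_def powr_def)

lemma npow_mult: "m > 0 \<Longrightarrow> n > 0 \<Longrightarrow> npow (m * n) s = npow m s * npow n s"
  by (simp add: npow_def ln_mult flip: exp_add) (simp add: algebra_simps)

lemma npow_1 [simp]: "npow (Suc 0) s = 1"
  by (simp add: npow_def)

lemma npow_add: "npow n (s + t) = npow n s * npow n t"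
  by (simp add: npow_def algebra_simps flip: exp_add)

lemma npow_one: "n > 0 \<Longrightarrow> npow n 1 = 1 / of_nat n"
  by (simp add: npow_def exp_minus exp_of_real field_simps)

lemma npow_of_real: "n > 0 \<Longrightarrow> npow n (of_real x) = of_real (real n powr (- x))"
  by (simp add: npow_def powr_def flip: exp_of_real)

lemma npow_has_field_derivative [derivative_intros]:
  "(npow n has_field_derivative (- of_real (ln (real n)) * npow n s)) (at s within A)"
  unfolding npow_def by (auto intro!: derivative_eq_intros)

lemma rpow_has_vector_derivative:
  fixes x :: real and s :: complex
  assumes "x > 0"
  shows "((\<lambda>x. exp (- s * of_real (ln x))) has_vector_derivative
           (- s * exp (- (s + 1) * of_real (ln x)))) (at x within A)"
proof -
  have e: "exp (- (s + 1) * of_real (ln x)) = exp (- s * of_real (ln x)) / of_real x"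
    using assms by (simp add: ring_distribs exp_diff exp_of_real)
  have "((\<lambda>x. of_real (ln x) :: complex) has_vector_derivative of_real (1 / x)) (at x within A)"
    using assms by (intro has_vector_derivative_real_field derivative_eq_intros) auto
  then have "((\<lambda>x. - s * of_real (ln x)) has_vector_derivative (- s * of_real (1/x))) (at x within A)"
    by (intro has_vector_derivative_mult_right)
  from field_vector_diff_chain_within[OF this, of exp "exp (- s * of_real (ln x))"]
  have "((exp \<circ> (\<lambda>x. - s * of_real (ln x))) has_vector_derivative
           (- s * of_real (1/x)) * exp (- s * of_real (ln x))) (at x within A)"
    by (auto intro: DERIV_subset[OF DERIV_exp])
  then show ?thesis using e by (simp add: o_def field_simps)
qed

lemma norm_rpow: "x > 0 \<Longrightarrow> norm (exp (- s * of_real (ln x))) = x powr (- Re s)" for x :: real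
  by (simp add: powr_def)

lemma rpow_diff_bound:
  fixes x y :: real
  assumes "1 \<le> x" "x \<le> y" "Re s \<ge> -1"
  shows "norm (exp (- s * of_real (ln y)) - exp (- s * of_real (ln x)))
           \<le> norm s * x powr (- Re s - 1) * (y - x)"
proof -
  have "norm (exp (- s * of_real (ln y)) - exp (- s * of_real (ln x)))
          \<le> (norm s * x powr (- Re s - 1)) * norm (y - x)"
  proof (rule differentiable_bound[where S = "{x..y}"])
    fix z assume z: "z \<in> {x..y}"
    show "((\<lambda>x. exp (- s * of_real (ln x))) has_derivative
        (\<lambda>h. h *\<^sub>R (- s * exp (- (s + 1) * of_real (ln z))))) (at z within {x..y})"
      using rpow_has_vector_derivative[of z s "{x..y}"] z assms
      by (simp add: has_vector_derivative_def)
    have "z powr (- Re s - 1) \<le> x powr (- Re s - 1)"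
      using z assms by (intro powr_mono2') auto
    then show "onorm (\<lambda>h. h *\<^sub>R (- s * exp (- (s + 1) * of_real (ln z)))) \<le> norm s * x powr (- Re s - 1)"
      using z assms norm_rpow[of z "s + 1"]
      by (subst onorm_scaleR_left)
         (auto simp: norm_mult onorm_id intro!: mult_left_mono bounded_linear_ident)
  qed (use assms in auto)
  then show ?thesis using assms by simp
qed

text \<open>This is \<open>(s - 1)\<close> times the difference between \<open>n^(-s)\<close> and
  the integral of \<open>x^(-s)\<close> over \<open>[n, n + 1]\<close>. The factor cancels the pole
  of zeta, so \<open>s = 1\<close> is no special case.\<close>

definition zterm :: "complex \<Rightarrow> nat \<Rightarrow> complex" where
  "zterm s n = (s - 1) * npow n s + npow (Suc n) (s - 1) - npow n (s - 1)"

text \<open>The term is the error of the linearization of \<open>x^(1 - s)\<close> at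
  \<open>x = n\<close>, hence a second-order quantity; the factor \<open>1 / n\<close> gained over
  \<open>n^(-s)\<close> carries the series down to \<open>Re s > 0\<close>.\<close>

lemma norm_zterm:
  assumes "n > 0" "Re s \<ge> 0"
  shows "norm (zterm s n) \<le> norm s * norm (s - 1) * real n powr (- Re s - 1)"
proof -
  let ?f = "\<lambda>x::real. exp (- (s - 1) * of_real (ln x))"
  let ?f' = "\<lambda>x::real. - (s - 1) * exp (- ((s - 1) + 1) * of_real (ln x))"
  have "norm (?f (real (Suc n)) - ?f (real n) - (real (Suc n) - real n) *\<^sub>R ?f' (real n))
     \<le> norm (real (Suc n) - real n) * (norm s * norm (s - 1) * real n powr (- Re s - 1))"
  proof (rule vector_differentiable_bound_linearization[where S = "{real n..real (Suc n)}"
      and f' = ?f' and ?x0.0 = "real n"])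
    fix x assume x: "x \<in> {real n..real (Suc n)}"
    show "(?f has_vector_derivative ?f' x) (at x within {real n..real (Suc n)})"
      using x assms by (intro rpow_has_vector_derivative) auto
    have "norm (exp (- s * of_real (ln x)) - exp (- s * of_real (ln (real n))))
           \<le> norm s * real n powr (- Re s - 1) * (x - real n)"
      using x assms by (intro rpow_diff_bound) auto
    also have "\<dots> \<le> norm s * real n powr (- Re s - 1) * 1"
      using x by (intro mult_left_mono) auto
    finally have "norm (s - 1) * norm (exp (- s * of_real (ln x)) - exp (- s * of_real (ln (real n))))
      \<le> norm (s - 1) * (norm s * real n powr (- Re s - 1))" by (intro mult_left_mono) auto
    moreover have "?f' x - ?f' (real n) =
        - ((s - 1) * (exp (- s * of_real (ln x)) - exp (- s * of_real (ln (real n)))))"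
      by (simp add: algebra_simps)
    ultimately show "norm (?f' x - ?f' (real n)) \<le> norm s * norm (s - 1) * real n powr (- Re s - 1)"
      by (simp only: norm_minus_cancel norm_mult mult.left_commute mult.assoc)
  qed (auto simp: closed_segment_eq_real_ivl)
  then show ?thesis
    by (simp add: zterm_def npow_def algebra_simps)
qed

lemma summable_Suc_powr: "a > 1 \<Longrightarrow> summable (\<lambda>n. real (Suc n) powr (- a))"
  by (subst summable_Suc_iff) (simp add: summable_real_powr_iff)

text \<open>Weierstrass test on balls whose radius is half the distance to the line
  \<open>Re s = c\<close>: there the exponents stay below \<open>-1 - d\<close>, and the continuous
  factor \<open>B\<close> is bounded by compactness. This permits termwise differentiation.\<close>

lemma dirichlet_like_series:
  fixes f f' :: "nat \<Rightarrow> complex \<Rightarrow> complex" and B :: "complex \<Rightarrow> real"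
  assumes der: "\<And>n s. Re s > c \<Longrightarrow> (f n has_field_derivative f' n s) (at s)"
    and bd: "\<And>n s. Re s > c \<Longrightarrow> norm (f n s) \<le> B s * real (Suc n) powr (- Re s - 1 + c)"
    and B: "continuous_on UNIV B" "\<And>s. B s \<ge> 0"
  shows "\<exists>g g'. \<forall>s\<in>{s. Re s > c}. (\<lambda>n. f n s) sums g s \<and> (\<lambda>n. f' n s) sums g' s
           \<and> (g has_field_derivative g' s) (at s)"
proof (rule series_and_derivative_comparison_local)
  show "open {s. Re s > c}" by (simp add: open_halfspace_Re_gt)
  fix x assume "x \<in> {s. Re s > c}"
  then have x: "Re x > c" by simp
  define d where "d = (Re x - c) / 2"
  have d: "d > 0" using x by (simp add: d_def)
  have "compact (B ` cball x d)"
    using B by (intro compact_continuous_image) (auto intro: continuous_on_subset)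
  then obtain K where K: "\<And>y. y \<in> cball x d \<Longrightarrow> B y \<le> K"
    by (meson bounded_imp_bdd_above bdd_above.E compact_imp_bounded imageI)
  have "norm (f n y) \<le> K * real (Suc n) powr (- 1 - d)"
    if y: "y \<in> ball x d \<inter> {s. Re s > c}" for n y
  proof -
    have "norm (y - x) < d" using y by (simp add: dist_norm norm_minus_commute)
    then have "\<bar>Re y - Re x\<bar> < d" using abs_Re_le_cmod[of "y - x"] by simp
    then have "Re y > c + d" by (simp add: d_def abs_if field_simps split: if_splits)
    then have "real (Suc n) powr (- Re y - 1 + c) \<le> real (Suc n) powr (- 1 - d)"
      by (intro powr_mono) auto
    then have "B y * real (Suc n) powr (- Re y - 1 + c) \<le> K * real (Suc n) powr (- 1 - d)"
      using y K[of y] B(2)[of y] by (intro mult_mono) (auto simp: dist_norm)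
    then show ?thesis using bd[of y n] y by auto
  qed
  moreover have "summable (\<lambda>n. K * real (Suc n) powr (- 1 - d))"
    using d summable_Suc_powr[of "1 + d"] by (intro summable_mult) (simp add: algebra_simps)
  ultimately show "\<exists>d h. 0 < d \<and> summable h \<and>
      (\<forall>\<^sub>F n in sequentially. \<forall>y\<in>ball x d \<inter> {s. Re s > c}. norm (f n y) \<le> h n)"
    using d by (intro exI[of _ d] exI[of _ "\<lambda>n. K * real (Suc n) powr (- 1 - d)"]) auto
qed (use der in auto)

text \<open>\<open>zfun s = (s - 1) * \<zeta>(s)\<close>, defined by a series that converges already for \<open>Re s > 0\<close>.\<close>

definition zfun :: "complex \<Rightarrow> complex" where
  "zfun s = 1 + (\<Sum>n. zterm s (Suc n))"

lemma zfun_holomorphic: "zfun holomorphic_on {s. Re s > 0}"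
proof -
  have "\<exists>g g'. \<forall>s\<in>{s. Re s > 0}. (\<lambda>n. zterm s (Suc n)) sums g s \<and>
      (\<lambda>n. npow (Suc n) s + (s - 1) * (- of_real (ln (real (Suc n))) * npow (Suc n) s)
          + (- of_real (ln (real (Suc (Suc n)))) * npow (Suc (Suc n)) (s - 1))
          - (- of_real (ln (real (Suc n))) * npow (Suc n) (s - 1))) sums g' s
       \<and> (g has_field_derivative g' s) (at s)"
  proof (rule dirichlet_like_series[where B = "\<lambda>s. norm s * norm (s - 1)"])
    fix n s assume "Re s > 0"
    show "((\<lambda>s. zterm s (Suc n)) has_field_derivative
       (npow (Suc n) s + (s - 1) * (- of_real (ln (real (Suc n))) * npow (Suc n) s)
          + (- of_real (ln (real (Suc (Suc n)))) * npow (Suc (Suc n)) (s - 1))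
          - (- of_real (ln (real (Suc n))) * npow (Suc n) (s - 1)))) (at s)"
      unfolding zterm_def npow_def
      by (rule derivative_eq_intros refl | simp add: algebra_simps)+
  next
    fix n s assume "Re s > 0"
    then show "norm (zterm s (Suc n)) \<le> norm s * norm (s - 1) * real (Suc n) powr (- Re s - 1 + 0)"
      using norm_zterm[of "Suc n" s] by simp
  qed (auto intro!: continuous_intros)
  then obtain g g' where g: "\<And>s. Re s > 0 \<Longrightarrow> (\<lambda>n. zterm s (Suc n)) sums g s"
      "\<And>s. Re s > 0 \<Longrightarrow> (g has_field_derivative g' s) (at s)" by auto
  have "g holomorphic_on {s. Re s > 0}"
    using g(2) by (auto simp: holomorphic_on_open open_halfspace_Re_gt)
  then have "(\<lambda>s. 1 + g s) holomorphic_on {s. Re s > 0}"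
    by (intro holomorphic_intros)
  then show ?thesis
    by (rule holomorphic_transform) (use g(1) in \<open>auto simp: zfun_def sums_iff\<close>)
qed

lemma zfun_1 [simp]: "zfun 1 = 1"
  by (simp add: zfun_def zterm_def npow_def)

section \<open>Dirichlet series of zeta and of the von Mangoldt function\<close>

definition lzeta :: "complex \<Rightarrow> complex" where
  "lzeta s = (\<Sum>n. npow (Suc n) s)"

text \<open>On \<open>Re s > 1\<close> this is the negative logarithmic derivative of zeta.\<close>

definition lmangoldt :: "complex \<Rightarrow> complex" where
  "lmangoldt s = (\<Sum>n. mangoldt (Suc n) * npow (Suc n) s)"

lemma summable_norm_npow: "Re s > 1 \<Longrightarrow> summable (\<lambda>n. norm (npow (Suc n) s))"
  by (simp only: norm_npow zero_less_Suc summable_Suc_powr)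

lemma summable_ln_powr:
  assumes "a > 1"
  shows "summable (\<lambda>n. ln (real (Suc n)) * real (Suc n) powr (- a))"
proof (rule summable_comparison_test)
  define d where "d = (a - 1) / 2"
  have d: "d > 0" using assms by (simp add: d_def)
  show "summable (\<lambda>n. (1 / d) * real (Suc n) powr (- (1 + d)))"
    using d by (intro summable_mult summable_Suc_powr) auto
  have "norm (ln (real (Suc n)) * real (Suc n) powr (- a)) \<le> (1 / d) * real (Suc n) powr (- (1 + d))" for n
  proof -
    have "ln (real (Suc n)) * real (Suc n) powr (- a) \<le> (real (Suc n) powr d / d) * real (Suc n) powr (- a)"
      using d by (intro mult_right_mono ln_powr_bound) auto
    also have "\<dots> = (1 / d) * real (Suc n) powr (d - a)"
      by (simp only: powr_add[symmetric] times_divide_eq_left mult_1 diff_conv_add_uminus)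
    also have "d - a = - (1 + d)" by (simp add: d_def field_simps)
    finally show ?thesis by (simp add: abs_mult)
  qed
  then show "\<exists>N. \<forall>n\<ge>N. norm (ln (real (Suc n)) * real (Suc n) powr (- a)) \<le> (1 / d) * real (Suc n) powr (- (1 + d))"
    by blast
qed

lemma summable_norm_ln_npow:
  assumes "Re s > 1"
  shows "summable (\<lambda>n. norm (of_real (ln (real (Suc n))) * npow (Suc n) s))"
  using summable_ln_powr[OF assms] by (simp add: norm_mult norm_npow)

lemma summable_norm_mangoldt_npow:
  assumes "Re s > 1"
  shows "summable (\<lambda>n. norm (mangoldt (Suc n) * npow (Suc n) s))"
proof (rule summable_comparison_test)
  show "summable (\<lambda>n. norm (of_real (ln (real (Suc n))) * npow (Suc n) s))"
    by (rule summable_norm_ln_npow[OF assms])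
  have "norm (norm (mangoldt (Suc n) * npow (Suc n) s))
          \<le> norm (of_real (ln (real (Suc n))) * npow (Suc n) s)" for n
    using mangoldt_le[of "Suc n"] mangoldt_nonneg[of "Suc n"]
    by (simp add: norm_mult mult_right_mono del: of_nat_Suc)
  then show "\<exists>N. \<forall>n\<ge>N. norm (norm (mangoldt (Suc n) * npow (Suc n) s))
          \<le> norm (of_real (ln (real (Suc n))) * npow (Suc n) s)" by blast
qed

lemma has_sum_Suc:
  fixes F :: "nat \<Rightarrow> complex"
  assumes "summable (\<lambda>n. norm (F (Suc n)))"
  shows "(F has_sum (\<Sum>n. F (Suc n))) {0<..}" "(\<lambda>n. norm (F n)) summable_on {0<..}"
proof -
  have bij: "bij_betw Suc UNIV {0<..}"
    by (rule bij_betwI[of _ _ _ "\<lambda>n. n - 1"]) auto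
  have "((\<lambda>n. F (Suc n)) has_sum (\<Sum>n. F (Suc n))) UNIV"
    by (rule norm_summable_imp_has_sum[OF assms summable_sums[OF summable_norm_cancel[OF assms]]])
  then show "(F has_sum (\<Sum>n. F (Suc n))) {0<..}"
    using has_sum_reindex_bij_betw[OF bij] by blast
  have "(\<lambda>n. norm (F (Suc n))) summable_on UNIV"
    using assms by (simp add: norm_summable_imp_summable_on)
  then show "(\<lambda>n. norm (F n)) summable_on {0<..}"
    using summable_on_reindex_bij_betw[OF bij, of "\<lambda>n. norm (F n)"] by blast
qed

text \<open>Dirichlet product: the absolutely summable double series over pairs
  \<open>(m, d)\<close> is reindexed by \<open>n = m * d\<close> and the divisor \<open>d\<close> of
  \<open>n\<close>, and the von Mangoldt function sums to \<open>ln n\<close> over the divisors of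
  \<open>n\<close>.\<close>

lemma lmangoldt_times_lzeta:
  assumes s: "Re s > 1"
  shows "lmangoldt s * lzeta s = (\<Sum>n. of_real (ln (real (Suc n))) * npow (Suc n) s)"
proof -
  let ?P = "{0::nat<..}" and ?h = "\<lambda>d. mangoldt d * npow d s"
  have l2: "(?h has_sum lmangoldt s) ?P" "(\<lambda>d. norm (?h d)) summable_on ?P"
    using has_sum_Suc[of ?h, OF summable_norm_mangoldt_npow[OF s]] by (auto simp: lmangoldt_def)
  have z2: "((\<lambda>n. npow n s) has_sum lzeta s) ?P" "(\<lambda>n. norm (npow n s)) summable_on ?P"
    using has_sum_Suc[of "\<lambda>n. npow n s", OF summable_norm_npow[OF s]] by (auto simp: lzeta_def)
  let ?F = "\<lambda>(m, d). npow m s * ?h d"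
  have abs: "(\<lambda>x. norm (?F x)) summable_on ?P \<times> ?P"
    unfolding Infinite_Sum.abs_summable_on_Sigma_iff
  proof (intro conjI ballI)
    fix m assume "m \<in> ?P"
    show "(\<lambda>y. norm (case (m, y) of (m, d) \<Rightarrow> npow m s * ?h d)) summable_on ?P"
      using l2(2) by (simp add: norm_mult summable_on_cmult_right mult.assoc)
  next
    have eq: "norm (\<Sum>\<^sub>\<infinity>y\<in>?P. norm (case (m, y) of (m, d) \<Rightarrow> npow m s * ?h d))
        = norm (npow m s) * (\<Sum>\<^sub>\<infinity>y\<in>?P. norm (?h y))" for m
      by (simp add: norm_mult infsum_cmult_right' infsum_nonneg mangoldt_nonneg)
    show "(\<lambda>m. norm (\<Sum>\<^sub>\<infinity>y\<in>?P. norm (case (m, y) of (m, d) \<Rightarrow> npow m s * ?h d))) summable_on ?P"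
      unfolding eq using z2(2) by (intro summable_on_cmult_left) auto
  qed
  then have sm: "?F summable_on ?P \<times> ?P" by (rule abs_summable_summable)
  have "infsum ?F (?P \<times> ?P) = (\<Sum>\<^sub>\<infinity>m\<in>?P. \<Sum>\<^sub>\<infinity>d\<in>?P. npow m s * ?h d)"
    using infsum_Sigma'_banach[of "\<lambda>m d. npow m s * ?h d" ?P "\<lambda>_. ?P"] sm by simp
  also have "\<dots> = (\<Sum>\<^sub>\<infinity>m\<in>?P. npow m s * lmangoldt s)"
    using infsumI[OF l2(1)] by (simp add: infsum_cmult_right')
  also have "\<dots> = lmangoldt s * lzeta s"
    using infsumI[OF z2(1)] by (simp add: infsum_cmult_left' infsum_cmult_right' mult.commute)
  finally have 1: "infsum ?F (?P \<times> ?P) = lmangoldt s * lzeta s" .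
  let ?D = "Sigma ?P (\<lambda>n. {d. d dvd n})" and ?g = "\<lambda>(n::nat, d). (n div d, d)"
  have bij: "bij_betw ?g ?D (?P \<times> ?P)"
    by (rule bij_betwI[of _ _ _ "\<lambda>(m, d). (m * d, d)"]) (auto intro!: Nat.gr0I elim!: dvdE)
  have eq: "?F (?g x) = (case x of (n, d) \<Rightarrow> mangoldt d * npow n s)" if "x \<in> ?D" for x
  proof -
    obtain n d where x: "x = (n, d)" by (cases x)
    have nd: "n > 0" "d dvd n" using that x by auto
    then obtain k where k0: "n = d * k" by (auto elim: dvdE)
    have k: "n = d * k" "d > 0" "k > 0" using k0 nd by (auto intro: Nat.gr0I)
    then have "npow n s = npow k s * npow d s" by (simp add: npow_mult mult.commute)
    then show ?thesis using x k by simp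
  qed
  have "(\<lambda>x. ?F (?g x)) summable_on ?D"
    using sm by (subst summable_on_reindex_bij_betw[OF bij]) 
  then have sm2: "(\<lambda>(n, d). mangoldt d * npow n s) summable_on ?D"
    using summable_on_cong[of ?D "\<lambda>x. ?F (?g x)", OF eq] by blast
  have "infsum ?F (?P \<times> ?P) = infsum (\<lambda>x. ?F (?g x)) ?D"
    by (rule infsum_reindex_bij_betw[OF bij, symmetric])
  also have "\<dots> = infsum (\<lambda>(n, d). mangoldt d * npow n s) ?D"
    by (rule infsum_cong) (use eq in blast)
  also have "\<dots> = (\<Sum>\<^sub>\<infinity>n\<in>?P. \<Sum>\<^sub>\<infinity>d\<in>{d. d dvd n}. mangoldt d * npow n s)"
    using infsum_Sigma'_banach[of "\<lambda>n d. mangoldt d * npow n s" ?P "\<lambda>n. {d. d dvd n}"] sm2 by simp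
  also have "\<dots> = (\<Sum>\<^sub>\<infinity>n\<in>?P. of_real (ln (real n)) * npow n s)"
    by (rule infsum_cong) (simp add: mangoldt_sum flip: sum_distrib_right)
  also have "\<dots> = (\<Sum>n. of_real (ln (real (Suc n))) * npow (Suc n) s)"
    using has_sum_Suc(1)[of "\<lambda>n. of_real (ln (real n)) * npow n s", OF summable_norm_ln_npow[OF s]]
    by (rule infsumI)
  finally show ?thesis using 1 by simp
qed

lemma zfun_eq_lzeta:
  assumes s: "Re s > 1"
  shows "zfun s = (s - 1) * lzeta s"
proof -
  have lim: "(\<lambda>n. npow (Suc n) (s - 1)) \<longlonglongrightarrow> 0"
  proof (rule tendsto_norm_zero_cancel)
    have "(\<lambda>n. real (Suc n) powr (- (Re s - 1))) \<longlonglongrightarrow> 0"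
      using s by real_asymp
    then show "(\<lambda>n. norm (npow (Suc n) (s - 1))) \<longlonglongrightarrow> 0"
      by (simp add: norm_npow)
  qed
  have "(\<lambda>n. npow (Suc n) s) sums lzeta s"
    unfolding lzeta_def by (rule summable_sums[OF summable_norm_cancel[OF summable_norm_npow[OF s]]])
  then have "(\<lambda>n. (s - 1) * npow (Suc n) s + (npow (Suc (Suc n)) (s - 1) - npow (Suc n) (s - 1)))
       sums ((s - 1) * lzeta s + (0 - npow (Suc 0) (s - 1)))"
    by (intro sums_add sums_mult telescope_sums[OF lim])
  then show ?thesis
    by (simp add: zfun_def zterm_def sums_iff algebra_simps)
qed

text \<open>Logarithmic derivative of \<open>(s - 1)\<close> times zeta, multiplied out because
  non-vanishing of \<open>zfun\<close> is only derived later, from this very identity.\<close>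

lemma deriv_zfun:
  assumes s: "Re s > 1"
  shows "lmangoldt s * zfun s = zfun s / (s - 1) - deriv zfun s"
proof -
  have "\<exists>g g'. \<forall>s\<in>{s. Re s > 1}. (\<lambda>n. npow (Suc n) s) sums g s \<and>
      (\<lambda>n. - of_real (ln (real (Suc n))) * npow (Suc n) s) sums g' s
       \<and> (g has_field_derivative g' s) (at s)"
  proof (rule dirichlet_like_series[where B = "\<lambda>s. 1"])
    fix n s
    show "(npow (Suc n) has_field_derivative - of_real (ln (real (Suc n))) * npow (Suc n) s) (at s)"
      by (rule npow_has_field_derivative)
  next
    fix n s
    show "norm (npow (Suc n) s) \<le> 1 * real (Suc n) powr (- Re s - 1 + 1)"
      by (simp add: norm_npow)
  qed auto
  then obtain g g' where g: "\<And>s. Re s > 1 \<Longrightarrow> (\<lambda>n. npow (Suc n) s) sums g s"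
      "\<And>s. Re s > 1 \<Longrightarrow> (\<lambda>n. - of_real (ln (real (Suc n))) * npow (Suc n) s) sums g' s"
      "\<And>s. Re s > 1 \<Longrightarrow> (g has_field_derivative g' s) (at s)" by auto
  have eqg: "zfun w = (w - 1) * g w" if "Re w > 1" for w
    using zfun_eq_lzeta[OF that] g(1)[OF that] by (simp add: lzeta_def sums_iff)
  have "((\<lambda>w. (w - 1) * g w) has_field_derivative (g s + (s - 1) * g' s)) (at s)"
    using g(3)[OF s] by (auto intro!: derivative_eq_intros)
  then have "(zfun has_field_derivative (g s + (s - 1) * g' s)) (at s)"
    by (rule has_field_derivative_transform_within_open[of _ _ _ "{w. Re w > 1}"])
       (use s eqg in \<open>auto simp: open_halfspace_Re_gt\<close>)
  then have d: "deriv zfun s = g s + (s - 1) * g' s" by (rule DERIV_imp_deriv)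
  have "(\<lambda>n. - (- of_real (ln (real (Suc n))) * npow (Suc n) s)) sums (- g' s)"
    by (rule sums_minus[OF g(2)[OF s]])
  then have "lmangoldt s * lzeta s = - g' s"
    using lmangoldt_times_lzeta[OF s] by (simp add: sums_iff)
  moreover have "lzeta s = g s" using g(1)[OF s] by (simp add: lzeta_def sums_iff)
  moreover have "s \<noteq> 1" using s by auto
  moreover have "lmangoldt s * zfun s = (s - 1) * (lmangoldt s * g s)"
    using eqg[OF s] by (simp add: mult_ac)
  ultimately show ?thesis
    using eqg[OF s] d by simp
qed

lemma lmangoldt_eq:
  assumes "Re s > 1" "zfun s \<noteq> 0"
  shows "lmangoldt s = 1 / (s - 1) - deriv zfun s / zfun s"
  using deriv_zfun[OF assms(1)] assms(2) by (simp add: field_simps)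

section \<open>Non-vanishing of zeta on the closed half-plane \<open>Re s >= 1\<close>\<close>

lemma filterlim_add_of_real_at_right:
  "((\<lambda>e::real. s + of_real e :: complex) \<longlongrightarrow> s) (at_right 0)"
  by (rule tendsto_eq_intros refl | simp)+

lemma lmangoldt_limit_1: "((\<lambda>e. of_real e * lmangoldt (1 + of_real e)) \<longlongrightarrow> 1) (at_right 0)"
proof -
  have c: "continuous_on {s. Re s > 0} zfun" "continuous_on {s. Re s > 0} (deriv zfun)"
    using zfun_holomorphic by (auto intro!: holomorphic_on_imp_continuous_on holomorphic_deriv
        simp: open_halfspace_Re_gt)
  have i: "isCont zfun 1" "isCont (deriv zfun) 1"
    using c by (auto simp: continuous_on_eq_continuous_at open_halfspace_Re_gt)
  note t = isCont_tendsto_compose[OF i(1) filterlim_add_of_real_at_right]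
    isCont_tendsto_compose[OF i(2) filterlim_add_of_real_at_right]
  have nz: "eventually (\<lambda>e. zfun (1 + of_real e) \<noteq> 0) (at_right 0)"
    using t(1) by (rule tendsto_imp_eventually_ne) simp
  have "((\<lambda>e. 1 - of_real e * deriv zfun (1 + of_real e) / zfun (1 + of_real e)) \<longlongrightarrow>
      1 - of_real 0 * deriv zfun 1 / zfun 1) (at_right 0)"
    by (intro tendsto_intros t) auto
  then have lim: "((\<lambda>e. 1 - of_real e * deriv zfun (1 + of_real e) / zfun (1 + of_real e)) \<longlongrightarrow> 1) (at_right 0)"
    by simp
  show ?thesis
  proof (rule Lim_transform_eventually[OF lim])
    show "\<forall>\<^sub>F e in at_right 0. 1 - of_real e * deriv zfun (1 + of_real e) / zfun (1 + of_real e)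
        = of_real e * lmangoldt (1 + of_real e)"
      using nz eventually_at_right_less[of "0::real"]
      by eventually_elim (simp add: lmangoldt_eq field_simps)
  qed
qed

text \<open>The logarithmic derivative of \<open>zfun\<close> has at \<open>s0\<close> a residue
  equal to the order of the zero, and \<open>1 / (s - 1)\<close> is regular at \<open>s0\<close>.
  The factorization \<open>zfun w = g w * (w - s0) ^ k\<close> with \<open>k = 0\<close> allowed
  treats zeros and non-zeros alike.\<close>

lemma lmangoldt_limit:
  assumes s0: "Re s0 \<ge> 1" "s0 \<noteq> 1"
  shows "\<exists>m::nat. (zfun s0 = 0 \<longrightarrow> m > 0) \<and>
           ((\<lambda>e. of_real e * lmangoldt (s0 + of_real e)) \<longlongrightarrow> - of_nat m) (at_right 0)"
proof -
  let ?S = "{s. Re s > 0}"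
  define g where "g = zor_poly zfun s0"
  define k where "k = nat (zorder zfun s0)"
  have S: "open ?S" "connected ?S"
    by (auto simp: open_halfspace_Re_gt intro!: convex_connected convex_halfspace_Re_gt)
  have ex: "(if zfun s0 = 0 then zorder zfun s0 > 0 else zorder zfun s0 = 0) \<and>
     (\<exists>r>0. cball s0 r \<subseteq> ?S \<and> g holomorphic_on cball s0 r \<and>
         (\<forall>w\<in>cball s0 r. zfun w = g w * (w - s0) ^ k \<and> g w \<noteq> 0))"
    unfolding g_def k_def
    by (rule zorder_exist_zero[OF zfun_holomorphic S]) (use s0 in \<open>auto intro!: exI[of _ 1]\<close>)
  then obtain r where r: "r > 0" "cball s0 r \<subseteq> ?S" "g holomorphic_on cball s0 r"
    "\<And>w. w \<in> cball s0 r \<Longrightarrow> zfun w = g w * (w - s0) ^ k" "\<And>w. w \<in> cball s0 r \<Longrightarrow> g w \<noteq> 0"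
    by blast
  have gh: "g holomorphic_on ball s0 r"
    using r(3) ball_subset_cball holomorphic_on_subset by blast
  have i: "isCont g s0" "isCont (deriv g) s0"
    using holomorphic_on_imp_continuous_on[OF gh]
      holomorphic_on_imp_continuous_on[OF holomorphic_deriv[OF gh open_ball]] r(1)
    by (auto simp: continuous_on_eq_continuous_at)
  note t = isCont_tendsto_compose[OF i(1) filterlim_add_of_real_at_right]
    isCont_tendsto_compose[OF i(2) filterlim_add_of_real_at_right]
  have "((\<lambda>e. of_real e / (s0 + of_real e - 1) - of_real e * deriv g (s0 + of_real e) / g (s0 + of_real e) - of_nat k)
     \<longlongrightarrow> of_real 0 / (s0 - 1) - of_real 0 * deriv g s0 / g s0 - of_nat k) (at_right 0)"
    using s0 r(5)[of s0] r(1) by (intro tendsto_intros t filterlim_add_of_real_at_right) auto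
  then have lim: "((\<lambda>e. of_real e / (s0 + of_real e - 1) - of_real e * deriv g (s0 + of_real e) / g (s0 + of_real e) - of_nat k)
     \<longlongrightarrow> - of_nat k) (at_right 0)" by simp
  have "eventually (\<lambda>e. e \<in> {0<..<r}) (at_right 0)"
    using r(1) by (rule eventually_at_right_real)
  then have "eventually (\<lambda>e. of_real e / (s0 + of_real e - 1) - of_real e * deriv g (s0 + of_real e) / g (s0 + of_real e) - of_nat k
        = of_real e * lmangoldt (s0 + of_real e)) (at_right 0)"
  proof eventually_elim
    case (elim e)
    define w where "w = s0 + of_real e"
    have w: "w \<in> ball s0 r" "w \<in> cball s0 r" "Re w > 1" "w - s0 = of_real e"
      using elim s0 by (auto simp: w_def dist_norm)
    then have "w \<noteq> 1" by auto
    have "(g has_field_derivative deriv g w) (at w)"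
      using gh w(1) by (simp add: holomorphic_derivI)
    then have "((\<lambda>w. g w * (w - s0) ^ k) has_field_derivative
       (deriv g w * (w - s0) ^ k + g w * (of_nat k * (w - s0) ^ (k - 1)))) (at w)"
      by (auto intro!: derivative_eq_intros simp: algebra_simps)
    then have "(zfun has_field_derivative
       (deriv g w * (w - s0) ^ k + g w * (of_nat k * (w - s0) ^ (k - 1)))) (at w)"
      by (rule has_field_derivative_transform_within_open[of _ _ _ "ball s0 r"])
         (use w r(4) in auto)
    then have d: "deriv zfun w = deriv g w * of_real e ^ k + g w * (of_nat k * of_real e ^ (k - 1))"
      using w(4) by (simp add: DERIV_imp_deriv)
    have z: "zfun w = g w * of_real e ^ k" "g w \<noteq> 0" using r(4,5)[OF w(2)] w(4) by auto
    have "lmangoldt w = 1 / (w - 1) - deriv zfun w / zfun w"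
      using z elim w by (intro lmangoldt_eq) auto
    also have "deriv zfun w / zfun w = deriv g w / g w + of_nat k / of_real e"
    proof (cases k)
      case 0
      then show ?thesis using z d by simp
    next
      case (Suc k')
      then show ?thesis using z d elim by (simp add: field_simps)
    qed
    finally show ?case using elim unfolding w_def[symmetric]
      by (simp add: field_simps)
  qed
  with lim have "((\<lambda>e. of_real e * lmangoldt (s0 + of_real e)) \<longlongrightarrow> - of_nat k) (at_right 0)"
    by (rule Lim_transform_eventually)
  moreover have "zfun s0 = 0 \<longrightarrow> k > 0" using ex by (auto simp: k_def)
  ultimately show ?thesis by blast
qed

lemma lmangoldt_sums: "Re s > 1 \<Longrightarrow> (\<lambda>n. mangoldt (Suc n) * npow (Suc n) s) sums lmangoldt s"
  unfolding lmangoldt_def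
  by (rule summable_sums[OF summable_norm_cancel[OF summable_norm_mangoldt_npow]])

lemma Re_mangoldt_npow:
  "Re (mangoldt n * npow n (of_real x + \<i> * of_real t)) = mangoldt n * exp (- x * ln (real n)) * cos (t * ln (real n))"
proof -
  have "mangoldt n = (of_real (mangoldt n) :: complex)" by simp
  then show ?thesis
    by (simp add: npow_def Re_exp mult.assoc del: of_real_mangoldt)
qed

text \<open>The classical inequality
  \<open>3 + 4 * cos x + cos (2 * x) = 2 * (1 + cos x)^2 >= 0\<close>, summed with the weights of
  \<open>lmangoldt\<close> at real part \<open>1 + e\<close>. Multiplied by \<open>e\<close> and
  taken to the limit, it reads \<open>3 - 4 * m - m' >= 0\<close>, which excludes
  \<open>m >= 1\<close>.\<close>

lemma zfun_nonzero_line: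
  assumes "t \<noteq> 0"
  shows "zfun (1 + \<i> * of_real t) \<noteq> 0"
proof
  assume z: "zfun (1 + \<i> * of_real t) = 0"
  let ?s = "1 + \<i> * of_real t" and ?s' = "1 + \<i> * of_real (2 * t)"
  obtain m where m: "m > 0" "((\<lambda>e. of_real e * lmangoldt (?s + of_real e)) \<longlongrightarrow> - of_nat m) (at_right 0)"
    using lmangoldt_limit[of ?s] assms z by auto
  obtain m' where m': "((\<lambda>e. of_real e * lmangoldt (?s' + of_real e)) \<longlongrightarrow> - of_nat m') (at_right 0)"
    using lmangoldt_limit[of ?s'] assms by auto
  let ?F = "\<lambda>e. Re (3 * (of_real e * lmangoldt (1 + of_real e)) + 4 * (of_real e * lmangoldt (?s + of_real e))
       + of_real e * lmangoldt (?s' + of_real e))"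
  have "(?F \<longlongrightarrow> Re (3 * 1 + 4 * (- of_nat m) + (- of_nat m'))) (at_right 0)"
    by (intro tendsto_intros lmangoldt_limit_1 m(2) m')
  moreover have "eventually (\<lambda>e. ?F e \<ge> 0) (at_right 0)"
    using eventually_at_right_less[of "0::real"]
  proof eventually_elim
    case (elim e)
    let ?T = "\<lambda>n s. mangoldt (Suc n) * npow (Suc n) s"
    have 1: "(\<lambda>n. ?T n (1 + of_real e)) sums lmangoldt (1 + of_real e)"
         "(\<lambda>n. ?T n (?s + of_real e)) sums lmangoldt (?s + of_real e)"
         "(\<lambda>n. ?T n (?s' + of_real e)) sums lmangoldt (?s' + of_real e)"
      using elim by (auto intro!: lmangoldt_sums)
    have sm: "(\<lambda>n. Re (3 * ?T n (1 + of_real e) + 4 * ?T n (?s + of_real e) + ?T n (?s' + of_real e))) sums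
        Re (3 * lmangoldt (1 + of_real e) + 4 * lmangoldt (?s + of_real e) + lmangoldt (?s' + of_real e))"
      by (intro sums_Re sums_add sums_mult 1)
    have nn: "0 \<le> Re (3 * ?T n (1 + of_real e) + 4 * ?T n (?s + of_real e) + ?T n (?s' + of_real e))" for n
    proof -
      let ?l = "ln (real (Suc n))" let ?c = "cos (t * ?l)"
      have r: "Re (3 * a + 4 * b + c) = 3 * Re a + 4 * Re b + Re c" for a b c by simp
      have e: "1 + of_real e = of_real (1 + e) + \<i> * of_real 0"
          "?s + of_real e = of_real (1 + e) + \<i> * of_real t"
          "?s' + of_real e = of_real (1 + e) + \<i> * of_real (2 * t)" by auto
      have "Re (3 * ?T n (1 + of_real e) + 4 * ?T n (?s + of_real e) + ?T n (?s' + of_real e))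
          = mangoldt (Suc n) * exp (- (1 + e) * ?l) * (3 + 4 * ?c + cos (2 * (t * ?l)))"
        unfolding r e Re_mangoldt_npow by (simp add: algebra_simps)
      also have "3 + 4 * ?c + cos (2 * (t * ?l)) = 2 * (1 + ?c)\<^sup>2"
        by (subst cos_double_cos) (simp add: power2_eq_square algebra_simps)
      finally show ?thesis by (simp add: mangoldt_nonneg)
    qed
    have "0 \<le> Re (3 * lmangoldt (1 + of_real e) + 4 * lmangoldt (?s + of_real e) + lmangoldt (?s' + of_real e))"
      using sums_le[OF nn sums_zero sm] by blast
    then have "0 \<le> e * Re (3 * lmangoldt (1 + of_real e) + 4 * lmangoldt (?s + of_real e) + lmangoldt (?s' + of_real e))"
      using elim by simp
    then show ?case by (simp add: algebra_simps)
  qed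
  ultimately have "Re (3 * 1 + 4 * (- of_nat m) + (- of_nat m')) \<ge> 0"
    by (rule tendsto_lowerbound) simp
  then show False using m(1) by simp
qed

text \<open>To the right of the line the same limit decides: absolute convergence bounds
  \<open>lmangoldt\<close> near \<open>s\<close>, so \<open>e * lmangoldt (s + e)\<close> tends to 0
  and the order of a zero would have to be 0.\<close>

lemma zfun_nonzero:
  assumes "Re s \<ge> 1"
  shows "zfun s \<noteq> 0"
proof (cases "Re s = 1")
  case True
  then have s: "s = 1 + \<i> * of_real (Im s)" by (simp add: complex_eq_iff)
  show ?thesis
  proof (cases "Im s = 0")
    case True
    then have "s = 1" using s by simp
    then show ?thesis by simp
  next
    case False
    then show ?thesis using zfun_nonzero_line[of "Im s"] s by simp
  qed
next
  case False
  then have s: "Re s > 1" using assms by simp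
  then obtain m where m: "zfun s = 0 \<longrightarrow> m > 0"
     "((\<lambda>e. of_real e * lmangoldt (s + of_real e)) \<longlongrightarrow> - of_nat m) (at_right 0)"
    using lmangoldt_limit[of s] by fastforce
  define B where "B = (\<Sum>n. norm (mangoldt (Suc n) * npow (Suc n) s))"
  have "((\<lambda>e. of_real e * lmangoldt (s + of_real e)) \<longlongrightarrow> 0) (at_right 0)"
  proof (rule Lim_null_comparison)
    show "((\<lambda>e. e * B) \<longlongrightarrow> 0) (at_right 0)"
      by (rule tendsto_eq_intros refl | simp)+
    show "\<forall>\<^sub>F e in at_right 0. norm (of_real e * lmangoldt (s + of_real e)) \<le> e * B"
      using eventually_at_right_less[of "0::real"]
    proof eventually_elim
      case (elim e)
      have s': "Re (s + of_real e) > 1" using s elim by simp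
      have "norm (lmangoldt (s + of_real e)) \<le> (\<Sum>n. norm (mangoldt (Suc n) * npow (Suc n) (s + of_real e)))"
        unfolding lmangoldt_def by (rule summable_norm[OF summable_norm_mangoldt_npow[OF s']])
      also have "\<dots> \<le> B" unfolding B_def
      proof (rule suminf_le[OF _ summable_norm_mangoldt_npow[OF s'] summable_norm_mangoldt_npow[OF s]])
        fix n
        have "real (Suc n) powr - Re (s + of_real e) \<le> real (Suc n) powr - Re s"
          using elim by (intro powr_mono) auto
        then show "norm (mangoldt (Suc n) * npow (Suc n) (s + of_real e)) \<le> norm (mangoldt (Suc n) * npow (Suc n) s)"
          by (simp only: norm_mult norm_npow zero_less_Suc mult_left_mono norm_ge_zero)
      qed
      finally show ?case using elim by (simp add: norm_mult mult_left_mono)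
    qed
  qed
  with m(2) have "- of_nat m = (0::complex)"
    by (rule tendsto_unique[rotated]) simp
  then show ?thesis using m(1) by auto
qed

lemma sum_powr_tail_bound:
  fixes x :: real
  assumes x: "x > 0" and N: "N > 0"
  shows "(\<Sum>n. real (Suc (n + N)) powr (- x - 1)) \<le> real N powr (- x) / x"
    and "summable (\<lambda>n. real (Suc (n + N)) powr (- x - 1))"
proof -
  have step: "real (Suc k) powr (- x - 1) \<le> (real k powr (- x) - real (Suc k) powr (- x)) / x" if k: "k > 0" for k
  proof -
    have "\<exists>z. real k < z \<and> z < real (Suc k) \<and>
        real (Suc k) powr (- x) - real k powr (- x) = (real (Suc k) - real k) * (- x * z powr (- x - 1))"
      using k by (intro MVT2) (auto intro!: derivative_eq_intros)
    then obtain z where z: "real k < z" "z < real (Suc k)"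
      "real (Suc k) powr (- x) - real k powr (- x) = - x * z powr (- x - 1)" by auto
    have "real (Suc k) powr (- x - 1) \<le> z powr (- x - 1)"
      using z k x by (intro powr_mono2') auto
    from mult_left_mono[OF this, of x]
    have "x * real (Suc k) powr (- x - 1) \<le> real k powr (- x) - real (Suc k) powr (- x)"
      using z(3) x by linarith
    then show ?thesis using x by (simp add: field_simps)
  qed
  have lim: "(\<lambda>n. real (n + N) powr (- x)) \<longlonglongrightarrow> 0" using x by real_asymp
  have t: "(\<lambda>n. (real (n + N) powr (- x) - real (Suc n + N) powr (- x)) / x) sums ((real (0 + N) powr (- x) - 0) / x)"
    by (intro sums_divide telescope_sums'[OF lim])
  have le: "real (Suc (n + N)) powr (- x - 1) \<le> (real (n + N) powr (- x) - real (Suc n + N) powr (- x)) / x" for n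
    using step[of "n + N"] N by simp
  show s: "summable (\<lambda>n. real (Suc (n + N)) powr (- x - 1))"
    by (rule summable_comparison_test[OF _ sums_summable[OF t]]) (use le in auto)
  show "(\<Sum>n. real (Suc (n + N)) powr (- x - 1)) \<le> real N powr (- x) / x"
    using sums_le[OF le summable_sums[OF s] t] by simp
qed

text \<open>Comparison with the integral of \<open>x powr (t - 1)\<close>. The term
  \<open>1 / N\<close> pays for the last summand when the summands increase, that is for
  \<open>t > 1\<close>.\<close>

lemma sum_powr_bound:
  fixes t :: real
  assumes t: "t > 0" and N: "N > 0"
  shows "(\<Sum>n<N. real (Suc n) powr (t - 1)) \<le> real N powr t * (1 / t + 1 / real N)"
proof (cases "t \<le> 1")
  case True
  have step: "real (Suc k) powr (t - 1) \<le> (real (Suc k) powr t - real k powr t) / t" for k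
  proof (cases "k = 0")
    case True then show ?thesis using t \<open>t \<le> 1\<close> by simp
  next
    case False
    have "\<exists>z. real k < z \<and> z < real (Suc k) \<and>
        real (Suc k) powr t - real k powr t = (real (Suc k) - real k) * (t * z powr (t - 1))"
      using False by (intro MVT2) (auto intro!: derivative_eq_intros)
    then obtain z where z: "real k < z" "z < real (Suc k)"
      "real (Suc k) powr t - real k powr t = t * z powr (t - 1)" by auto
    have "real (Suc k) powr (t - 1) \<le> z powr (t - 1)"
      using z False t True by (intro powr_mono2') auto
    from mult_left_mono[OF this, of t]
    have "t * real (Suc k) powr (t - 1) \<le> real (Suc k) powr t - real k powr t"
      using z(3) t by linarith
    then show ?thesis using t by (simp add: field_simps)
  qed
  have "(\<Sum>n<N. real (Suc n) powr (t - 1)) \<le> (\<Sum>n<N. (real (Suc n) powr t - real n powr t) / t)"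
    by (rule sum_mono[OF step])
  also have "\<dots> = real N powr t / t"
    using sum_lessThan_telescope[of "\<lambda>n. real n powr t" N] t
    by (simp del: of_nat_Suc flip: sum_divide_distrib)
  also have "\<dots> \<le> real N powr t * (1 / t + 1 / real N)" by (simp add: algebra_simps)
  finally show ?thesis .
next
  case False
  have step: "real (Suc k) powr (t - 1) \<le> (real (Suc (Suc k)) powr t - real (Suc k) powr t) / t" for k
  proof -
    have "\<exists>z. real (Suc k) < z \<and> z < real (Suc (Suc k)) \<and>
        real (Suc (Suc k)) powr t - real (Suc k) powr t = (real (Suc (Suc k)) - real (Suc k)) * (t * z powr (t - 1))"
      by (intro MVT2) (auto intro!: derivative_eq_intros)
    then obtain z where z: "real (Suc k) < z" "z < real (Suc (Suc k))"
      "real (Suc (Suc k)) powr t - real (Suc k) powr t = t * z powr (t - 1)" by auto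
    have "real (Suc k) powr (t - 1) \<le> z powr (t - 1)"
      using z False by (intro powr_mono2) auto
    from mult_left_mono[OF this, of t]
    have "t * real (Suc k) powr (t - 1) \<le> real (Suc (Suc k)) powr t - real (Suc k) powr t"
      using z(3) t by linarith
    then show ?thesis using t by (simp add: field_simps)
  qed
  obtain N' where N': "N = Suc N'" using N by (cases N) auto
  have "real (Suc 0) powr t = 1" by simp
  have "(\<Sum>n<N. real (Suc n) powr (t - 1)) \<le> (\<Sum>n<N'. (real (Suc (Suc n)) powr t - real (Suc n) powr t) / t) + real N powr (t - 1)"
    unfolding N' sum.lessThan_Suc by (intro add_mono sum_mono step) auto
  also have "(\<Sum>n<N'. (real (Suc (Suc n)) powr t - real (Suc n) powr t) / t) = (real N powr t - 1) / t"
    using sum_lessThan_telescope[of "\<lambda>n. real (Suc n) powr t" N'] N' \<open>real (Suc 0) powr t = 1\<close>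
    by (simp del: of_nat_Suc flip: sum_divide_distrib)
  also have "(real N powr t - 1) / t + real N powr (t - 1) \<le> real N powr t * (1 / t + 1 / real N)"
    using N t by (simp add: powr_diff field_simps)
  finally show ?thesis by simp
qed

section \<open>Newman's Tauberian theorem and the prime number theorem\<close>

text \<open>Newman's kernel: on the circle of radius \<open>R\<close> one has
  \<open>1 / z = cnj z / R^2\<close>, so the kernel is real there and vanishes on the imaginary
  axis. This zero compensates the factor \<open>1 / Re z\<close> in the bounds for the
  series.\<close>

lemma circle_kernel:
  assumes "norm z = R" "R > 0"
  shows "norm ((1 + z\<^sup>2 / of_real R ^ 2) / z) = 2 * \<bar>Re z\<bar> / R\<^sup>2"
proof -
  have z: "z \<noteq> 0" using assms by auto
  have "z * cnj z = of_real (R ^ 2)" using assms(1) complex_norm_square[of z] by simp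
  then have "1 / z = cnj z / of_real R ^ 2" using z assms(2) by (simp add: field_simps)
  then have "(1 + z\<^sup>2 / of_real R ^ 2) / z = (cnj z + z) / of_real R ^ 2"
    using z by (simp add: add_divide_distrib power2_eq_square)
  also have "cnj z + z = of_real (2 * Re z)" by (simp add: complex_eq_iff)
  finally show ?thesis by (simp add: norm_divide norm_power norm_mult)
qed

text \<open>The plane minus the nonnegative reals: the part of the contour to the left of the imaginary
  axis may be exchanged for a semicircle inside it.\<close>

lemma starlike_slit: "starlike {z::complex. Im z \<noteq> 0 \<or> Re z < 0}" "open {z::complex. Im z \<noteq> 0 \<or> Re z < 0}"
proof -
  have "(-1::complex) \<in> {z. Im z \<noteq> 0 \<or> Re z < 0}" by simp
  moreover have "closed_segment (-1) x \<subseteq> {z. Im z \<noteq> 0 \<or> Re z < 0}" if x: "Im x \<noteq> 0 \<or> Re x < 0" for x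
  proof
    fix z assume "z \<in> closed_segment (-1) x"
    then obtain u where u: "0 \<le> u" "u \<le> 1" "z = (1 - u) *\<^sub>R (-1) + u *\<^sub>R x"
      by (auto simp: closed_segment_def)
    have "Re z < 0" if "Im z = 0"
    proof (cases "u = 0")
      case False
      then have "Re x < 0" using u x that by simp
      then have "u * Re x < 0" using False u by (simp add: mult_pos_neg)
      then show ?thesis using u by simp
    qed (use u in auto)
    then show "z \<in> {z. Im z \<noteq> 0 \<or> Re z < 0}" by blast
  qed
  ultimately show "starlike {z::complex. Im z \<noteq> 0 \<or> Re z < 0}"
    unfolding starlike_def by blast
  have "{z::complex. Im z \<noteq> 0 \<or> Re z < 0} = {z. Im z < 0} \<union> {z. Im z > 0} \<union> {z. Re z < 0}" by auto
  then show "open {z::complex. Im z \<noteq> 0 \<or> Re z < 0}"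
    by (simp add: open_Un open_halfspace_Im_lt open_halfspace_Im_gt open_halfspace_Re_lt)
qed

text \<open>Cauchy's formula at 0 for \<open>(G z - S z) * N^z * (1 + z^2 / R^2)\<close>, with
  \<open>S\<close> the partial sum, over a right semicircle \<open>A\<close> and a three-sided path
  \<open>L\<close> of depth \<open>e\<close> in the left half-plane. On \<open>A\<close> the
  difference is a tail of the series. On the left, the entire function \<open>S\<close> is
  integrated over the left semicircle \<open>D\<close> instead, while \<open>G\<close> stays on
  \<open>L\<close>: the horizontal sides have length \<open>e\<close>, and \<open>N^z\<close> is
  small on the vertical one. \<open>B\<close> and \<open>d\<close> depend neither on
  \<open>e\<close> nor on \<open>N\<close>.\<close>

lemma newman_estimate:
  fixes a :: "nat \<Rightarrow> complex" and G :: "complex \<Rightarrow> complex" and C R :: real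
  assumes bdd: "\<And>n. norm (a n) \<le> C"
    and U: "open U" "{z. Re z \<ge> 0} \<subseteq> U" "G holomorphic_on U"
    and series: "\<And>z. Re z > 0 \<Longrightarrow> (\<lambda>n. a n * npow (Suc n) (z + 1)) sums G z"
    and R: "R \<ge> 1"
  shows "\<exists>B d. B \<ge> 0 \<and> d > 0 \<and> (\<forall>e N. 0 < e \<and> e \<le> d \<and> N > 0 \<longrightarrow>
     norm (G 0 - (\<Sum>n<N. a n * npow (Suc n) 1)) \<le> 2 * C / R + C / real N + B * e + B * R * real N powr (- e) / e)"
proof -
  have C: "C \<ge> 0" using bdd[of 0] norm_ge_zero order_trans by blast
  let ?K = "closed_segment (- \<i> * of_real (R + 1)) (\<i> * of_real (R + 1))"
  have K: "?K \<subseteq> U"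
  proof -
    have "Re z = 0" if "z \<in> ?K" for z using that by (auto simp: closed_segment_def)
    then show ?thesis using U(2) by force
  qed
  obtain \<delta> where \<delta>: "\<delta> > 0" "(\<Union>x\<in>?K. ball x \<delta>) \<subseteq> U"
    by (rule compact_subset_open_imp_ball_epsilon_subset[OF compact_segment U(1) K])
  \<comment> \<open>A convex open set inside the domain of \<open>G\<close>, as Cauchy's formula in
    convex form demands: a horizontal strip whose left edge is moved to \<open>- \<delta>\<close>,
    the width of a tube around the compact segment \<open>?K\<close>.\<close>
  define W where "W = {z. Re z > - \<delta>} \<inter> {z. Im z < R + 1} \<inter> {z. Im z > - (R + 1)}"
  have W: "open W" "convex W"
    unfolding W_def by (auto intro!: open_Int convex_Int open_halfspace_Re_gt open_halfspace_Im_gt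
        open_halfspace_Im_lt convex_halfspace_Re_gt convex_halfspace_Im_gt convex_halfspace_Im_lt)
  have WU: "W \<subseteq> U"
  proof
    fix z assume z: "z \<in> W"
    show "z \<in> U"
    proof (cases "Re z \<ge> 0")
      case False
      define u where "u = (Im z + R + 1) / (2 * (R + 1))"
      have u: "0 \<le> u" "u \<le> 1" using z R by (auto simp: W_def u_def field_simps)
      have eq: "\<i> * of_real (Im z) = (1 - u) *\<^sub>R (- \<i> * of_real (R + 1)) + u *\<^sub>R (\<i> * of_real (R + 1))"
      proof -
        have nz: "2 * (R + 1) \<noteq> 0" using R by simp
        have "u * (2 * (R + 1)) = Im z + R + 1"
          by (simp only: u_def times_divide_eq_left nonzero_mult_div_cancel_right[OF nz])
        then show ?thesis by (simp add: complex_eq_iff algebra_simps)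
      qed
      then have "\<i> * of_real (Im z) \<in> ?K" unfolding closed_segment_def using u by blast
      moreover have "z \<in> ball (\<i> * of_real (Im z)) \<delta>"
      proof -
        have "\<i> * of_real (Im z) - z = - of_real (Re z)" by (simp add: complex_eq_iff)
        then show ?thesis using z False by (simp add: dist_norm W_def)
      qed
      ultimately show ?thesis using \<delta>(2) by blast
    qed (use U(2) in auto)
  qed
  have GW: "G holomorphic_on W" using U(3) WU holomorphic_on_subset by blast
  define d where "d = min (\<delta> / 2) (1 / 2)"
  have d: "0 < d" "d < \<delta>" "d < 1" using \<delta>(1) by (auto simp: d_def)
  define Q where "Q = cbox (Complex (- d) (- R)) (Complex 0 R)"
  have QW: "Q \<subseteq> W" using d R by (auto simp: Q_def W_def in_cbox_complex_iff)
  have "compact (G ` Q)"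
    using holomorphic_on_imp_continuous_on[OF holomorphic_on_subset[OF GW QW]]
    by (intro compact_continuous_image) (auto simp: Q_def)
  then have "bounded (G ` Q)" by (rule compact_imp_bounded)
  then obtain B0 where "\<forall>x\<in>G ` Q. norm x \<le> B0" unfolding bounded_iff by blast
  then have B0: "\<And>z. z \<in> Q \<Longrightarrow> norm (G z) \<le> B0" by blast
  define B where "B = max B0 0"
  have B: "B \<ge> 0" "\<And>z. z \<in> Q \<Longrightarrow> norm (G z) \<le> B"
    using B0 by (auto simp: B_def max.coboundedI1)
  have main: "norm (G 0 - (\<Sum>n<N. a n * npow (Suc n) 1)) \<le> 2 * C / R + C / real N + B * e + B * R * real N powr (- e) / e"
    if e: "0 < e" "e \<le> d" and N: "N > 0" for e N
  proof -
    define S where "S z = (\<Sum>n<N. a n * npow (Suc n) (z + 1))" for z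
    define k where "k z = npow N (- z) * (1 + z\<^sup>2 / of_real R ^ 2)" for z
    define h where "h z = (G z - S z) * k z" for z
    have Sh: "S holomorphic_on A" for A
      unfolding S_def npow_def by (intro holomorphic_intros)
    have kh: "k holomorphic_on A" for A
      unfolding k_def npow_def using R by (intro holomorphic_intros) auto
    have hW: "h holomorphic_on W"
      unfolding h_def by (intro holomorphic_intros GW Sh kh)
    have h0: "h 0 = G 0 - (\<Sum>n<N. a n * npow (Suc n) 1)"
      by (simp add: h_def S_def k_def npow_def)
    define A where "A = part_circlepath 0 R (- (pi / 2)) (pi / 2)"
    define D where "D = part_circlepath 0 R (pi / 2) (3 * pi / 2)"
    define p1 where "p1 = \<i> * of_real R" 
    define p2 where "p2 = Complex (- e) R"
    define p3 where "p3 = Complex (- e) (- R)"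
    define p4 where "p4 = - \<i> * of_real R"
    define L where "L = linepath p1 p2 +++ linepath p2 p3 +++ linepath p3 p4"
    have cis32: "cis (3 * pi / 2) = - \<i>"
      using cis_mult[of pi "pi / 2"] by (simp add: field_simps)
    have ex: "exp (\<i> * of_real (- (pi / 2))) = - \<i>" "exp (\<i> * of_real (pi / 2)) = \<i>"
        "exp (\<i> * of_real (3 * pi / 2)) = - \<i>"
      unfolding cis_conv_exp[symmetric] cis32 by (simp_all add: complex_eq_iff)
    have ends: "pathstart A = p4" "pathfinish A = p1" "pathstart D = p1" "pathfinish D = p4"
       "pathstart L = p1" "pathfinish L = p4"
      unfolding A_def D_def L_def pathstart_part_circlepath pathfinish_part_circlepath ex
      by (simp_all add: p1_def p4_def)
    have vp: "valid_path A" "valid_path D" "valid_path L"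
      by (auto simp: A_def D_def L_def)
    have imA: "z \<in> path_image A \<Longrightarrow> norm z = R \<and> Re z \<ge> 0" for z
    proof -
      assume z: "z \<in> path_image A"
      then have "norm z = R"
        using in_path_image_part_circlepath[of z 0 R "- (pi / 2)" "pi / 2"] R by (simp add: A_def)
      moreover have "z \<in> (\<lambda>x. 0 + of_real R * cis x) ` closed_segment (- (pi/2)) (pi/2)"
        using z by (simp only: A_def path_image_part_circlepath')
      then obtain x where "x \<in> closed_segment (- (pi/2)) (pi/2)" "z = 0 + of_real R * cis x" by blast
      then have "z = of_real R * cis x" "- (pi/2) \<le> x" "x \<le> pi/2"
        by (simp_all add: closed_segment_eq_real_ivl)
      ultimately show ?thesis using R cos_ge_zero[of x] by auto
    qed
    have imD: "z \<in> path_image D \<Longrightarrow> norm z = R \<and> Re z \<le> 0" for z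
    proof -
      assume z: "z \<in> path_image D"
      then have "norm z = R"
        using in_path_image_part_circlepath[of z 0 R "pi / 2" "3 * pi / 2"] R by (simp add: D_def)
      moreover have "z \<in> (\<lambda>x. 0 + of_real R * cis x) ` closed_segment (pi/2) (3*pi/2)"
        using z by (simp only: D_def path_image_part_circlepath')
      then obtain x where "x \<in> closed_segment (pi/2) (3*pi/2)" "z = 0 + of_real R * cis x" by blast
      then have x: "z = of_real R * cis x" "pi/2 \<le> x" "x \<le> 3*pi/2"
        by (simp_all add: closed_segment_eq_real_ivl)
      have "cos (x - pi) \<ge> 0" using x by (intro cos_ge_zero) auto
      then have "cos x \<le> 0" by (simp add: cos_diff)
      ultimately show ?thesis using R x by (auto intro!: mult_nonneg_nonpos)
    qed
    have ue: "u * e \<le> e" "0 \<le> u * e" if "0 \<le> u" "u \<le> 1" for u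
      using that e by (auto simp: mult_left_le_one_le)
    have seg1: "- e \<le> Re z \<and> Re z \<le> 0 \<and> Im z = R" if z: "z \<in> closed_segment p1 p2" for z
    proof -
      obtain u where u: "0 \<le> u" "u \<le> 1" "z = (1 - u) *\<^sub>R p1 + u *\<^sub>R p2"
        using z by (auto simp: closed_segment_def)
      have "Re z = - (u * e)" "Im z = R" unfolding u(3) by (simp_all add: p1_def p2_def algebra_simps)
      then show ?thesis using ue[OF u(1,2)] by simp
    qed
    have seg3: "- e \<le> Re z \<and> Re z \<le> 0 \<and> Im z = - R" if z: "z \<in> closed_segment p3 p4" for z
    proof -
      obtain u where u: "0 \<le> u" "u \<le> 1" "z = (1 - u) *\<^sub>R p3 + u *\<^sub>R p4"
        using z by (auto simp: closed_segment_def)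
      have "Re z = u * e - e" "Im z = - R" unfolding u(3) by (simp_all add: p3_def p4_def algebra_simps)
      then show ?thesis using ue[OF u(1,2)] by simp
    qed
    have seg2: "Re z = - e \<and> \<bar>Im z\<bar> \<le> R" if z: "z \<in> closed_segment p2 p3" for z
    proof -
      obtain u where u: "0 \<le> u" "u \<le> 1" "z = (1 - u) *\<^sub>R p2 + u *\<^sub>R p3"
        using z by (auto simp: closed_segment_def)
      have "Im z = (1 - 2 * u) * R" "Re z = - e"
        unfolding u(3) by (simp_all add: p2_def p3_def algebra_simps)
      moreover have "\<bar>1 - 2 * u\<bar> * R \<le> 1 * R" using u R by (intro mult_right_mono) auto
      ultimately show ?thesis using R by (simp add: abs_mult)
    qed
    have imL: "path_image L = closed_segment p1 p2 \<union> closed_segment p2 p3 \<union> closed_segment p3 p4"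
      by (auto simp: L_def path_image_join)
    have LQ: "z \<in> Q \<and> z \<in> {z. Im z \<noteq> 0 \<or> Re z < 0}" if z: "z \<in> path_image L" for z
    proof -
      consider "z \<in> closed_segment p1 p2" | "z \<in> closed_segment p2 p3" | "z \<in> closed_segment p3 p4"
        using z imL by blast
      then show ?thesis
      proof cases
        case 1 then show ?thesis using seg1[OF 1] e R d by (auto simp: Q_def in_cbox_complex_iff)
      next
        case 2 then show ?thesis using seg2[OF 2] e R d by (auto simp: Q_def in_cbox_complex_iff)
      next
        case 3 then show ?thesis using seg3[OF 3] e R d by (auto simp: Q_def in_cbox_complex_iff)
      qed
    qed
    have Dslit: "path_image D \<subseteq> {z. Im z \<noteq> 0 \<or> Re z < 0}"
    proof
      fix z assume "z \<in> path_image D"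
      then have "norm z = R" "Re z \<le> 0" using imD by auto
      then have "\<not> (Im z = 0 \<and> Re z = 0)" using R by (auto simp: cmod_def)
      then show "z \<in> {z. Im z \<noteq> 0 \<or> Re z < 0}" using \<open>Re z \<le> 0\<close> by auto
    qed
    have Lslit: "path_image L \<subseteq> {z. Im z \<noteq> 0 \<or> Re z < 0}" using LQ by blast
    \<comment> \<open>Used twice: for \<open>1 / w\<close>, which gives the winding number of the
      closed path, and for \<open>S w * k w / w\<close>, which moves the partial sum from
      \<open>L\<close> to \<open>D\<close>.\<close>
    have indep: "f contour_integrable_on L \<and> f contour_integrable_on D \<and> contour_integral L f = contour_integral D f"
      if f: "f holomorphic_on {z. Im z \<noteq> 0 \<or> Re z < 0}" for f
    proof -
      obtain g where g: "\<And>x. x \<in> {z. Im z \<noteq> 0 \<or> Re z < 0} \<Longrightarrow> (g has_field_derivative f x) (at x)"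
        using holomorphic_starlike_primitive[OF holomorphic_on_imp_continuous_on[OF f] starlike_slit finite.emptyI]
          holomorphic_on_imp_differentiable_at[OF f starlike_slit(2)] by auto
      have "(f has_contour_integral (g (pathfinish L) - g (pathstart L))) L"
        by (rule contour_integral_primitive[OF has_field_derivative_at_within[OF g] vp(3) Lslit])
      moreover have "(f has_contour_integral (g (pathfinish D) - g (pathstart D))) D"
        by (rule contour_integral_primitive[OF has_field_derivative_at_within[OF g] vp(2) Dslit])
      ultimately show ?thesis
        by (metis contour_integrable_on_def contour_integral_unique ends(3-6))
    qed
    define \<gamma> where "\<gamma> = A +++ L"
    have \<gamma>: "valid_path \<gamma>" "pathfinish \<gamma> = pathstart \<gamma>"
      using vp ends by (auto simp: \<gamma>_def)
    have im\<gamma>: "path_image \<gamma> = path_image A \<union> path_image L"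
      using ends by (simp add: \<gamma>_def path_image_join)
    have \<gamma>W: "path_image \<gamma> \<subseteq> W - {0}"
    proof
      fix z assume "z \<in> path_image \<gamma>"
      then consider "z \<in> path_image A" | "z \<in> path_image L" using im\<gamma> by blast
      then show "z \<in> W - {0}"
      proof cases
        case 1
        then have z: "norm z = R" "Re z \<ge> 0" using imA by auto
        then have "\<bar>Im z\<bar> \<le> R" using abs_Im_le_cmod[of z] by simp
        then show ?thesis using z R \<delta>(1) by (auto simp: W_def)
      next
        case 2
        then show ?thesis using LQ[OF 2] QW by auto
      qed
    qed
    have 0: "(0::complex) \<in> interior W" using W(1) \<delta>(1) R by (simp add: interior_open) (simp add: W_def)
    have wn: "winding_number \<gamma> 0 = 1"
    proof -
      have inv: "(\<lambda>w. 1 / w) holomorphic_on {z. Im z \<noteq> 0 \<or> Re z < 0}"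
        by (intro holomorphic_intros) auto
      have "((\<lambda>w. 1 / w) has_contour_integral \<i> * of_real (b - c)) (part_circlepath 0 R c b)" if "c < b" for b c
      proof -
        have "((\<lambda>x. 1 / (0 + of_real R * exp (\<i> * of_real x)) * of_real R * \<i> * exp (\<i> * of_real x)) has_integral \<i> * of_real (b - c)) {c..b}"
          using has_integral_const_real[of "\<i>" c b] that R by (simp add: mult.commute scaleR_conv_of_real)
        then show ?thesis
          using that by (simp add: has_contour_integral_part_circlepath_iff cis_conv_exp mult_ac)
      qed
      from this[of "- (pi/2)" "pi/2"] this[of "pi/2" "3*pi/2"]
      have A1: "((\<lambda>w. 1 / w) has_contour_integral \<i> * of_real pi) A"
         and D1: "((\<lambda>w. 1 / w) has_contour_integral \<i> * of_real pi) D"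
        by (auto simp: A_def D_def field_simps)
      have "((\<lambda>w. 1 / w) has_contour_integral \<i> * of_real pi) L"
        using indep[OF inv] D1 by (metis contour_integral_unique has_contour_integral_integral)
      then have "((\<lambda>w. 1 / w) has_contour_integral (\<i> * of_real pi + \<i> * of_real pi)) \<gamma>"
        unfolding \<gamma>_def using A1 vp by (intro has_contour_integral_join)
      then have "contour_integral \<gamma> (\<lambda>w. 1 / w) = \<i> * of_real pi + \<i> * of_real pi"
        by (rule contour_integral_unique)
      then show ?thesis
        using winding_number_valid_path[OF \<gamma>(1), of 0] \<gamma>W by (auto simp: field_simps)
    qed
    have ci: "((\<lambda>w. h w / w) has_contour_integral (2 * of_real pi * \<i> * h 0)) \<gamma>"
      using Cauchy_integral_formula_convex_simple[OF W(2) hW 0 \<gamma>(1) \<gamma>W \<gamma>(2)] wn by simp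
    have Aint: "(\<lambda>w. h w / w) contour_integrable_on A" and Lint: "(\<lambda>w. h w / w) contour_integrable_on L"
      using has_contour_integral_integrable[OF ci] vp
      unfolding \<gamma>_def by (blast dest: contour_integrable_joinD1 contour_integrable_joinD2)+
    have split: "2 * of_real pi * \<i> * h 0 = contour_integral A (\<lambda>w. h w / w) + contour_integral L (\<lambda>w. h w / w)"
      using contour_integral_unique[OF ci] contour_integral_join[OF Aint Lint vp(1) vp(3)]
      by (simp add: \<gamma>_def)
    have SD: "(\<lambda>w. S w * k w / w) holomorphic_on {z. Im z \<noteq> 0 \<or> Re z < 0}"
      by (intro holomorphic_intros Sh kh) auto
    have "(\<lambda>w. G w * k w / w) contour_integrable_on L"
      using contour_integrable_add[OF Lint conjunct1[OF indep[OF SD]]]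
      by (simp add: h_def algebra_simps diff_divide_distrib)
    moreover have "(\<lambda>w. h w / w) = (\<lambda>w. G w * k w / w - S w * k w / w)"
      by (simp add: h_def algebra_simps diff_divide_distrib)
    ultimately have Leq: "contour_integral L (\<lambda>w. h w / w) = contour_integral L (\<lambda>w. G w * k w / w) - contour_integral D (\<lambda>w. S w * k w / w)"
      using indep[OF SD] by (simp add: contour_integral_diff)
    have GL: "(\<lambda>w. G w * k w / w) contour_integrable_on L" by fact
    have normN: "norm (npow N (- z)) = real N powr Re z" for z
      using N by (simp add: norm_npow)
    have kz: "norm (k z / z) = real N powr Re z * (2 * \<bar>Re z\<bar> / R\<^sup>2)" if "norm z = R" for z
      using circle_kernel[OF that] R normN[of z] by (simp add: k_def norm_mult flip: times_divide_eq_right)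
    \<comment> \<open>the right semicircle: \<open>G - S\<close> is the tail of the series\<close>
    have bA: "norm (contour_integral A (\<lambda>w. h w / w)) \<le> 2 * C / R\<^sup>2 * R * (pi / 2 - - (pi / 2))"
    proof (rule has_contour_integral_bound_part_circlepath_strong[where k = "{p1, p4}"])
      show "((\<lambda>w. h w / w) has_contour_integral contour_integral A (\<lambda>w. h w / w)) (part_circlepath 0 R (- (pi / 2)) (pi / 2))"
        using Aint by (simp add: A_def has_contour_integral_integral)
      fix z assume "z \<in> path_image (part_circlepath 0 R (- (pi / 2)) (pi / 2)) - {p1, p4}"
      then have z: "norm z = R" "Re z \<ge> 0" "z \<noteq> p1" "z \<noteq> p4" using imA[of z] by (auto simp: A_def)
      have "Re z \<noteq> 0"
      proof
        assume "Re z = 0"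
        then have "\<bar>Im z\<bar> = R" using z(1) by (simp add: cmod_def)
        then show False using z \<open>Re z = 0\<close> by (auto simp: p1_def p4_def complex_eq_iff abs_if split: if_splits)
      qed
      then have x: "Re z > 0" using z by simp
      have "(\<lambda>n. a (n + N) * npow (Suc (n + N)) (z + 1)) sums (G z - S z)"
        using sums_split_initial_segment[OF series[OF x], of N] by (simp add: S_def)
      then have eq: "G z - S z = (\<Sum>n. a (n + N) * npow (Suc (n + N)) (z + 1))" by (simp add: sums_iff)
      have le: "norm (a (n + N) * npow (Suc (n + N)) (z + 1)) \<le> C * real (Suc (n + N)) powr (- Re z - 1)" for n
        using bdd[of "n + N"] by (simp add: norm_mult norm_npow mult_right_mono del: of_nat_Suc)
      have sm: "summable (\<lambda>n. C * real (Suc (n + N)) powr (- Re z - 1))"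
        by (intro summable_mult sum_powr_tail_bound x N)
      have "norm (G z - S z) \<le> (\<Sum>n. C * real (Suc (n + N)) powr (- Re z - 1))"
        unfolding eq by (rule norm_suminf_le[OF le sm]) 
      also have "\<dots> = C * (\<Sum>n. real (Suc (n + N)) powr (- Re z - 1))"
        by (intro suminf_mult sum_powr_tail_bound x N)
      also have "\<dots> \<le> C * (real N powr (- Re z) / Re z)"
        by (intro mult_left_mono sum_powr_tail_bound x N C)
      finally have "norm (G z - S z) \<le> C * (real N powr (- Re z) / Re z)" .
      then have "norm (G z - S z) * norm (k z / z) \<le> C * (real N powr (- Re z) / Re z) * norm (k z / z)"
        by (rule mult_right_mono) simp
      also have "\<dots> = C * (real N powr (- Re z) / Re z) * (real N powr Re z * (2 * Re z / R\<^sup>2))"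
        using kz[OF z(1)] x by simp
      also have "\<dots> = 2 * C / R\<^sup>2"
        using x N by (simp add: powr_minus field_simps)
      finally show "norm (h z / z) \<le> 2 * C / R\<^sup>2" by (simp add: h_def norm_mult norm_divide)
    qed (use R C in auto)
    have bD: "norm (contour_integral D (\<lambda>w. S w * k w / w)) \<le> (2 * C / R\<^sup>2 + 2 * C / (R * real N)) * R * (3 * pi / 2 - pi / 2)"
    proof (rule has_contour_integral_bound_part_circlepath_strong[where k = "{p1, p4}"])
      show "((\<lambda>w. S w * k w / w) has_contour_integral contour_integral D (\<lambda>w. S w * k w / w)) (part_circlepath 0 R (pi / 2) (3 * pi / 2))"
        using indep[OF SD] by (simp add: D_def has_contour_integral_integral)
      fix z assume "z \<in> path_image (part_circlepath 0 R (pi / 2) (3 * pi / 2)) - {p1, p4}"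
      then have z: "norm z = R" "Re z \<le> 0" "z \<noteq> p1" "z \<noteq> p4" using imD[of z] by (auto simp: D_def)
      have "Re z \<noteq> 0"
      proof
        assume "Re z = 0"
        then have "\<bar>Im z\<bar> = R" using z(1) by (simp add: cmod_def)
        then show False using z \<open>Re z = 0\<close> by (auto simp: p1_def p4_def complex_eq_iff abs_if split: if_splits)
      qed
      define t where "t = - Re z"
      have t: "t > 0" "t \<le> R" using z \<open>Re z \<noteq> 0\<close> abs_Re_le_cmod[of z] by (auto simp: t_def)
      have "norm (S z) \<le> (\<Sum>n<N. C * real (Suc n) powr (t - 1))"
        unfolding S_def
        by (rule order_trans[OF norm_sum sum_mono])
           (use bdd in \<open>simp add: norm_mult norm_npow mult_right_mono t_def del: of_nat_Suc\<close>)
      also have "\<dots> \<le> C * (real N powr t * (1 / t + 1 / real N))"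
        unfolding sum_distrib_left[symmetric] by (intro mult_left_mono sum_powr_bound t N C)
      finally have "norm (S z) * norm (k z / z) \<le> C * (real N powr t * (1 / t + 1 / real N)) * norm (k z / z)"
        by (rule mult_right_mono) simp
      also have "\<dots> = C * (real N powr t * (1 / t + 1 / real N)) * (real N powr (- t) * (2 * t / R\<^sup>2))"
        using kz[OF z(1)] t by (simp add: t_def)
      also have "\<dots> = 2 * C / R\<^sup>2 + 2 * C * t / (R\<^sup>2 * real N)"
        using t N R by (simp add: powr_minus field_simps)
      also have "2 * C * t / (R\<^sup>2 * real N) \<le> 2 * C * R / (R\<^sup>2 * real N)"
        using t C N R by (intro divide_right_mono mult_left_mono) auto
      also have "2 * C * R / (R\<^sup>2 * real N) = 2 * C / (R * real N)"
        using R by (simp add: power2_eq_square)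
      finally show "norm (S z * k z / z) \<le> 2 * C / R\<^sup>2 + 2 * C / (R * real N)" by (simp add: norm_mult norm_divide)
    qed (use R C in auto)
    have kL: "norm (1 + z\<^sup>2 / of_real R ^ 2) \<le> 3" if z: "z \<in> Q" for z
    proof -
      have "norm z ^ 2 \<le> 1 + R ^ 2"
      proof -
        have "\<bar>Re z\<bar> \<le> 1" "\<bar>Im z\<bar> \<le> \<bar>R\<bar>" using z d R by (auto simp: Q_def in_cbox_complex_iff)
        then have "(Re z)\<^sup>2 \<le> 1" "(Im z)\<^sup>2 \<le> R\<^sup>2"
          by (simp_all only: abs_square_le_1 abs_le_square_iff)
        then show ?thesis by (simp add: cmod_power2)
      qed
      also have "1 + R ^ 2 \<le> 2 * R ^ 2" using R by (simp add: one_le_power)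
      finally have "norm (z\<^sup>2 / of_real R ^ 2) \<le> 2" using R by (simp add: norm_divide norm_power field_simps)
      then show ?thesis using norm_triangle_ineq[of 1 "z\<^sup>2 / of_real R ^ 2"] by simp
    qed
    have Gbound: "norm (G z * k z / z) \<le> B * (3 * real N powr Re z / c)" if z: "z \<in> Q" "norm z \<ge> c" "c > 0" for z c
    proof -
      have "norm (G z * k z / z) = norm (G z) * (real N powr Re z * norm (1 + z\<^sup>2 / of_real R ^ 2) / norm z)"
        by (simp add: k_def norm_mult norm_divide normN)
      also have "\<dots> \<le> B * (real N powr Re z * 3 / c)"
        using z B kL[OF z(1)] by (intro mult_mono frac_le) auto
      finally show ?thesis by (simp add: mult.commute)
    qed
    have intL: "(\<lambda>w. G w * k w / w) contour_integrable_on linepath p1 p2"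
      "(\<lambda>w. G w * k w / w) contour_integrable_on linepath p2 p3"
      "(\<lambda>w. G w * k w / w) contour_integrable_on linepath p3 p4"
      using GL by (auto simp: L_def)
    have Leq2: "contour_integral L (\<lambda>w. G w * k w / w) = contour_integral (linepath p1 p2) (\<lambda>w. G w * k w / w)
      + (contour_integral (linepath p2 p3) (\<lambda>w. G w * k w / w) + contour_integral (linepath p3 p4) (\<lambda>w. G w * k w / w))"
      using intL by (simp add: L_def)
    have c1: "norm (contour_integral (linepath p1 p2) (\<lambda>w. G w * k w / w)) \<le> (3 * B) * norm (p2 - p1)"
    proof (rule contour_integral_bound_linepath[OF intL(1)])
      fix z assume z: "z \<in> closed_segment p1 p2"
      have zQ: "z \<in> Q" using LQ[of z] z imL by blast
      have "norm z \<ge> 1" using seg1[OF z] abs_Im_le_cmod[of z] R by simp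
      from Gbound[OF zQ this] have "norm (G z * k z / z) \<le> B * (3 * real N powr Re z)" by simp
      also have "\<dots> \<le> B * (3 * real N powr 0)"
        using seg1[OF z] B N by (intro mult_left_mono powr_mono) auto
      finally show "norm (G z * k z / z) \<le> 3 * B" using N by simp
    qed (use B in auto)
    have c3: "norm (contour_integral (linepath p3 p4) (\<lambda>w. G w * k w / w)) \<le> (3 * B) * norm (p4 - p3)"
    proof (rule contour_integral_bound_linepath[OF intL(3)])
      fix z assume z: "z \<in> closed_segment p3 p4"
      have zQ: "z \<in> Q" using LQ[of z] z imL by blast
      have "norm z \<ge> 1" using seg3[OF z] abs_Im_le_cmod[of z] R by simp
      from Gbound[OF zQ this] have "norm (G z * k z / z) \<le> B * (3 * real N powr Re z)" by simp
      also have "\<dots> \<le> B * (3 * real N powr 0)"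
        using seg3[OF z] B N by (intro mult_left_mono powr_mono) auto
      finally show "norm (G z * k z / z) \<le> 3 * B" using N by simp
    qed (use B in auto)
    have c2: "norm (contour_integral (linepath p2 p3) (\<lambda>w. G w * k w / w)) \<le> (B * (3 * real N powr (- e) / e)) * norm (p3 - p2)"
    proof (rule contour_integral_bound_linepath[OF intL(2)])
      fix z assume z: "z \<in> closed_segment p2 p3"
      have zQ: "z \<in> Q" using LQ[of z] z imL by blast
      have "norm z \<ge> e" using seg2[OF z] abs_Re_le_cmod[of z] e by simp
      from Gbound[OF zQ this e(1)] show "norm (G z * k z / z) \<le> B * (3 * real N powr (- e) / e)"
        using seg2[OF z] by simp
    qed (use B e in auto)
    have lens: "norm (p2 - p1) = e" "norm (p4 - p3) = e" "norm (p3 - p2) = 2 * R"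
      using e R by (auto simp: p1_def p2_def p3_def p4_def cmod_def real_sqrt_mult)
    have bL: "norm (contour_integral L (\<lambda>w. G w * k w / w)) \<le> 6 * B * e + 6 * B * R * real N powr (- e) / e"
    proof -
      have "norm (contour_integral L (\<lambda>w. G w * k w / w)) \<le> (3 * B) * e + ((B * (3 * real N powr (- e) / e)) * (2 * R) + (3 * B) * e)"
        unfolding Leq2
        by (intro order_trans[OF norm_triangle_ineq] add_mono c1[unfolded lens] c2[unfolded lens] c3[unfolded lens])
      then show ?thesis by (simp add: algebra_simps)
    qed
    have "2 * pi * norm (h 0) = norm (2 * of_real pi * \<i> * h 0)" by (simp add: norm_mult)
    also have "\<dots> \<le> norm (contour_integral A (\<lambda>w. h w / w)) + (norm (contour_integral L (\<lambda>w. G w * k w / w))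
        + norm (contour_integral D (\<lambda>w. S w * k w / w)))"
      unfolding split Leq
      by (rule order_trans[OF norm_triangle_ineq add_left_mono[OF norm_triangle_ineq4]])
    also have "\<dots> \<le> 2 * C / R\<^sup>2 * R * (pi / 2 - - (pi / 2)) + ((6 * B * e + 6 * B * R * real N powr (- e) / e)
        + (2 * C / R\<^sup>2 + 2 * C / (R * real N)) * R * (3 * pi / 2 - pi / 2))"
      by (intro add_mono bA bD bL)
    also have "\<dots> = 2 * pi * (2 * C / R + C / real N) + 6 * (B * e + B * R * real N powr (- e) / e)"
      using R N e by (simp add: field_simps power2_eq_square)
    also have "\<dots> \<le> 2 * pi * (2 * C / R + C / real N) + (2 * pi) * (B * e + B * R * real N powr (- e) / e)"
      using pi_gt3 B R e by (intro add_left_mono mult_right_mono) auto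
    also have "\<dots> = 2 * pi * (2 * C / R + C / real N + B * e + B * R * real N powr (- e) / e)"
      by (simp add: algebra_simps)
    finally show ?thesis unfolding h0 using pi_gt_zero by simp
  qed
  then show ?thesis using B(1) d(1) by blast
qed

text \<open>Order of the choices: \<open>R\<close> makes \<open>2 * C / R\<close> small and thereby
  fixes \<open>B\<close> and \<open>d\<close>; then \<open>e\<close> makes \<open>B * e\<close>
  small; the remaining terms vanish as \<open>N\<close> grows.\<close>

theorem newman_tauberian:
  fixes a :: "nat \<Rightarrow> complex" and G :: "complex \<Rightarrow> complex"
  assumes bdd: "\<And>n. norm (a n) \<le> C"
    and U: "open U" "{z. Re z \<ge> 0} \<subseteq> U" "G holomorphic_on U"
    and series: "\<And>z. Re z > 0 \<Longrightarrow> (\<lambda>n. a n * npow (Suc n) (z + 1)) sums G z"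
  shows "(\<lambda>n. a n / of_nat (Suc n)) sums G 0"
proof -
  have C: "C \<ge> 0" using bdd[of 0] norm_ge_zero order_trans by blast
  have eq: "a n * npow (Suc n) 1 = a n / of_nat (Suc n)" for n
    by (simp add: npow_one del: of_nat_Suc)
  have "(\<lambda>N. \<Sum>n<N. a n * npow (Suc n) 1) \<longlonglongrightarrow> G 0"
  proof (rule tendstoI)
    fix \<epsilon> :: real assume \<epsilon>: "\<epsilon> > 0"
    define R where "R = max 1 (8 * C / \<epsilon>)"
    have R: "R \<ge> 1" "R \<ge> 8 * C / \<epsilon>" by (auto simp: R_def)
    then have CR: "2 * C / R \<le> \<epsilon> / 4" using \<epsilon> by (simp add: field_simps)
    obtain B d where Bd: "B \<ge> 0" "d > 0" "\<And>e N. 0 < e \<Longrightarrow> e \<le> d \<Longrightarrow> N > 0 \<Longrightarrow>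
     norm (G 0 - (\<Sum>n<N. a n * npow (Suc n) 1)) \<le> 2 * C / R + C / real N + B * e + B * R * real N powr (- e) / e"
      using newman_estimate[OF bdd U series R(1)] by blast
    define e where "e = min d (\<epsilon> / (4 * (B + 1)))"
    have e: "e > 0" "e \<le> d" "B * e \<le> \<epsilon> / 4"
    proof -
      show "e > 0" "e \<le> d" using Bd \<epsilon> by (auto simp: e_def)
      have "B * e \<le> B * (\<epsilon> / (4 * (B + 1)))" using Bd by (intro mult_left_mono) (auto simp: e_def)
      also have "\<dots> \<le> \<epsilon> / 4" using Bd \<epsilon> by (simp add: field_simps)
      finally show "B * e \<le> \<epsilon> / 4" .
    qed
    have "(\<lambda>N. C / real N + B * R * real N powr (- e) / e) \<longlonglongrightarrow> C * 0 + B * R * 0 / e"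
    proof (intro tendsto_intros)
      show "(\<lambda>N. C / real N) \<longlonglongrightarrow> C * 0" by real_asymp
      show "(\<lambda>N. real N powr (- e)) \<longlonglongrightarrow> 0" using e(1) by real_asymp
      show "e \<noteq> 0" using e by simp
    qed
    then have "(\<lambda>N. C / real N + B * R * real N powr (- e) / e) \<longlonglongrightarrow> 0" by simp
    then have "eventually (\<lambda>N. C / real N + B * R * real N powr (- e) / e < \<epsilon> / 4) sequentially"
      by (rule order_tendstoD) (use \<epsilon> in auto)
    then show "eventually (\<lambda>N. dist (\<Sum>n<N. a n * npow (Suc n) 1) (G 0) < \<epsilon>) sequentially"
      using eventually_gt_at_top[of "0::nat"]
    proof eventually_elim
      case (elim N)
      have "norm (G 0 - (\<Sum>n<N. a n * npow (Suc n) 1)) \<le> 2 * C / R + C / real N + B * e + B * R * real N powr (- e) / e"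
        using elim e by (intro Bd) auto
      then have "norm (G 0 - (\<Sum>n<N. a n * npow (Suc n) 1)) < \<epsilon>"
        using elim(1) CR e(3) \<epsilon> by linarith
      then show ?case by (simp add: dist_norm norm_minus_commute)
    qed
  qed
  then show ?thesis by (simp add: sums_def eq)
qed

section \<open>Chebyshev's function and its asymptotics\<close>

definition psi :: "nat \<Rightarrow> real" where
  "psi n = (\<Sum>k<n. mangoldt (Suc k))"

lemma psi_Suc: "psi (Suc n) = psi n + mangoldt (Suc n)"
  by (simp add: psi_def)

lemma psi_0 [simp]: "psi 0 = 0"
  by (simp add: psi_def)

lemma psi_mono: "m \<le> n \<Longrightarrow> psi m \<le> psi n"
  unfolding psi_def by (intro sum_mono2) (auto simp: mangoldt_nonneg)

lemma psi_nonneg: "psi n \<ge> 0"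
  unfolding psi_def by (intro sum_nonneg mangoldt_nonneg)

lemma psi_altdef: "psi n = (\<Sum>d\<in>{1..n}. mangoldt d)"
proof -
  have "Suc ` {..<n} = {1..n}" by (rule image_Suc_lessThan)
  then show ?thesis unfolding psi_def by (subst sum.reindex[of Suc, unfolded o_def, symmetric]) auto
qed

lemma card_multiples:
  assumes "d > 0"
  shows "card {k\<in>{1..n}. d dvd k} = n div d"
proof -
  have "{k\<in>{1..n}. d dvd k} = (\<lambda>i. d * i) ` {1..n div d}"
  proof (intro equalityI subsetI)
    fix k assume "k \<in> {k\<in>{1..n}. d dvd k}"
    then obtain i where i: "k = d * i" "1 \<le> k" "k \<le> n" by auto
    then have "i \<le> n div d" using assms by (metis div_le_mono nonzero_mult_div_cancel_left neq0_conv)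
    then show "k \<in> (\<lambda>i. d * i) ` {1..n div d}" using i by (intro image_eqI[of _ _ i]) (auto intro: Nat.gr0I)
  next
    fix k assume "k \<in> (\<lambda>i. d * i) ` {1..n div d}"
    then obtain i where "i \<in> {1..n div d}" "k = d * i" by blast
    then have i: "k = d * i" "1 \<le> i" "i \<le> n div d" by auto
    have "d * i \<le> d * (n div d)" using i by simp
    also have "\<dots> \<le> n" by simp
    finally show "k \<in> {k\<in>{1..n}. d dvd k}" using i assms by auto
  qed
  then show ?thesis using assms by (simp add: card_image inj_on_def)
qed

lemma ln_fact_mangoldt:
  assumes "n \<le> m"
  shows "ln (fact n :: real) = (\<Sum>d\<in>{1..m}. mangoldt d * real (n div d))"
proof -
  have "(fact n :: real) = (\<Prod>k\<in>{1..n}. real k)" by (simp add: fact_prod)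
  then have "ln (fact n :: real) = (\<Sum>k\<in>{1..n}. ln (real k))"
    by (simp only:) (rule ln_prod, auto)
  also have "\<dots> = (\<Sum>k\<in>{1..n}. \<Sum>d\<in>{1..m}. if d dvd k then mangoldt d else 0)"
  proof (rule sum.cong[OF refl])
    fix k assume k: "k \<in> {1..n}"
    have "ln (real k) = (\<Sum>d | d dvd k. mangoldt d)" using k by (subst mangoldt_sum) auto
    also have "{d. d dvd k} = {d\<in>{1..m}. d dvd k}"
      using k assms by (auto intro!: Nat.gr0I dest: dvd_imp_le)
    also have "(\<Sum>d\<in>\<dots>. mangoldt d) = (\<Sum>d\<in>{1..m}. if d dvd k then mangoldt d else (0::real))"
      by (rule sum.inter_filter) simp
    finally show "ln (real k) = (\<Sum>d\<in>{1..m}. if d dvd k then mangoldt d else 0)" .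
  qed
  also have "\<dots> = (\<Sum>d\<in>{1..m}. \<Sum>k\<in>{1..n}. if d dvd k then mangoldt d else 0)"
    by (rule sum.swap)
  also have "\<dots> = (\<Sum>d\<in>{1..m}. mangoldt d * real (n div d))"
  proof (rule sum.cong[OF refl])
    fix d assume d: "d \<in> {1..m}"
    have "(\<Sum>k\<in>{1..n}. if d dvd k then mangoldt d else (0::real)) = (\<Sum>k\<in>{k\<in>{1..n}. d dvd k}. mangoldt d)"
      by (rule sum.inter_filter[symmetric]) simp
    also have "\<dots> = mangoldt d * real (n div d)" using card_multiples[of d n] d by simp
    finally show "(\<Sum>k\<in>{1..n}. if d dvd k then mangoldt d else (0::real)) = mangoldt d * real (n div d)" .
  qed
  finally show ?thesis .
qed

text \<open>Chebyshev's argument: the logarithm of the central binomial coefficient is a sum of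
  \<open>mangoldt d\<close> with coefficients \<open>(2 * m) div d - 2 * (m div d)\<close>, which
  are never negative and at least 1 for \<open>m < d <= 2 * m\<close>.\<close>

lemma psi_double: "psi (2 * m) - psi m \<le> 2 * real m * ln 2"
proof -
  have le: "m \<le> 2 * m" by simp
  have bin: "real ((2 * m) choose m) = fact (2 * m) / (fact m * fact m)"
    by (simp add: binomial_fact)
  have "ln (real ((2 * m) choose m)) = ln (fact (2 * m)) - 2 * ln (fact m)"
    unfolding bin by (simp add: ln_div ln_mult)
  also have "\<dots> = (\<Sum>d\<in>{1..2*m}. mangoldt d * (real ((2 * m) div d) - 2 * real (m div d)))"
    using ln_fact_mangoldt[OF le] ln_fact_mangoldt[OF order_refl, of "2 * m"]
    by (simp only: sum_distrib_left sum_subtractf[symmetric] right_diff_distrib mult.left_commute)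
  also have "\<dots> \<ge> (\<Sum>d\<in>{1..2*m}. if d \<in> {m<..2*m} then mangoldt d else 0)"
  proof (rule sum_mono)
    fix d assume d: "d \<in> {1..2*m}"
    show "(if d \<in> {m<..2*m} then mangoldt d else 0) \<le> mangoldt d * (real ((2 * m) div d) - 2 * real (m div d))"
    proof (cases "d \<in> {m<..2*m}")
      case True
      then have "m div d = 0" "(2 * m) div d \<ge> 1" by (auto simp: div_greater_zero_iff Suc_le_eq)
      then have "mangoldt d * 1 \<le> mangoldt d * (real ((2 * m) div d) - 2 * real (m div d))"
        by (intro mult_left_mono mangoldt_nonneg) auto
      then show ?thesis using True by simp
    next
      case False
      have "2 * (m div d) \<le> (2 * m) div d"
        using d by (simp add: less_eq_div_iff_mult_less_eq mult.assoc)
      then have "2 * real (m div d) \<le> real ((2 * m) div d)" by linarith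
      then have "0 \<le> mangoldt d * (real ((2 * m) div d) - 2 * real (m div d))"
        by (intro mult_nonneg_nonneg mangoldt_nonneg) simp
      then show ?thesis using False by (simp only: if_False)
    qed
  qed
  also have "(\<Sum>d\<in>{1..2*m}. if d \<in> {m<..2*m} then mangoldt d else 0) = (\<Sum>d\<in>{m<..2*m}. mangoldt d)"
    by (subst sum.inter_filter[symmetric]) (auto intro!: sum.cong)
  also have "\<dots> = psi (2 * m) - psi m"
  proof -
    have "{1..2*m} = {1..m} \<union> {m<..2*m}" by auto
    then have "psi (2 * m) = (\<Sum>d\<in>{1..m}. mangoldt d) + (\<Sum>d\<in>{m<..2*m}. mangoldt d)"
      unfolding psi_altdef by (simp only:) (subst sum.union_disjoint, auto)
    then show ?thesis by (simp add: psi_altdef)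
  qed
  finally have "psi (2 * m) - psi m \<le> ln (real ((2 * m) choose m))" .
  also have "\<dots> \<le> ln (2 ^ (2 * m))"
  proof -
    have "(2 * m) choose m \<le> 2 ^ (2 * m)" by (rule binomial_le_pow2)
    then have "real ((2 * m) choose m) \<le> 2 ^ (2 * m)" by (metis of_nat_le_iff of_nat_numeral of_nat_power)
    then show ?thesis by (intro ln_mono) auto
  qed
  also have "\<dots> = 2 * real m * ln 2" by (simp add: ln_realpow)
  finally show ?thesis .
qed

text \<open>Halving gives \<open>psi n <= 6 * m + 2 * m\<close> for the rounded-up half
  \<open>m\<close>; the constant 6 is chosen so that \<open>4 * m <= 3 * n\<close>, valid from
  \<open>n = 2\<close> on, closes the induction.\<close>

lemma psi_le: "psi n \<le> 6 * real n"
proof (induction n rule: less_induct)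
  case (less n)
  show ?case
  proof (cases "n \<ge> 2")
    case False
    then have "n = 0 \<or> n = 1" by auto
    then show ?thesis using psi_Suc[of 0] by auto
  next
    case True
    define m where "m = (n + 1) div 2"
    have m: "m < n" "n \<le> 2 * m" "4 * m \<le> 3 * n" using True by (auto simp: m_def)
    have "psi n \<le> psi (2 * m)" using m by (intro psi_mono)
    also have "\<dots> \<le> psi m + 2 * real m * ln 2" using psi_double[of m] by simp
    also have "\<dots> \<le> 6 * real m + 2 * real m * 1"
      using less.IH[OF m(1)] ln2_le_25_over_36 by (intro add_mono mult_left_mono) auto
    also have "\<dots> \<le> 6 * real n" using m(3) by simp
    finally show ?thesis .
  qed
qed

lemma psi_partial_summation:
  assumes s: "Re s > 1"
  shows "(\<lambda>n. of_real (psi (Suc n)) * (npow (Suc n) s - npow (Suc (Suc n)) s)) sums lmangoldt s"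
proof -
  have part: "(\<Sum>n<N. of_real (psi (Suc n)) * (npow (Suc n) s - npow (Suc (Suc n)) s))
      = (\<Sum>n<N. mangoldt (Suc n) * npow (Suc n) s) - of_real (psi N) * npow (Suc N) s" for N
  proof (induction N)
    case (Suc N)
    have "of_real (psi (Suc N)) = (of_real (psi N) + mangoldt (Suc N) :: complex)"
      by (simp add: psi_Suc)
    then show ?case unfolding sum.lessThan_Suc Suc.IH by (simp only:) (simp add: algebra_simps)
  qed simp
  have "(\<lambda>N. of_real (psi N) * npow (Suc N) s) \<longlonglongrightarrow> 0"
  proof (rule Lim_null_comparison)
    show "\<forall>\<^sub>F N in sequentially. norm (of_real (psi N) * npow (Suc N) s) \<le> 6 * real N * real (Suc N) powr (- Re s)"
      using psi_le psi_nonneg by (intro always_eventually) (simp add: norm_mult norm_npow mult_right_mono del: of_nat_Suc)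
    show "(\<lambda>N. 6 * real N * real (Suc N) powr (- Re s)) \<longlonglongrightarrow> 0"
      using s by real_asymp
  qed
  from tendsto_diff[OF lmangoldt_sums[OF s, unfolded sums_def] this]
  show ?thesis unfolding sums_def part by simp
qed

text \<open>Newman's theorem for the sequence \<open>(psi n - n) / n\<close>, bounded by
  \<open>psi_le\<close>. With \<open>s = z + 1\<close> its Dirichlet series is the sum of
  \<open>psi n * n^(-s-1)\<close> minus zeta(s), and \<open>s\<close> times the former sum is
  \<open>lmangoldt s\<close> plus a series \<open>H\<close> that converges for
  \<open>Re s > 0\<close>. Non-vanishing of \<open>zfun\<close> makes the result holomorphic around
  \<open>Re z >= 0\<close>.\<close>

lemma psi_error_summable: "summable (\<lambda>n. (psi (Suc n) - real (Suc n)) / (real (Suc n))\<^sup>2)"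
proof -
  let ?S = "{s. Re s > 0}"
  have zd: "deriv zfun holomorphic_on ?S"
    using zfun_holomorphic by (intro holomorphic_deriv) (auto simp: open_halfspace_Re_gt)
  define E where "E s = (if s = 1 then deriv zfun 1 else (zfun s - zfun 1) / (s - 1))" for s
  have Eh: "E holomorphic_on ?S"
    unfolding E_def[abs_def]
    by (rule pole_lemma_open[OF zfun_holomorphic]) (simp add: open_halfspace_Re_gt)
  \<comment> \<open>Chebyshev's bound costs one power of \<open>n\<close>, which the decay of
    \<open>zterm\<close> at \<open>s + 1\<close> instead of \<open>s\<close> returns.\<close>
  have "\<exists>g g'. \<forall>s\<in>?S. (\<lambda>n. of_real (psi (Suc n)) * zterm (s + 1) (Suc n)) sums g s \<and>
      (\<lambda>n. deriv (\<lambda>s. of_real (psi (Suc n)) * zterm (s + 1) (Suc n)) s) sums g' s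
       \<and> (g has_field_derivative g' s) (at s)"
  proof (rule dirichlet_like_series[where B = "\<lambda>s. 6 * (norm (s + 1) * norm s)"])
    fix n s
    have "(\<lambda>s. of_real (psi (Suc n)) * zterm (s + 1) (Suc n)) holomorphic_on UNIV"
      unfolding zterm_def npow_def by (intro holomorphic_intros)
    then show "((\<lambda>s. of_real (psi (Suc n)) * zterm (s + 1) (Suc n)) has_field_derivative
       deriv (\<lambda>s. of_real (psi (Suc n)) * zterm (s + 1) (Suc n)) s) (at s)"
      by (rule holomorphic_derivI) auto
  next
    fix n :: nat and s :: complex assume s: "Re s > 0"
    have e2: "- Re (s + 1) - 1 = - Re s - 2" "s + 1 - 1 = s" by simp_all
    have "norm (of_real (psi (Suc n)) * zterm (s + 1) (Suc n))
        \<le> (6 * real (Suc n)) * (norm (s + 1) * norm s * real (Suc n) powr (- Re s - 2))"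
      using norm_zterm[of "Suc n" "s + 1", unfolded e2] psi_le[of "Suc n"] psi_nonneg[of "Suc n"] s
      unfolding norm_mult[of "of_real _"] by (intro mult_mono) (auto simp del: of_nat_Suc)
    also have "\<dots> = 6 * (norm (s + 1) * norm s) * (real (Suc n) powr 1 * real (Suc n) powr (- Re s - 2))"
      by simp
    also have "real (Suc n) powr 1 * real (Suc n) powr (- Re s - 2) = real (Suc n) powr (- Re s - 1 + 0)"
      unfolding powr_add[symmetric] by (rule arg_cong[of _ _ "\<lambda>x. _ powr x"]) simp
    finally show "norm (of_real (psi (Suc n)) * zterm (s + 1) (Suc n)) \<le> 6 * (norm (s + 1) * norm s) * real (Suc n) powr (- Re s - 1 + 0)" .
  qed (auto intro!: continuous_intros)
  then obtain H H' where H: "\<And>s. Re s > 0 \<Longrightarrow> (\<lambda>n. of_real (psi (Suc n)) * zterm (s + 1) (Suc n)) sums H s"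
      "\<And>s. Re s > 0 \<Longrightarrow> (H has_field_derivative H' s) (at s)" by auto
  have Hh: "H holomorphic_on ?S"
    using H(2) by (auto simp: holomorphic_on_open open_halfspace_Re_gt)
  define V where "V = {s\<in>?S. zfun s \<noteq> 0}"
  have V: "open V"
  proof -
    have "V = ?S \<inter> zfun -` (- {0})" by (auto simp: V_def)
    moreover have "open (?S \<inter> zfun -` (- {0}))"
      by (rule continuous_open_preimage[OF holomorphic_on_imp_continuous_on[OF zfun_holomorphic]])
         (auto simp: open_halfspace_Re_gt)
    ultimately show ?thesis by simp
  qed
  \<comment> \<open>The poles at 1 cancel: \<open>1 / (s * (s - 1)) = 1 / (s - 1) - 1 / s\<close>
    from \<open>lmangoldt s / s\<close>, and \<open>lzeta s = 1 / (s - 1) + E s\<close>.\<close>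
  define G where "G s = - E s - 1 / s - deriv zfun s / (s * zfun s) + H s / s" for s
  have Gh: "G holomorphic_on V"
    unfolding G_def
    by (intro holomorphic_intros holomorphic_on_subset[OF Eh] holomorphic_on_subset[OF zd]
        holomorphic_on_subset[OF Hh] holomorphic_on_subset[OF zfun_holomorphic]) (auto simp: V_def)
  define U where "U = (\<lambda>z. z + 1) -` V"
  define a where "a n = (of_real ((psi (Suc n) - real (Suc n)) / real (Suc n)) :: complex)" for n
  have "(\<lambda>n. a n / of_nat (Suc n)) sums (\<lambda>z. G (z + 1)) 0"
  proof (rule newman_tauberian)
    fix n
    have "\<bar>psi (Suc n) - real (Suc n)\<bar> \<le> 7 * real (Suc n)"
    proof -
      have "\<bar>p - x\<bar> \<le> 7 * x" if "p \<le> 6 * x" "0 \<le> p" "0 \<le> x" for p x :: real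
        using that by linarith
      from this[OF psi_le psi_nonneg of_nat_0_le_iff] show ?thesis .
    qed
    then show "norm (a n) \<le> 7"
      unfolding a_def norm_of_real abs_divide by (simp add: pos_divide_le_eq del: of_nat_Suc)
  next
    show "open U" unfolding U_def by (rule open_vimage[OF V]) (intro continuous_intros)
    show "{z. Re z \<ge> 0} \<subseteq> U" using zfun_nonzero by (auto simp: U_def V_def)
    have "(G \<circ> (\<lambda>z. z + 1)) holomorphic_on U"
      by (rule holomorphic_on_compose_gen[OF _ Gh]) (auto simp: U_def intro!: holomorphic_intros)
    then show "(\<lambda>z. G (z + 1)) holomorphic_on U" by (simp add: o_def)
  next
    fix z :: complex assume z: "Re z > 0"
    define s where "s = z + 1"
    have s: "Re s > 1" "s \<noteq> 0" "s \<noteq> 1" "Re s > 0" using z by (auto simp: s_def complex_eq_iff)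
    have sz: "(\<lambda>n. npow (Suc n) s) sums lzeta s"
      unfolding lzeta_def by (rule summable_sums[OF summable_norm_cancel[OF summable_norm_npow[OF s(1)]]])
    have "(\<lambda>n. (of_real (psi (Suc n)) * zterm (s + 1) (Suc n)
            + of_real (psi (Suc n)) * (npow (Suc n) s - npow (Suc (Suc n)) s)) / s - npow (Suc n) s)
          sums ((H s + lmangoldt s) / s - lzeta s)"
      by (intro sums_diff sums_divide sums_add H s psi_partial_summation sz)
    moreover have "(of_real (psi (Suc n)) * zterm (s + 1) (Suc n)
            + of_real (psi (Suc n)) * (npow (Suc n) s - npow (Suc (Suc n)) s)) / s - npow (Suc n) s
        = a n * npow (Suc n) (z + 1)" for n
    proof -
      have "zterm (s + 1) (Suc n) = s * (npow (Suc n) s / of_nat (Suc n)) + npow (Suc (Suc n)) s - npow (Suc n) s"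
        by (simp add: zterm_def npow_add npow_one del: of_nat_Suc)
      then have X: "of_real (psi (Suc n)) * zterm (s + 1) (Suc n)
            + of_real (psi (Suc n)) * (npow (Suc n) s - npow (Suc (Suc n)) s)
          = s * (of_real (psi (Suc n)) * (npow (Suc n) s / of_nat (Suc n)))"
        by (simp only:) (simp add: algebra_simps)
      show ?thesis unfolding X s_def[symmetric] a_def using s by (simp add: field_simps del: of_nat_Suc)
    qed
    moreover have "(H s + lmangoldt s) / s - lzeta s = G (z + 1)"
    proof -
      have nz: "zfun s \<noteq> 0" using s by (intro zfun_nonzero) auto
      have L: "lmangoldt s = 1 / (s - 1) - deriv zfun s / zfun s" by (rule lmangoldt_eq[OF s(1) nz])
      have Z: "lzeta s = zfun s / (s - 1)" using zfun_eq_lzeta[OF s(1)] s by simp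
      show ?thesis using s nz
        unfolding L Z G_def E_def s_def[symmetric] by (simp add: divide_simps) (simp add: algebra_simps)
    qed
    ultimately show "(\<lambda>n. a n * npow (Suc n) (z + 1)) sums G (z + 1)" by simp
  qed
  moreover have "a n / of_nat (Suc n) = of_real ((psi (Suc n) - real (Suc n)) / (real (Suc n))\<^sup>2)" for n
    by (simp add: a_def power2_eq_square del: of_nat_Suc)
  ultimately have "summable (\<lambda>n. of_real ((psi (Suc n) - real (Suc n)) / (real (Suc n))\<^sup>2) :: complex)"
    by (simp add: sums_iff)
  then show ?thesis by (simp only: summable_of_real_iff)
qed

text \<open>If \<open>psi m >= (1 + \<delta>) * m\<close>, monotonicity keeps
  \<open>psi n - n\<close> above \<open>\<delta> * m / 2\<close> for all \<open>n\<close> from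
  \<open>m\<close> to about \<open>m + \<delta> * m / 2\<close>, so this block of the convergent
  series is at least \<open>c\<close>, against the Cauchy criterion. A value that is too small
  spoils the block to the left of \<open>m\<close> in the same way. The 16 in \<open>c\<close> comes
  from the first case, where denominators reach \<open>(2 * m)^2\<close>.\<close>

theorem psi_asymp: "(\<lambda>n. psi n / real n) \<longlonglongrightarrow> 1"
proof (rule tendstoI)
  fix \<delta>' :: real assume "\<delta>' > 0"
  define \<delta> where "\<delta> = min \<delta>' 1"
  have \<delta>: "0 < \<delta>" "\<delta> \<le> 1" "\<delta> \<le> \<delta>'" using \<open>\<delta>' > 0\<close> by (auto simp: \<delta>_def)
  let ?t = "\<lambda>n. (psi (Suc n) - real (Suc n)) / (real (Suc n))\<^sup>2"
  define c where "c = \<delta>\<^sup>2 / 16"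
  have c: "c > 0" using \<delta> by (simp add: c_def)
  obtain N0 where N0: "\<And>m n. m \<ge> N0 \<Longrightarrow> norm (sum ?t {m..<n}) < c"
    using psi_error_summable c unfolding summable_Cauchy by blast
  have up: "psi m < (1 + \<delta>) * real m" if m: "m \<ge> Suc N0" for m
  proof (rule ccontr)
    assume "\<not> psi m < (1 + \<delta>) * real m"
    then have big: "psi m \<ge> (1 + \<delta>) * real m" by simp
    define k where "k = nat \<lfloor>\<delta> * real m / 2\<rfloor>"
    have k: "real k \<le> \<delta> * real m / 2" "\<delta> * real m / 2 \<le> real (Suc k)"
    proof -
      have "real k = real_of_int \<lfloor>\<delta> * real m / 2\<rfloor>" using \<delta> by (simp add: k_def)
      then show "real k \<le> \<delta> * real m / 2" "\<delta> * real m / 2 \<le> real (Suc k)"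
        using floor_correct[of "\<delta> * real m / 2"] by linarith+
    qed
    have "c \<le> (\<delta> * real m / 2) * ((\<delta> * real m / 2) / (2 * real m)\<^sup>2)"
      using m by (simp add: c_def power2_eq_square field_simps)
    also have "\<dots> \<le> real (Suc k) * ((\<delta> * real m / 2) / (2 * real m)\<^sup>2)"
      using k \<delta> by (intro mult_right_mono) auto
    also have "\<dots> = (\<Sum>n\<in>{m - 1..<m + k}. (\<delta> * real m / 2) / (2 * real m)\<^sup>2)"
      using m by simp
    also have "\<dots> \<le> sum ?t {m - 1..<m + k}"
    proof (rule sum_mono)
      fix n assume n: "n \<in> {m - 1..<m + k}"
      then have n': "m \<le> Suc n" "Suc n \<le> m + k" by auto
      have r: "real (Suc n) \<le> real m + \<delta> * real m / 2" using n' k by linarith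
      have "psi m \<le> psi (Suc n)" by (rule psi_mono[OF n'(1)])
      then have 1: "\<delta> * real m / 2 \<le> psi (Suc n) - real (Suc n)" using big r by (simp add: algebra_simps)
      have "\<delta> * real m \<le> 1 * real m" using \<delta> by (intro mult_right_mono) auto
      then have "real (Suc n) \<le> 2 * real m" using r by linarith
      then have "(real (Suc n))\<^sup>2 \<le> (2 * real m)\<^sup>2" by (intro power_mono) auto
      moreover have "0 \<le> \<delta> * real m / 2" using \<delta> by simp
      then have "0 \<le> psi (Suc n) - real (Suc n)" using 1 by linarith
      ultimately show "(\<delta> * real m / 2) / (2 * real m)\<^sup>2 \<le> ?t n"
        using 1 by (intro frac_le) auto
    qed
    also have "\<dots> < c" using N0[of "m - 1" "m + k"] m by (simp add: abs_less_iff)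
    finally show False by simp
  qed
  have low: "psi m > (1 - \<delta>) * real m" if m: "m \<ge> 2 * N0 + 2" for m
  proof (rule ccontr)
    assume "\<not> psi m > (1 - \<delta>) * real m"
    then have small: "psi m \<le> (1 - \<delta>) * real m" by simp
    define k where "k = nat \<lfloor>\<delta> * real m / 2\<rfloor>"
    have k: "real k \<le> \<delta> * real m / 2" "\<delta> * real m / 2 \<le> real (Suc k)"
    proof -
      have "real k = real_of_int \<lfloor>\<delta> * real m / 2\<rfloor>" using \<delta> by (simp add: k_def)
      then show "real k \<le> \<delta> * real m / 2" "\<delta> * real m / 2 \<le> real (Suc k)"
        using floor_correct[of "\<delta> * real m / 2"] by linarith+
    qed
    have "\<delta> * real m \<le> 1 * real m" using \<delta> by (intro mult_right_mono) auto
    then have "2 * real k \<le> real m" using k(1) by linarith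
    then have km: "2 * k \<le> m" by linarith
    have "c \<le> (\<delta> * real m / 2) * ((\<delta> * real m / 2) / (real m)\<^sup>2)"
      using m \<delta> by (simp add: c_def power2_eq_square field_simps)
    also have "\<dots> \<le> real (Suc k) * ((\<delta> * real m / 2) / (real m)\<^sup>2)"
      using k \<delta> by (intro mult_right_mono) auto
    also have "\<dots> = (\<Sum>n\<in>{m - 1 - k..<m}. (\<delta> * real m / 2) / (real m)\<^sup>2)"
      using m km by (simp add: Suc_diff_Suc of_nat_diff)
    also have "\<dots> \<le> (\<Sum>n\<in>{m - 1 - k..<m}. - ?t n)"
    proof (rule sum_mono)
      fix n assume n: "n \<in> {m - 1 - k..<m}"
      then have n': "m \<le> Suc n + k" "Suc n \<le> m" by auto
      have r: "real (Suc n) \<ge> real m - \<delta> * real m / 2" using n' k by linarith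
      have "psi (Suc n) \<le> psi m" by (rule psi_mono[OF n'(2)])
      then have 1: "\<delta> * real m / 2 \<le> real (Suc n) - psi (Suc n)" using small r by (simp add: algebra_simps)
      have "(real (Suc n))\<^sup>2 \<le> (real m)\<^sup>2" using n' by (intro power_mono) auto
      moreover have "0 \<le> \<delta> * real m / 2" using \<delta> by simp
      then have "0 \<le> real (Suc n) - psi (Suc n)" using 1 by linarith
      ultimately have "(\<delta> * real m / 2) / (real m)\<^sup>2 \<le> (real (Suc n) - psi (Suc n)) / (real (Suc n))\<^sup>2"
        using 1 by (intro frac_le) auto
      then show "(\<delta> * real m / 2) / (real m)\<^sup>2 \<le> - ?t n" by (simp add: minus_divide_left)
    qed
    also have "\<dots> = - sum ?t {m - 1 - k..<m}" by (rule sum_negf)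
    also have "\<dots> < c" using N0[of "m - 1 - k" "m"] m km by (simp add: abs_less_iff)
    finally show False by simp
  qed
  show "eventually (\<lambda>n. dist (psi n / real n) 1 < \<delta>') sequentially"
    using eventually_ge_at_top[of "2 * N0 + 2"]
  proof eventually_elim
    case (elim n)
    have n: "real n > 0" using elim by simp
    have "psi n / real n < 1 + \<delta>" "psi n / real n > 1 - \<delta>"
      using up[of n] low[of n] elim n by (simp_all add: field_simps)
    then show ?case using \<delta> by (auto simp: dist_real_def abs_less_iff)
  qed
qed

section \<open>From Chebyshev's function to the prime number theorem\<close>

definition primepi :: "nat \<Rightarrow> nat" where
  "primepi n = card {p. prime p \<and> p \<le> n}"

lemma finite_primes_le: "finite {p::nat. prime p \<and> p \<le> n}"
  by (rule finite_subset[of _ "{..n}"]) auto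

text \<open>Each prime \<open>p <= n\<close> contributes \<open>ln p\<close> once for every power
  not exceeding \<open>n\<close>, in total at most \<open>ln n\<close>.\<close>

lemma psi_le_primepi: 
  assumes n: "n \<ge> 1"
  shows "psi n \<le> real (primepi n) * ln (real n)"
proof -
  let ?P = "{p::nat. prime p \<and> p \<le> n}"
  let ?I = "Sigma ?P (\<lambda>p. {1..nat \<lfloor>ln (real n) / ln (real p)\<rfloor>})"
  let ?f = "\<lambda>(p::nat, k::nat). p ^ k"
  have fin: "finite ?I" using finite_primes_le by auto
  have "psi n = (\<Sum>d\<in>{d\<in>{1..n}. primepow d}. mangoldt d)"
    unfolding psi_altdef by (rule sum.mono_neutral_right) (auto simp: mangoldt_def)
  also have "\<dots> \<le> (\<Sum>d\<in>?f ` ?I. mangoldt d)"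
  proof (rule sum_mono2)
    show "{d\<in>{1..n}. primepow d} \<subseteq> ?f ` ?I"
    proof
      fix d assume d: "d \<in> {d\<in>{1..n}. primepow d}"
      then obtain p k where pk: "prime p" "k > 0" "d = p ^ k" by (auto simp: primepow_def)
      have p1: "p > 1" using pk(1) prime_gt_1_nat by blast
      have "p ^ 1 \<le> p ^ k" using pk p1 by (intro power_increasing) auto
      then have "p \<le> n" using d pk by auto
      have "real k * ln (real p) = ln (real d)" using pk p1 by (simp add: ln_realpow)
      also have "\<dots> \<le> ln (real n)" using d by simp
      finally have "real k \<le> ln (real n) / ln (real p)" using p1 by (simp add: field_simps)
      then have "k \<le> nat \<lfloor>ln (real n) / ln (real p)\<rfloor>" by (simp add: le_nat_floor)
      then show "d \<in> ?f ` ?I" using pk \<open>p \<le> n\<close> by (intro image_eqI[of _ _ "(p, k)"]) auto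
    qed
  qed (use fin in \<open>auto simp: mangoldt_nonneg\<close>)
  also have "\<dots> \<le> sum (mangoldt \<circ> ?f) ?I"
    by (rule sum_image_le[OF fin]) (simp add: mangoldt_nonneg)
  also have "\<dots> = (\<Sum>(p, k)\<in>?I. ln (real p))"
    by (rule sum.cong) auto
  also have "\<dots> = (\<Sum>p\<in>?P. \<Sum>k\<in>{1..nat \<lfloor>ln (real n) / ln (real p)\<rfloor>}. ln (real p))"
    using finite_primes_le by (subst sum.Sigma) auto
  also have "\<dots> \<le> (\<Sum>p\<in>?P. ln (real n))"
  proof (rule sum_mono)
    fix p assume p: "p \<in> ?P"
    then have p1: "p > 1" using prime_gt_1_nat by blast
    have "real (nat \<lfloor>ln (real n) / ln (real p)\<rfloor>) \<le> ln (real n) / ln (real p)"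
      using n p1 by (intro of_nat_floor) auto
    then show "(\<Sum>k\<in>{1..nat \<lfloor>ln (real n) / ln (real p)\<rfloor>}. ln (real p)) \<le> ln (real n)"
      using p1 by (simp add: field_simps)
  qed
  also have "\<dots> = real (primepi n) * ln (real n)" by (simp add: primepi_def)
  finally show ?thesis .
qed

text \<open>Primes above \<open>n powr (1 - e)\<close> contribute at least
  \<open>(1 - e) * ln n\<close> each, and there are at most \<open>n powr (1 - e)\<close> others, a
  negligible number.\<close>

lemma primepi_le_psi:
  assumes n: "n \<ge> 2" and e: "0 < e" "e < 1"
  shows "(1 - e) * ln (real n) * (real (primepi n) - real n powr (1 - e)) \<le> psi n"
proof -
  let ?P = "{p::nat. prime p \<and> p \<le> n}" and ?x = "real n powr (1 - e)"
  let ?Q = "{p\<in>?P. real p > ?x}"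
  have fin: "finite ?P" "finite ?Q" using finite_primes_le by auto
  have "card ?P \<le> card (?Q \<union> {1..nat \<lfloor>?x\<rfloor>})"
  proof (rule card_mono)
    show "?P \<subseteq> ?Q \<union> {1..nat \<lfloor>?x\<rfloor>}"
    proof
      fix p assume p: "p \<in> ?P"
      then have "p \<ge> 1" using prime_ge_1_nat by blast
      moreover have "p \<le> nat \<lfloor>?x\<rfloor>" if "\<not> real p > ?x"
        using that by (intro le_nat_floor) simp
      ultimately show "p \<in> ?Q \<union> {1..nat \<lfloor>?x\<rfloor>}" using p by auto
    qed
  qed (use fin in auto)
  also have "\<dots> \<le> card ?Q + nat \<lfloor>?x\<rfloor>" using card_Un_le[of ?Q "{1..nat \<lfloor>?x\<rfloor>}"] by simp
  finally have "real (primepi n) \<le> real (card ?Q) + real (nat \<lfloor>?x\<rfloor>)"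
    unfolding primepi_def by linarith
  also have "real (nat \<lfloor>?x\<rfloor>) \<le> ?x" by simp
  finally have c: "real (primepi n) - ?x \<le> real (card ?Q)" by simp
  have "(1 - e) * ln (real n) * (real (primepi n) - ?x) \<le> (1 - e) * ln (real n) * real (card ?Q)"
    using c e n by (intro mult_left_mono) auto
  also have "\<dots> = (\<Sum>p\<in>?Q. (1 - e) * ln (real n))" by simp
  also have "\<dots> \<le> (\<Sum>p\<in>?Q. mangoldt p)"
  proof (rule sum_mono)
    fix p assume p: "p \<in> ?Q"
    have "(1 - e) * ln (real n) = ln ?x" using n by (simp add: ln_powr)
    also have "\<dots> \<le> ln (real p)" using p n by (intro ln_mono) auto
    finally show "(1 - e) * ln (real n) \<le> mangoldt p" using p by simp
  qed
  also have "\<dots> \<le> (\<Sum>p\<in>{1..n}. mangoldt p)"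
    using prime_ge_1_nat by (intro sum_mono2) (auto simp: mangoldt_nonneg)
  finally show ?thesis by (simp add: psi_altdef)
qed

theorem prime_number_theorem: "(\<lambda>n. real (primepi n) * ln (real n) / real n) \<longlonglongrightarrow> 1"
proof (rule tendstoI)
  fix \<epsilon> :: real assume \<epsilon>: "\<epsilon> > 0"
  define e where "e = min (\<epsilon> / (2 * (2 + \<epsilon>))) (1 / 2)"
  have e: "0 < e" "e < 1" "1 / (1 - e) \<le> 1 + \<epsilon> / 2"
  proof -
    show e01: "0 < e" "e < 1" using \<epsilon> by (auto simp: e_def)
    have "e \<le> \<epsilon> / (2 + \<epsilon>)" using \<epsilon> by (auto simp: e_def min_def field_simps)
    then have "e * (2 + \<epsilon>) \<le> \<epsilon>" using \<epsilon> by (simp add: field_simps)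
    then have "1 \<le> (1 + \<epsilon> / 2) * (1 - e)" by (simp add: algebra_simps)
    then show "1 / (1 - e) \<le> 1 + \<epsilon> / 2" using e01 by (simp add: field_simps)
  qed
  have "(\<lambda>n. (psi n / real n) / (1 - e) + real n powr (1 - e) * ln (real n) / real n) \<longlonglongrightarrow> 1 / (1 - e) + 0"
  proof (intro tendsto_add tendsto_divide psi_asymp tendsto_const)
    show "(\<lambda>n. real n powr (1 - e) * ln (real n) / real n) \<longlonglongrightarrow> 0"
      using e by real_asymp
  qed (use e in auto)
  then have ev1: "eventually (\<lambda>n. (psi n / real n) / (1 - e) + real n powr (1 - e) * ln (real n) / real n < 1 + \<epsilon>) sequentially"
    by (rule order_tendstoD) (use e \<epsilon> in auto)
  have ev2: "eventually (\<lambda>n. psi n / real n > 1 - \<epsilon>) sequentially"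
    using psi_asymp by (rule order_tendstoD) (use \<epsilon> in auto)
  show "eventually (\<lambda>n. dist (real (primepi n) * ln (real n) / real n) 1 < \<epsilon>) sequentially"
    using ev1 ev2 eventually_ge_at_top[of 2]
  proof eventually_elim
    case (elim n)
    have n: "real n > 0" using elim by simp
    have "psi n / real n \<le> real (primepi n) * ln (real n) / real n"
      using psi_le_primepi[of n] elim by (intro divide_right_mono) auto
    moreover have "real (primepi n) * ln (real n) / real n \<le> (psi n / real n) / (1 - e) + real n powr (1 - e) * ln (real n) / real n"
    proof -
      have "(real (primepi n) * ln (real n) - real n powr (1 - e) * ln (real n)) * (1 - e) \<le> psi n"
        using primepi_le_psi[of n e] elim e by (simp add: algebra_simps)
      then have "real (primepi n) * ln (real n) - real n powr (1 - e) * ln (real n) \<le> psi n / (1 - e)"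
        using e by (simp add: pos_le_divide_eq)
      then have "(real (primepi n) * ln (real n) - real n powr (1 - e) * ln (real n)) / real n \<le> (psi n / (1 - e)) / real n"
        by (rule divide_right_mono) simp
      then show ?thesis by (simp add: diff_divide_distrib divide_divide_eq_left mult.commute)
    qed
    ultimately show ?case using elim by (simp add: dist_real_def abs_less_iff)
  qed
qed

section \<open>The Kalmar function as a weighted sum\<close>

text \<open>\<open>Dfac t n\<close> is the number of ordered factorizations of \<open>n\<close> into \<open>t + 1\<close> positive integers.\<close>

definition Dfac :: "nat \<Rightarrow> nat \<Rightarrow> nat" where
  "Dfac t n = (\<Prod>p\<in>prime_factors n. (t + multiplicity p n) choose multiplicity p n)"

lemma prime_factors_finite_superset_eq:
  fixes f :: "nat \<Rightarrow> nat \<Rightarrow> 'a :: comm_monoid_mult"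
  assumes "finite A" "prime_factors n \<subseteq> A" "\<And>p. p \<in> A \<Longrightarrow> prime p" "\<And>p. f p 0 = 1" "n > 0"
  shows "(\<Prod>p\<in>prime_factors n. f p (multiplicity p n)) = (\<Prod>p\<in>A. f p (multiplicity p n))"
proof (rule prod.mono_neutral_left[OF assms(1,2)], rule ballI)
  fix p assume "p \<in> A - prime_factors n"
  then have "multiplicity p n = 0"
    using assms(3,5) by (auto simp: prime_factors_multiplicity)
  then show "f p (multiplicity p n) = 1" using assms(4) by simp
qed

lemma Dfac_1 [simp]: "Dfac t (Suc 0) = 1"
  by (simp add: Dfac_def)

lemma prod_prime_factors_power_mult:
  fixes f :: "nat \<Rightarrow> nat \<Rightarrow> 'a :: comm_monoid_mult"
  assumes p: "prime p" "\<not> p dvd m" "m > 0" and f: "\<And>p. f p 0 = 1"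
  shows "(\<Prod>q\<in>prime_factors (p ^ k * m). f q (multiplicity q (p ^ k * m)))
       = f p k * (\<Prod>q\<in>prime_factors m. f q (multiplicity q m))"
proof -
  let ?A = "insert p (prime_factors m)" and ?n = "p ^ k * m"
  have p0: "p > 0" using p prime_gt_0_nat by blast
  have mp: "multiplicity p ?n = k"
    using p p0 by (simp add: prime_elem_multiplicity_mult_distrib not_dvd_imp_multiplicity_0)
  have mq: "multiplicity q ?n = multiplicity q m" if "prime q" "q \<noteq> p" for q
    using that p p0 by (simp add: prime_elem_multiplicity_mult_distrib 
        multiplicity_distinct_prime_power)
  have sub: "prime_factors ?n \<subseteq> ?A"
    using p p0 by (cases "k = 0") (auto simp: prime_factors_product prime_factorization_prime_power)
  have "(\<Prod>q\<in>prime_factors ?n. f q (multiplicity q ?n)) = (\<Prod>q\<in>?A. f q (multiplicity q ?n))"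
    using p sub f p0 by (intro prime_factors_finite_superset_eq) auto
  also have "\<dots> = f p (multiplicity p ?n) * (\<Prod>q\<in>prime_factors m. f q (multiplicity q ?n))"
    using p by (subst prod.insert) auto
  also have "(\<Prod>q\<in>prime_factors m. f q (multiplicity q ?n)) = (\<Prod>q\<in>prime_factors m. f q (multiplicity q m))"
    using p by (intro prod.cong refl) (metis mq in_prime_factors_iff)
  finally show ?thesis using mp by simp
qed

lemma Dfac_prime_power_mult:
  assumes "prime p" "\<not> p dvd m" "m > 0"
  shows "Dfac t (p ^ k * m) = ((t + k) choose k) * Dfac t m"
  using prod_prime_factors_power_mult[OF assms, of "\<lambda>p k. (t + k) choose k" k] by (simp add: Dfac_def)

lemma nat_prime_power_decomp:
  assumes "n > (0::nat)" "prime p"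
  obtains m where "n = p ^ multiplicity p n * m" "\<not> p dvd m" "m > 0"
proof -
  obtain m where "n = p ^ multiplicity p n * m" "\<not> p dvd m"
    using multiplicity_decompose'[of n p] assms by (metis not_prime_unit gr_implies_not0)
  then show ?thesis using assms that by (metis bot_nat_0.not_eq_extremum mult_is_0)
qed

lemma bij_divisors_prime_power_mult:
  assumes p: "prime (p::nat)" "\<not> p dvd m" "m > 0"
  shows "bij_betw (\<lambda>(i, e). p ^ i * e) ({..k} \<times> {e. e dvd m}) {d. d dvd p ^ k * m}"
  unfolding bij_betw_def
proof
  have p0: "p > 0" using p prime_gt_0_nat by blast
  have mult: "multiplicity p (p ^ i * e) = i" if "e dvd m" for i e
  proof -
    have "e \<noteq> 0" using that p by auto
    moreover have "\<not> p dvd e" using that p(2) dvd_trans by blast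
    ultimately show ?thesis using p p0
      by (simp add: prime_elem_multiplicity_mult_distrib not_dvd_imp_multiplicity_0)
  qed
  show "inj_on (\<lambda>(i, e). p ^ i * e) ({..k} \<times> {e. e dvd m})"
  proof (rule inj_onI, clarsimp)
    fix i e j e' assume "e dvd m" "e' dvd m" "p ^ i * e = p ^ j * e'"
    then have "i = j" using mult by metis
    then show "i = j \<and> e = e'" using \<open>p ^ i * e = p ^ j * e'\<close> p0 by simp
  qed
  show "(\<lambda>(i, e). p ^ i * e) ` ({..k} \<times> {e. e dvd m}) = {d. d dvd p ^ k * m}"
  proof (intro equalityI subsetI)
    fix d assume "d \<in> (\<lambda>(i, e). p ^ i * e) ` ({..k} \<times> {e. e dvd m})"
    then show "d \<in> {d. d dvd p ^ k * m}" by (auto intro!: mult_dvd_mono le_imp_power_dvd)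
  next
    fix d assume "d \<in> {d. d dvd p ^ k * m}"
    then have d: "d dvd p ^ k * m" by simp
    have n0: "p ^ k * m > 0" using p p0 by simp
    then have d0: "d > 0" using d by (meson dvd_pos_nat)
    obtain e where e: "d = p ^ multiplicity p d * e" "\<not> p dvd e" "e > 0"
      by (rule nat_prime_power_decomp[OF d0 p(1)])
    have "multiplicity p d \<le> multiplicity p (p ^ k * m)"
      using d n0 by (intro dvd_imp_multiplicity_le) auto
    then have "multiplicity p d \<le> k" using mult[of m k] by simp
    moreover have "e dvd m"
    proof -
      have "coprime e (p ^ k)" using p e
        by (metis coprime_power_right_iff prime_imp_coprime_nat coprime_commute)
      moreover have "e dvd p ^ k * m" using d e(1) by (metis dvd_mult_right)
      ultimately show ?thesis by (simp add: coprime_dvd_mult_right_iff)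
    qed
    ultimately show "d \<in> (\<lambda>(i, e). p ^ i * e) ` ({..k} \<times> {e. e dvd m})"
      using e(1) by (intro image_eqI[of _ _ "(multiplicity p d, e)"]) auto
  qed
qed

text \<open>The functions \<open>Dfac t\<close> are the iterated divisor functions. Splitting off
  one prime power reduces the claim to the hockey-stick identity for the binomials
  \<open>(t + i) choose i\<close>.\<close>

lemma sum_divisors_Dfac:
  assumes "n > 0"
  shows "(\<Sum>d | d dvd n. Dfac t d) = Dfac (Suc t) n"
  using assms
proof (induction n rule: less_induct)
  case (less n)
  show ?case
  proof (cases "n = 1")
    case True
    then show ?thesis by (simp add: Dfac_def)
  next
    case False
    then obtain p where p: "prime p" "p dvd n" using prime_factor_nat by blast
    obtain m where m: "n = p ^ multiplicity p n * m" "\<not> p dvd m" "m > 0"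
      by (rule nat_prime_power_decomp[OF less.prems p(1)])
    define k where "k = multiplicity p n"
    have n: "n = p ^ k * m" using m by (simp add: k_def)
    have "k > 0" using p less.prems by (simp add: k_def prime_multiplicity_gt_zero_iff)
    then have "p ^ k > 1" by (intro one_less_power prime_gt_1_nat[OF p(1)])
    then have "m < n" using n m(3) by simp
    have fin: "finite {e. e dvd m}" using m(3) by simp
    have "(\<Sum>d | d dvd n. Dfac t d) = (\<Sum>(i, e)\<in>{..k} \<times> {e. e dvd m}. Dfac t (p ^ i * e))"
      unfolding n by (subst sum.reindex_bij_betw[OF bij_divisors_prime_power_mult[OF p(1) m(2,3)], symmetric])
        (simp add: case_prod_unfold)
    also have "\<dots> = (\<Sum>(i, e)\<in>{..k} \<times> {e. e dvd m}. ((t + i) choose i) * Dfac t e)"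
    proof (rule sum.cong[OF refl], clarsimp)
      fix i e assume "e dvd m"
      then have "\<not> p dvd e" "e > 0" using m by (auto dest: dvd_trans intro: dvd_pos_nat)
      then show "Dfac t (p ^ i * e) = ((t + i) choose i) * Dfac t e"
        by (rule Dfac_prime_power_mult[OF p(1)])
    qed
    also have "\<dots> = (\<Sum>i\<le>k. (t + i) choose i) * (\<Sum>e | e dvd m. Dfac t e)"
      by (simp add: sum_product sum.cartesian_product)
    also have "\<dots> = ((Suc t + k) choose k) * Dfac (Suc t) m"
      using less.IH[OF \<open>m < n\<close> m(3)] by (simp add: sum_choose_lower)
    also have "\<dots> = Dfac (Suc t) n"
      unfolding n by (rule Dfac_prime_power_mult[OF p(1) m(2,3), symmetric])
    finally show ?thesis .
  qed
qed

section \<open>Ordered factorizations and the weighted sum for \<open>Kalmar\<close>\<close>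

text \<open>Unlike the set in \<open>Kalmar\<close> it admits the empty list, so that
  \<open>n = 1\<close> has exactly one element and the recursion on the first factor is
  uniform.\<close>

definition flists :: "nat \<Rightarrow> nat list set" where
  "flists n = {xs. (\<forall>x\<in>set xs. 2 \<le> x) \<and> prod_list xs = n}"

lemma flists_1: "flists (Suc 0) = {[]}"
proof -
  have "xs = []" if "\<forall>x\<in>set xs. (2::nat) \<le> x" "prod_list xs = Suc 0" for xs
    using that by (cases xs) auto
  then show ?thesis by (auto simp: flists_def)
qed

lemma flists_rec:
  assumes n: "n \<ge> 2"
  shows "flists n = (\<Union>x\<in>{x. x dvd n \<and> 2 \<le> x}. (#) x ` flists (n div x))"
proof (intro equalityI subsetI)
  fix xs assume xs: "xs \<in> flists n"
  then obtain x ys where x: "xs = x # ys" using n by (cases xs) (auto simp: flists_def)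
  then have "x * prod_list ys = n" "2 \<le> x" "\<forall>x\<in>set ys. 2 \<le> x" using xs by (auto simp: flists_def)
  then show "xs \<in> (\<Union>x\<in>{x. x dvd n \<and> 2 \<le> x}. (#) x ` flists (n div x))"
    using x by (auto simp: flists_def intro!: exI[of _ x])
qed (auto simp: flists_def)

lemma finite_flists: "n > 0 \<Longrightarrow> finite (flists n)"
proof (induction n rule: less_induct)
  case (less n)
  show ?case
  proof (cases "n = 1")
    case False
    then have n: "n \<ge> 2" using less.prems by simp
    have "finite (flists (n div x))" if "x dvd n" "2 \<le> x" for x
      using that less.prems by (intro less.IH) (auto simp: div_greater_zero_iff intro: dvd_imp_le)
    then show ?thesis unfolding flists_rec[OF n] using less.prems by (intro finite_UN_I) auto
  qed (simp add: flists_1)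
qed

lemma Kalmar_eq_card: "n > 0 \<Longrightarrow> Kalmar n = card (flists n)"
proof (cases "n = 1")
  case False
  then have "{xs. xs \<noteq> [] \<and> (\<forall>x\<in>set xs. 2 \<le> x) \<and> prod_list xs = n} = flists n"
    by (auto simp: flists_def)
  then show ?thesis using False by (simp add: Kalmar_def)
qed (simp add: Kalmar_def flists_1)

text \<open>The first factor \<open>x >= 2\<close> of a factorization leaves one of the proper
  divisor \<open>n div x\<close>.\<close>

lemma Kalmar_rec:
  assumes n: "n \<ge> 2"
  shows "Kalmar n = (\<Sum>d | d dvd n \<and> d < n. Kalmar d)"
proof -
  let ?A = "{x. x dvd n \<and> 2 \<le> x}"
  have fin: "finite ?A" by (rule finite_subset[of _ "{..n}"]) (use n in \<open>auto dest: dvd_imp_le\<close>)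
  have pos: "n div x > 0" if "x \<in> ?A" for x using that n by (auto simp: div_greater_zero_iff intro: dvd_imp_le)
  have "Kalmar n = card (\<Union>x\<in>?A. (#) x ` flists (n div x))"
    using n flists_rec[OF n] by (simp add: Kalmar_eq_card)
  also have "\<dots> = (\<Sum>x\<in>?A. card ((#) x ` flists (n div x)))"
    using fin pos finite_flists by (intro card_UN_disjoint) auto
  also have "\<dots> = (\<Sum>x\<in>?A. Kalmar (n div x))"
    using pos by (intro sum.cong refl) (simp add: card_image Kalmar_eq_card)
  also have "\<dots> = (\<Sum>d | d dvd n \<and> d < n. Kalmar d)"
  proof (rule sum.reindex_bij_witness[of _ "\<lambda>d. n div d" "\<lambda>x. n div x"])
    fix x assume x: "x \<in> ?A"
    then obtain k where k: "n = x * k" by (auto elim: dvdE)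
    then have "k > 0" using n by (auto intro: Nat.gr0I)
    then show "n div (n div x) = x" "n div x \<in> {d. d dvd n \<and> d < n}"
      using k x by auto
  next
    fix d assume d: "d \<in> {d. d dvd n \<and> d < n}"
    then obtain k where k: "n = d * k" by (auto elim: dvdE)
    then have "k \<noteq> 0" "k \<noteq> 1" "d > 0" using d n by (auto intro: Nat.gr0I)
    then show "n div (n div d) = d" "n div d \<in> ?A" using k by auto
  qed simp
  finally show ?thesis .
qed

definition wt :: "nat \<Rightarrow> nat \<Rightarrow> real" where
  "wt n t = real (Dfac t n) / 2 ^ t"

lemma choose_le_power: "(t + a) choose a \<le> (t + 1) ^ a"
proof (induction a)
  case (Suc a)
  have "Suc a * ((t + Suc a) choose Suc a) = Suc (t + a) * ((t + a) choose a)"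
    using Suc_times_binomial_eq[of "t + a" a] by (simp add: mult.commute)
  also have "\<dots> \<le> (Suc a * (t + 1)) * (t + 1) ^ a"
    by (intro mult_mono Suc.IH) auto
  finally have "Suc a * ((t + Suc a) choose Suc a) \<le> Suc a * (t + 1) ^ Suc a"
    by (simp only: power_Suc mult.assoc)
  then show ?case by (simp only: mult_le_cancel1) 
qed simp

definition bigomega :: "nat \<Rightarrow> nat" where
  "bigomega n = (\<Sum>p\<in>prime_factors n. multiplicity p n)"

lemma Dfac_le: "Dfac t n \<le> (t + 1) ^ bigomega n"
  unfolding Dfac_def bigomega_def power_sum by (intro prod_mono choose_le_power conjI) auto

lemma Dfac_pos: "Dfac t n > 0"
  unfolding Dfac_def by (intro prod_pos) auto

lemma wt_pos: "wt n t > 0"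
  using Dfac_pos[of t n] by (simp add: wt_def)

lemma summable_wt_power: "summable (\<lambda>t. real (t + 1) ^ k * wt n t)"
proof (rule summable_comparison_test_ev)
  let ?a = "real (k + bigomega n)"
  have "((\<lambda>t. real (t + 1) powr ?a * (1/2) ^ t / (3/4) ^ t) \<longlongrightarrow> 0) at_top"
    by real_asymp
  then have "eventually (\<lambda>t. real (t + 1) powr ?a * (1/2) ^ t / (3/4) ^ t < 1) at_top"
    by (rule order_tendstoD) simp
  then show "eventually (\<lambda>t. norm (real (t + 1) ^ k * wt n t) \<le> (3/4) ^ t) at_top"
  proof eventually_elim
    case (elim t)
    have "real (Dfac t n) \<le> real (t + 1) ^ bigomega n"
      using Dfac_le[of t n] by (metis of_nat_le_iff of_nat_power)
    then have "wt n t \<le> real (t + 1) ^ bigomega n / 2 ^ t"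
      unfolding wt_def by (rule divide_right_mono) simp
    then have "wt n t \<le> real (t + 1) ^ bigomega n * (1/2) ^ t"
      by (simp only: power_one_over mult_1_right times_divide_eq_right)
    then have "real (t + 1) ^ k * wt n t \<le> real (t + 1) ^ k * (real (t + 1) ^ bigomega n * (1/2) ^ t)"
      by (intro mult_left_mono) auto
    also have "\<dots> = real (t + 1) powr ?a * (1/2) ^ t"
      by (simp only: powr_realpow power_add of_nat_0_less_iff zero_less_Suc Suc_eq_plus1[symmetric] mult.assoc)
    also have "\<dots> \<le> (3/4) ^ t" using elim by (simp add: field_simps)
    finally show ?case using wt_pos[of n t] by simp
  qed
qed simp

lemma summable_wt: "summable (wt n)"
  using summable_wt_power[of 0 n] by simp

definition Usum :: "nat \<Rightarrow> real" where
  "Usum n = (\<Sum>t. wt n t)"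

lemma Usum_pos: "Usum n > 0"
  unfolding Usum_def by (rule suminf_pos[OF summable_wt wt_pos])

lemma wt_1: "wt (Suc 0) t = (1/2) ^ t"
  by (simp add: wt_def power_one_over)

lemma Usum_1: "Usum (Suc 0) = 2"
  unfolding Usum_def wt_1[abs_def] by (simp add: suminf_geometric)

text \<open>Summing over divisors shifts \<open>t\<close> by one, which doubles the weight
  \<open>2^(-t)\<close> and loses the initial term \<open>wt n 0 = 1\<close>.\<close>

lemma Usum_divisors:
  assumes "n > 0"
  shows "(\<Sum>d | d dvd n. Usum d) = 2 * (Usum n - 1)"
proof -
  have fin: "finite {d. d dvd n}" using assms by simp
  have "(\<Sum>d | d dvd n. Usum d) = (\<Sum>t. \<Sum>d | d dvd n. wt d t)"
    unfolding Usum_def by (rule suminf_sum[symmetric]) (rule summable_wt)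
  also have "(\<lambda>t. \<Sum>d | d dvd n. wt d t) = (\<lambda>t. 2 * wt n (Suc t))"
  proof
    fix t
    have "(\<Sum>d | d dvd n. wt d t) = real (\<Sum>d | d dvd n. Dfac t d) / 2 ^ t"
      by (simp add: wt_def sum_divide_distrib)
    then show "(\<Sum>d | d dvd n. wt d t) = 2 * wt n (Suc t)"
      using assms by (simp add: sum_divisors_Dfac wt_def)
  qed
  also have "(\<Sum>t. 2 * wt n (Suc t)) = 2 * (\<Sum>t. wt n (Suc t))"
    using summable_wt[of n] by (intro suminf_mult) (simp add: summable_Suc_iff)
  also have "(\<Sum>t. wt n (Suc t)) = Usum n - wt n 0"
    unfolding Usum_def by (rule suminf_split_head[OF summable_wt])
  also have "wt n 0 = 1" by (simp add: wt_def Dfac_def)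
  finally show ?thesis .
qed

text \<open>\<open>Usum n\<close> is 2 plus the sum of \<open>Usum\<close> over the proper divisors,
  while \<open>Kalmar\<close> obeys this recursion without the 2. The divisor 1 contributes
  \<open>Usum 1 = 2\<close>, only half of \<open>4 * Kalmar 1\<close>, and the constant 2 supplies
  the other half.\<close>

lemma Kalmar_eq_Usum: "n \<ge> 2 \<Longrightarrow> real (Kalmar n) = Usum n / 4"
proof (induction n rule: less_induct)
  case (less n)
  let ?D = "{d. d dvd n \<and> d < n}"
  have fin: "finite ?D" by (rule finite_subset[of _ "{..<n}"]) auto
  have one: "1 \<in> ?D" using less.prems by auto
  have D: "{d. d dvd n} = insert n ?D"
    using less.prems by (auto dest: dvd_imp_le simp: le_less)
  have "2 * (Usum n - 1) = Usum n + (\<Sum>d\<in>?D. Usum d)"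
  proof -
    have "sum Usum (insert n ?D) = Usum n + sum Usum ?D" using fin by (subst sum.insert) auto
    then show ?thesis using Usum_divisors[of n] less.prems D by simp
  qed
  then have U: "Usum n = 2 + (\<Sum>d\<in>?D. Usum d)" by simp
  also have "(\<Sum>d\<in>?D. Usum d) = Usum 1 + (\<Sum>d\<in>?D - {1}. Usum d)"
    by (rule sum.remove[OF fin one])
  also have "(\<Sum>d\<in>?D - {1}. Usum d) = (\<Sum>d\<in>?D - {1}. 4 * real (Kalmar d))"
  proof (rule sum.cong[OF refl])
    fix d assume "d \<in> ?D - {1}"
    then have "d < n" "d \<ge> 2" using less.prems by (cases d; force)+
    then show "Usum d = 4 * real (Kalmar d)" using less.IH[of d] by simp
  qed
  also have "\<dots> = 4 * (\<Sum>d\<in>?D - {1}. real (Kalmar d))" by (simp add: sum_distrib_left)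
  finally have U2: "Usum n = 4 + 4 * (\<Sum>d\<in>?D - {1}. real (Kalmar d))" by (simp add: Usum_1)
  have "real (Kalmar n) = (\<Sum>d\<in>?D. real (Kalmar d))" using Kalmar_rec[OF less.prems] by simp
  also have "\<dots> = real (Kalmar 1) + (\<Sum>d\<in>?D - {1}. real (Kalmar d))"
    by (rule sum.remove[OF fin one])
  finally show ?case using U2 by (simp add: Kalmar_def)
qed

section \<open>Mean and concentration of the weights\<close>

definition tau :: "nat \<Rightarrow> real" where
  "tau n = (\<Sum>t. real t * wt n t) / Usum n"

text \<open>At \<open>x = t + 1\<close> this is the ratio of \<open>Dfac (t + 1) n\<close> to
  \<open>Dfac t n\<close>; the weights therefore grow as long as it exceeds 2.\<close>

definition rising :: "nat \<Rightarrow> real \<Rightarrow> real" where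
  "rising n x = (\<Prod>p\<in>prime_factors n. 1 + real (multiplicity p n) / x)"

lemma summable_t_wt: "summable (\<lambda>t. real t ^ k * wt n t)"
proof (rule summable_comparison_test[OF _ summable_wt_power])
  have "norm (real t ^ k * wt n t) \<le> real (t + 1) ^ k * wt n t" for t
    using wt_pos[of n t] by (simp add: abs_mult) (intro mult_right_mono power_mono, auto)
  then show "\<exists>N. \<forall>t\<ge>N. norm (real t ^ k * wt n t) \<le> real (t + 1) ^ k * wt n t" by blast
qed

lemma summable_t1_wt: "summable (\<lambda>t. real t * wt n t)"
  using summable_t_wt[of 1 n] by simp

lemma tau_times_Usum: "(\<Sum>t. real t * wt n t) = tau n * Usum n"
  using Usum_pos[of n] by (simp add: tau_def)

lemma tau_nonneg: "tau n \<ge> 0"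
  unfolding tau_def using Usum_pos[of n] wt_pos
  by (intro divide_nonneg_pos suminf_nonneg summable_t1_wt mult_nonneg_nonneg) (auto intro: less_imp_le)

lemma Dfac_mult_prime:
  assumes n: "n > 0" and p: "prime p"
  shows "Dfac t (n * p) * (multiplicity p n + 1) = Dfac t n * (t + multiplicity p n + 1)"
proof -
  define k where "k = multiplicity p n"
  obtain m where m: "n = p ^ k * m" "\<not> p dvd m" "m > 0"
    using nat_prime_power_decomp[OF n p] unfolding k_def by metis
  have "n * p = p ^ Suc k * m" using m(1) by simp
  then have 1: "Dfac t (n * p) = ((t + Suc k) choose Suc k) * Dfac t m"
    using Dfac_prime_power_mult[OF p m(2,3)] by metis
  have 2: "Dfac t n = ((t + k) choose k) * Dfac t m"
    unfolding m(1) by (rule Dfac_prime_power_mult[OF p m(2,3)])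
  have "((t + Suc k) choose Suc k) * Suc k = Suc (t + k) * ((t + k) choose k)"
    using Suc_times_binomial_eq[of "t + k" k] by simp
  then have "(((t + Suc k) choose Suc k) * Suc k) * Dfac t m = (Suc (t + k) * ((t + k) choose k)) * Dfac t m"
    by (simp only:)
  then show ?thesis unfolding 1 2 k_def[symmetric]
    by (simp only: Suc_eq_plus1 add.assoc mult.assoc mult.commute mult.left_commute)
qed

lemma wt_mult_prime:
  assumes n: "n > 0" and p: "prime p"
  shows "wt (n * p) t = wt n t * (1 + real t / (real (multiplicity p n) + 1))"
proof -
  have "real (Dfac t (n * p)) * (real (multiplicity p n) + 1) = real (Dfac t n) * (real t + real (multiplicity p n) + 1)"
    using arg_cong[OF Dfac_mult_prime[OF assms, of t], of real] by (simp add: algebra_simps)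
  then have "real (Dfac t (n * p)) = real (Dfac t n) * (1 + real t / (real (multiplicity p n) + 1))"
    by (simp add: field_simps)
  then show ?thesis by (simp add: wt_def)
qed

lemma Usum_mult_prime:
  assumes n: "n > 0" and p: "prime p"
  shows "Usum (n * p) = Usum n * (1 + tau n / (real (multiplicity p n) + 1))"
proof -
  let ?a = "real (multiplicity p n) + 1"
  have "Usum (n * p) = (\<Sum>t. wt n t + (real t * wt n t) / ?a)"
    unfolding Usum_def by (rule suminf_cong) (simp add: wt_mult_prime[OF assms] algebra_simps)
  also have "\<dots> = (\<Sum>t. wt n t) + (\<Sum>t. (real t * wt n t) / ?a)"
    by (intro suminf_add[symmetric] summable_wt summable_divide summable_t1_wt)
  also have "(\<Sum>t. (real t * wt n t) / ?a) = (\<Sum>t. real t * wt n t) / ?a"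
    by (intro suminf_divide summable_t1_wt)
  also have "\<dots> = tau n * Usum n / ?a" by (simp only: tau_times_Usum)
  finally show ?thesis by (simp add: Usum_def[symmetric] algebra_simps)
qed

text \<open>A further prime multiplies the weight at \<open>t\<close> by an increasing affine
  function of \<open>t\<close>, which can only raise the mean; in formulas this is the nonnegativity
  of the variance.\<close>

lemma tau_mult_prime:
  assumes n: "n > 0" and p: "prime p"
  shows "tau n \<le> tau (n * p)"
proof -
  define c where "c = real (multiplicity p n) + 1"
  have c: "c > 0" and cc: "real (multiplicity p n) + 1 = c" by (simp_all add: c_def)
  let ?S2 = "\<Sum>t. real t ^ 2 * wt n t"
  note s2 = summable_t_wt[of 2 n]
  have "0 \<le> (\<Sum>t. (real t - tau n)\<^sup>2 * wt n t)"
  proof (rule suminf_nonneg)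
    have "summable (\<lambda>t. real t ^ 2 * wt n t - 2 * tau n * (real t * wt n t) + (tau n)\<^sup>2 * wt n t)"
      by (intro summable_add summable_diff summable_mult s2 summable_t1_wt summable_wt)
    then show "summable (\<lambda>t. (real t - tau n)\<^sup>2 * wt n t)"
      by (simp add: power2_eq_square algebra_simps)
  qed (simp add: less_imp_le[OF wt_pos])
  also have "(\<lambda>t. (real t - tau n)\<^sup>2 * wt n t) = (\<lambda>t. real t ^ 2 * wt n t - 2 * tau n * (real t * wt n t) + (tau n)\<^sup>2 * wt n t)"
    by (simp add: power2_eq_square algebra_simps)
  also have "suminf \<dots> = ?S2 - 2 * tau n * (tau n * Usum n) + (tau n)\<^sup>2 * Usum n"
    using summable_sums[OF s2] summable_sums[OF summable_t1_wt[of n], unfolded tau_times_Usum]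
      summable_sums[OF summable_wt[of n], folded Usum_def]
    by (intro sums_unique[symmetric] sums_add sums_diff sums_mult)
  finally have var: "(tau n)\<^sup>2 * Usum n \<le> ?S2" by (simp add: power2_eq_square algebra_simps)
  have "(\<Sum>t. real t * wt (n * p) t) = (\<Sum>t. real t * wt n t + (real t ^ 2 * wt n t) / c)"
    by (rule suminf_cong) (simp add: wt_mult_prime[OF assms, unfolded cc] power2_eq_square algebra_simps)
  also have "\<dots> = (\<Sum>t. real t * wt n t) + (\<Sum>t. (real t ^ 2 * wt n t) / c)"
    by (intro suminf_add[symmetric] summable_t1_wt summable_divide s2)
  also have "\<dots> = tau n * Usum n + ?S2 / c"
    using suminf_divide[OF s2, of c] by (simp only: tau_times_Usum)
  finally have num: "tau (n * p) * Usum (n * p) = tau n * Usum n + ?S2 / c"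
    by (simp only: tau_times_Usum)
  have "tau n * Usum (n * p) = tau n * Usum n + ((tau n)\<^sup>2 * Usum n) / c"
    by (simp add: Usum_mult_prime[OF assms, unfolded cc] power2_eq_square algebra_simps)
  also have "\<dots> \<le> tau (n * p) * Usum (n * p)"
    unfolding num using var c by (intro add_left_mono divide_right_mono) auto
  finally show ?thesis using Usum_pos[of "n * p"] by simp
qed

lemma dvd_mono_nat:
  fixes f :: "nat \<Rightarrow> real"
  assumes step: "\<And>n p. n > 0 \<Longrightarrow> prime p \<Longrightarrow> f n \<le> f (n * p)"
    and dvd: "m dvd n" and n: "n > 0"
  shows "f m \<le> f n"
proof -
  obtain k where k: "n = m * k" using dvd by (auto elim: dvdE)
  have "m > 0" using k n by (auto intro: Nat.gr0I)
  have "k > 0 \<Longrightarrow> f m \<le> f (m * k)"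
  proof (induction k rule: prime_divisors_induct)
    case (factor p x)
    then have "x > 0" "prime p" by (auto intro: Nat.gr0I)
    have "f m \<le> f (m * x)" by (rule factor(2)) fact
    also have "\<dots> \<le> f (m * x * p)" using \<open>m > 0\<close> \<open>x > 0\<close> \<open>prime p\<close> by (intro step) auto
    finally show ?case by (simp add: mult_ac)
  qed auto
  then show ?thesis using k n by (auto intro: Nat.gr0I)
qed

lemma tau_mono: "m dvd n \<Longrightarrow> n > 0 \<Longrightarrow> tau m \<le> tau n"
  by (rule dvd_mono_nat[OF tau_mult_prime])

lemma wt_Suc: "wt n (Suc t) = wt n t * (rising n (real (Suc t)) / 2)"
proof -
  have "real (Suc t + a choose a) = real (t + a choose a) * (1 + real a / real (Suc t))" for a
  proof -
    have "(Suc t) * (Suc t + a choose a) = (Suc t + a) * (t + a choose a)"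
      using binomial_absorb_comp[of "Suc t + a" a] by simp
    then have "real (Suc t) * real (Suc t + a choose a) = real (Suc t + a) * real (t + a choose a)"
      by (metis of_nat_mult)
    then show ?thesis by (simp add: field_simps del: of_nat_Suc) (simp add: algebra_simps)
  qed
  then have "real (Dfac (Suc t) n) = real (Dfac t n) * rising n (real (Suc t))"
    unfolding Dfac_def rising_def of_nat_prod by (simp only: prod.distrib)
  then show ?thesis by (simp add: wt_def)
qed

lemma one_plus_sum_le_prod:
  fixes y :: "'a \<Rightarrow> real"
  assumes "finite A" "\<And>i. i \<in> A \<Longrightarrow> 0 \<le> y i"
  shows "1 + (\<Sum>i\<in>A. y i) \<le> (\<Prod>i\<in>A. 1 + y i)"
  using assms
proof (induction A rule: finite_induct)
  case (insert i A)
  have "1 + (\<Sum>i\<in>insert i A. y i) \<le> (1 + y i) * (1 + (\<Sum>i\<in>A. y i))"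
    using insert by (simp add: algebra_simps sum_nonneg)
  also have "\<dots> \<le> (1 + y i) * (\<Prod>i\<in>A. 1 + y i)"
    using insert by (intro mult_left_mono) auto
  finally show ?case using insert by simp
qed simp

lemma one_minus_sum_le_prod:
  fixes y :: "'a \<Rightarrow> real"
  assumes "finite A" "\<And>i. i \<in> A \<Longrightarrow> 0 \<le> y i \<and> y i \<le> 1"
  shows "1 - (\<Sum>i\<in>A. y i) \<le> (\<Prod>i\<in>A. 1 - y i) \<and> (\<Prod>i\<in>A. 1 - y i) \<le> 1 \<and> 0 \<le> (\<Prod>i\<in>A. 1 - y i)"
  using assms
proof (induction A rule: finite_induct)
  case (insert i A)
  let ?Q = "\<Prod>i\<in>A. 1 - y i"
  have ih: "1 - (\<Sum>i\<in>A. y i) \<le> ?Q" "?Q \<le> 1" "0 \<le> ?Q" using insert by auto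
  have yi: "0 \<le> y i" "y i \<le> 1" using insert by auto
  have "y i * ?Q \<le> y i * 1" using yi ih by (intro mult_left_mono) auto
  moreover have "(1 - y i) * ?Q \<le> 1 * 1" using yi ih by (intro mult_mono) auto
  moreover have "0 \<le> (1 - y i) * ?Q" using yi ih by (intro mult_nonneg_nonneg) auto
  ultimately show ?case using insert(1,2) ih(1) by (simp add: algebra_simps)
qed simp

text \<open>As a function of \<open>v\<close> on the unit interval the product is convex, so it lies
  below the chord from its value 1 at \<open>v = 0\<close> to its value at \<open>v = 1\<close>. The
  induction carries this out without derivatives.\<close>

lemma prod_chord:
  fixes y :: "'a \<Rightarrow> real"
  assumes "finite A" "\<And>i. i \<in> A \<Longrightarrow> 0 \<le> y i \<and> y i \<le> 1" "0 \<le> v" "v \<le> 1"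
  shows "(\<Prod>i\<in>A. 1 - y i * v) \<le> 1 - v * (1 - (\<Prod>i\<in>A. 1 - y i))"
  using assms
proof (induction A rule: finite_induct)
  case (insert i A)
  let ?Q = "\<Prod>i\<in>A. 1 - y i"
  have ih: "(\<Prod>i\<in>A. 1 - y i * v) \<le> 1 - v * (1 - ?Q)" using insert by auto
  have yi: "0 \<le> y i" "y i \<le> 1" using insert by auto
  have Q: "?Q \<le> 1" using one_minus_sum_le_prod[of A y] insert by auto
  have "y i * v \<le> 1 * 1" using yi insert by (intro mult_mono) auto
  then have "(1 - y i * v) * (\<Prod>i\<in>A. 1 - y i * v) \<le> (1 - y i * v) * (1 - v * (1 - ?Q))"
    using ih by (intro mult_left_mono) auto
  also have "\<dots> = 1 - v * (1 - (1 - y i) * ?Q) - y i * v * (1 - ?Q) * (1 - v)"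
    by (simp add: algebra_simps)
  also have "\<dots> \<le> 1 - v * (1 - (1 - y i) * ?Q)"
    using yi insert Q by simp
  finally show ?case using insert by simp
qed simp

lemma bigomega_pos: "n \<ge> 2 \<Longrightarrow> bigomega n \<ge> 1"
proof -
  assume n: "n \<ge> 2"
  then obtain p where p: "prime p" "p dvd n" using prime_factor_nat[of n] by auto
  then have pn: "p \<in> prime_factors n" using n by (simp add: in_prime_factors_iff)
  then have "multiplicity p n \<ge> 1" by (simp add: prime_factors_multiplicity Suc_le_eq)
  also have "multiplicity p n \<le> bigomega n" unfolding bigomega_def
    using pn by (intro member_le_sum) auto
  finally show ?thesis .
qed

lemma rising_ge: "x > 0 \<Longrightarrow> 1 + real (bigomega n) / x \<le> rising n x"
  using one_plus_sum_le_prod[of "prime_factors n" "\<lambda>p. real (multiplicity p n) / x"]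
  by (simp add: rising_def bigomega_def sum_divide_distrib)

lemma rising_le_exp: "x > 0 \<Longrightarrow> rising n x \<le> exp (real (bigomega n) / x)"
proof -
  assume x: "x > 0"
  have "rising n x \<le> (\<Prod>p\<in>prime_factors n. exp (real (multiplicity p n) / x))"
    unfolding rising_def using x by (intro prod_mono conjI) (auto intro: add_nonneg_nonneg)
  also have "\<dots> = exp (\<Sum>p\<in>prime_factors n. real (multiplicity p n) / x)"
    by (simp add: exp_sum)
  finally show ?thesis by (simp add: bigomega_def sum_divide_distrib)
qed

lemma rising_pos: "x > 0 \<Longrightarrow> rising n x > 0"
  unfolding rising_def by (intro prod_pos) (auto intro: add_pos_nonneg)

text \<open>The point \<open>M\<close> of the overview. The two bounds belong to the choice, so that
  they come with the root.\<close>

definition Mval :: "nat \<Rightarrow> real" where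
  "Mval n = (SOME x. real (bigomega n) \<le> x \<and> x \<le> real (bigomega n) / ln 2 \<and> rising n x = 2)"

text \<open>Intermediate values:
  \<open>1 + bigomega n / x <= rising n x <= exp (bigomega n / x)\<close> puts the value 2 between
  the two bounds.\<close>

lemma Mval:
  assumes n: "n \<ge> 2"
  shows "real (bigomega n) \<le> Mval n" "Mval n \<le> real (bigomega n) / ln 2" "rising n (Mval n) = 2"
    "Mval n \<ge> 1"
proof -
  let ?a = "real (bigomega n)" and ?b = "real (bigomega n) / ln 2"
  have a: "?a \<ge> 1" using bigomega_pos[OF n] by simp
  have ln2: "0 < ln (2::real)" "ln (2::real) < 1" using ln2_le_25_over_36 by auto
  have ab: "?a \<le> ?b" using a ln2 by (simp add: field_simps)
  have b: "?b > 0" using a ab by linarith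
  have "\<exists>x\<ge>?a. x \<le> ?b \<and> rising n x = 2"
  proof (rule IVT2')
    show "2 \<le> rising n ?a" using rising_ge[of ?a n] a by simp
    show "rising n ?b \<le> 2" using rising_le_exp[OF b, of n] a by simp
    show "continuous_on {?a..?b} (rising n)"
      unfolding rising_def[abs_def] using a by (intro continuous_intros) auto
  qed (use ab in auto)
  then have "\<exists>x. ?a \<le> x \<and> x \<le> ?b \<and> rising n x = 2" by blast
  from someI_ex[OF this] show "?a \<le> Mval n" "Mval n \<le> ?b" "rising n (Mval n) = 2"
    unfolding Mval_def by auto
  then show "Mval n \<ge> 1" using a by linarith
qed

text \<open>With \<open>M = Mval n\<close> the ratio of consecutive weights crosses 1 at \<open>M\<close>, at a definite rate.\<close>

lemma rising_Mval_bounds: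
  assumes n: "n \<ge> 2" and r: "r > 0"
  shows "r \<ge> Mval n \<Longrightarrow> rising n r / 2 \<le> 1 - (r - Mval n) / (2 * r)"
    and "r \<le> Mval n \<Longrightarrow> rising n r / 2 \<ge> 1 + (Mval n - r) / (2 * r)"
proof -
  define M where "M = Mval n"
  have M: "M > 0" "rising n M = 2" using Mval[OF n] by (auto simp: M_def)
  \<comment> \<open>The factor of \<open>rising\<close> at \<open>r\<close> becomes the one at
    \<open>M\<close> times \<open>1 + y p * (M / r - 1)\<close>, and the product of the
    \<open>1 - y p\<close> is \<open>1 / 2\<close>. For \<open>r >= M\<close> the chord bound
    applies; for \<open>r <= M\<close> the half enters through the sum of the \<open>y p\<close>
    being at least \<open>1 / 2\<close>.\<close>
  define y where "y p = real (multiplicity p n) / (M + real (multiplicity p n))" for p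
  have y: "0 \<le> y p" "y p \<le> 1" for p using M by (auto simp: y_def field_simps)
  have inv: "1 - y p = 1 / (1 + real (multiplicity p n) / M)" for p
    using M by (simp add: y_def field_simps add_pos_nonneg)
  have half: "(\<Prod>p\<in>prime_factors n. 1 - y p) = 1 / 2"
    unfolding inv using M(2) by (simp add: rising_def prod_dividef)
  have fac: "1 + real (multiplicity p n) / r = (1 + real (multiplicity p n) / M) * (1 + y p * (M / r - 1))" for p
  proof -
    define a where "a = real (multiplicity p n)"
    have pos: "M + a > 0" using M by (simp add: add_pos_nonneg a_def)
    have "1 + a / M = (M + a) / M" using M by (simp add: field_simps)
    then have "(1 + a / M) * y p = a / M" using pos by (simp add: y_def a_def[symmetric])
    then have "(1 + a / M) * (1 + y p * (M / r - 1)) = (1 + a / M) + (a / M) * (M / r - 1)"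
      by (simp only: distrib_left mult_1_right mult.assoc[symmetric])
    also have "\<dots> = 1 + a / r" using M r by (simp add: field_simps)
    finally show ?thesis by (simp add: a_def)
  qed
  have rr: "rising n r / 2 = (\<Prod>p\<in>prime_factors n. 1 + y p * (M / r - 1))"
    unfolding rising_def fac prod.distrib using M(2) by (simp add: rising_def)
  have S: "(\<Sum>p\<in>prime_factors n. y p) \<ge> 1 / 2"
    using one_minus_sum_le_prod[of "prime_factors n" y] y half by auto
  show "r \<ge> Mval n \<Longrightarrow> rising n r / 2 \<le> 1 - (r - Mval n) / (2 * r)"
  proof -
    assume "r \<ge> Mval n"
    then have rM: "M \<le> r" by (simp add: M_def)
    have "(\<Prod>p\<in>prime_factors n. 1 - y p * (1 - M / r)) \<le> 1 - (1 - M / r) * (1 - 1 / 2)"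
      using prod_chord[of "prime_factors n" y "1 - M / r"] y half rM M r by (simp add: field_simps)
    also have "(\<lambda>p. 1 - y p * (1 - M / r)) = (\<lambda>p. 1 + y p * (M / r - 1))"
      by (simp add: algebra_simps)
    finally show ?thesis unfolding rr M_def[symmetric] using r by (simp add: field_simps)
  qed
  show "r \<le> Mval n \<Longrightarrow> rising n r / 2 \<ge> 1 + (Mval n - r) / (2 * r)"
  proof -
    assume "r \<le> Mval n"
    then have u: "M / r - 1 \<ge> 0" using r by (simp add: M_def)
    have "1 + (1 / 2) * (M / r - 1) \<le> 1 + (\<Sum>p\<in>prime_factors n. y p) * (M / r - 1)"
      using S u by (intro add_left_mono mult_right_mono) auto
    also have "\<dots> = 1 + (\<Sum>p\<in>prime_factors n. y p * (M / r - 1))"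
      by (simp only: sum_distrib_right)
    also have "\<dots> \<le> (\<Prod>p\<in>prime_factors n. 1 + y p * (M / r - 1))"
      using y u by (intro one_plus_sum_le_prod) auto
    finally show ?thesis unfolding rr M_def[symmetric] using r by (simp add: field_simps)
  qed
qed

lemma rising_antimono: "0 < x \<Longrightarrow> x \<le> y \<Longrightarrow> rising n y \<le> rising n x"
  unfolding rising_def by (intro prod_mono conjI add_left_mono divide_left_mono) (auto intro!: add_nonneg_nonneg)

lemma rising_mult_prime:
  assumes n: "n > 0" and p: "prime p" and x: "x > 0"
  shows "rising (n * p) x = rising n x * (1 + 1 / (x + real (multiplicity p n)))"
proof -
  define k where "k = multiplicity p n"
  obtain m where m: "n = p ^ k * m" "\<not> p dvd m" "m > 0"
    using nat_prime_power_decomp[OF n p] unfolding k_def by metis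
  let ?f = "\<lambda>(p::nat) a. 1 + real a / x"
  have r: "rising (p ^ j * m) x = (1 + real j / x) * (\<Prod>q\<in>prime_factors m. 1 + real (multiplicity q m) / x)" for j
    using prod_prime_factors_power_mult[OF p m(2,3), of ?f j] by (simp add: rising_def)
  have "n * p = p ^ Suc k * m" using m(1) by simp
  moreover have "1 + real (Suc k) / x = (1 + real k / x) * (1 + 1 / (x + real k))"
  proof -
    define y where "y = x + real k"
    have y: "y > 0" using x by (simp add: add_pos_nonneg y_def)
    have "1 + real k / x = y / x" using x by (simp add: y_def field_simps)
    moreover have "(y / x) * (1 + 1 / y) = y / x + 1 / x" using x y by (simp add: field_simps)
    ultimately have "(1 + real k / x) * (1 + 1 / (x + real k)) = (x + real k) / x + 1 / x"
      by (simp only: y_def)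
    also have "\<dots> = 1 + real (Suc k) / x" using x by (simp add: field_simps)
    finally show ?thesis by simp
  qed
  ultimately have "rising (n * p) x = (1 + real k / x) * (1 + 1 / (x + real k)) * (\<Prod>q\<in>prime_factors m. 1 + real (multiplicity q m) / x)"
    using r[of "Suc k"] by metis
  also have "\<dots> = rising n x * (1 + 1 / (x + real k))"
    using r[of k] unfolding m(1)[symmetric] by simp
  finally show ?thesis unfolding k_def .
qed

text \<open>The new prime multiplies \<open>rising\<close> by more than 1, so the root cannot move
  down. At \<open>r = M + 2\<close> the old value, halved, is at most \<open>1 - 1 / r\<close>, and
  the new factor is at most \<open>1 + 1 / r\<close>; their product is below 1, so the new root lies
  below \<open>r\<close>.\<close>

lemma Mval_mult_prime:
  assumes n: "n \<ge> 2" and p: "prime p"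
  shows "Mval n \<le> Mval (n * p)" "Mval (n * p) \<le> Mval n + 2"
proof -
  have np: "n * p \<ge> 2" using n prime_ge_2_nat[OF p] by (metis One_nat_def Suc_1 le_trans mult_le_mono nat_mult_1_right one_le_numeral)
  have n0: "n > 0" using n by simp
  define M where "M = Mval n"
  define M' where "M' = Mval (n * p)"
  have M: "M \<ge> 1" "rising n M = 2" using Mval[OF n] by (auto simp: M_def)
  have M': "M' \<ge> 1" "rising (n * p) M' = 2" using Mval[OF np] by (auto simp: M'_def)
  show "Mval n \<le> Mval (n * p)"
  proof (rule ccontr)
    assume "\<not> Mval n \<le> Mval (n * p)"
    then have lt: "M' < M" by (simp add: M_def M'_def)
    have "1 < 1 + (M - M') / (2 * M')" using lt M' by simp
    also have "\<dots> \<le> rising n M' / 2"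
      using rising_Mval_bounds(2)[OF n, of M'] lt M' by (simp add: M_def)
    also have "\<dots> \<le> rising (n * p) M' / 2"
      using rising_mult_prime[OF n0 p, of M'] rising_pos[of M' n] M'(1) by simp
    finally show False using M'(2) by simp
  qed
  show "Mval (n * p) \<le> Mval n + 2"
  proof (rule ccontr)
    assume "\<not> Mval (n * p) \<le> Mval n + 2"
    then have gt: "M + 2 < M'" by (simp add: M_def M'_def)
    let ?r = "M + 2"
    have "rising (n * p) ?r / 2 = (rising n ?r / 2) * (1 + 1 / (?r + real (multiplicity p n)))"
      using rising_mult_prime[OF n0 p, of ?r] M(1) by simp
    also have "\<dots> \<le> (1 - (?r - M) / (2 * ?r)) * (1 + 1 / ?r)"
      using rising_Mval_bounds(1)[OF n, of ?r] rising_pos[of ?r n] M(1)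
      by (intro mult_mono add_left_mono divide_left_mono) (auto simp: M_def intro!: mult_pos_pos add_pos_nonneg)
    also have "\<dots> = 1 - (1 / ?r) * (1 / ?r)"
    proof -
      have "(1 - 2 / (2 * r)) * (1 + 1 / r) = 1 - (1 / r) * (1 / r)" if "r > 0" for r :: real
        using that by (simp add: field_simps)
      from this[of ?r] show ?thesis using M(1) by simp
    qed
    also have "\<dots> < 1" using M(1) by simp
    finally have "rising (n * p) ?r < 2" by simp
    moreover have "rising (n * p) M' \<le> rising (n * p) ?r" using gt M(1) by (intro rising_antimono) auto
    ultimately show False using M'(2) by simp
  qed
qed

text \<open>Summation by parts with \<open>wt n (Suc t) = wt n t * (rising / 2)\<close>: the sum of
  \<open>wt n t * (1 - rising / 2) * (t + 1 - M)\<close> telescopes to at most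
  \<open>Usum n\<close>, and by the crossing rate each of its terms dominates the quadratic
  one.\<close>

lemma Usum_variance:
  assumes n: "n \<ge> 2"
  shows "summable (\<lambda>t. wt n t * ((real (Suc t) - Mval n)\<^sup>2 / (2 * real (Suc t))))"
    and "(\<Sum>t. wt n t * ((real (Suc t) - Mval n)\<^sup>2 / (2 * real (Suc t)))) \<le> Usum n"
proof -
  define M where "M = Mval n"
  have M: "M \<ge> 1" using Mval[OF n] by (simp add: M_def)
  let ?g = "\<lambda>t. wt n t * ((real (Suc t) - M)\<^sup>2 / (2 * real (Suc t)))"
  let ?f = "\<lambda>t. wt n t * (real (Suc t) - M)"
  have key: "(r - M)\<^sup>2 / (2 * r) \<le> (1 - rising n r / 2) * (r - M)" if r: "r > 0" for r
  proof (cases "r \<ge> M")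
    case True
    have "((r - M) / (2 * r)) * (r - M) \<le> (1 - rising n r / 2) * (r - M)"
    proof (rule mult_right_mono)
      show "(r - M) / (2 * r) \<le> 1 - rising n r / 2"
        using rising_Mval_bounds(1)[OF n r, folded M_def] True by linarith
    qed (use True in auto)
    then show ?thesis by (simp add: power2_eq_square)
  next
    case False
    have "((M - r) / (2 * r)) * (M - r) \<le> (rising n r / 2 - 1) * (M - r)"
    proof (rule mult_right_mono)
      show "(M - r) / (2 * r) \<le> rising n r / 2 - 1"
        using rising_Mval_bounds(2)[OF n r, folded M_def] False by linarith
    qed (use False in auto)
    moreover have "((M - r) / (2 * r)) * (M - r) = (r - M)\<^sup>2 / (2 * r)"
      by (simp add: power2_eq_square algebra_simps)
    moreover have "(a - 1) * (M - r) = (1 - a) * (r - M)" for a by (simp add: algebra_simps)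
    ultimately show ?thesis by metis
  qed
  have g_le: "?g t \<le> (?f t - ?f (Suc t)) + wt n (Suc t)" for t
  proof -
    have "?g t \<le> wt n t * ((1 - rising n (real (Suc t)) / 2) * (real (Suc t) - M))"
      using wt_pos[of n t] by (intro mult_left_mono key) auto
    also have "\<dots> = ?f t - wt n (Suc t) * (real (Suc t) - M)"
      unfolding wt_Suc by (simp add: algebra_simps)
    also have "\<dots> = (?f t - ?f (Suc t)) + wt n (Suc t)" by (simp add: algebra_simps)
    finally show ?thesis .
  qed
  have "summable (\<lambda>t. real t * wt n t + (1 - M) * wt n t)"
    by (intro summable_add summable_mult summable_t1_wt summable_wt)
  then have "summable ?f" by (simp add: algebra_simps)
  then have "?f \<longlonglongrightarrow> 0" by (rule summable_LIMSEQ_zero)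
  then have "(\<lambda>t. ?f t - ?f (Suc t)) sums (?f 0 - 0)" by (rule telescope_sums')
  moreover have "(\<lambda>t. wt n (Suc t)) sums (Usum n - wt n 0)"
    unfolding Usum_def using sums_split_initial_segment[OF summable_sums[OF summable_wt[of n]], of 1] by simp
  ultimately have s: "(\<lambda>t. (?f t - ?f (Suc t)) + wt n (Suc t)) sums (?f 0 - 0 + (Usum n - wt n 0))"
    by (rule sums_add)
  have g0: "0 \<le> ?g t" for t using wt_pos[of n t] by (intro mult_nonneg_nonneg) auto
  have "norm (?g t) \<le> (?f t - ?f (Suc t)) + wt n (Suc t)" for t
    using g_le[of t] g0[of t] by (simp only: real_norm_def abs_of_nonneg)
  then have sg: "summable ?g"
    by (intro summable_comparison_test[OF _ sums_summable[OF s]]) blast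
  then show "summable (\<lambda>t. wt n t * ((real (Suc t) - Mval n)\<^sup>2 / (2 * real (Suc t))))"
    by (simp add: M_def)
  have "suminf ?g \<le> ?f 0 - 0 + (Usum n - wt n 0)"
    by (rule sums_le[OF g_le summable_sums[OF sg] s])
  also have "\<dots> = Usum n - M * wt n 0" by (simp add: algebra_simps)
  also have "\<dots> \<le> Usum n" using M wt_pos[of n 0] by simp
  finally show "(\<Sum>t. wt n t * ((real (Suc t) - Mval n)\<^sup>2 / (2 * real (Suc t)))) \<le> Usum n"
    by (simp add: M_def)
qed

text \<open>With \<open>k = sqrt M\<close>, the inequality
  \<open>|r - M| <= k * (r - M)^2 / (2 * r) + r / (2 * k)\<close> turns the variance bound into
  \<open>|R - M| <= k + R / (2 * k)\<close> for \<open>R = tau n + 1\<close>. A first crude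
  consequence \<open>R <= 4 * M\<close> then makes the right side at most
  \<open>3 * k\<close>.\<close>

lemma tau_Mval:
  assumes n: "n \<ge> 2"
  shows "\<bar>tau n + 1 - Mval n\<bar> \<le> 3 * sqrt (Mval n)"
proof -
  define M where "M = Mval n"
  have M: "M \<ge> 1" using Mval[OF n] by (simp add: M_def)
  define k where "k = sqrt M"
  have k: "k \<ge> 1" "k * k = M" using M by (auto simp: k_def)
  let ?d = "\<lambda>t. real (Suc t) - M"
  let ?g = "\<lambda>t. wt n t * ((?d t)\<^sup>2 / (2 * real (Suc t)))"
  note v = Usum_variance[OF n, folded M_def]
  have sR: "(\<lambda>t. wt n t * real (Suc t)) sums (tau n * Usum n + Usum n)"
  proof -
    have "(\<lambda>t. real t * wt n t + wt n t) sums (tau n * Usum n + Usum n)"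
      unfolding tau_times_Usum[symmetric]
      by (intro sums_add summable_sums summable_t1_wt) (simp add: Usum_def summable_sums summable_wt)
    then show ?thesis by (simp add: algebra_simps)
  qed
  define R where "R = tau n + 1"
  have R: "R \<ge> 1" using tau_nonneg[of n] by (simp add: R_def)
  have U: "Usum n > 0" by (rule Usum_pos)
  have pt: "\<bar>?d t\<bar> \<le> k * ((?d t)\<^sup>2 / (2 * real (Suc t))) + real (Suc t) / (2 * k)" for t
  proof -
    have "0 \<le> (k * \<bar>?d t\<bar> - real (Suc t))\<^sup>2" by simp
    then have "2 * k * \<bar>?d t\<bar> * real (Suc t) \<le> k\<^sup>2 * (?d t)\<^sup>2 + (real (Suc t))\<^sup>2"
      by (simp add: power2_diff power_mult_distrib algebra_simps)
    then have "2 * k * \<bar>?d t\<bar> * real (Suc t) / (2 * k * real (Suc t)) \<le> (k\<^sup>2 * (?d t)\<^sup>2 + (real (Suc t))\<^sup>2) / (2 * k * real (Suc t))"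
      using k by (intro divide_right_mono) auto
    also have "2 * k * \<bar>?d t\<bar> * real (Suc t) / (2 * k * real (Suc t)) = \<bar>?d t\<bar>" using k by simp
    also have "(k\<^sup>2 * (?d t)\<^sup>2 + (real (Suc t))\<^sup>2) / (2 * k * real (Suc t)) = k * ((?d t)\<^sup>2 / (2 * real (Suc t))) + real (Suc t) / (2 * k)"
      using k(1) by (simp add: add_divide_distrib power2_eq_square)
    finally show ?thesis .
  qed
  have s1: "(\<lambda>t. k * ?g t + (wt n t * real (Suc t)) / (2 * k)) sums (k * suminf ?g + (R * Usum n) / (2 * k))"
    using sR unfolding R_def by (intro sums_add sums_mult sums_divide summable_sums v(1)) (simp add: algebra_simps)
  have s2: "(\<lambda>t. wt n t * ?d t) sums (R * Usum n - M * Usum n)"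
  proof -
    have "(\<lambda>t. wt n t * real (Suc t) - M * wt n t) sums ((tau n * Usum n + Usum n) - M * Usum n)"
      by (intro sums_diff sums_mult sR) (simp add: Usum_def summable_sums summable_wt)
    then show ?thesis by (simp add: R_def algebra_simps)
  qed
  have le: "\<bar>wt n t * ?d t\<bar> \<le> k * ?g t + (wt n t * real (Suc t)) / (2 * k)" for t
  proof -
    have "wt n t * \<bar>?d t\<bar> \<le> wt n t * (k * ((?d t)\<^sup>2 / (2 * real (Suc t))) + real (Suc t) / (2 * k))"
      using wt_pos[of n t] by (intro mult_left_mono pt) auto
    then show ?thesis using wt_pos[of n t] by (simp add: abs_mult distrib_left mult_ac)
  qed
  have up: "R * Usum n - M * Usum n \<le> k * suminf ?g + (R * Usum n) / (2 * k)"
    by (rule sums_le[OF _ s2 s1]) (use le abs_le_iff in blast)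
  have lo: "- (R * Usum n - M * Usum n) \<le> k * suminf ?g + (R * Usum n) / (2 * k)"
    by (rule sums_le[OF _ sums_minus[OF s2] s1]) (use le abs_le_iff in blast)
  have "k * suminf ?g \<le> k * Usum n" using v(2) k by (intro mult_left_mono) auto
  then have "\<bar>R * Usum n - M * Usum n\<bar> \<le> k * Usum n + (R * Usum n) / (2 * k)" using up lo by linarith
  then have "\<bar>R - M\<bar> * Usum n \<le> (k + R / (2 * k)) * Usum n"
  proof -
    have "R * Usum n - M * Usum n = (R - M) * Usum n" by (simp only: left_diff_distrib)
    moreover have "\<bar>(R - M) * Usum n\<bar> = \<bar>R - M\<bar> * Usum n" using U by (simp add: abs_mult)
    moreover have "k * Usum n + (R * Usum n) / (2 * k) = (k + R / (2 * k)) * Usum n"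
      by (simp only: distrib_right times_divide_eq_left)
    ultimately show ?thesis using \<open>\<bar>R * Usum n - M * Usum n\<bar> \<le> _\<close> by simp
  qed
  then have d: "\<bar>R - M\<bar> \<le> k + R / (2 * k)" using U by simp
  have "R / (2 * k) \<le> R / 2" using R k by (intro divide_left_mono) auto
  then have "R \<le> 2 * M + 2 * k" using d by linarith
  also have "\<dots> \<le> 2 * (k * k) + 2 * (k * k)" using k mult_mono[of 1 k 1 k] by (simp flip: k(2))
  finally have "R / (2 * k) \<le> (4 * (k * k)) / (2 * k)" using k by (intro divide_right_mono) auto
  also have "\<dots> = 2 * k" using k(1) by simp
  finally show ?thesis using d unfolding R_def[symmetric] M_def[symmetric] k_def[symmetric] by linarith
qed

section \<open>Several prime factors at once, and the shape of champions\<close>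

lemma multiplicity_mult_prime_ge: "n > 0 \<Longrightarrow> m > 0 \<Longrightarrow> multiplicity (q::nat) n \<le> multiplicity q (n * m)"
  by (intro dvd_imp_multiplicity_le) auto

lemma multiplicity_self_mult: "n > 0 \<Longrightarrow> prime (q::nat) \<Longrightarrow> multiplicity q (n * q) = multiplicity q n + 1"
  by (simp add: prime_elem_multiplicity_mult_distrib prime_gt_0_nat)

lemma multiplicity_other_mult:
  "n > 0 \<Longrightarrow> prime (q::nat) \<Longrightarrow> prime p \<Longrightarrow> p \<noteq> q \<Longrightarrow> multiplicity q (n * p) = multiplicity q n"
  by (simp add: prime_elem_multiplicity_mult_distrib prime_gt_0_nat prime_multiplicity_other)

lemma prod_list_primes_pos: "(\<forall>q\<in>set ps. prime (q::nat)) \<Longrightarrow> prod_list ps > 0"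
  by (induction ps) (auto simp: prime_gt_0_nat)

text \<open>Each new prime multiplies \<open>Usum\<close> by 1 plus \<open>tau\<close> over its
  exponent plus 1. Along the way \<open>tau\<close> only grows and the exponent plus 1 never exceeds
  the final exponent, so the initial bound \<open>lo\<close> and the final bound \<open>D\<close>
  serve at every step. The upper estimate below uses the final \<open>tau\<close> and the initial
  exponents.\<close>

lemma Usum_prod_list_lower:
  assumes "n > 0" "\<forall>q\<in>set ps. prime q" "0 \<le> lo" "lo \<le> tau n"
    and "\<forall>q\<in>set ps. real (multiplicity q (n * prod_list ps)) \<le> D" "D > 0"
  shows "Usum n * (1 + lo / D) ^ length ps \<le> Usum (n * prod_list ps)"
  using assms
proof (induction ps arbitrary: n)
  case (Cons q qs)
  have q: "prime q" and n: "n > 0" using Cons.prems by auto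
  have q0: "q > 0" using q prime_gt_0_nat by blast
  have pos: "prod_list qs > 0" using Cons.prems prod_list_primes_pos by auto
  have "multiplicity q (n * q) \<le> multiplicity q (n * q * prod_list qs)"
    using n q0 pos by (intro multiplicity_mult_prime_ge) auto
  then have le: "real (multiplicity q n) + 1 \<le> D"
    using Cons.prems(5) multiplicity_self_mult[OF n q] by (force simp: mult.assoc)
  have t: "tau n \<le> tau (n * q)" by (rule tau_mult_prime[OF n q])
  have "lo / D \<le> tau n / (real (multiplicity q n) + 1)"
    using le Cons.prems tau_nonneg[of n] by (intro frac_le) auto
  then have s: "Usum n * (1 + lo / D) \<le> Usum (n * q)"
    unfolding Usum_mult_prime[OF n q] using Usum_pos[of n] by (intro mult_left_mono) auto
  have "Usum n * (1 + lo / D) ^ length (q # qs) = (Usum n * (1 + lo / D)) * (1 + lo / D) ^ length qs"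
    by simp
  also have "\<dots> \<le> Usum (n * q) * (1 + lo / D) ^ length qs"
    using s Cons.prems by (intro mult_right_mono) auto
  also have "\<dots> \<le> Usum (n * q * prod_list qs)"
    using Cons.prems n q0 t by (intro Cons.IH) (auto simp: mult.assoc)
  finally show ?case by (simp add: mult.assoc)
qed simp

lemma Usum_prod_list_upper:
  assumes "n > 0" "\<forall>q\<in>set ps. prime q" "0 \<le> hi" "tau (n * prod_list ps) \<le> hi"
    and "\<forall>q\<in>set ps. d \<le> real (multiplicity q n) + 1" "d > 0"
  shows "Usum (n * prod_list ps) \<le> Usum n * (1 + hi / d) ^ length ps"
  using assms
proof (induction ps arbitrary: n)
  case (Cons q qs)
  have q: "prime q" and n: "n > 0" using Cons.prems by auto
  have q0: "q > 0" using q prime_gt_0_nat by blast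
  have pos: "prod_list qs > 0" using Cons.prems prod_list_primes_pos by auto
  have "tau n \<le> tau (n * prod_list (q # qs))"
    using n q0 pos by (intro tau_mono) auto
  then have t: "tau n \<le> hi" using Cons.prems by linarith
  have "tau n / (real (multiplicity q n) + 1) \<le> hi / d"
    using t Cons.prems tau_nonneg[of n] by (intro frac_le) auto
  then have s: "Usum (n * q) \<le> Usum n * (1 + hi / d)"
    unfolding Usum_mult_prime[OF n q] using Usum_pos[of n] by (intro mult_left_mono) auto
  have mle: "multiplicity r n \<le> multiplicity r (n * q)" for r
    using n q0 by (intro multiplicity_mult_prime_ge) auto
  have "Usum (n * q * prod_list qs) \<le> Usum (n * q) * (1 + hi / d) ^ length qs"
  proof (rule Cons.IH)
    show "\<forall>r\<in>set qs. d \<le> real (multiplicity r (n * q)) + 1"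
    proof
      fix r assume "r \<in> set qs"
      then have "d \<le> real (multiplicity r n) + 1" using Cons.prems by auto
      then show "d \<le> real (multiplicity r (n * q)) + 1" using mle[of r] by linarith
    qed
  qed (use Cons.prems n q0 in \<open>auto simp: mult.assoc\<close>)
  also have "\<dots> \<le> (Usum n * (1 + hi / d)) * (1 + hi / d) ^ length qs"
    using s Cons.prems by (intro mult_right_mono) auto
  finally show ?case by (simp add: mult.assoc)
qed simp

lemma Mval_prod_list:
  assumes "n \<ge> 2" "\<forall>q\<in>set ps. prime q"
  shows "Mval n \<le> Mval (n * prod_list ps)" "Mval (n * prod_list ps) \<le> Mval n + 2 * real (length ps)"
proof -
  have "Mval n \<le> Mval (n * prod_list ps) \<and> Mval (n * prod_list ps) \<le> Mval n + 2 * real (length ps)"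
    using assms
  proof (induction ps arbitrary: n)
    case (Cons q qs)
    have q: "prime q" using Cons.prems by simp
    have "n * q \<ge> 2 * 1" using Cons.prems(1) prime_ge_1_nat[OF q] by (intro mult_le_mono) auto
    then have ih: "Mval (n * q) \<le> Mval (n * q * prod_list qs) \<and> Mval (n * q * prod_list qs) \<le> Mval (n * q) + 2 * real (length qs)"
      using Cons.prems by (intro Cons.IH) auto
    show ?case using ih Mval_mult_prime[OF Cons.prems(1) q] by (simp add: mult.assoc)
  qed simp
  then show "Mval n \<le> Mval (n * prod_list ps)" "Mval (n * prod_list ps) \<le> Mval n + 2 * real (length ps)" by auto
qed

lemma champion_Usum_less:
  assumes "K_champion N" "2 \<le> m" "m < N"
  shows "Usum m < Usum N"
proof -
  have "Kalmar m < Kalmar N" using assms by (auto simp: K_champion_def)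
  then have "real (Kalmar m) < real (Kalmar N)" by simp
  then show ?thesis using assms Kalmar_eq_Usum[of m] Kalmar_eq_Usum[of N] by simp
qed

text \<open>Replacing one factor \<open>p\<close> by a smaller prime \<open>q\<close> gives a
  smaller number, hence a smaller \<open>Usum\<close>; by the quotient formula for
  \<open>n = N / p\<close> the exponent of \<open>q\<close> in \<open>n\<close> then exceeds that of
  \<open>p\<close>.\<close>

lemma champion_multiplicity_mono:
  assumes N: "K_champion N" and p: "prime p" and q: "prime q" and qp: "q \<le> p"
  shows "multiplicity p N \<le> multiplicity q N"
proof (cases "p dvd N \<and> q \<noteq> p")
  case False
  then show ?thesis by (auto simp: not_dvd_imp_multiplicity_0)
next
  case True
  then obtain n where "N = p * n" by (auto elim: dvdE)
  then have n: "N = n * p" by simp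
  have "N > 0" using N by (simp add: K_champion_def)
  then have n0: "n > 0" using n by (auto intro: Nat.gr0I)
  have mp: "multiplicity p N = multiplicity p n + 1" unfolding n by (rule multiplicity_self_mult[OF n0 p])
  have mq: "multiplicity q N = multiplicity q n" unfolding n by (rule multiplicity_other_mult[OF n0 q p]) (use True in auto)
  have "1 * 2 \<le> n * q" using n0 prime_ge_2_nat[OF q] by (intro mult_le_mono) auto
  moreover have "n * q < N" unfolding n using n0 qp True by auto
  ultimately have "Usum (n * q) < Usum (n * p)" using champion_Usum_less[OF N] n by simp
  then have lt: "tau n / (real (multiplicity q n) + 1) < tau n / (real (multiplicity p n) + 1)"
    unfolding Usum_mult_prime[OF n0 p] Usum_mult_prime[OF n0 q] using Usum_pos[of n] by simp
  have "multiplicity p n < multiplicity q n"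
  proof (rule ccontr)
    assume "\<not> multiplicity p n < multiplicity q n"
    then have "tau n / (real (multiplicity p n) + 1) \<le> tau n / (real (multiplicity q n) + 1)"
      using tau_nonneg[of n] by (intro divide_left_mono) auto
    then show False using lt by simp
  qed
  then show ?thesis using mp mq by simp
qed

lemma champion_even:
  assumes N: "K_champion N" "N \<ge> 2"
  shows "multiplicity 2 N \<ge> 1"
proof -
  obtain p where p: "prime p" "p dvd N" using prime_factor_nat[of N] N(2) by auto
  have "N > 0" using N by simp
  then have "multiplicity p N \<ge> 1" using p by (simp add: Suc_le_eq prime_multiplicity_gt_zero_iff)
  also have "\<dots> \<le> multiplicity 2 N"
    using champion_multiplicity_mono[OF N(1) p(1) two_is_prime_nat] prime_ge_2_nat[OF p(1)] by simp
  finally show ?thesis .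
qed

lemma tau_bounds:
  assumes "n \<ge> 2" "Mval n \<le> B"
  shows "tau n \<le> B + 3 * sqrt B" "Mval n - 3 * sqrt B - 1 \<le> tau n"
proof -
  have "sqrt (Mval n) \<le> sqrt B" using assms by simp
  then show "tau n \<le> B + 3 * sqrt B" "Mval n - 3 * sqrt B - 1 \<le> tau n"
    using tau_Mval[OF assms(1)] assms(2) by linarith+
qed

lemma prod_list_replicate_power: "prod_list (replicate k (x::nat)) = x ^ k"
  by (induction k) auto

lemma multiplicity_mult_power_2:
  "n > 0 \<Longrightarrow> multiplicity 2 (n * 2 ^ x :: nat) = multiplicity 2 n + x"
  by (simp add: prime_elem_multiplicity_mult_distrib)

lemma multiplicity_prod_list_other:
  assumes "n > 0" "\<forall>q\<in>set ps. prime q \<and> q \<noteq> p" "prime (p::nat)"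
  shows "multiplicity p (n * prod_list ps) = multiplicity p n"
  using assms
proof (induction ps arbitrary: n)
  case (Cons q qs)
  then have q: "prime q" "q \<noteq> p" by auto
  have "multiplicity p (n * q * prod_list qs) = multiplicity p (n * q)"
    using Cons.prems q prime_gt_0_nat[OF q(1)] by (intro Cons.IH) auto
  then show ?case using multiplicity_other_mult[OF Cons.prems(1) assms(3) q(1) q(2)] by (simp add: mult.assoc)
qed simp

section \<open>Exchange inequalities for champions\<close>

text \<open>The competitor is \<open>n * 2 ^ x < N\<close>; both values are compared through
  \<open>Usum n\<close>. In \<open>6 * s\<close>, removing at most \<open>s\<close> primes lowers
  \<open>Mval\<close> by at most \<open>2 * s\<close>, the distance of \<open>tau\<close> from
  \<open>Mval\<close> takes \<open>3 * s\<close>, and the last \<open>s\<close> absorbs the constant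
  1.\<close>

lemma champion_exchange_remove:
  assumes N: "K_champion N" and n: "n \<ge> 2" "n * prod_list ps = N"
    and ps: "\<forall>q\<in>set ps. prime q \<and> q \<noteq> 2" and x: "2 ^ x < prod_list ps"
    and M: "M = Mval N" "s = sqrt M" "s \<ge> 6" "real (length ps) \<le> s"
    and d: "d > 0" "\<forall>q\<in>set ps. d \<le> real (multiplicity q n) + 1"
  shows "(1 + (M - 6 * s) / (real (multiplicity 2 N) + real x)) ^ x < (1 + (M + 6 * s) / d) ^ length ps"
proof -
  have ps': "\<forall>q\<in>set ps. prime q" using ps by auto
  have n0: "n > 0" using n by simp
  have N2: "N \<ge> 2" using n prod_list_primes_pos[OF ps'] by (metis One_nat_def Suc_leI le_trans mult.right_neutral mult_le_mono2)
  have M0: "M \<ge> 0" "s * s = M" "s \<ge> 0" using M Mval(4)[OF N2] by auto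
  have Mn: "Mval n \<le> M" "M - 2 * real (length ps) \<le> Mval n"
    using Mval_prod_list[OF n(1) ps'] n(2) M(1) by auto
  have lo: "M - 6 * s \<le> tau n" using tau_bounds(2)[OF n(1) Mn(1)] Mn(2) M by linarith
  have hi: "tau N \<le> M + 6 * s" using tau_bounds(1)[OF N2, of M] M M0 by simp
  have "6 * s \<le> s * s" using M(3) by (intro mult_right_mono) auto
  then have lo0: "0 \<le> M - 6 * s" using M0 by simp
  let ?D = "real (multiplicity 2 N) + real x"
  have m2: "multiplicity 2 N = multiplicity 2 n"
    unfolding n(2)[symmetric] using n0 ps by (intro multiplicity_prod_list_other) auto
  have "n * 2 ^ x < N" unfolding n(2)[symmetric] using n0 x by simp
  moreover have "2 * 1 \<le> n * 2 ^ x" using n by (intro mult_le_mono) auto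
  ultimately have lt: "Usum (n * 2 ^ x) < Usum N" using champion_Usum_less[OF N] by simp
  have D: "?D > 0" using champion_even[OF N N2] by linarith
  have "Usum n * (1 + (M - 6 * s) / ?D) ^ length (replicate x (2::nat)) \<le> Usum (n * prod_list (replicate x 2))"
    by (rule Usum_prod_list_lower[OF n0 _ lo0 lo])
       (use D m2 n0 in \<open>auto simp: prod_list_replicate_power multiplicity_mult_power_2\<close>)
  also have "\<dots> < Usum N" using lt by (simp add: prod_list_replicate_power)
  also have "Usum N \<le> Usum n * (1 + (M + 6 * s) / d) ^ length ps"
    unfolding n(2)[symmetric]
    by (rule Usum_prod_list_upper[OF n0 ps' _ _ d(2,1)]) (use hi n M0 in auto)
  finally show ?thesis using Usum_pos[of n] by simp
qed

text \<open>The converse trade, with competitor \<open>n * prod_list ps\<close>. The upper bound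
  runs over the powers of 2 that rebuild \<open>N\<close> from \<open>n\<close>, so it involves the
  exponent of 2 in \<open>n\<close>.\<close>

lemma champion_exchange_insert:
  assumes N: "K_champion N" and n: "n \<ge> 2" "n * 2 ^ x = N"
    and ps: "\<forall>q\<in>set ps. prime q \<and> q \<noteq> 2" and x: "prod_list ps < 2 ^ x"
    and M: "M = Mval N" "s = sqrt M" "s \<ge> 6" "real x \<le> s"
    and D: "D > 0" "\<forall>q\<in>set ps. real (multiplicity q (N * prod_list ps)) \<le> D"
  shows "(1 + (M - 6 * s) / D) ^ length ps < (1 + (M + 6 * s) / (real (multiplicity 2 n) + 1)) ^ x"
proof -
  have ps': "\<forall>q\<in>set ps. prime q" using ps by auto
  have n0: "n > 0" using n by simp
  have N2: "N \<ge> 2" using n by (metis le_trans mult.right_neutral mult_le_mono2 one_le_numeral one_le_power)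
  have M0: "M \<ge> 0" "s * s = M" "s \<ge> 0" using M Mval(4)[OF N2] by auto
  let ?r = "replicate x (2::nat)"
  have r: "prod_list ?r = 2 ^ x" by (rule prod_list_replicate_power)
  have Mn: "Mval n \<le> M" "M - 2 * real x \<le> Mval n"
    using Mval_prod_list[OF n(1), of ?r] n(2) M(1) r by auto
  have lo: "M - 6 * s \<le> tau n" using tau_bounds(2)[OF n(1) Mn(1)] Mn(2) M by linarith
  have hi: "tau N \<le> M + 6 * s" using tau_bounds(1)[OF N2, of M] M M0 by simp
  have "6 * s \<le> s * s" using M(3) by (intro mult_right_mono) auto
  then have lo0: "0 \<le> M - 6 * s" using M0 by simp
  have "n * prod_list ps < N" unfolding n(2)[symmetric] using n0 x by simp
  moreover have "2 * 1 \<le> n * prod_list ps" using n prod_list_primes_pos[OF ps'] by (intro mult_le_mono) auto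
  ultimately have lt: "Usum (n * prod_list ps) < Usum N" using champion_Usum_less[OF N] by simp
  have "Usum n * (1 + (M - 6 * s) / D) ^ length ps \<le> Usum (n * prod_list ps)"
  proof (rule Usum_prod_list_lower[OF n0 ps' lo0 lo _ D(1)])
    show "\<forall>q\<in>set ps. real (multiplicity q (n * prod_list ps)) \<le> D"
    proof
      fix q assume q: "q \<in> set ps"
      have "multiplicity q (n * prod_list ps) \<le> multiplicity q (n * prod_list ps * 2 ^ x)"
        using n0 prod_list_primes_pos[OF ps'] by (intro multiplicity_mult_prime_ge) auto
      also have "n * prod_list ps * 2 ^ x = N * prod_list ps" using n(2) by (simp add: mult_ac)
      finally show "real (multiplicity q (n * prod_list ps)) \<le> D" using D(2) q by force
    qed
  qed
  also have "\<dots> < Usum N" by (rule lt)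
  also have "Usum N = Usum (n * prod_list ?r)" using n(2) r by simp
  also have "\<dots> \<le> Usum n * (1 + (M + 6 * s) / (real (multiplicity 2 n) + 1)) ^ length ?r"
    by (rule Usum_prod_list_upper[OF n0]) (use hi n r M0 in auto)
  finally show ?thesis using Usum_pos[of n] by simp
qed

lemma eventually_champions: "eventually (\<lambda>N. K_champion N \<and> N \<ge> 2) champions_at_top"
  unfolding champions_at_top_def eventually_inf_principal
  using eventually_ge_at_top[of 2] by eventually_elim auto

lemma bigomega_le_Mval_bound: "n \<ge> 2 \<Longrightarrow> prime p \<Longrightarrow> real (multiplicity p n) \<le> Mval n"
proof -
  assume n: "n \<ge> 2" and p: "prime p"
  have "multiplicity p n \<le> bigomega n"
  proof (cases "p \<in> prime_factors n")
    case True
    then show ?thesis unfolding bigomega_def by (intro member_le_sum) auto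
  next
    case False
    then have "multiplicity p n = 0" using p n by (auto simp: prime_factors_multiplicity)
    then show ?thesis by simp
  qed
  then show ?thesis using Mval(1)[OF n] by linarith
qed

text \<open>A bounded \<open>Mval\<close> bounds \<open>bigomega N\<close> by \<open>B\<close>. By
  monotonicity of the exponents a prime factor beyond \<open>P\<close>, the largest of
  \<open>B + 1\<close> primes, would force all these primes to divide \<open>N\<close>; hence
  \<open>N <= P ^ B\<close>.\<close>

lemma Mval_at_top: "filterlim Mval at_top champions_at_top"
  unfolding filterlim_at_top
proof
  fix Z :: real
  define B where "B = nat \<lceil>Z\<rceil>"
  have "infinite {p::nat. prime p}" by (rule primes_infinite)
  then obtain S where S: "finite S" "card S = Suc B" "S \<subseteq> {p::nat. prime p}"
    using infinite_arbitrarily_large by blast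
  define P where "P = Max S"
  have SP: "\<And>q. q \<in> S \<Longrightarrow> q \<le> P" using S(1) by (simp add: P_def)
  have main: "Mval N \<ge> Z" if N: "K_champion N" "N \<ge> 2" and big: "N > P ^ B" for N
  proof (rule ccontr)
    assume "\<not> Mval N \<ge> Z"
    then have "real (bigomega N) < Z" using Mval(1)[OF N(2)] by linarith
    then have om: "bigomega N \<le> B" unfolding B_def by linarith
    have N0: "N > 0" using N by simp
    have pP: "p \<le> P" if p: "p \<in> prime_factors N" for p
    proof (rule ccontr)
      assume "\<not> p \<le> P"
      then have lt: "\<And>q. q \<in> S \<Longrightarrow> q \<le> p" using SP by force
      have pp: "prime p" "multiplicity p N \<ge> 1" using p by (auto simp: prime_factors_multiplicity Suc_le_eq)
      have "S \<subseteq> prime_factors N"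
      proof
        fix q assume q: "q \<in> S"
        then have "prime q" "q \<le> p" using S lt by auto
        then have "multiplicity q N \<ge> 1" using champion_multiplicity_mono[OF N(1) pp(1)] pp(2) by (meson le_trans)
        then show "q \<in> prime_factors N" using \<open>prime q\<close> by (simp add: prime_factors_multiplicity Suc_le_eq)
      qed
      then have "Suc B \<le> card (prime_factors N)" using S card_mono[of "prime_factors N" S] by simp
      also have "\<dots> = (\<Sum>p\<in>prime_factors N. 1)" by simp
      also have "\<dots> \<le> bigomega N" unfolding bigomega_def
        by (intro sum_mono) (auto simp: prime_factors_multiplicity)
      finally show False using om by simp
    qed
    have ne: "P \<ge> 1"
    proof -
      obtain q where "q \<in> S" using S by (metis card.empty equals0I nat.distinct(1))
      then show ?thesis using SP S prime_ge_1_nat by (metis le_trans mem_Collect_eq subset_iff)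
    qed
    have "N = (\<Prod>p\<in>prime_factors N. p ^ multiplicity p N)" using N0 by (intro prime_factorization_nat)
    also have "\<dots> \<le> (\<Prod>p\<in>prime_factors N. P ^ multiplicity p N)"
      using pP by (intro prod_mono conjI power_mono) auto
    also have "\<dots> = P ^ bigomega N" by (simp add: power_sum bigomega_def)
    also have "\<dots> \<le> P ^ B" using ne om by (intro power_increasing) auto
    finally show False using big by simp
  qed
  show "eventually (\<lambda>N. Z \<le> Mval N) champions_at_top"
    unfolding champions_at_top_def eventually_inf_principal
    by (rule eventually_mono[OF eventually_ge_at_top[of "max 2 (P ^ B + 1)"]])
       (use main in auto)
qed

lemma eventually_Mval: "eventually P at_top \<Longrightarrow> eventually (\<lambda>N. P (Mval N)) champions_at_top"
  using Mval_at_top by (simp add: filterlim_iff)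

section \<open>Lower bound for the exponent of 2\<close>

lemma sum_inverse_squares_ge_3:
  assumes "finite A" "A \<subseteq> {3::nat..}"
  shows "(\<Sum>p\<in>A. 1 / (real p)\<^sup>2) \<le> 1 / 2"
proof -
  have main: "(\<Sum>p\<in>{3..m}. 1 / (real p)\<^sup>2) \<le> 1 / 2 - 1 / real m" if "m \<ge> 2" for m :: nat
    using that
  proof (induction m rule: dec_induct)
    case (step m)
    have "1 / (real (Suc m))\<^sup>2 \<le> 1 / real m - 1 / real (Suc m)"
    proof -
      have "1 / (real (Suc m))\<^sup>2 \<le> 1 / (real m * real (Suc m))"
        using step by (intro divide_left_mono) (auto simp: power2_eq_square)
      also have "\<dots> = 1 / real m - 1 / real (Suc m)" using step by (simp add: field_simps)
      finally show ?thesis .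
    qed
    moreover have "(\<Sum>p\<in>{3..Suc m}. 1 / (real p)\<^sup>2) = (\<Sum>p\<in>{3..m}. 1 / (real p)\<^sup>2) + 1 / (real (Suc m))\<^sup>2"
      using step by (subst sum.cl_ivl_Suc) auto
    ultimately show ?case using step by linarith
  qed simp
  define m where "m = Max (insert 2 A)"
  have "m \<ge> 2" "A \<subseteq> {3..m}" using assms by (auto simp: m_def)
  then have "(\<Sum>p\<in>A. 1 / (real p)\<^sup>2) \<le> (\<Sum>p\<in>{3..m}. 1 / (real p)\<^sup>2)"
    by (intro sum_mono2) auto
  also have "\<dots> \<le> 1 / 2 - 1 / real m" by (rule main) fact
  also have "\<dots> \<le> 1 / 2" by simp
  finally show ?thesis .
qed

lemma odd_prime_ge_3: "prime (p::nat) \<Longrightarrow> p \<noteq> 2 \<Longrightarrow> p \<ge> 3 \<and> odd p"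
  using prime_ge_2_nat[of p] prime_odd_nat[of p] by auto

lemma odd_between_powers_of_2:
  assumes "odd m" "m \<ge> (3::nat)"
  obtains x where "x \<ge> 1" "2 ^ x < m" "m < 2 ^ Suc x"
proof -
  obtain x where x: "2 ^ x \<le> m" "m < 2 ^ (x + 1)"
    using ex_power_ivl1[of 2 m] assms by auto
  have "x \<noteq> 0" using x assms by (intro notI) auto
  then have "even ((2::nat) ^ x)" by simp
  then have "2 ^ x \<noteq> m" using assms by auto
  then show ?thesis using that[of x] x \<open>x \<noteq> 0\<close> by auto
qed

lemma champion_remove_prime:
  assumes N: "K_champion N" "N \<ge> 2" and p: "prime p" "p \<noteq> 2" "p dvd N"
    and x: "2 ^ x < p"
    and M: "M = Mval N" "s = sqrt M" "s \<ge> 6"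
  shows "(1 + (M - 6 * s) / (real (multiplicity 2 N) + real x)) ^ x < 1 + (M + 6 * s) / real (multiplicity p N)"
proof -
  obtain n where "N = p * n" using p by (auto elim: dvdE)
  then have n: "n * p = N" by simp
  have n0: "n > 0" using n N by (auto intro: Nat.gr0I)
  have "multiplicity 2 N = multiplicity 2 n"
    unfolding n[symmetric] using p by (intro multiplicity_other_mult n0) auto
  then have "multiplicity 2 n \<ge> 1" using champion_even[OF N] by simp
  then have "2 dvd n" using not_dvd_imp_multiplicity_0 by fastforce
  then have n2: "n \<ge> 2" using n0 by (auto dest: dvd_imp_le)
  have mp: "multiplicity p N = multiplicity p n + 1" unfolding n[symmetric] by (rule multiplicity_self_mult[OF n0 p(1)])
  have "(1 + (M - 6 * s) / (real (multiplicity 2 N) + real x)) ^ x < (1 + (M + 6 * s) / real (multiplicity p N)) ^ length [p]"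
    by (rule champion_exchange_remove[OF N(1) n2 _ _ _ M]) (use n p x M(3) mp in auto)
  then show ?thesis by simp
qed

text \<open>Suppose the exponent of 2 is below \<open>M / 600\<close>. For
  \<open>x <= sqrt M <= M / 600\<close> every inserted 2 gains a factor of at least
  \<open>1 + 255 = 2^8\<close>, so trading an odd \<open>p\<close> for \<open>2 ^ x\<close> with
  \<open>2 ^ x < p < 2 ^ Suc x\<close> forces its exponent below a multiple of
  \<open>M / p^8\<close>. The odd primes then contribute at most \<open>0.375 * M\<close> to
  \<open>bigomega N\<close>, and a total of \<open>0.4 * M\<close> contradicts
  \<open>bigomega N >= M * ln 2\<close>.\<close>

lemma eventually_multiplicity_2_ge:
  "eventually (\<lambda>N. real (multiplicity 2 N) \<ge> Mval N / 600) champions_at_top"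
proof -
  have "eventually (\<lambda>M::real. sqrt M \<ge> 6 \<and> sqrt M \<le> M / 600 \<and> M - 6 * sqrt M \<ge> 0.9 * M \<and> M + 6 * sqrt M \<le> 1.1 * M
         \<and> 2.1 * M < 256 powr (sqrt M - 1) \<and> M \<ge> 1) at_top"
    by (intro eventually_conj; real_asymp)
  from eventually_Mval[OF this] eventually_champions show ?thesis
  proof eventually_elim
    case (elim N)
    define M where "M = Mval N"
    define s where "s = sqrt M"
    have N: "K_champion N" "N \<ge> 2" using elim by auto
    have s: "s \<ge> 6" "s \<le> M / 600" "M - 6 * s \<ge> 0.9 * M" "M + 6 * s \<le> 1.1 * M" "2.1 * M < 256 powr (s - 1)" "M \<ge> 1"
      using elim by (auto simp: s_def M_def)
    show ?case
    proof (rule ccontr)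
      assume "\<not> real (multiplicity 2 N) \<ge> Mval N / 600"
      then have small: "real (multiplicity 2 N) < M / 600" by (simp add: M_def)
      have bound: "real (multiplicity p N) < 2.1 * M / 256 ^ x"
        if p: "prime p" "p \<noteq> 2" "p dvd N" "2 ^ x < p" "real x \<le> s" for p x
      proof -
        have ap: "real (multiplicity p N) \<ge> 1" "real (multiplicity p N) \<le> M"
          using p N bigomega_le_Mval_bound[OF N(2) p(1)]
          by (auto simp: M_def Suc_le_eq prime_multiplicity_gt_zero_iff)
        have D: "real (multiplicity 2 N) + real x > 0" "real (multiplicity 2 N) + real x \<le> M / 300"
          using champion_even[OF N] small p(5) s(2) by linarith+
        have "255 = (0.85 * M) / (M / 300)" using s by simp
        also have "\<dots> \<le> (M - 6 * s) / (real (multiplicity 2 N) + real x)"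
          using D s by (intro frac_le) auto
        finally have "256 ^ x \<le> (1 + (M - 6 * s) / (real (multiplicity 2 N) + real x)) ^ x"
          by (intro power_mono) auto
        also have "\<dots> < 1 + (M + 6 * s) / real (multiplicity p N)"
          by (rule champion_remove_prime[OF N p(1-4) M_def s_def s(1)])
        also have "\<dots> \<le> M / real (multiplicity p N) + 1.1 * M / real (multiplicity p N)"
          using ap s by (intro add_mono divide_right_mono) auto
        also have "\<dots> = 2.1 * M / real (multiplicity p N)" using ap by (simp add: field_simps)
        finally show ?thesis using ap by (simp add: field_simps)
      qed
      \<comment> \<open>Exchanges are controlled only for \<open>x <= sqrt M\<close>; a prime above
        \<open>2 ^ X\<close> is therefore tested with \<open>x = X\<close>, where the bound for its
        exponent already falls below 1.\<close>
      define X where "X = nat \<lfloor>s\<rfloor>"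
      have X: "real X \<le> s" "s - 1 \<le> real X" using s(1) unfolding X_def by linarith+
      have pX: "p \<le> 2 ^ X" if p: "prime p" "p \<noteq> 2" "p dvd N" for p
      proof (rule ccontr)
        assume "\<not> p \<le> 2 ^ X"
        then have "real (multiplicity p N) < 2.1 * M / 256 ^ X" using bound[OF p, of X] X by simp
        also have "\<dots> < 1"
        proof -
          have "2.1 * M < 256 powr (s - 1)" by (rule s)
          also have "\<dots> \<le> 256 powr (real X)" using X by (intro powr_mono) auto
          also have "\<dots> = 256 ^ X" by (simp add: powr_realpow)
          finally show ?thesis by simp
        qed
        finally have "multiplicity p N = 0" by simp
        then show False using p N by (auto simp: prime_multiplicity_gt_zero_iff[symmetric])
      qed
      have each: "real (multiplicity p N) \<le> 0.75 * M * (1 / (real p)\<^sup>2)" if p: "prime p" "p \<noteq> 2" "p dvd N" for p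
      proof -
        have p3: "p \<ge> 3" "odd p" using odd_prime_ge_3 p by auto
        obtain x where x: "x \<ge> 1" "2 ^ x < p" "p < 2 ^ Suc x"
          using odd_between_powers_of_2[OF p3(2,1)] by blast
        have "(2::nat) ^ x < 2 ^ X" using x(2) pX[OF p] by linarith
        then have "x \<le> X" by simp
        then have "real x \<le> s" using X by linarith
        then have "real (multiplicity p N) < 2.1 * M / 256 ^ x" by (rule bound[OF p x(2)])
        also have "256 ^ x = (2 ^ Suc x) ^ 8 / (256::real)"
          by (simp add: power_mult_distrib power_mult[symmetric] mult.commute[of _ 8]) (simp add: power_mult)
        also have "2.1 * M / ((2 ^ Suc x) ^ 8 / 256) \<le> 2.1 * M / (real p ^ 8 / 256)"
        proof (intro divide_left_mono divide_right_mono power_mono)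
          have "real p \<le> real (2 ^ Suc x)" using x(3) by linarith
          then show "real p \<le> 2 ^ Suc x" by simp
        qed (use p3 s in auto)
        also have "\<dots> = 537.6 * M / (real p ^ 6 * (real p)\<^sup>2)"
          by (simp add: power_add[symmetric])
        also have "\<dots> \<le> 537.6 * M / (729 * (real p)\<^sup>2)"
        proof (intro divide_left_mono mult_right_mono)
          have "(3::real) ^ 6 \<le> real p ^ 6" using p3 by (intro power_mono) auto
          then show "729 \<le> real p ^ 6" by simp
        qed (use p3 s in auto)
        also have "\<dots> \<le> 0.75 * M * (1 / (real p)\<^sup>2)" using s p3 by (simp add: field_simps)
        finally show ?thesis by simp
      qed
      let ?P = "prime_factors N"
      have fin: "finite ?P" by simp
      have two: "2 \<in> ?P" using champion_even[OF N] by (simp add: prime_factors_multiplicity Suc_le_eq)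
      have "real (bigomega N) = real (multiplicity 2 N) + (\<Sum>p\<in>?P - {2}. real (multiplicity p N))"
        unfolding bigomega_def of_nat_sum by (rule sum.remove[OF fin two])
      also have "\<dots> \<le> M / 600 + (\<Sum>p\<in>?P - {2}. 0.75 * M * (1 / (real p)\<^sup>2))"
        using small each by (intro add_mono sum_mono) (auto simp: in_prime_factors_iff)
      also have "(\<Sum>p\<in>?P - {2}. 0.75 * M * (1 / (real p)\<^sup>2)) = 0.75 * M * (\<Sum>p\<in>?P - {2}. 1 / (real p)\<^sup>2)"
        by (rule sum_distrib_left[symmetric])
      also have "\<dots> \<le> 0.75 * M * (1 / 2)"
        using s odd_prime_ge_3 by (intro mult_left_mono sum_inverse_squares_ge_3) (auto simp: in_prime_factors_iff)
      finally have "real (bigomega N) \<le> 0.4 * M" using s by simp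
      moreover have "M * ln 2 \<le> real (bigomega N)"
        using Mval(2)[OF N(2)] by (simp add: M_def pos_le_divide_eq)
      moreover have "M * (2 / 3) \<le> M * ln 2" using s ln2_ge_two_thirds by (intro mult_left_mono) auto
      ultimately show False using s by simp
    qed
  qed
qed

text \<open>\<open>lam N\<close> makes \<open>1 + M / \<alpha>\<^sub>p = p powr lam N\<close> exact at \<open>p = 2\<close>.\<close>

definition lam :: "nat \<Rightarrow> real" where
  "lam N = log 2 (1 + Mval N / real (multiplicity 2 N))"

lemma lam_ln2: "real (multiplicity 2 N) > 0 \<Longrightarrow> N \<ge> 2 \<Longrightarrow> lam N * ln 2 = ln (1 + Mval N / real (multiplicity 2 N))"
  by (simp add: lam_def log_def)

lemma lam_powr: "real (multiplicity 2 N) > 0 \<Longrightarrow> N \<ge> 2 \<Longrightarrow> 2 powr lam N = 1 + Mval N / real (multiplicity 2 N)"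
  using Mval(4)[of N] by (simp add: lam_def powr_log_cancel add_pos_nonneg)

text \<open>The exponent of 2 lies between \<open>M / 600\<close> and \<open>M\<close>, so
  \<open>2 powr lam N\<close> lies between 2 and 601, which is below \<open>2^10\<close>.\<close>

lemma lam_bounds:
  assumes N: "K_champion N" "N \<ge> 2" and a: "real (multiplicity 2 N) \<ge> Mval N / 600"
  shows "1 \<le> lam N" "lam N \<le> 10" "lam N * ln 2 \<le> 600"
proof -
  define a where "a = real (multiplicity 2 N)"
  define M where "M = Mval N"
  have a1: "a \<ge> 1" "a \<le> M" "M \<le> 600 * a"
    using champion_even[OF N] bigomega_le_Mval_bound[OF N(2), of 2] a by (auto simp: a_def M_def)
  have q: "M / a \<ge> 1" "M / a \<le> 600" using a1 by (auto simp: field_simps)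
  have p: "2 powr lam N = 1 + M / a" using lam_powr[of N] N a1 by (simp add: a_def M_def)
  then have "(2::real) powr 1 \<le> 2 powr lam N" using q by simp
  then show "1 \<le> lam N" by (simp only: powr_le_cancel_iff)
  have "2 powr lam N \<le> (2::real) powr 10" using p q by simp
  then show "lam N \<le> 10" by (simp only: powr_le_cancel_iff)
  have "lam N * ln 2 = ln (1 + M / a)" using lam_ln2[of N] N a1 by (simp add: a_def M_def)
  also have "\<dots> \<le> M / a" using q by (intro ln_add_one_self_le_self) auto
  finally show "lam N * ln 2 \<le> 600" using q by simp
qed

section \<open>Exchange inequalities in logarithmic form\<close>

text \<open>Since \<open>s = M / s <= 600 * a / s\<close>, the shift of \<open>a\<close> by
  \<open>x <= s\<close> is a relative change of at most \<open>600 / s\<close>, and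
  \<open>M - 6 * s\<close> is \<open>M\<close> times \<open>1 - 6 / s\<close>; the logarithms of
  these factors add up to less than \<open>2000 / s\<close>. In \<open>ln_ratio_upper\<close> both
  changes go the other way.\<close>

lemma ln_ratio_lower:
  fixes M s a x :: real
  assumes "s * s = M" "s \<ge> 1200" "a \<ge> M / 600" "0 \<le> x" "x \<le> s"
  shows "ln (1 + M / a) - 2000 / s \<le> ln (1 + (M - 6 * s) / (a + x))"
proof -
  have M0: "M > 0" using assms(1,2) by (metis mult_pos_pos not_le_imp_less linorder_not_less order_less_le_trans zero_less_numeral)
  have a0: "a > 0" using assms(3) M0 by linarith
  define k where "k = (1 - 6 / s) / (1 + 600 / s)"
  have "0 < 1 - 6 / s" "1 - 6 / s \<le> 1 + 600 / s" "0 < 1 + 600 / s" using assms(2) by (auto simp: field_simps)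
  then have k: "0 < k" "k \<le> 1" by (simp_all add: k_def)
  have "s = M / s" using assms(1,2) by (simp add: field_simps)
  also have "\<dots> \<le> (600 * a) / s" using assms by (intro divide_right_mono) auto
  finally have "a + x \<le> a * (1 + 600 / s)" using assms(5) by (simp add: algebra_simps)
  moreover have "M - 6 * s = M * (1 - 6 / s)" using assms(1,2) by (simp add: algebra_simps) (simp add: field_simps)
  moreover have "0 \<le> 1 - 6 / s" using assms(2) by (simp add: field_simps)
  ultimately have "(M * (1 - 6 / s)) / (a * (1 + 600 / s)) \<le> (M - 6 * s) / (a + x)"
    using M0 a0 assms by (intro frac_le) auto
  then have "(M / a) * k \<le> (M - 6 * s) / (a + x)" by (simp add: k_def)
  then have "(1 + M / a) * k \<le> 1 + (M - 6 * s) / (a + x)" using k by (simp add: distrib_right)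
  then have "ln ((1 + M / a) * k) \<le> ln (1 + (M - 6 * s) / (a + x))"
    using k M0 a0 by (intro ln_mono) (auto intro!: mult_pos_pos add_pos_nonneg)
  moreover have "ln ((1 + M / a) * k) = ln (1 + M / a) + ln k"
    using k M0 a0 by (intro ln_mult_pos) (auto intro!: add_pos_nonneg)
  moreover have "ln k = ln (1 - 6 / s) - ln (1 + 600 / s)"
    unfolding k_def using assms(2) by (intro ln_divide_pos) (auto simp: field_simps)
  moreover have "ln (1 + 600 / s) \<le> 600 / s" using assms(2) by (intro ln_add_one_self_le_self) auto
  moreover have "- (6 / s) - 2 * (6 / s)\<^sup>2 \<le> ln (1 - 6 / s)"
    using assms(2) by (intro ln_one_minus_pos_lower_bound) (auto simp: field_simps)
  moreover have "2 * (6 / s)\<^sup>2 \<le> 72 / s"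
  proof -
    have "1 / s \<le> 1" using assms(2) by (simp add: field_simps)
    then have "72 / s * (1 / s) \<le> 72 / s * 1" using assms(2) by (intro mult_left_mono) auto
    then show ?thesis by (simp add: power2_eq_square)
  qed
  moreover have "2000 / s = 600 / s + 6 / s + 72 / s + 1322 / s" by (simp add: add_divide_distrib[symmetric])
  moreover have "1322 / s \<ge> 0" using assms(2) by simp
  ultimately show ?thesis by linarith
qed

lemma ln_ratio_upper:
  fixes M s a x :: real
  assumes "s * s = M" "s \<ge> 1200" "a \<ge> M / 600" "0 \<le> x" "x \<le> s"
  shows "ln (1 + (M + 6 * s) / (a - x + 1)) \<le> ln (1 + M / a) + 2000 / s"
proof -
  have M0: "M > 0" using assms(1,2) by (metis mult_pos_pos not_le_imp_less linorder_not_less order_less_le_trans zero_less_numeral)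
  have a0: "a > 0" using assms(3) M0 by linarith
  define k where "k = (1 + 6 / s) / (1 - 600 / s)"
  have s6: "0 < 1 - 600 / s" using assms(2) by (simp add: field_simps)
  have k: "1 \<le> k" using assms(2) s6 by (simp add: k_def pos_le_divide_eq) 
  have "s = M / s" using assms(1,2) by (simp add: field_simps)
  also have "\<dots> \<le> (600 * a) / s" using assms by (intro divide_right_mono) auto
  finally have le: "a * (1 - 600 / s) \<le> a - x + 1" using assms(5) by (simp add: algebra_simps)
  have pos: "0 < a * (1 - 600 / s)" using a0 s6 by simp
  have "M + 6 * s = M * (1 + 6 / s)" using assms(1,2) by (simp add: algebra_simps) (simp add: field_simps)
  then have "(M + 6 * s) / (a - x + 1) \<le> (M * (1 + 6 / s)) / (a * (1 - 600 / s))"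
    using M0 pos le assms by (intro frac_le) auto
  then have "(M + 6 * s) / (a - x + 1) \<le> (M / a) * k" by (simp add: k_def)
  then have "1 + (M + 6 * s) / (a - x + 1) \<le> (1 + M / a) * k" using k by (simp add: distrib_right)
  moreover have "0 < 1 + (M + 6 * s) / (a - x + 1)"
    by (rule add_pos_nonneg[OF zero_less_one divide_nonneg_pos]) (use M0 assms(2) less_le_trans[OF pos le] in auto)
  ultimately have "ln (1 + (M + 6 * s) / (a - x + 1)) \<le> ln ((1 + M / a) * k)"
    by (intro ln_mono) auto
  moreover have "ln ((1 + M / a) * k) = ln (1 + M / a) + ln k"
    using k M0 a0 by (intro ln_mult_pos) (auto intro!: add_pos_nonneg)
  moreover have "ln k = ln (1 + 6 / s) - ln (1 - 600 / s)"
    unfolding k_def using assms(2) s6 by (intro ln_divide_pos) (auto intro!: add_pos_nonneg)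
  moreover have "ln (1 + 6 / s) \<le> 6 / s" using assms(2) by (intro ln_add_one_self_le_self) auto
  moreover have "- (600 / s) - 2 * (600 / s)\<^sup>2 \<le> ln (1 - 600 / s)"
    using assms(2) by (intro ln_one_minus_pos_lower_bound) (auto simp: field_simps)
  moreover have "2 * (600 / s)\<^sup>2 \<le> 600 / s"
  proof -
    have "1200 / s \<le> 1" using assms(2) by (simp add: field_simps)
    then have "600 / s * (1200 / s) \<le> 600 / s * 1" using assms(2) by (intro mult_left_mono) auto
    then show ?thesis by (simp add: power2_eq_square)
  qed
  moreover have "2000 / s = 600 / s + 600 / s + 6 / s + 794 / s" by (simp add: add_divide_distrib[symmetric])
  moreover have "794 / s \<ge> 0" using assms(2) by simp
  ultimately show ?thesis by linarith
qed

text \<open>Bundles what every large champion satisfies, so that the exchange inequalities can be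
  stated for a single \<open>N\<close> without filters. The bound 1200 keeps \<open>600 / s\<close>
  at most \<open>1 / 2\<close>, as the estimate for \<open>ln (1 - 600 / s)\<close>
  requires.\<close>

definition good_champion :: "nat \<Rightarrow> bool" where
  "good_champion N \<longleftrightarrow> K_champion N \<and> N \<ge> 2 \<and> real (multiplicity 2 N) \<ge> Mval N / 600 \<and> sqrt (Mval N) \<ge> 1200"

lemma eventually_good_champion: "eventually good_champion champions_at_top"
proof -
  have "eventually (\<lambda>M::real. sqrt M \<ge> 1200) at_top" by real_asymp
  from eventually_Mval[OF this] eventually_champions eventually_multiplicity_2_ge
  show ?thesis by eventually_elim (simp add: good_champion_def)
qed

lemma good_championD:
  assumes "good_champion N"
  shows "K_champion N" "N \<ge> 2" "real (multiplicity 2 N) \<ge> Mval N / 600" "sqrt (Mval N) \<ge> 1200"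
    "sqrt (Mval N) * sqrt (Mval N) = Mval N" "real (multiplicity 2 N) > 0" "Mval N > 0" "N > 0"
    "1 \<le> lam N" "lam N \<le> 10" "lam N * ln 2 \<le> 600"
    "lam N * ln 2 = ln (1 + Mval N / real (multiplicity 2 N))" "Mval N \<ge> 1440000"
proof -
  show 1: "K_champion N" "N \<ge> 2" "real (multiplicity 2 N) \<ge> Mval N / 600" "sqrt (Mval N) \<ge> 1200"
    using assms by (auto simp: good_champion_def)
  show M: "Mval N > 0" and "N > 0" using Mval(4)[OF 1(2)] 1 by auto
  then show ss: "sqrt (Mval N) * sqrt (Mval N) = Mval N" by simp
  show 2: "real (multiplicity 2 N) > 0" using champion_even[OF 1(1,2)] by simp
  show "1 \<le> lam N" "lam N \<le> 10" "lam N * ln 2 \<le> 600" by (rule lam_bounds[OF 1(1-3)])+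
  show "lam N * ln 2 = ln (1 + Mval N / real (multiplicity 2 N))" by (rule lam_ln2[OF 2 1(2)])
  have "1200 * 1200 \<le> sqrt (Mval N) * sqrt (Mval N)" 
    by (rule mult_mono[OF 1(4) 1(4)]) (use M in auto)
  then show "Mval N \<ge> 1440000" using ss by simp
qed

text \<open>Oddness keeps a nonempty product away from the powers of 2, so it lies strictly between
  two consecutive ones. Every factor is at least 3 and hence at least \<open>exp 1\<close>, so the
  logarithm of the product bounds their number.\<close>

lemma prod_list_odd_primes:
  assumes "\<forall>q\<in>set ps. prime q \<and> q \<noteq> (2::nat)" "ps \<noteq> []"
  shows "odd (prod_list ps)" "prod_list ps \<ge> 3" "real (length ps) \<le> ln (real (prod_list ps))"
proof -
  have "odd (prod_list ps) \<and> 3 ^ length ps \<le> prod_list ps" using assms(1)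
  proof (induction ps)
    case (Cons q qs)
    then have "odd (prod_list qs)" "3 ^ length qs \<le> prod_list qs" "q \<ge> 3" "odd q"
      using odd_prime_ge_3 by auto
    then show ?case by (auto intro: mult_le_mono)
  qed simp
  then have o: "odd (prod_list ps)" and le: "3 ^ length ps \<le> prod_list ps" by auto
  show "odd (prod_list ps)" by (rule o)
  have "(3::nat) ^ 1 \<le> 3 ^ length ps" using assms(2) by (intro power_increasing) (auto simp: Suc_le_eq)
  then show "prod_list ps \<ge> 3" using le by simp
  have "exp 1 \<le> (3::real)" by (rule exp_le)
  then have "1 \<le> ln (3::real)" by (subst ln_ge_iff) auto
  then have "real (length ps) * 1 \<le> real (length ps) * ln 3" by (intro mult_left_mono) auto
  also have "\<dots> = ln (3 ^ length ps)" by (simp add: ln_realpow)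
  also have "\<dots> \<le> ln (real (prod_list ps))"
  proof (intro ln_mono)
    have "real (3 ^ length ps) \<le> real (prod_list ps)" using le by (simp only: of_nat_le_iff)
    then show "3 ^ length ps \<le> real (prod_list ps)" by simp
  qed (use le in \<open>auto intro: order.strict_trans2[of 0 "3 ^ length ps"]\<close>)
  finally show "real (length ps) \<le> ln (real (prod_list ps))" by simp
qed

lemma remove_log_raw:
  assumes g: "good_champion N" and n: "n * prod_list ps = N"
    and ps: "\<forall>q\<in>set ps. prime q \<and> q \<noteq> 2" and x: "2 ^ x < prod_list ps"
    and len: "real (length ps) \<le> sqrt (Mval N)" "real x \<le> sqrt (Mval N)"
    and d: "d > 0" "\<forall>q\<in>set ps. d \<le> real (multiplicity q n) + 1"
  shows "real x * (lam N * ln 2 - 2000 / sqrt (Mval N)) \<le> real (length ps) * ln (1 + (Mval N + 6 * sqrt (Mval N)) / d)"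
proof -
  note G = good_championD[OF g]
  define M where "M = Mval N"
  define s where "s = sqrt M"
  have s: "s * s = M" "s \<ge> 1200" "M > 0" using G by (auto simp: s_def M_def)
  have n0: "n > 0" using n G(8) by (auto intro: Nat.gr0I)
  have "multiplicity 2 N = multiplicity 2 n"
    unfolding n[symmetric] using n0 ps by (intro multiplicity_prod_list_other) auto
  then have "2 dvd n" using G(6) not_dvd_imp_multiplicity_0 by fastforce
  then have n2: "n \<ge> 2" using n0 by (auto dest: dvd_imp_le)
  let ?b = "1 + (M - 6 * s) / (real (multiplicity 2 N) + real x)"
  have "(6::real) * s \<le> s * s" using s by (intro mult_right_mono) auto
  then have b: "?b \<ge> 1" using s by simp
  have c: "1 + (M + 6 * s) / d > 0" using d s by (intro add_pos_nonneg divide_nonneg_pos) auto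
  have "?b ^ x < (1 + (M + 6 * s) / d) ^ length ps"
    by (rule champion_exchange_remove[OF G(1) n2 n ps x M_def s_def _ _ d]) (use s len in \<open>auto simp: s_def M_def\<close>)
  then have "ln (?b ^ x) \<le> ln ((1 + (M + 6 * s) / d) ^ length ps)"
    using b by (intro ln_mono) (auto intro!: zero_less_power)
  then have 1: "real x * ln ?b \<le> real (length ps) * ln (1 + (M + 6 * s) / d)"
    using b c by (simp add: ln_realpow)
  have "ln (1 + M / real (multiplicity 2 N)) - 2000 / s \<le> ln ?b"
    by (rule ln_ratio_lower) (use s len G(3) in \<open>auto simp: M_def s_def\<close>)
  then have "real x * (lam N * ln 2 - 2000 / s) \<le> real x * ln ?b"
    unfolding G(12) by (intro mult_left_mono) (auto simp: M_def)
  then show ?thesis using 1 unfolding M_def[symmetric] s_def[symmetric] by linarith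
qed

text \<open>Rounding the product down to a power of 2 costs at most
  \<open>lam N * ln 2 <= 600\<close>, and the error \<open>2000 / sqrt M\<close> per factor 2 sums
  to at most 2000 because \<open>x <= sqrt M\<close>. The total 3000 does not depend on the length
  of \<open>ps\<close>; this is the gain from moving many primes.\<close>

lemma remove_log:
  assumes g: "good_champion N" and n: "n * prod_list ps = N"
    and ps: "\<forall>q\<in>set ps. prime q \<and> q \<noteq> 2" "ps \<noteq> []"
    and len: "ln (real (prod_list ps)) \<le> sqrt (Mval N) / 4"
    and d: "d > 0" "\<forall>q\<in>set ps. d \<le> real (multiplicity q n) + 1"
  shows "lam N * ln (real (prod_list ps)) \<le> real (length ps) * ln (1 + (Mval N + 6 * sqrt (Mval N)) / d) + 3000"
proof -
  note G = good_championD[OF g]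
  define m where "m = prod_list ps"
  define s where "s = sqrt (Mval N)"
  have s: "s \<ge> 1200" using G by (simp add: s_def)
  have m: "odd m" "m \<ge> 3" "real (length ps) \<le> ln (real m)"
    using prod_list_odd_primes[OF ps] by (auto simp: m_def)
  obtain x where x: "x \<ge> 1" "2 ^ x < m" "m < 2 ^ Suc x"
    using odd_between_powers_of_2[OF m(1,2)] by blast
  have r: "2 ^ x < real m" "real m < 2 ^ Suc x"
    using x(2,3) by (metis of_nat_less_iff of_nat_numeral of_nat_power)+
  have "ln (2 ^ x) \<le> ln (real m)" using r by (intro ln_mono) auto
  then have x1: "real x * ln 2 \<le> ln (real m)" by (simp add: ln_realpow)
  have "ln (real m) \<le> ln (2 ^ Suc x)" using r m by (intro ln_mono) auto
  also have "\<dots> = (real x + 1) * ln 2" by (subst ln_realpow) (auto simp: algebra_simps)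
  finally have x2: "ln (real m) \<le> (real x + 1) * ln 2" .
  have "real x * (2 / 3) \<le> real x * ln 2" using ln2_ge_two_thirds by (intro mult_left_mono) auto
  then have "real x \<le> (3 / 2) * ln (real m)" using x1 by linarith
  then have xs: "real x \<le> s" using len s unfolding m_def[symmetric] s_def[symmetric] by linarith
  have ls: "real (length ps) \<le> s" using m(3) len s unfolding m_def[symmetric] s_def[symmetric] by linarith
  have "real x * (lam N * ln 2 - 2000 / s) \<le> real (length ps) * ln (1 + (Mval N + 6 * s) / d)"
    unfolding s_def by (rule remove_log_raw[OF g n ps(1) _ _ _ d]) (use x xs ls in \<open>auto simp: m_def s_def\<close>)
  then have 1: "real x * (lam N * ln 2) \<le> real (length ps) * ln (1 + (Mval N + 6 * s) / d) + real x * (2000 / s)"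
    by (simp add: algebra_simps)
  have "real x * (2000 / s) \<le> s * (2000 / s)" using xs s by (intro mult_right_mono) auto
  then have 2: "real x * (2000 / s) \<le> 2000" using s by simp
  have "lam N * ln (real m) \<le> lam N * ((real x + 1) * ln 2)" using x2 G(9) by (intro mult_left_mono) auto
  also have "\<dots> = real x * (lam N * ln 2) + lam N * ln 2" by (simp add: algebra_simps)
  finally show ?thesis using 1 2 G(11) unfolding m_def s_def by linarith
qed

text \<open>Here the power of 2 is rounded up and has to divide \<open>N\<close> with a factor 2 to
  spare; the bound \<open>M / 600\<close> on the exponent of 2 exceeds \<open>sqrt M + 1\<close> and
  guarantees this.\<close>

lemma insert_log:
  assumes g: "good_champion N"
    and ps: "\<forall>q\<in>set ps. prime q \<and> q \<noteq> 2" "ps \<noteq> []"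
    and len: "ln (real (prod_list ps)) \<le> sqrt (Mval N) / 4"
    and D: "D > 0" "\<forall>q\<in>set ps. real (multiplicity q (N * prod_list ps)) \<le> D"
  shows "real (length ps) * ln (1 + (Mval N - 6 * sqrt (Mval N)) / D) \<le> lam N * ln (real (prod_list ps)) + 3000"
proof -
  note G = good_championD[OF g]
  define m where "m = prod_list ps"
  define M where "M = Mval N"
  define s where "s = sqrt M"
  have s: "s * s = M" "s \<ge> 1200" "M > 0" using G by (auto simp: s_def M_def)
  have m: "odd m" "m \<ge> 3" "real (length ps) \<le> ln (real m)"
    using prod_list_odd_primes[OF ps] by (auto simp: m_def)
  obtain y where y: "y \<ge> 1" "2 ^ y < m" "m < 2 ^ Suc y"
    using odd_between_powers_of_2[OF m(1,2)] by blast
  define x where "x = Suc y"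
  have r: "2 ^ y < real m" using y(2) by (metis of_nat_less_iff of_nat_numeral of_nat_power)
  have "ln (2 ^ y) \<le> ln (real m)" using r by (intro ln_mono) auto
  then have x1: "(real x - 1) * ln 2 \<le> ln (real m)" by (simp add: ln_realpow x_def)
  have "(real x - 1) * (2 / 3) \<le> (real x - 1) * ln 2" using ln2_ge_two_thirds by (intro mult_left_mono) (auto simp: x_def)
  then have "(real x - 1) * (2 / 3) \<le> ln (real m)" using x1 by (rule order_trans)
  then have "real x \<le> (3 / 2) * ln (real m) + 1" by (simp add: field_simps)
  then have xs: "real x \<le> s" using len s(2) unfolding m_def[symmetric] M_def[symmetric] s_def[symmetric] by linarith
  have "s + 1 \<le> 2 * s" using s by simp
  also have "2 * s \<le> (s / 600) * s" using s by (intro mult_right_mono) auto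
  also have "\<dots> = M / 600" using s(1) by simp
  finally have xa: "real x + 1 \<le> real (multiplicity 2 N)" using xs G(3) by (simp add: M_def)
  then have xa': "x + 1 \<le> multiplicity 2 N" by linarith
  have "2 ^ x dvd N" by (rule multiplicity_dvd') (use xa' in simp)
  then obtain n where "N = 2 ^ x * n" by (auto elim: dvdE)
  then have n: "n * 2 ^ x = N" by simp
  have n0: "n > 0" using n G(8) by (auto intro: Nat.gr0I)
  have mn: "multiplicity 2 N = multiplicity 2 n + x"
    unfolding n[symmetric] by (rule multiplicity_mult_power_2[OF n0])
  then have "multiplicity 2 n > 0" using xa' by simp
  then have "2 dvd n" using not_dvd_imp_multiplicity_0 by fastforce
  then have n2: "n \<ge> 2" using n0 by (auto dest: dvd_imp_le)
  let ?b = "1 + (M + 6 * s) / (real (multiplicity 2 n) + 1)"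
  have b: "?b > 0"
    by (rule add_pos_nonneg[OF zero_less_one divide_nonneg_pos]) (use s in auto)
  have "(6::real) * s \<le> s * s" using s by (intro mult_right_mono) auto
  then have c: "1 + (M - 6 * s) / D \<ge> 1" using D s by simp
  have "(1 + (M - 6 * s) / D) ^ length ps < ?b ^ x"
    by (rule champion_exchange_insert[OF G(1) n2 n ps(1) _ M_def s_def _ _ D]) (use s xs y in \<open>auto simp: m_def x_def\<close>)
  then have "ln ((1 + (M - 6 * s) / D) ^ length ps) \<le> ln (?b ^ x)"
    using c by (intro ln_mono) (auto intro!: zero_less_power)
  then have 1: "real (length ps) * ln (1 + (M - 6 * s) / D) \<le> real x * ln ?b"
    using b c by (simp add: ln_realpow)
  have e: "real (multiplicity 2 n) + 1 = real (multiplicity 2 N) - real x + 1" using mn by simp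
  have "ln ?b \<le> ln (1 + M / real (multiplicity 2 N)) + 2000 / s"
    unfolding e by (rule ln_ratio_upper) (use s xs G(3) in \<open>auto simp: M_def\<close>)
  then have "real x * ln ?b \<le> real x * (lam N * ln 2 + 2000 / s)"
    unfolding G(12) by (intro mult_left_mono) (auto simp: M_def)
  then have 2: "real x * ln ?b \<le> lam N * ((real x - 1) * ln 2) + lam N * ln 2 + real x * (2000 / s)"
    by (simp add: algebra_simps)
  have "real x * (2000 / s) \<le> s * (2000 / s)" using xs s by (intro mult_right_mono) auto
  then have 3: "real x * (2000 / s) \<le> 2000" using s by simp
  have "lam N * ((real x - 1) * ln 2) \<le> lam N * ln (real m)" using x1 G(9) by (intro mult_left_mono) auto
  then show ?thesis using 1 2 3 G(11) unfolding m_def[symmetric] M_def[symmetric] s_def[symmetric] by linarith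
qed

section \<open>Crude bounds for the prime factors and their exponents\<close>

text \<open>A prime beyond \<open>M^3\<close> could be traded for \<open>2 ^ x\<close> with
  \<open>x\<close> about \<open>5 / 2 * ln M\<close>: each 2 gains at least \<open>3 / 5\<close> in
  the logarithm, about \<open>3 / 2 * ln M\<close> in all, while removing \<open>p\<close> costs at
  most \<open>ln (3 * M)\<close>. The bound makes \<open>remove_log\<close> applicable to every
  single prime factor.\<close>

lemma eventually_prime_factor_bound:
  "eventually (\<lambda>N. \<forall>p. prime p \<and> p dvd N \<longrightarrow> ln (real p) \<le> 3 * ln (Mval N)) champions_at_top"
proof -
  have "eventually (\<lambda>M::real. 5 / 2 * ln M \<le> sqrt M \<and> 2000 / sqrt M \<le> 1 / 15 \<and> 1 + (M + 6 * sqrt M) \<le> 3 * M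
      \<and> (5 / 2 * ln M - 1) * (3 / 5) > ln (3 * M) \<and> ln M > 1) at_top"
    by (intro eventually_conj; real_asymp)
  from eventually_Mval[OF this] eventually_good_champion show ?thesis
  proof (eventually_elim, intro allI impI)
    fix N p
    assume A: "5 / 2 * ln (Mval N) \<le> sqrt (Mval N) \<and> 2000 / sqrt (Mval N) \<le> 1 / 15 \<and>
      1 + (Mval N + 6 * sqrt (Mval N)) \<le> 3 * Mval N \<and>
       (5 / 2 * ln (Mval N) - 1) * (3 / 5) > ln (3 * Mval N) \<and> ln (Mval N) > 1"
      and g: "good_champion N" and p: "prime p \<and> p dvd N"
    note G = good_championD[OF g]
    define M where "M = Mval N"
    define s where "s = sqrt M"
    have A1: "5 / 2 * ln M \<le> s" "2000 / s \<le> 1 / 15" "1 + (M + 6 * s) \<le> 3 * M"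
       "(5 / 2 * ln M - 1) * (3 / 5) > ln (3 * M)" "ln M > 1"
      using A by (auto simp: M_def s_def)
    have s: "s * s = M" "s \<ge> 1200" "M > 0" using G by (auto simp: s_def M_def)
    show "ln (real p) \<le> 3 * ln (Mval N)"
    proof (cases "p = 2")
      case True
      then show ?thesis using A1 ln2_le_25_over_36 by (simp add: M_def)
    next
      case False
      show ?thesis
      proof (rule ccontr)
        assume "\<not> ln (real p) \<le> 3 * ln (Mval N)"
        then have big: "ln (real p) > 3 * ln M" by (simp add: M_def)
        define x where "x = nat \<lfloor>5 / 2 * ln M\<rfloor>"
        have x: "real x \<le> 5 / 2 * ln M" "5 / 2 * ln M - 1 \<le> real x" using A1(5) unfolding x_def by linarith+
        have "real x * ln 2 \<le> real x * 1" using ln2_le_25_over_36 by (intro mult_left_mono) auto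
        then have "real x * ln 2 < ln (real p)" using x big A1(5) by linarith
        then have "ln (2 ^ x) < ln (real p)" by (simp add: ln_realpow)
        then have "2 ^ x < real p" using p prime_gt_0_nat by (subst (asm) ln_less_cancel_iff) auto
        then have xp: "2 ^ x < p" by (metis of_nat_less_iff of_nat_numeral of_nat_power)
        obtain n where "N = p * n" using p by (auto elim: dvdE)
        then have n: "n * prod_list [p] = N" by simp
        have "real x * (lam N * ln 2 - 2000 / s) \<le> real (length [p]) * ln (1 + (M + 6 * s) / 1)"
          unfolding s_def M_def
          by (rule remove_log_raw[OF g n]) (use p False xp x A1 s in \<open>auto simp: s_def M_def\<close>)
        also have "\<dots> = ln (1 + (M + 6 * s))" by simp
        also have "\<dots> \<le> ln (3 * M)" by (rule ln_mono) (use A1 s in auto)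
        finally have 1: "real x * (lam N * ln 2 - 2000 / s) \<le> ln (3 * M)" .
        have "1 * (2 / 3) \<le> lam N * ln 2" using G(9) ln2_ge_two_thirds by (intro mult_mono) auto
        then have "3 / 5 \<le> lam N * ln 2 - 2000 / s" using A1(2) by linarith
        then have "(5 / 2 * ln M - 1) * (3 / 5) \<le> real x * (lam N * ln 2 - 2000 / s)"
          using x A1(5) by (intro mult_mono) auto
        then show False using 1 A1(4) by linarith
      qed
    qed
  qed
qed

text \<open>One copy of \<open>p\<close> traded for a power of 2 gives
  \<open>lam N * ln p <= ln (3 * M / a) + 3000\<close> for its exponent \<open>a\<close>. The huge
  constant does not matter: the bound only serves to dominate sums over primes.\<close>

lemma eventually_multiplicity_upper:
  "\<exists>C>0. eventually (\<lambda>N. \<forall>p::nat. prime p \<longrightarrow> real (multiplicity p N) \<le> C * Mval N * real p powr (- lam N)) champions_at_top"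
proof (intro exI conjI)
  let ?C = "3 * exp 3000 :: real"
  show "?C > 0" by simp
  have "eventually (\<lambda>M::real. 3 * ln M \<le> sqrt M / 4 \<and> 6 * sqrt M \<le> M) at_top"
    by (intro eventually_conj; real_asymp)
  from eventually_Mval[OF this] eventually_good_champion eventually_prime_factor_bound
  show "eventually (\<lambda>N. \<forall>p::nat. prime p \<longrightarrow> real (multiplicity p N) \<le> ?C * Mval N * real p powr (- lam N)) champions_at_top"
  proof (eventually_elim, intro allI impI)
    fix N p :: nat
    assume A: "3 * ln (Mval N) \<le> sqrt (Mval N) / 4 \<and> 6 * sqrt (Mval N) \<le> Mval N" and g: "good_champion N"
      and B: "\<forall>p. prime p \<and> p dvd N \<longrightarrow> ln (real p) \<le> 3 * ln (Mval N)" and p: "prime p"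
    note G = good_championD[OF g]
    define M where "M = Mval N"
    have p0: "real p > 0" using p prime_gt_0_nat by simp
    show "real (multiplicity p N) \<le> ?C * Mval N * real p powr (- lam N)"
    proof (cases "p dvd N")
      case False
      then show ?thesis using G(7) by (simp add: not_dvd_imp_multiplicity_0)
    next
      case True
      define a where "a = real (multiplicity p N)"
      have a: "a \<ge> 1" "a \<le> M"
        using True p G(8) bigomega_le_Mval_bound[OF G(2) p] by (auto simp: a_def M_def Suc_le_eq prime_multiplicity_gt_zero_iff)
      have key: "lam N * ln (real p) \<le> ln (3 * M / a) + 3000"
      proof (cases "p = 2")
        case True
        have "1 + M / a \<le> 3 * M / a" using a by (simp add: field_simps)
        moreover have "1 + M / a > 0" using a by (intro add_pos_nonneg) auto
        ultimately have "ln (1 + M / a) \<le> ln (3 * M / a)" by (intro ln_mono) auto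
        then show ?thesis using G(12) True by (simp add: a_def M_def)
      next
        case False
        obtain n where "N = p * n" using True by (auto elim: dvdE)
        then have n: "n * prod_list [p] = N" by simp
        have n0: "n > 0" using n G(8) by (auto intro: Nat.gr0I)
        have mp: "multiplicity p N = multiplicity p n + 1"
          using multiplicity_self_mult[OF n0 p] n by simp
        have "ln (real p) \<le> sqrt M / 4" using B p True A by (auto simp: M_def)
        then have "lam N * ln (real (prod_list [p])) \<le> real (length [p]) * ln (1 + (Mval N + 6 * sqrt (Mval N)) / a) + 3000"
          using p False a mp by (intro remove_log[OF g n]) (auto simp: a_def M_def)
        also have "ln (1 + (Mval N + 6 * sqrt (Mval N)) / a) \<le> ln (3 * M / a)"
        proof (intro ln_mono)
          have "(Mval N + 6 * sqrt (Mval N)) / a \<le> 2 * M / a" using A a by (intro divide_right_mono) (auto simp: M_def)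
          moreover have "1 \<le> M / a" using a by simp
          moreover have "3 * M / a = M / a + 2 * M / a" by (simp add: add_divide_distrib[symmetric])
          ultimately show "1 + (Mval N + 6 * sqrt (Mval N)) / a \<le> 3 * M / a" by linarith
          show "0 < 1 + (Mval N + 6 * sqrt (Mval N)) / a" using G(7) a by (intro add_pos_nonneg divide_nonneg_pos) auto
        qed
        finally show ?thesis by simp
      qed
      have "real p powr lam N = exp (lam N * ln (real p))" using p0 by (simp add: powr_def)
      also have "\<dots> \<le> exp (ln (3 * M / a) + 3000)" using key by simp
      also have "\<dots> = 3 * M / a * exp 3000" using a by (simp add: exp_add)
      finally have "a * real p powr lam N \<le> ?C * M" using a by (simp add: field_simps)
      then have "a \<le> ?C * M / real p powr lam N" using p0 by (simp add: field_simps)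
      then show ?thesis by (simp add: a_def M_def powr_minus divide_inverse)
    qed
  qed
qed

section \<open>Convergence of the exponent to rho\<close>

lemma real_zeta_summable: "s > 1 \<Longrightarrow> summable (\<lambda>n. 1 / real (Suc n) powr s)"
  using summable_Suc_powr[of s] by (simp add: powr_minus divide_inverse)

lemma real_zeta_sums: "s > 1 \<Longrightarrow> (\<lambda>n. 1 / real (Suc n) powr s) sums real_zeta s"
  unfolding real_zeta_def by (rule summable_sums[OF real_zeta_summable])

lemma real_zeta_eq_zfun:
  assumes s: "s > 1"
  shows "real_zeta s = Re (zfun (of_real s)) / (s - 1)"
proof -
  have "(\<lambda>n. of_real (1 / real (Suc n) powr s) :: complex) sums of_real (real_zeta s)"
    by (rule sums_of_real[OF real_zeta_sums[OF s]])
  moreover have "of_real (1 / real (Suc n) powr s) = npow (Suc n) (of_real s)" for n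
    by (simp only: npow_of_real zero_less_Suc powr_minus divide_inverse mult_1)
  ultimately have "lzeta (of_real s) = of_real (real_zeta s)"
    by (simp add: lzeta_def sums_iff)
  then have "zfun (of_real s) = of_real ((s - 1) * real_zeta s)"
    using zfun_eq_lzeta[of "of_real s"] s by simp
  then show ?thesis using s by simp
qed

lemma real_zeta_continuous: "continuous_on {1<..} real_zeta"
proof -
  have "continuous_on {1<..} (\<lambda>s. Re (zfun (of_real s)) / (s - 1))"
    by (intro continuous_intros continuous_on_compose2[OF holomorphic_on_imp_continuous_on[OF zfun_holomorphic]]) auto
  then show ?thesis
    by (rule continuous_on_eq) (simp add: real_zeta_eq_zfun)
qed

text \<open>Of the termwise difference only the term of the integer 2 (index 1) is kept. The
  definite rate gives uniqueness of \<open>rho\<close> and later converts closeness of zeta values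
  into closeness of arguments.\<close>

lemma real_zeta_decreasing:
  assumes "1 < s" "s \<le> t"
  shows "real_zeta t + (2 powr (- s) - 2 powr (- t)) \<le> real_zeta s"
proof -
  let ?f = "\<lambda>n. 1 / real (Suc n) powr s - 1 / real (Suc n) powr t"
  have sm: "?f sums (real_zeta s - real_zeta t)"
    using assms by (intro sums_diff real_zeta_sums) auto
  have nn: "?f n \<ge> 0" for n
    using assms powr_mono[of s t "real (Suc n)"] by (auto intro!: divide_left_mono simp del: of_nat_Suc)
  have "sum ?f {1} \<le> suminf ?f"
    by (rule sum_le_suminf[OF sums_summable[OF sm]]) (use nn in auto)
  then show ?thesis using sums_unique[OF sm] by (simp add: powr_minus divide_inverse)
qed

lemma real_zeta_gt_near_1: "\<exists>s. 1 < s \<and> s < 2 \<and> real_zeta s > 2"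
proof -
  have "isCont zfun 1"
    using holomorphic_on_imp_continuous_on[OF zfun_holomorphic]
    by (auto simp: continuous_on_eq_continuous_at open_halfspace_Re_gt)
  then have "((\<lambda>e. zfun (1 + of_real e)) \<longlongrightarrow> zfun 1) (at_right 0)"
    by (rule isCont_tendsto_compose[OF _ filterlim_add_of_real_at_right])
  then have "((\<lambda>e. Re (zfun (1 + of_real e))) \<longlongrightarrow> 1) (at_right 0)"
    using tendsto_Re by fastforce
  then have "eventually (\<lambda>e. Re (zfun (1 + of_real e)) > 1 / 2) (at_right 0)"
    by (rule order_tendstoD) simp
  moreover have "eventually (\<lambda>e::real. e \<in> {0<..<1/4}) (at_right 0)"
    by (rule eventually_at_right_real) simp
  ultimately have "eventually (\<lambda>e::real. Re (zfun (1 + of_real e)) > 1 / 2 \<and> e \<in> {0<..<1/4}) (at_right 0)"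
    by (rule eventually_conj)
  then obtain e :: real where e: "Re (zfun (1 + of_real e)) > 1 / 2" "0 < e" "e < 1/4"
    using eventually_happens[of _ "at_right (0::real)"] by (auto simp: trivial_limit_at_right_real)
  have "2 * e < Re (zfun (of_real (1 + e)))" using e by simp
  then have "2 < Re (zfun (of_real (1 + e))) / (1 + e - 1)" using e(2) by (simp add: pos_less_divide_eq)
  then have "real_zeta (1 + e) > 2"
    using real_zeta_eq_zfun[of "1 + e"] e(2) by simp
  then show ?thesis using e by (intro exI[of _ "1 + e"]) auto
qed

lemma real_zeta_3: "real_zeta 3 < 2"
proof -
  have a: "(\<lambda>n. 1 / real (Suc n) powr 2) sums (pi\<^sup>2 / 6)"
    using inverse_squares_sums by (simp add: powr_numeral)
  have b: "(\<lambda>n. 1 / real (Suc (Suc n)) powr 2) sums (pi\<^sup>2 / 6 - 1)"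
    using sums_split_initial_segment[OF a, of 1] by simp
  have c: "(\<lambda>n. 1 / real (Suc (Suc n)) powr 3) sums (real_zeta 3 - 1)"
    using sums_split_initial_segment[OF real_zeta_sums[of 3], of 1] by simp
  have "real_zeta 3 - 1 \<le> (pi\<^sup>2 / 6 - 1) / 2"
  proof (rule sums_le[OF _ c sums_divide[OF b]])
    fix n
    have "2 * real (Suc (Suc n)) ^ 2 \<le> real (Suc (Suc n)) * real (Suc (Suc n)) ^ 2"
      by (intro mult_right_mono) auto
    then have "2 * real (Suc (Suc n)) ^ 2 \<le> real (Suc (Suc n)) ^ 3"
      by (simp only: power3_eq_cube power2_eq_square mult.assoc)
    then have "1 / real (Suc (Suc n)) ^ 3 \<le> 1 / (2 * real (Suc (Suc n)) ^ 2)"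
      by (intro divide_left_mono) auto
    then show "1 / real (Suc (Suc n)) powr 3 \<le> 1 / real (Suc (Suc n)) powr 2 / 2"
      by (simp only: powr_numeral of_nat_0_less_iff zero_less_Suc of_nat_0_le_iff divide_divide_eq_left mult.commute)
  qed
  moreover have "pi\<^sup>2 < 4\<^sup>2" using pi_less_4 by (intro power_strict_mono) auto
  ultimately show ?thesis by simp
qed

lemma rho: "1 < rho" "real_zeta rho = 2" "rho < 3"
proof -
  obtain s where s: "1 < s" "s < 2" "real_zeta s > 2" using real_zeta_gt_near_1 by blast
  have "\<exists>x\<ge>s. x \<le> 3 \<and> real_zeta x = 2"
    by (rule IVT2') (use s real_zeta_3 in \<open>auto intro: continuous_on_subset[OF real_zeta_continuous]\<close>)
  then obtain x where x: "s \<le> x" "x \<le> 3" "real_zeta x = 2" by blast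
  have uniq: "y = x" if "1 < y" "real_zeta y = 2" for y
  proof (rule ccontr)
    assume "y \<noteq> x"
    then consider "y < x" | "x < y" by linarith
    then show False
    proof cases
      case 1
      have "(2::real) powr (- x) < 2 powr (- y)" using 1 by simp
      then show False using real_zeta_decreasing[of y x] 1 that x by simp
    next
      case 2
      have "(2::real) powr (- y) < 2 powr (- x)" using 2 by simp
      then show False using real_zeta_decreasing[of x y] 2 that x s by simp
    qed
  qed
  have "rho = x" unfolding rho_def by (rule the_equality) (use x s uniq in auto)
  moreover have "x \<noteq> 3" using x(3) real_zeta_3 by auto
  ultimately show "1 < rho" "real_zeta rho = 2" "rho < 3" using x s by auto
qed

lemma real_zeta_ge_1: "s > 1 \<Longrightarrow> real_zeta s \<ge> 1"
proof -
  assume s: "s > 1"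
  have "sum (\<lambda>n. 1 / real (Suc n) powr s) {0} \<le> suminf (\<lambda>n. 1 / real (Suc n) powr s)"
    by (rule sum_le_suminf[OF real_zeta_summable[OF s]]) auto
  then show ?thesis by (simp add: real_zeta_def)
qed

section \<open>Finite Euler products of the reciprocal of zeta\<close>

definition euler_prod :: "nat \<Rightarrow> real \<Rightarrow> real" where
  "euler_prod n s = (\<Prod>p | prime p \<and> p \<le> n. 1 - real p powr (- s))"

lemma has_sum_Suc_real:
  fixes F :: "nat \<Rightarrow> real"
  assumes "summable (\<lambda>n. F (Suc (n + k)))" "\<And>n. F n \<ge> 0"
  shows "(F has_sum (\<Sum>n. F (Suc (n + k)))) {k<..}"
proof -
  have bij: "bij_betw (\<lambda>n. Suc (n + k)) UNIV {k<..}"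
    by (rule bij_betwI[of _ _ _ "\<lambda>n. n - k - 1"]) auto
  have "((\<lambda>n. F (Suc (n + k))) has_sum (\<Sum>n. F (Suc (n + k)))) UNIV"
    by (rule norm_summable_imp_has_sum[OF _ summable_sums[OF assms(1)]]) (use assms in simp)
  then show ?thesis using has_sum_reindex_bij_betw[OF bij] by blast
qed

text \<open>Sieving the zeta series by the primes up to \<open>n\<close> leaves 1 and a part of the tail.\<close>

lemma euler_prod_zeta:
  assumes s: "s > 1" and n: "n > 0"
  shows "1 \<le> euler_prod n s * real_zeta s"
    "euler_prod n s * real_zeta s \<le> 1 + real n powr (1 - s) / (s - 1)"
proof -
  let ?f = "\<lambda>m::nat. real m powr (- s)"
  have s1: "summable (\<lambda>n. ?f (Suc (n + k)))" for k
    using summable_Suc_powr[OF s] summable_iff_shift[of "\<lambda>n. ?f (Suc n)" k] by simp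
  have z: "real_zeta s = infsum ?f {0<..}"
  proof -
    have "(?f has_sum (\<Sum>n. ?f (Suc (n + 0)))) {0<..}" by (rule has_sum_Suc_real[OF s1]) simp
    then show ?thesis by (simp add: real_zeta_def infsumI powr_minus divide_inverse)
  qed
  have sum0: "?f summable_on {0<..}"
    using has_sum_Suc_real[of ?f 0, OF s1] by (auto simp: summable_on_def)
  define S where "S A = {m::nat. m > 0 \<and> (\<forall>p\<in>A. \<not> p dvd m)}" for A
  have sumS: "?f summable_on B" if "B \<subseteq> {0<..}" for B
    by (rule summable_on_subset_banach[OF sum0 that])
  have step: "infsum ?f (S (insert p A)) = (1 - real p powr (- s)) * infsum ?f (S A)"
    if p: "prime p" "p \<notin> A" "\<forall>q\<in>A. prime q" for p A
  proof -
    have p0: "p > 0" using p prime_gt_0_nat by blast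
    \<comment> \<open>Among the numbers free of primes in \<open>A\<close>, those divisible by
      \<open>p\<close> are exactly \<open>p\<close> times such numbers, since \<open>p\<close>
      itself is outside \<open>A\<close>.\<close>
    have dec: "S A = S (insert p A) \<union> (*) p ` S A"
    proof (intro equalityI subsetI)
      fix m assume m: "m \<in> S A"
      show "m \<in> S (insert p A) \<union> (*) p ` S A"
      proof (cases "p dvd m")
        case True
        then obtain k where k: "m = p * k" by (auto elim: dvdE)
        then have "k \<in> S A" using m by (auto simp: S_def)
        then show ?thesis using k by blast
      qed (use m in \<open>auto simp: S_def\<close>)
    next
      fix m assume m: "m \<in> S (insert p A) \<union> (*) p ` S A"
      show "m \<in> S A"
      proof (cases "m \<in> S (insert p A)")
        case False
        then obtain k where k: "m = p * k" "k \<in> S A" using m by blast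
        have "\<not> q dvd p * k" if q: "q \<in> A" for q
        proof
          assume "q dvd p * k"
          then have "q dvd p" using k(2) q p(3) by (auto simp: S_def prime_dvd_mult_iff)
          then have "q = p" using p q primes_dvd_imp_eq by blast
          then show False using q p by simp
        qed
        then show ?thesis using k p0 by (auto simp: S_def)
      qed (auto simp: S_def)
    qed
    have disj: "S (insert p A) \<inter> (*) p ` S A = {}" by (auto simp: S_def)
    have inj: "inj_on ((*) p) (S A)" using p0 by (auto simp: inj_on_def)
    have "infsum ?f (S A) = infsum ?f (S (insert p A) \<union> (*) p ` S A)" using dec by simp
    also have "\<dots> = infsum ?f (S (insert p A)) + infsum ?f ((*) p ` S A)"
      by (intro infsum_Un_disjoint sumS disj) (use p0 in \<open>auto simp: S_def\<close>)
    also have "infsum ?f ((*) p ` S A) = infsum (\<lambda>m. real p powr (- s) * ?f m) (S A)"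
      by (subst infsum_reindex[OF inj]) (simp add: o_def powr_mult)
    also have "\<dots> = real p powr (- s) * infsum ?f (S A)" by (rule infsum_cmult_right')
    finally show ?thesis by (simp add: algebra_simps)
  qed
  have prodS: "infsum ?f (S A) = (\<Prod>p\<in>A. 1 - real p powr (- s)) * real_zeta s"
    if "finite A" "\<forall>p\<in>A. prime p" for A
    using that
  proof (induction A rule: finite_induct)
    case empty
    have "S {} = {0<..}" by (auto simp: S_def)
    then show ?case using z by simp
  next
    case (insert p A)
    then show ?case using step[of p A] by simp
  qed
  define A where "A = {p::nat. prime p \<and> p \<le> n}"
  have eq: "euler_prod n s * real_zeta s = infsum ?f (S A)"
    unfolding euler_prod_def A_def[symmetric]
    by (rule prodS[symmetric]) (use finite_primes_le in \<open>auto simp: A_def\<close>)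
  have S1: "S A = insert 1 (S A - {1})" using prime_gt_1_nat by (auto simp: S_def A_def)
  \<comment> \<open>Any survivor other than 1 has a prime factor, which exceeds
    \<open>n\<close>.\<close>
  have big: "S A - {1} \<subseteq> {n<..}"
  proof
    fix m assume m: "m \<in> S A - {1}"
    then obtain p where p: "prime p" "p dvd m" using prime_factor_nat[of m] by auto
    then have "p \<notin> A" using m by (auto simp: S_def)
    then have "p > n" using p by (auto simp: A_def)
    moreover have "p \<le> m" using p m by (auto simp: S_def intro: dvd_imp_le)
    ultimately show "m \<in> {n<..}" by simp
  qed
  have "infsum ?f (S A) = infsum ?f ({1} \<union> (S A - {1}))" using S1 by simp
  also have "\<dots> = infsum ?f {1} + infsum ?f (S A - {1})"
    by (intro infsum_Un_disjoint sumS) (auto simp: S_def)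
  also have "infsum ?f {1} = 1" by simp
  finally have e2: "infsum ?f (S A) = 1 + infsum ?f (S A - {1})" .
  have nn: "0 \<le> infsum ?f (S A - {1})" by (intro infsum_nonneg) auto
  have "infsum ?f (S A - {1}) \<le> infsum ?f {n<..}"
    by (intro infsum_mono_neutral sumS) (use big in \<open>auto simp: S_def\<close>)
  also have "\<dots> = (\<Sum>k. ?f (Suc (k + n)))"
    by (rule infsumI[OF has_sum_Suc_real[OF s1]]) simp
  also have "\<dots> \<le> real n powr (1 - s) / (s - 1)"
    using sum_powr_tail_bound(1)[of "s - 1" n] s n by simp
  finally show "1 \<le> euler_prod n s * real_zeta s"
    "euler_prod n s * real_zeta s \<le> 1 + real n powr (1 - s) / (s - 1)"
    using nn unfolding eq e2 by auto
qed

lemma euler_prod_tendsto: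
  assumes s: "s > 1"
  shows "(\<lambda>n. euler_prod n s) \<longlonglongrightarrow> 1 / real_zeta s"
proof -
  have z: "real_zeta s > 0" using real_zeta_ge_1[OF s] by simp
  have "(\<lambda>n. euler_prod n s * real_zeta s) \<longlonglongrightarrow> 1"
  proof (rule tendsto_sandwich[of "\<lambda>_. 1" _ _ "\<lambda>n. 1 + real n powr (1 - s) / (s - 1)"])
    show "eventually (\<lambda>n. 1 \<le> euler_prod n s * real_zeta s) sequentially"
      "eventually (\<lambda>n. euler_prod n s * real_zeta s \<le> 1 + real n powr (1 - s) / (s - 1)) sequentially"
      using eventually_gt_at_top[of "0::nat"] by (eventually_elim, simp add: euler_prod_zeta[OF s])+
    have "(\<lambda>n. 1 + real n powr (1 - s) / (s - 1)) \<longlonglongrightarrow> 1 + 0 / (s - 1)"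
    proof (intro tendsto_intros)
      show "(\<lambda>n. real n powr (1 - s)) \<longlonglongrightarrow> 0" using s by real_asymp
    qed (use s in auto)
    then show "(\<lambda>n. 1 + real n powr (1 - s) / (s - 1)) \<longlonglongrightarrow> 1" by simp
  qed simp
  then have "(\<lambda>n. euler_prod n s * real_zeta s / real_zeta s) \<longlonglongrightarrow> 1 / real_zeta s"
    using z by (intro tendsto_intros) auto
  then show ?thesis using z by simp
qed

lemma euler_prod_pos: "s > 0 \<Longrightarrow> euler_prod n s > 0"
proof -
  assume s: "s > 0"
  have "real p powr (- s) < 1" if "prime p" for p :: nat
    using prime_gt_1_nat[OF that] s by (simp add: powr_less_one)
  then show ?thesis unfolding euler_prod_def by (intro prod_pos) auto
qed

lemma euler_prod_mono:
  assumes "0 < s" "s \<le> t"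
  shows "euler_prod n s \<le> euler_prod n t"
  unfolding euler_prod_def
proof (intro prod_mono conjI)
  fix p :: nat assume "p \<in> {p. prime p \<and> p \<le> n}"
  then have p: "p > 1" using prime_gt_1_nat by blast
  show "0 \<le> 1 - real p powr (- s)" using powr_less_one[of "real p" "- s"] p assms by simp
  show "1 - real p powr (- s) \<le> 1 - real p powr (- t)" using p assms by simp
qed

text \<open>The relative deviation of \<open>\<alpha>\<^sub>p\<close> from the ideal exponent \<open>M / (p powr lam - 1)\<close>.\<close>

definition expo_err :: "nat \<Rightarrow> nat \<Rightarrow> real" where
  "expo_err N p = real (multiplicity p N) / Mval N * (real p powr lam N - 1) - 1"

text \<open>Links the exponents to zeta: over all primes the left sides multiply to
  \<open>rising N (Mval N) = 2\<close> times the Euler product at \<open>lam N\<close>, and the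
  right sides to a number near 1 when the errors are small.\<close>

lemma expo_factor:
  assumes "p > 0"
  shows "(1 + real (multiplicity p N) / Mval N) * (1 - real p powr (- lam N)) = 1 + expo_err N p * real p powr (- lam N)"
proof -
  have "real p powr lam N * real p powr (- lam N) = 1" using assms by (simp add: powr_minus)
  moreover have "(1 + A) * (1 - v) = 1 + (A * (u - 1) - 1) * v" if "u * v = 1" for A u v :: real
  proof -
    have "1 + (A * (u - 1) - 1) * v = 1 + A * (u * v) - A * v - v" by (simp add: algebra_simps)
    then show ?thesis using that by (simp add: algebra_simps)
  qed
  ultimately show ?thesis unfolding expo_err_def by blast
qed

lemma exp_le_one_plus_double: "0 \<le> x \<Longrightarrow> x \<le> 1 \<Longrightarrow> exp x \<le> 1 + 2 * (x::real)"
  using exp_bound[of x] mult_left_mono[of x 1 x] by (simp add: power2_eq_square)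

text \<open>Here \<open>q\<close> is a prime power \<open>p powr lam\<close> and \<open>a\<close> the exponent of \<open>p\<close>; \<open>L\<close> copies of \<open>p\<close> are
  exchanged, so that the rounding to a power of 2 costs only a factor \<open>exp (3000 / L)\<close> per copy.\<close>

lemma expo_err_real_lower:
  fixes M s a q k L :: real
  assumes q: "q \<ge> 2" and k: "0 \<le> k" and M: "M > 0" "s > 0" "s * s = M" "s \<ge> 6" and L: "L > 0" "a \<ge> 0"
    and le: "1 + (M - 6 * s) / (a + L) \<le> q * exp k"
  shows "a / M * (q - 1) - 1 \<ge> - (2 * k + 6 / s + L * q / M)"
proof -
  define z where "z = exp k"
  have z: "z \<ge> 1" using k by (simp add: z_def)
  have "(M - 6 * s) / (a + L) \<le> q * z - 1" using le by (simp add: z_def)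
  then have "M - 6 * s \<le> (q * z - 1) * (a + L)" using L by (simp add: pos_divide_le_eq)
  \<comment> \<open>Moves the error factor from \<open>q\<close> to \<open>q - 1\<close>, at the
    price of squaring it.\<close>
  also have "\<dots> \<le> ((q - 1) * z\<^sup>2) * (a + L)"
  proof (rule mult_right_mono)
    have "1 * 1 \<le> (q - 1) * z" using q z by (intro mult_mono) auto
    then have "0 \<le> (z - 1) * ((q - 1) * z - 1)" using z by (intro mult_nonneg_nonneg) auto
    then show "q * z - 1 \<le> (q - 1) * z\<^sup>2" by (simp add: algebra_simps power2_eq_square)
  qed (use L in auto)
  finally have "(M - 6 * s) / z\<^sup>2 \<le> (q - 1) * (a + L)" using z by (simp add: pos_divide_le_eq mult_ac)
  also have "(M - 6 * s) / z\<^sup>2 = (M - 6 * s) * exp (- (2 * k))"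
    by (simp add: z_def exp_minus power2_eq_square exp_add[symmetric] divide_inverse)
  finally have 1: "(M - 6 * s) * exp (- (2 * k)) \<le> (q - 1) * (a + L)" .
  have "6 * s \<le> s * s" using M by (intro mult_right_mono) auto
  then have "(M - 6 * s) * (1 - 2 * k) \<le> (M - 6 * s) * exp (- (2 * k))"
    using exp_ge_add_one_self[of "- (2 * k)"] M by (intro mult_left_mono) auto
  then have "(M - 6 * s) * (1 - 2 * k) \<le> (q - 1) * (a + L)" using 1 by linarith
  then have "((M - 6 * s) * (1 - 2 * k)) / M \<le> ((q - 1) * (a + L)) / M" using M by (intro divide_right_mono) auto
  moreover have "((M - 6 * s) * (1 - 2 * k)) / M = (1 - 6 / s) * (1 - 2 * k)"
    unfolding M(3)[symmetric] using M(2) by (simp add: field_simps)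
  moreover have "(1 - 6 / s) * (1 - 2 * k) = 1 - 6 / s - 2 * k + 12 * k / s" by (simp add: algebra_simps)
  moreover have "12 * k / s \<ge> 0" using k M by simp
  moreover have "((q - 1) * (a + L)) / M = a / M * (q - 1) + L * q / M - L / M"
    by (simp add: add_divide_distrib diff_divide_distrib algebra_simps)
  moreover have "L / M \<ge> 0" using L M by simp
  ultimately show ?thesis by linarith
qed

text \<open>Mirror image of the lower estimate. The hypotheses \<open>q >= 3\<close> and
  \<open>k <= 1 / 4\<close> make \<open>(q - 1) * exp (- k)\<close> at least 1, which is what
  \<open>q * exp (- k) - 1 >= (q - 1) * exp (- 2 * k)\<close> needs.\<close>

lemma expo_err_real_upper:
  fixes M s a q k L d :: real
  assumes q: "q \<ge> 3" and k: "0 \<le> k" "k \<le> 1 / 4" and M: "M > 0" "s > 0" "s * s = M" and L: "L > 0"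
    and d: "d > 0" "d \<ge> a - L"
    and le: "q * exp (- k) \<le> 1 + (M + 6 * s) / d"
  shows "a / M * (q - 1) - 1 \<le> 4 * k + 12 / s + L * q / M"
proof -
  define w where "w = exp (- k)"
  have w: "0 < w" "w \<le> 1" "w \<ge> 1 / 2"
    using k exp_ge_add_one_self[of "- k"] by (auto simp: w_def)
  have "q * w - 1 \<le> (M + 6 * s) / d" using le by (simp add: w_def)
  then have 0: "(q * w - 1) * d \<le> M + 6 * s" using d by (simp add: pos_le_divide_eq)
  have "(q - 1) * w\<^sup>2 \<le> q * w - 1"
  proof -
    have "2 * (1 / 2) \<le> (q - 1) * w" using q w by (intro mult_mono) auto
    then have "0 \<le> (1 - w) * ((q - 1) * w - 1)" using w by (intro mult_nonneg_nonneg) auto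
    then show ?thesis by (simp add: algebra_simps power2_eq_square)
  qed
  then have "((q - 1) * w\<^sup>2) * d \<le> (q * w - 1) * d" using d by (intro mult_right_mono) auto
  then have "((q - 1) * w\<^sup>2) * d \<le> M + 6 * s" using 0 by linarith
  then have "(q - 1) * d \<le> (M + 6 * s) / w\<^sup>2" using w by (simp add: pos_le_divide_eq mult_ac)
  also have "(M + 6 * s) / w\<^sup>2 = (M + 6 * s) * exp (2 * k)"
    by (simp add: w_def exp_minus power2_eq_square exp_add[symmetric] divide_inverse)
  also have "\<dots> \<le> (M + 6 * s) * (1 + 2 * (2 * k))"
    using k M by (intro mult_left_mono exp_le_one_plus_double) auto
  finally have 1: "(q - 1) * d \<le> (M + 6 * s) * (1 + 4 * k)" by simp
  have "(q - 1) * (a - L) \<le> (q - 1) * d" using d q by (intro mult_left_mono) auto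
  then have "((q - 1) * (a - L)) / M \<le> ((M + 6 * s) * (1 + 4 * k)) / M"
    using 1 M by (intro divide_right_mono) auto
  moreover have "((M + 6 * s) * (1 + 4 * k)) / M = (1 + 6 / s) * (1 + 4 * k)"
    unfolding M(3)[symmetric] using M(2) by (simp add: field_simps)
  moreover have "(1 + 6 / s) * (1 + 4 * k) = 1 + 6 / s + 4 * k + 24 * k / s" by (simp add: algebra_simps)
  moreover have "24 * k / s \<le> 6 / s" using k M by (intro divide_right_mono) auto
  moreover have "12 / s = 6 / s + 6 / s" by (simp add: add_divide_distrib[symmetric])
  moreover have "((q - 1) * (a - L)) / M = a / M * (q - 1) - L * q / M + L / M"
    by (simp add: add_divide_distrib diff_divide_distrib algebra_simps)
  moreover have "L / M \<ge> 0" using L M by simp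
  ultimately show ?thesis by linarith
qed

text \<open>With \<open>L\<close> about \<open>(ln M)^2\<close> copies of \<open>p\<close>, the
  rounding error 3000 becomes \<open>k = 3000 / (ln M)^2\<close> per copy. The copies shift the
  exponent by \<open>L\<close>, an error of order \<open>L * p powr lam N / M\<close>; since
  \<open>lam N <= 10\<close>, the cutoff \<open>exp (sqrt (ln M))\<close> keeps it below
  \<open>1 / (ln M)^2\<close>. The constant is \<open>4 * 3000 + 2\<close>.\<close>

lemma eventually_expo_err_small:
  "eventually (\<lambda>N. \<forall>p::nat. prime p \<and> real p \<le> exp (sqrt (ln (Mval N))) \<longrightarrow>
      \<bar>expo_err N p\<bar> \<le> 12002 / (ln (Mval N))\<^sup>2) champions_at_top"
proof -
  have "eventually (\<lambda>M::real. ((ln M)\<^sup>2 + 1) * sqrt (ln M) \<le> sqrt M / 4 \<and> 12 / sqrt M \<le> 1 / (ln M)\<^sup>2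
      \<and> ((ln M)\<^sup>2 + 1) * exp (10 * sqrt (ln M)) / M \<le> 1 / (ln M)\<^sup>2 \<and> 3000 / (ln M)\<^sup>2 \<le> 1 / 4 \<and> ln M \<ge> 1) at_top"
    by (intro eventually_conj; real_asymp)
  from eventually_Mval[OF this] eventually_good_champion show ?thesis
  proof (eventually_elim, intro allI impI)
    fix N p :: nat
    assume A: "((ln (Mval N))\<^sup>2 + 1) * sqrt (ln (Mval N)) \<le> sqrt (Mval N) / 4 \<and> 12 / sqrt (Mval N) \<le> 1 / (ln (Mval N))\<^sup>2
      \<and> ((ln (Mval N))\<^sup>2 + 1) * exp (10 * sqrt (ln (Mval N))) / Mval N \<le> 1 / (ln (Mval N))\<^sup>2
      \<and> 3000 / (ln (Mval N))\<^sup>2 \<le> 1 / 4 \<and> ln (Mval N) \<ge> 1"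
      and g: "good_champion N" and p: "prime p \<and> real p \<le> exp (sqrt (ln (Mval N)))"
    note G = good_championD[OF g]
    define M where "M = Mval N"
    define s where "s = sqrt M"
    define l where "l = ln M"
    define a where "a = real (multiplicity p N)"
    define q where "q = real p powr lam N"
    define k where "k = 3000 / l\<^sup>2"
    define L where "L = nat \<lceil>l\<^sup>2\<rceil>"
    have A1: "(l\<^sup>2 + 1) * sqrt l \<le> s / 4" "12 / s \<le> 1 / l\<^sup>2" "(l\<^sup>2 + 1) * exp (10 * sqrt l) / M \<le> 1 / l\<^sup>2"
      "k \<le> 1 / 4" "l \<ge> 1"
      using A by (auto simp: M_def s_def l_def k_def)
    have s: "s * s = M" "s \<ge> 1200" "M > 0" using G by (auto simp: s_def M_def)
    have p0: "p > 0" using p prime_gt_0_nat by blast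
    have lnp: "ln (real p) \<le> sqrt l"
      using p p0 ln_le_cancel_iff[of "real p" "exp (sqrt l)"] by (simp add: l_def M_def)
    show "\<bar>expo_err N p\<bar> \<le> 12002 / (ln (Mval N))\<^sup>2"
    proof (cases "p = 2")
      case True
      have "2 powr lam N = 1 + M / a" using lam_powr[OF G(6) G(2)] True by (simp add: M_def a_def)
      moreover have "a > 0" using G(6) True by (simp add: a_def)
      ultimately have "expo_err N p = 0"
        unfolding expo_err_def M_def[symmetric] a_def[symmetric] using True s by simp
      then show ?thesis by simp
    next
      case False
      have p3: "p \<ge> 3" using odd_prime_ge_3[of p] p False by auto
      have L: "l\<^sup>2 \<le> real L" "real L \<le> l\<^sup>2 + 1" "L > 0"
      proof -
        have "1 * 1 \<le> l * l" using A1(5) by (intro mult_mono) auto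
        then have l2: "l\<^sup>2 \<ge> 1" by (simp add: power2_eq_square)
        show "l\<^sup>2 \<le> real L" "real L \<le> l\<^sup>2 + 1" using l2 unfolding L_def by linarith+
        then show "L > 0" using l2 by (intro Nat.gr0I) auto
      qed
      have "real p powr 1 \<le> q" unfolding q_def using G(9) p3 by (intro powr_mono) auto
      then have q3: "q \<ge> 3" using p3 by simp
      have lnp0: "ln (real p) \<ge> 0" using p3 by simp
      have lq: "ln q = lam N * ln (real p)" using p0 by (simp add: q_def ln_powr)
      have "lam N * ln (real p) \<le> 10 * sqrt l" using G(9,10) lnp lnp0 by (intro mult_mono) auto
      then have "exp (ln q) \<le> exp (10 * sqrt l)" unfolding lq by simp
      then have qle: "q \<le> exp (10 * sqrt l)" using q3 by simp
      have "real L * q \<le> (l\<^sup>2 + 1) * exp (10 * sqrt l)" using L qle q3 by (intro mult_mono) auto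
      then have "real L * q / M \<le> (l\<^sup>2 + 1) * exp (10 * sqrt l) / M" using s by (intro divide_right_mono) auto
      then have LqM: "real L * q / M \<le> 1 / l\<^sup>2" using A1(3) by linarith
      have k0: "0 \<le> k" "3000 / real L \<le> k" unfolding k_def using L A1(5) by (auto intro!: divide_left_mono)
      let ?ps = "replicate L p"
      have ps: "\<forall>q\<in>set ?ps. prime q \<and> q \<noteq> 2" "?ps \<noteq> []" using p False L by auto
      have lnm: "ln (real (prod_list ?ps)) = real L * ln (real p)"
        using p0 by (simp add: prod_list_replicate_power ln_realpow)
      have "real L * ln (real p) \<le> (l\<^sup>2 + 1) * sqrt l" using L lnp lnp0 by (intro mult_mono) auto
      then have len: "ln (real (prod_list ?ps)) \<le> sqrt (Mval N) / 4"
        unfolding lnm using A1(1) by (simp add: s_def M_def)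
      have mpow: "multiplicity p (n * p ^ L) = multiplicity p n + L" if "n > 0" for n
        using that p p0 by (simp add: prime_elem_multiplicity_mult_distrib)
      have split12: "(12002::real) / l\<^sup>2 = 4 * k + 1 / l\<^sup>2 + 1 / l\<^sup>2" by (simp add: k_def add_divide_distrib[symmetric])
      have lower: "a / M * (q - 1) - 1 \<ge> - (2 * k + 6 / s + real L * q / M)"
      proof (rule expo_err_real_lower)
        have aL: "a + real L > 0" using L by (simp add: a_def)
        have "real (length ?ps) * ln (1 + (Mval N - 6 * sqrt (Mval N)) / (a + real L))
            \<le> lam N * ln (real (prod_list ?ps)) + 3000"
          using aL mpow[OF G(8)] by (intro insert_log[OF g ps len]) (auto simp: prod_list_replicate_power a_def)
        then have "real L * ln (1 + (M - 6 * s) / (a + real L)) \<le> real L * ln q + 3000"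
          unfolding lnm lq by (simp add: M_def s_def mult_ac)
        then have "ln (1 + (M - 6 * s) / (a + real L)) \<le> (real L * ln q + 3000) / real L"
          using L by (simp add: pos_le_divide_eq mult.commute)
        also have "\<dots> = ln q + 3000 / real L" using L by (simp add: add_divide_distrib)
        also have "\<dots> \<le> ln q + k" using k0 by simp
        finally have ln1: "ln (1 + (M - 6 * s) / (a + real L)) \<le> ln q + k" .
        have "(6::real) * s \<le> s * s" using s by (intro mult_right_mono) auto
        then have pos: "1 + (M - 6 * s) / (a + real L) > 0"
          by (intro add_pos_nonneg[OF zero_less_one divide_nonneg_pos]) (use s aL in auto)
        have "1 + (M - 6 * s) / (a + real L) = exp (ln (1 + (M - 6 * s) / (a + real L)))" using pos by simp
        also have "\<dots> \<le> exp (ln q + k)" using ln1 by simp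
        also have "\<dots> = q * exp k" using q3 by (simp add: exp_add)
        finally show "1 + (M - 6 * s) / (a + real L) \<le> q * exp k" .
      qed (use q3 k0 s L in \<open>auto simp: a_def\<close>)
      have upper: "a / M * (q - 1) - 1 \<le> 4 * k + 12 / s + real L * q / M"
      \<comment> \<open>With fewer than \<open>L\<close> copies present nothing can be removed, but
        then \<open>a <= L\<close> and the bound is immediate.\<close>
      proof (cases "L \<le> multiplicity p N")
        case False
        then have "a \<le> real L" by (simp add: a_def)
        then have "a * (q - 1) \<le> real L * q" using q3 by (intro mult_mono) auto
        then have "a / M * (q - 1) \<le> real L * q / M" using s by (simp add: divide_right_mono)
        moreover have "12 / s \<ge> 0" using s by simp
        ultimately show ?thesis using k0 by linarith
      next
        case True
        have "p ^ L dvd N" by (rule multiplicity_dvd'[OF True])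
        then obtain n where "N = p ^ L * n" by (auto elim: dvdE)
        then have n: "n * p ^ L = N" by simp
        have n0: "n > 0" using n G(8) by (auto intro: Nat.gr0I)
        define d where "d = real (multiplicity p n) + 1"
        have d: "d > 0" "d \<ge> a - real L" using mpow[OF n0] n by (auto simp: d_def a_def)
        show ?thesis
        proof (rule expo_err_real_upper[OF _ _ _ _ _ _ _ d])
          have "lam N * ln (real (prod_list ?ps)) \<le> real (length ?ps) * ln (1 + (Mval N + 6 * sqrt (Mval N)) / d) + 3000"
            using n d by (intro remove_log[OF g _ ps len]) (auto simp: prod_list_replicate_power d_def)
          then have "real L * ln q \<le> real L * ln (1 + (M + 6 * s) / d) + 3000"
            unfolding lnm lq by (simp add: M_def s_def mult_ac)
          then have "ln q \<le> (real L * ln (1 + (M + 6 * s) / d) + 3000) / real L"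
            using L by (simp add: pos_le_divide_eq mult.commute)
          also have "\<dots> = ln (1 + (M + 6 * s) / d) + 3000 / real L" using L by (simp add: add_divide_distrib)
          also have "\<dots> \<le> ln (1 + (M + 6 * s) / d) + k" using k0 by simp
          finally have ln1: "ln q - k \<le> ln (1 + (M + 6 * s) / d)" by simp
          have pos: "1 + (M + 6 * s) / d > 0"
            by (rule add_pos_nonneg[OF zero_less_one divide_nonneg_pos]) (use s d in auto)
          have "q * exp (- k) = exp (ln q - k)" using q3 by (simp add: exp_diff exp_minus divide_inverse)
          also have "\<dots> \<le> exp (ln (1 + (M + 6 * s) / d))" using ln1 by simp
          also have "\<dots> = 1 + (M + 6 * s) / d" using pos by simp
          finally show "q * exp (- k) \<le> 1 + (M + 6 * s) / d" .
        qed (use q3 k0 A1 s L in auto)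
      qed
      have "6 / s \<le> 12 / s" using s by (intro divide_right_mono) auto
      then have "\<bar>a / M * (q - 1) - 1\<bar> \<le> 4 * k + 1 / l\<^sup>2 + 1 / l\<^sup>2"
        using lower upper A1(2) LqM k0 by linarith
      then show ?thesis unfolding split12[symmetric]
        by (simp add: expo_err_def a_def M_def q_def l_def)
    qed
  qed
qed

text \<open>Serves the primes beyond the cutoff \<open>exp (sqrt (ln M))\<close>, where only the
  crude upper bound for the exponents is at hand.\<close>

lemma eventually_expo_err_bounded:
  "\<exists>C>0. eventually (\<lambda>N. \<forall>p::nat. prime p \<longrightarrow> \<bar>expo_err N p\<bar> \<le> C) champions_at_top"
proof -
  obtain C where C: "C > 0" "eventually (\<lambda>N. \<forall>p::nat. prime p \<longrightarrow> real (multiplicity p N) \<le> C * Mval N * real p powr (- lam N)) champions_at_top"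
    using eventually_multiplicity_upper by blast
  have "eventually (\<lambda>N. \<forall>p::nat. prime p \<longrightarrow> \<bar>expo_err N p\<bar> \<le> C + 1) champions_at_top"
    using C(2) eventually_good_champion
  proof (eventually_elim, intro allI impI)
    fix N p :: nat
    assume A: "\<forall>p::nat. prime p \<longrightarrow> real (multiplicity p N) \<le> C * Mval N * real p powr (- lam N)"
      and g: "good_champion N" and p: "prime p"
    note G = good_championD[OF g]
    have p1: "real p > 1" using prime_gt_1_nat[OF p] by simp
    have q1: "real p powr lam N \<ge> 1" using G(9) p1 by (simp add: ge_one_powr_ge_zero)
    have "real (multiplicity p N) / Mval N \<le> C * real p powr (- lam N)"
      using A p G(7) by (simp add: pos_divide_le_eq mult_ac)
    then have "real (multiplicity p N) / Mval N * (real p powr lam N - 1) \<le> C * real p powr (- lam N) * real p powr lam N"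
      using q1 C G(7) by (intro mult_mono) auto
    also have "\<dots> = C" using p1 by (simp add: powr_minus)
    finally have "real (multiplicity p N) / Mval N * (real p powr lam N - 1) \<le> C" .
    moreover have "0 \<le> real (multiplicity p N) / Mval N * (real p powr lam N - 1)"
      using q1 G(7) by simp
    ultimately show "\<bar>expo_err N p\<bar> \<le> C + 1" unfolding expo_err_def using C(1) by linarith
  qed
  then show ?thesis using C(1) by (intro exI[of _ "C + 1"]) auto
qed

lemma prod_expo_le_2:
  assumes "N \<ge> 2"
  shows "(\<Prod>p | prime p \<and> p \<le> n. 1 + real (multiplicity p N) / Mval N) \<le> 2"
    and "n \<ge> N \<Longrightarrow> (\<Prod>p | prime p \<and> p \<le> n. 1 + real (multiplicity p N) / Mval N) = 2"
proof -
  note M = Mval[OF assms]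
  have eq: "(\<Prod>p | prime p \<and> p \<le> n. 1 + real (multiplicity p N) / Mval N) = 2" if n: "n \<ge> N" for n
  proof -
    have "rising N (Mval N) = (\<Prod>p | prime p \<and> p \<le> n. 1 + real (multiplicity p N) / Mval N)"
      unfolding rising_def
    proof (rule prime_factors_finite_superset_eq[OF finite_primes_le, of N n "\<lambda>p a. 1 + real a / Mval N"])
      show "prime_factors N \<subseteq> {p. prime p \<and> p \<le> n}"
      proof
        fix p assume "p \<in> prime_factors N"
        then have "prime p" "p dvd N" by (auto simp: in_prime_factors_iff)
        moreover have "p \<le> N" using \<open>p dvd N\<close> assms by (intro dvd_imp_le) auto
        ultimately show "p \<in> {p. prime p \<and> p \<le> n}" using n by simp
      qed
    qed (use assms in auto)
    then show ?thesis using M(3) by simp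
  qed
  then show "n \<ge> N \<Longrightarrow> (\<Prod>p | prime p \<and> p \<le> n. 1 + real (multiplicity p N) / Mval N) = 2" .
  have "(\<Prod>p | prime p \<and> p \<le> n. 1 + real (multiplicity p N) / Mval N)
      \<le> (\<Prod>p | prime p \<and> p \<le> max n N. 1 + real (multiplicity p N) / Mval N)"
    using M(4) by (intro prod_mono2 finite_primes_le) auto
  also have "\<dots> = 2" by (rule eq) simp
  finally show "(\<Prod>p | prime p \<and> p \<le> n. 1 + real (multiplicity p N) / Mval N) \<le> 2" .
qed

lemma prod_err:
  shows "(\<Prod>p | prime p \<and> p \<le> n. 1 + expo_err N p * real p powr (- lam N))
    = (\<Prod>p | prime p \<and> p \<le> n. 1 + real (multiplicity p N) / Mval N) * euler_prod n (lam N)"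
  unfolding euler_prod_def prod.distrib[symmetric]
  by (intro prod.cong refl) (simp add: expo_factor prime_gt_0_nat)

lemma prod_one_plus_minus_one_le:
  fixes f :: "nat \<Rightarrow> real"
  assumes "finite A" "(\<Sum>a\<in>A. \<bar>f a\<bar>) \<le> B"
  shows "\<bar>(\<Prod>a\<in>A. 1 + f a) - 1\<bar> \<le> exp B - 1"
proof -
  have "\<bar>(\<Prod>a\<in>A. 1 + f a) - 1\<bar> \<le> (\<Prod>a\<in>A. 1 + \<bar>f a\<bar>) - 1"
    using norm_prod_minus1_le_prod_minus1[of f A] by simp
  also have "(\<Prod>a\<in>A. 1 + \<bar>f a\<bar>) \<le> (\<Prod>a\<in>A. exp \<bar>f a\<bar>)"
    by (intro prod_mono) auto
  also have "\<dots> = exp (\<Sum>a\<in>A. \<bar>f a\<bar>)" using assms by (simp add: exp_sum)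
  also have "\<dots> \<le> exp B" using assms by simp
  finally show ?thesis by simp
qed

section \<open>Localization of \<open>lam N\<close> near \<open>rho\<close>\<close>

lemma ln_Mval_at_top: "filterlim (\<lambda>N. ln (Mval N)) at_top champions_at_top"
  by (rule filterlim_compose[OF ln_at_top Mval_at_top])

text \<open>So far only \<open>lam N >= 1\<close> is known, too little to bound sums of
  \<open>p powr (- lam N)\<close>. If \<open>lam N\<close> were below the midpoint \<open>r\<close>
  of 1 and \<open>rho\<close>, a fixed Euler product with \<open>2 * euler_prod n r < 1\<close>
  would bound the product of the \<open>1 + expo_err\<close> factors away from 1, although its
  finitely many errors tend to 0. Working with finitely many primes avoids the tail that is not yet
  controlled.\<close>

lemma eventually_lam_ge: "eventually (\<lambda>N. lam N \<ge> (1 + rho) / 2) champions_at_top"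
proof -
  define r where "r = (1 + rho) / 2"
  have r: "1 < r" "r < rho" using rho by (auto simp: r_def)
  have "(2::real) powr (- rho) < 2 powr (- r)" using r by simp
  then have z: "real_zeta r > 2"
    using real_zeta_decreasing[OF r(1) less_imp_le[OF r(2)]] rho(2) by linarith
  have "(\<lambda>n. 2 * euler_prod n r) \<longlonglongrightarrow> 2 * (1 / real_zeta r)"
    by (intro tendsto_intros euler_prod_tendsto r)
  then have "eventually (\<lambda>n. 2 * euler_prod n r < 1) sequentially"
    by (rule order_tendstoD) (use z in auto)
  then obtain n where n: "2 * euler_prod n r < 1"
    by (meson eventually_happens trivial_limit_sequentially)
  define c where "c = real n * 12002"
  have lim: "((\<lambda>N. exp (c / (ln (Mval N))\<^sup>2) - 1) \<longlongrightarrow> 0) champions_at_top"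
  proof -
    have "((\<lambda>l::real. exp (c / l\<^sup>2) - 1) \<longlongrightarrow> 0) at_top" by real_asymp
    from filterlim_compose[OF this ln_Mval_at_top] show ?thesis .
  qed
  have ev1: "eventually (\<lambda>N. exp (c / (ln (Mval N))\<^sup>2) - 1 < 1 - 2 * euler_prod n r) champions_at_top"
    using lim by (rule order_tendstoD) (use n in simp)
  have ev2: "eventually (\<lambda>N. real n \<le> exp (sqrt (ln (Mval N)))) champions_at_top"
  proof -
    have "eventually (\<lambda>l::real. real n \<le> exp (sqrt l)) at_top" by real_asymp
    then show ?thesis by (rule eventually_compose_filterlim[OF _ ln_Mval_at_top])
  qed
  show ?thesis using ev1 ev2 eventually_good_champion eventually_expo_err_small
  proof eventually_elim
    case (elim N)
    note G = good_championD[OF elim(3)]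
    show ?case
    proof (rule ccontr)
      assume "\<not> (1 + rho) / 2 \<le> lam N"
      then have lt: "lam N \<le> r" by (simp add: r_def)
      let ?P = "{p::nat. prime p \<and> p \<le> n}"
      have each: "\<bar>expo_err N p * real p powr (- lam N)\<bar> \<le> 12002 / (ln (Mval N))\<^sup>2" if p: "p \<in> ?P" for p
      proof -
        have "real p \<le> exp (sqrt (ln (Mval N)))" using p elim(2) by simp
        then have "\<bar>expo_err N p\<bar> \<le> 12002 / (ln (Mval N))\<^sup>2" using elim(4) p by blast
        moreover have "real p powr (- lam N) \<le> 1"
          using p G(9) prime_ge_1_nat[of p] powr_mono[of "- lam N" 0 "real p"] by simp
        ultimately have "\<bar>expo_err N p\<bar> * real p powr (- lam N) \<le> 12002 / (ln (Mval N))\<^sup>2 * 1"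
          by (intro mult_mono) auto
        then show ?thesis by (simp add: abs_mult)
      qed
      have "(\<Sum>p\<in>?P. \<bar>expo_err N p * real p powr (- lam N)\<bar>) \<le> (\<Sum>p\<in>?P. 12002 / (ln (Mval N))\<^sup>2)"
        by (rule sum_mono[OF each])
      also have "\<dots> = real (card ?P) * (12002 / (ln (Mval N))\<^sup>2)" by simp
      also have "\<dots> \<le> real n * (12002 / (ln (Mval N))\<^sup>2)"
      proof (rule mult_right_mono)
        have "card ?P \<le> card {1..n}" using prime_ge_1_nat by (intro card_mono) auto
        then show "real (card ?P) \<le> real n" by simp
      qed simp
      finally have "(\<Sum>p\<in>?P. \<bar>expo_err N p * real p powr (- lam N)\<bar>) \<le> c / (ln (Mval N))\<^sup>2" by (simp add: c_def)
      then have "\<bar>(\<Prod>p\<in>?P. 1 + expo_err N p * real p powr (- lam N)) - 1\<bar> \<le> exp (c / (ln (Mval N))\<^sup>2) - 1"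
        by (rule prod_one_plus_minus_one_le[OF finite_primes_le])
      then have "2 * euler_prod n r < (\<Prod>p\<in>?P. 1 + expo_err N p * real p powr (- lam N))"
        using elim(1) by linarith
      also have "\<dots> = (\<Prod>p\<in>?P. 1 + real (multiplicity p N) / Mval N) * euler_prod n (lam N)"
        by (rule prod_err)
      also have "\<dots> \<le> 2 * euler_prod n r"
        using prod_expo_le_2(1)[OF G(2), of n] euler_prod_mono[of "lam N" r n] lt G(9) euler_prod_pos[of "lam N" n] 
        by (intro mult_mono) auto
      finally show False by simp
    qed
  qed
qed

text \<open>Up to 10, the upper bound for \<open>lam N\<close>, the function
  \<open>2 powr (- x)\<close> decreases at rate at least \<open>2^(-10) * ln 2\<close>, and
  \<open>ln 2 >= 2 / 3\<close>.\<close>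

lemma two_powr_diff_ge:
  fixes u v :: real
  assumes "u \<le> v" "v \<le> 10"
  shows "(v - u) / 2048 \<le> 2 powr (- u) - 2 powr (- v)"
proof -
  have "(v - u) * (2 / 3) \<le> (v - u) * ln 2" using assms ln2_ge_two_thirds by (intro mult_left_mono) auto
  also have "\<dots> \<le> exp ((v - u) * ln 2) - 1" using exp_ge_add_one_self[of "(v - u) * ln 2"] by linarith
  also have "exp ((v - u) * ln 2) = 2 powr (v - u)" by (simp add: powr_def)
  finally have "(2::real) powr (- v) * ((v - u) * (2 / 3)) \<le> 2 powr (- v) * (2 powr (v - u) - 1)"
    by (intro mult_left_mono) auto
  also have "\<dots> = 2 powr (- u) - 2 powr (- v)" by (simp add: right_diff_distrib powr_add[symmetric])
  finally have 1: "(2::real) powr (- v) * ((v - u) * (2 / 3)) \<le> 2 powr (- u) - 2 powr (- v)" .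
  have "(2::real) powr (- 10) \<le> 2 powr (- v)" using assms by (intro powr_mono) auto
  then have "(1 / 1024 :: real) * ((v - u) * (2 / 3)) \<le> 2 powr (- v) * ((v - u) * (2 / 3))"
    using assms by (intro mult_right_mono) (auto simp: powr_minus powr_numeral)
  then show ?thesis using 1 assms by simp
qed

text \<open>The equation \<open>rising N M = 2\<close> reads \<open>2 / real_zeta lam = \<Prod>p. 1 + expo_err N p * p powr (- lam)\<close>,
  which pins \<open>lam\<close> down to within \<open>o(1 / ln M)\<close>.\<close>

lemma lam_tendsto_rho_fast: "((\<lambda>N. (lam N - rho) * ln (Mval N)) \<longlongrightarrow> 0) champions_at_top"
proof -
  define r where "r = (1 + rho) / 2"
  have r: "1 < r" using rho by (auto simp: r_def)
  obtain C where C: "C > 0" "eventually (\<lambda>N. \<forall>p::nat. prime p \<longrightarrow> \<bar>expo_err N p\<bar> \<le> C) champions_at_top"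
    using eventually_expo_err_bounded by blast
  \<comment> \<open>A bound for the total error: up to \<open>exp (sqrt l)\<close> every error is
    \<open>O(1 / l^2)\<close>, beyond it the bounded errors meet the tail of the sum of
    \<open>n powr (- r)\<close>. Both parts still tend to 0 after multiplication by
    \<open>l\<close>.\<close>
  define eta where "eta l = 12002 / l\<^sup>2 * real_zeta r + C * ((exp (sqrt l) - 1) powr (1 - r) / (r - 1))" for l :: real
  define K where "K = 2048 * (real_zeta r * 2)"
  have etal: "((\<lambda>l. K * eta l * l) \<longlongrightarrow> 0) at_top"
  proof -
    have a: "((\<lambda>l::real. 12002 / l\<^sup>2 * l) \<longlongrightarrow> 0) at_top" by real_asymp
    have b: "((\<lambda>l::real. (exp (sqrt l) - 1) powr (1 - r) * l) \<longlongrightarrow> 0) at_top" using r by real_asymp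
    have "((\<lambda>l. K * (12002 / l\<^sup>2 * l * real_zeta r + C * (((exp (sqrt l) - 1) powr (1 - r) * l) / (r - 1)))) \<longlongrightarrow>
        K * (0 * real_zeta r + C * (0 / (r - 1)))) at_top"
      using r by (intro tendsto_intros a b) auto
    then show ?thesis by (simp add: eta_def algebra_simps)
  qed
  have eta0: "(eta \<longlongrightarrow> 0) at_top"
  proof -
    have a: "((\<lambda>l::real. 12002 / l\<^sup>2) \<longlongrightarrow> 0) at_top" by real_asymp
    have b: "((\<lambda>l::real. (exp (sqrt l) - 1) powr (1 - r)) \<longlongrightarrow> 0) at_top" using r by real_asymp
    have "((\<lambda>l. 12002 / l\<^sup>2 * real_zeta r + C * ((exp (sqrt l) - 1) powr (1 - r) / (r - 1))) \<longlongrightarrow>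
        0 * real_zeta r + C * (0 / (r - 1))) at_top"
      using r by (intro tendsto_intros a b) auto
    then show ?thesis by (simp add: eta_def[abs_def])
  qed
  have evl: "eventually (\<lambda>l::real. eta l \<le> 1 \<and> exp (sqrt l) \<ge> 3 \<and> l \<ge> 1) at_top"
  proof (intro eventually_conj)
    show "eventually (\<lambda>l. eta l \<le> 1) at_top"
      using order_tendstoD(2)[OF eta0, of 1] by (auto elim: eventually_mono)
    show "eventually (\<lambda>l::real. exp (sqrt l) \<ge> 3) at_top" by real_asymp
  qed (rule eventually_ge_at_top)
  then have evN: "eventually (\<lambda>N. eta (ln (Mval N)) \<le> 1 \<and> exp (sqrt (ln (Mval N))) \<ge> 3 \<and> ln (Mval N) \<ge> 1) champions_at_top"
    by (rule eventually_compose_filterlim[OF _ ln_Mval_at_top])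
  have main: "eventually (\<lambda>N. norm ((lam N - rho) * ln (Mval N)) \<le> K * eta (ln (Mval N)) * ln (Mval N)) champions_at_top"
    using evN eventually_good_champion eventually_expo_err_small C(2) eventually_lam_ge
  proof eventually_elim
    case (elim N)
    note G = good_championD[OF elim(2)]
    define l where "l = ln (Mval N)"
    define L where "L = lam N"
    have l: "eta l \<le> 1" "exp (sqrt l) \<ge> 3" "l \<ge> 1" using elim(1) by (auto simp: l_def)
    have L: "r \<le> L" "L > 1" "L \<le> 10" using elim(5) r G(10) by (auto simp: L_def r_def)
    define n0 where "n0 = nat \<lfloor>exp (sqrt l)\<rfloor>"
    have n0: "real n0 \<le> exp (sqrt l)" "exp (sqrt l) - 1 \<le> real n0" "n0 > 0"
      using l(2) unfolding n0_def by linarith+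
    have zr: "real_zeta r \<ge> 1" by (rule real_zeta_ge_1[OF r])
    have sum_bound: "(\<Sum>p | prime p \<and> p \<le> n. \<bar>expo_err N p * real p powr (- L)\<bar>) \<le> eta l" for n
    proof -
      let ?P = "{p::nat. prime p \<and> p \<le> n}"
      let ?A = "?P \<inter> {p. p \<le> n0}" and ?B = "?P \<inter> {p. n0 < p}"
      have fin: "finite ?P" by (rule finite_primes_le)
      have pw: "real p powr (- L) \<le> real p powr (- r)" if "prime p" for p :: nat
        using L that prime_ge_1_nat[OF that] by (intro powr_mono) auto
      have "?P = ?A \<union> ?B" by auto
      then have "(\<Sum>p\<in>?P. \<bar>expo_err N p * real p powr (- L)\<bar>)
         = (\<Sum>p\<in>?A \<union> ?B. \<bar>expo_err N p * real p powr (- L)\<bar>)" by simp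
      also have "\<dots> = (\<Sum>p\<in>?A. \<bar>expo_err N p * real p powr (- L)\<bar>) + (\<Sum>p\<in>?B. \<bar>expo_err N p * real p powr (- L)\<bar>)"
        using fin by (intro sum.union_disjoint) auto
      also have "(\<Sum>p\<in>?A. \<bar>expo_err N p * real p powr (- L)\<bar>) \<le> (\<Sum>p\<in>?A. 12002 / l\<^sup>2 * real p powr (- r))"
      proof (rule sum_mono)
        fix p assume p: "p \<in> ?A"
        then have "real p \<le> exp (sqrt (ln (Mval N)))" using n0(1) by (simp add: l_def)
        then have "\<bar>expo_err N p\<bar> \<le> 12002 / l\<^sup>2" using elim(3) p by (simp add: l_def)
        then show "\<bar>expo_err N p * real p powr (- L)\<bar> \<le> 12002 / l\<^sup>2 * real p powr (- r)"
          unfolding abs_mult using pw[of p] p by (intro mult_mono) auto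
      qed
      also have "\<dots> = 12002 / l\<^sup>2 * (\<Sum>p\<in>?A. real p powr (- r))" by (rule sum_distrib_left[symmetric])
      also have "\<dots> \<le> 12002 / l\<^sup>2 * real_zeta r"
      proof (rule mult_left_mono)
        have "(\<Sum>p\<in>?A. real p powr (- r)) \<le> (\<Sum>p\<in>Suc ` {..<n}. real p powr (- r))"
        proof (rule sum_mono2)
          show "?A \<subseteq> Suc ` {..<n}" using prime_ge_1_nat by (auto simp: image_Suc_lessThan)
        qed auto
        also have "\<dots> = (\<Sum>m<n. 1 / real (Suc m) powr r)"
          by (subst sum.reindex) (auto simp: powr_minus divide_inverse)
        also have "\<dots> \<le> real_zeta r" unfolding real_zeta_def
          by (rule sum_le_suminf[OF real_zeta_summable[OF r]]) auto
        finally show "(\<Sum>p\<in>?A. real p powr (- r)) \<le> real_zeta r" .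
      qed simp
      also have "(\<Sum>p\<in>?B. \<bar>expo_err N p * real p powr (- L)\<bar>) \<le> (\<Sum>p\<in>?B. C * real p powr (- r))"
      proof (rule sum_mono)
        fix p assume p: "p \<in> ?B"
        then show "\<bar>expo_err N p * real p powr (- L)\<bar> \<le> C * real p powr (- r)"
          unfolding abs_mult using pw[of p] elim(4) by (intro mult_mono) auto
      qed
      also have "\<dots> = C * (\<Sum>p\<in>?B. real p powr (- r))" by (rule sum_distrib_left[symmetric])
      also have "\<dots> \<le> C * ((exp (sqrt l) - 1) powr (1 - r) / (r - 1))"
      proof (rule mult_left_mono)
        have e1: "- (r - 1) - 1 = - r" by simp
        note tb = sum_powr_tail_bound[of "r - 1" n0, unfolded e1]
        have "(\<Sum>p\<in>?B. real p powr (- r)) \<le> (\<Sum>p\<in>(\<lambda>k. Suc (k + n0)) ` {..<n}. real p powr (- r))"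
        proof (rule sum_mono2)
          show "?B \<subseteq> (\<lambda>k. Suc (k + n0)) ` {..<n}"
          proof
            fix p assume "p \<in> ?B"
            then have "p - n0 - 1 < n" "p = Suc ((p - n0 - 1) + n0)" by auto
            then show "p \<in> (\<lambda>k. Suc (k + n0)) ` {..<n}" by blast
          qed
        qed auto
        also have "\<dots> = (\<Sum>k<n. real (Suc (k + n0)) powr (- r))"
          by (subst sum.reindex) (auto simp: inj_on_def)
        also have "\<dots> \<le> (\<Sum>k. real (Suc (k + n0)) powr (- r))"
          by (rule sum_le_suminf) (use tb r n0 in auto)
        also have "\<dots> \<le> real n0 powr (- (r - 1)) / (r - 1)" using tb r n0 by auto
        also have "\<dots> \<le> (exp (sqrt l) - 1) powr (1 - r) / (r - 1)"
          using r n0 l(2,3) powr_mono2'[of "1 - r" "exp (sqrt l) - 1" "real n0"] by (intro divide_right_mono) auto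
        finally show "(\<Sum>p\<in>?B. real p powr (- r)) \<le> (exp (sqrt l) - 1) powr (1 - r) / (r - 1)" .
      qed (use C in simp)
      finally show ?thesis by (simp add: eta_def)
    qed
    have fin_bound: "\<bar>2 * euler_prod n L - 1\<bar> \<le> exp (eta l) - 1" if n: "n \<ge> N" for n
    proof -
      have "\<bar>(\<Prod>p | prime p \<and> p \<le> n. 1 + expo_err N p * real p powr (- L)) - 1\<bar> \<le> exp (eta l) - 1"
        by (rule prod_one_plus_minus_one_le[OF finite_primes_le sum_bound])
      then show ?thesis unfolding L_def prod_err prod_expo_le_2(2)[OF G(2) n] by simp
    qed
    \<comment> \<open>The bound for finite products is uniform in \<open>n\<close>, so it survives
      the limit of \<open>euler_prod n L\<close> for fixed \<open>N\<close>.\<close>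
    have "\<bar>2 * (1 / real_zeta L) - 1\<bar> \<le> exp (eta l) - 1"
    proof (rule tendsto_upperbound)
      show "(\<lambda>n. \<bar>2 * euler_prod n L - 1\<bar>) \<longlonglongrightarrow> \<bar>2 * (1 / real_zeta L) - 1\<bar>"
        by (intro tendsto_intros euler_prod_tendsto L)
      show "eventually (\<lambda>n. \<bar>2 * euler_prod n L - 1\<bar> \<le> exp (eta l) - 1) sequentially"
        using eventually_ge_at_top[of N] by eventually_elim (rule fin_bound)
    qed simp
    also have "exp (eta l) - 1 \<le> 2 * eta l"
    proof -
      have "0 \<le> eta l" using sum_bound[of 0] by (simp)
      then show ?thesis using exp_le_one_plus_double[of "eta l"] l(1) by simp
    qed
    finally have 1: "\<bar>2 * (1 / real_zeta L) - 1\<bar> \<le> 2 * eta l" .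
    have zL: "real_zeta L \<ge> 1" by (rule real_zeta_ge_1[OF L(2)])
    have zLr: "real_zeta L \<le> real_zeta r"
    proof -
      have "(2::real) powr (- L) \<le> 2 powr (- r)" using L(1) by (intro powr_mono) auto
      then show ?thesis using real_zeta_decreasing[OF r L(1)] by linarith
    qed
    have "\<bar>2 - real_zeta L\<bar> = real_zeta L * \<bar>2 * (1 / real_zeta L) - 1\<bar>"
    proof -
      have "2 - real_zeta L = real_zeta L * (2 * (1 / real_zeta L) - 1)" using zL by (simp add: field_simps)
      then show ?thesis using zL by (simp add: abs_mult)
    qed
    also have "\<dots> \<le> real_zeta r * (2 * eta l)" using 1 zL zLr by (intro mult_mono) auto
    finally have 2: "\<bar>2 - real_zeta L\<bar> \<le> real_zeta r * (2 * eta l)" .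
    \<comment> \<open>The term of the integer 2 alone gives zeta a slope bounded away from 0 on the
      relevant range.\<close>
    have "\<bar>L - rho\<bar> / 2048 \<le> \<bar>2 - real_zeta L\<bar>"
    proof (cases "L \<le> rho")
      case True
      then show ?thesis using two_powr_diff_ge[of L rho] real_zeta_decreasing[OF L(2) True] rho by simp
    next
      case False
      then show ?thesis using two_powr_diff_ge[of rho L] real_zeta_decreasing[of rho L] rho L by simp
    qed
    then have "\<bar>L - rho\<bar> \<le> K * eta l" using 2 by (simp add: K_def)
    then have "\<bar>L - rho\<bar> * l \<le> K * eta l * l" using l(3) by (intro mult_right_mono) auto
    then show ?case using l(3) by (simp add: abs_mult L_def l_def)
  qed
  show ?thesis
    by (rule Lim_null_comparison[OF main filterlim_compose[OF etal ln_Mval_at_top]])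
qed

lemma lam_tendsto_rho: "(lam \<longlongrightarrow> rho) champions_at_top"
proof -
  have inv: "((\<lambda>N. 1 / ln (Mval N)) \<longlongrightarrow> 0) champions_at_top"
    using tendsto_inverse_0_at_top[OF ln_Mval_at_top] by (simp add: divide_inverse)
  have "((\<lambda>N. (lam N - rho) * ln (Mval N) * (1 / ln (Mval N))) \<longlongrightarrow> 0 * 0) champions_at_top"
    by (intro tendsto_mult lam_tendsto_rho_fast inv)
  then have "((\<lambda>N. (lam N - rho) * ln (Mval N) * (1 / ln (Mval N))) \<longlongrightarrow> 0) champions_at_top" by simp
  moreover have "eventually (\<lambda>N. (lam N - rho) * ln (Mval N) * (1 / ln (Mval N)) = lam N - rho) champions_at_top"
    using filterlim_at_top_dense[THEN iffD1, OF ln_Mval_at_top, rule_format, of 0] by eventually_elim simp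
  ultimately have "((\<lambda>N. lam N - rho) \<longlongrightarrow> 0) champions_at_top"
    by (rule Lim_transform_eventually)
  then show ?thesis by (simp add: LIM_zero_iff)
qed

lemma expo_err_tendsto_0:
  assumes p: "prime p"
  shows "((\<lambda>N. expo_err N p) \<longlongrightarrow> 0) champions_at_top"
proof (rule Lim_null_comparison)
  have "((\<lambda>l::real. 12002 / l\<^sup>2) \<longlongrightarrow> 0) at_top" by real_asymp
  from filterlim_compose[OF this ln_Mval_at_top]
  show "((\<lambda>N. 12002 / (ln (Mval N))\<^sup>2) \<longlongrightarrow> 0) champions_at_top" .
  have "eventually (\<lambda>l::real. real p \<le> exp (sqrt l)) at_top" by real_asymp
  then have "eventually (\<lambda>N. real p \<le> exp (sqrt (ln (Mval N)))) champions_at_top"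
    by (rule eventually_compose_filterlim[OF _ ln_Mval_at_top])
  then show "eventually (\<lambda>N. norm (expo_err N p) \<le> 12002 / (ln (Mval N))\<^sup>2) champions_at_top"
    using eventually_expo_err_small by eventually_elim (use p in simp)
qed

lemma expo_tendsto:
  assumes p: "prime p"
  shows "((\<lambda>N. real (multiplicity p N) / Mval N) \<longlongrightarrow> 1 / (real p powr rho - 1)) champions_at_top"
proof -
  have p1: "real p > 1" using prime_gt_1_nat[OF p] by simp
  have pr: "real p powr rho > 1" using p1 rho by simp
  have "((\<lambda>N. (1 + expo_err N p) / (real p powr lam N - 1)) \<longlongrightarrow> (1 + 0) / (real p powr rho - 1)) champions_at_top"
    using p1 pr by (intro tendsto_intros expo_err_tendsto_0[OF p] lam_tendsto_rho) auto
  moreover have "eventually (\<lambda>N. (1 + expo_err N p) / (real p powr lam N - 1) = real (multiplicity p N) / Mval N) champions_at_top"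
    using eventually_good_champion
  proof eventually_elim
    case (elim N)
    have "real p powr lam N > 1" using p1 good_championD(9)[OF elim] by simp
    then show ?case by (simp add: expo_err_def)
  qed
  ultimately show ?thesis by (simp add: Lim_transform_eventually)
qed

section \<open>Asymptotics of champions\<close>

definition prime_seq :: "nat \<Rightarrow> nat" where
  "prime_seq k = nth_prime (Suc k)"

lemma prime_seq_eq: "prime_seq k = enumerate {p. prime p} k"
  by (simp add: prime_seq_def nth_prime_def)

lemma prime_seq_prime: "prime (prime_seq k)"
  using enumerate_in_set[OF primes_infinite, of k] by (simp add: prime_seq_eq)

lemma inj_prime_seq: "inj prime_seq"
  using strict_mono_enumerate[OF primes_infinite] strict_mono_imp_inj_on by (auto simp: prime_seq_eq[abs_def])

lemma range_prime_seq: "range prime_seq = {p. prime p}"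
  using range_enumerate[OF primes_infinite] by (simp add: prime_seq_eq[abs_def])

lemma prime_seq_ge: "Suc k \<le> prime_seq k"
proof (induction k)
  case 0
  then show ?case using prime_ge_1_nat[OF prime_seq_prime[of 0]] by simp
next
  case (Suc k)
  have "prime_seq k < prime_seq (Suc k)"
    unfolding prime_seq_eq by (rule enumerate_step[OF primes_infinite])
  then show ?case using Suc by simp
qed

lemma summable_prime_seq_ln:
  assumes "r > 1"
  shows "summable (\<lambda>k. ln (real (prime_seq k)) * real (prime_seq k) powr (- r))"
proof (rule summable_comparison_test)
  define d where "d = (r - 1) / 2"
  have d: "d > 0" "r - d = 1 + d" using assms by (auto simp: d_def field_simps)
  show "summable (\<lambda>k. (1 / d) * real (Suc k) powr (- (1 + d)))"
    using d by (intro summable_mult summable_Suc_powr) auto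
  have "norm (ln (real (prime_seq k)) * real (prime_seq k) powr (- r)) \<le> (1 / d) * real (Suc k) powr (- (1 + d))" for k
  proof -
    define x where "x = real (prime_seq k)"
    have x: "x \<ge> 1" "real (Suc k) \<le> x"
      unfolding x_def using prime_ge_1_nat[OF prime_seq_prime[of k]] prime_seq_ge[of k] by linarith+
    have "ln x * x powr (- r) \<le> (x powr d / d) * x powr (- r)"
      using d x by (intro mult_right_mono ln_powr_bound) auto
    also have "\<dots> = (1 / d) * x powr (d - r)"
      by (simp only: powr_add[symmetric] times_divide_eq_left mult_1 diff_conv_add_uminus)
    also have "d - r = - (1 + d)" using d by simp
    also have "x powr (- (1 + d)) \<le> real (Suc k) powr (- (1 + d))"
      using x d by (intro powr_mono2') auto
    finally have "ln x * x powr (- r) \<le> (1 / d) * real (Suc k) powr (- (1 + d))"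
      using d by (simp add: divide_right_mono)
    then show ?thesis using x by (simp add: abs_mult x_def)
  qed
  then show "\<exists>K. \<forall>k\<ge>K. norm (ln (real (prime_seq k)) * real (prime_seq k) powr (- r)) \<le> (1 / d) * real (Suc k) powr (- (1 + d))"
    by blast
qed

lemma ln_eq_suminf:
  assumes N: "N > 0"
  shows "(\<Sum>k. real (multiplicity (prime_seq k) N) * ln (real (prime_seq k))) = ln (real N)"
proof -
  let ?I = "{k. prime_seq k \<in> prime_factors N}"
  have finI: "finite ?I"
    using finite_vimageI[OF _ inj_prime_seq, of "prime_factors N"] by (simp add: vimage_def)
  have "(\<Sum>k. real (multiplicity (prime_seq k) N) * ln (real (prime_seq k)))
      = (\<Sum>k\<in>?I. real (multiplicity (prime_seq k) N) * ln (real (prime_seq k)))"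
    by (rule suminf_finite[OF finI]) (use prime_seq_prime in \<open>auto simp: prime_factors_multiplicity\<close>)
  also have "\<dots> = (\<Sum>p\<in>prime_seq ` ?I. real (multiplicity p N) * ln (real p))"
    by (subst sum.reindex) (use inj_prime_seq in \<open>auto intro: inj_on_subset\<close>)
  also have "prime_seq ` ?I = prime_factors N"
  proof
    show "prime_factors N \<subseteq> prime_seq ` ?I"
    proof
      fix p assume p: "p \<in> prime_factors N"
      then have "p \<in> range prime_seq" unfolding range_prime_seq by auto
      then show "p \<in> prime_seq ` ?I" using p by auto
    qed
  qed auto
  also have "(\<Sum>p\<in>prime_factors N. real (multiplicity p N) * ln (real p)) = (\<Sum>p\<in>prime_factors N. ln (real p ^ multiplicity p N))"
    by (intro sum.cong refl) (simp add: ln_realpow prime_gt_0_nat in_prime_factors_iff)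
  also have "\<dots> = ln (\<Prod>p\<in>prime_factors N. real p ^ multiplicity p N)"
    by (rule ln_prod[symmetric]) (auto simp: in_prime_factors_iff)
  also have "(\<Prod>p\<in>prime_factors N. real p ^ multiplicity p N) = real (\<Prod>p\<in>prime_factors N. p ^ multiplicity p N)"
    by simp
  also have "(\<Prod>p\<in>prime_factors N. p ^ multiplicity p N) = N"
    using prime_factorization_nat[OF N] by simp
  finally show ?thesis .
qed

lemma a_const_eq: "a_const = 1 / (\<Sum>k. ln (real (prime_seq k)) / (real (prime_seq k) powr rho - 1))"
  by (simp add: a_const_def prime_seq_def)

lemma prime_seq_powr_bound:
  "1 / (real (prime_seq k) powr rho - 1) \<le> 2 * real (prime_seq k) powr (- rho)"
proof -
  define q where "q = real (prime_seq k) powr rho"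
  have "prime_seq k \<ge> 2" by (rule prime_ge_2_nat[OF prime_seq_prime])
  moreover from this have "real (prime_seq k) powr 1 \<le> q"
    unfolding q_def using rho by (intro powr_mono) auto
  ultimately have "q \<ge> 2" by simp
  then have "1 / (q - 1) \<le> 2 / q" by (simp add: field_simps)
  then show ?thesis by (simp add: q_def powr_minus divide_inverse)
qed

lemma a_const_pos: "a_const > 0"
proof -
  let ?f = "\<lambda>k. ln (real (prime_seq k)) / (real (prime_seq k) powr rho - 1)"
  have pos: "?f k > 0" for k
  proof -
    have "real (prime_seq k) > 1" using prime_gt_1_nat[OF prime_seq_prime[of k]] by simp
    then show ?thesis using rho by simp
  qed
  have "summable ?f"
  proof (rule summable_comparison_test)
    show "summable (\<lambda>k. 2 * (ln (real (prime_seq k)) * real (prime_seq k) powr (- rho)))"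
      using rho by (intro summable_mult summable_prime_seq_ln)
    have "norm (?f k) \<le> 2 * (ln (real (prime_seq k)) * real (prime_seq k) powr (- rho))" for k
    proof -
      have "ln (real (prime_seq k)) \<ge> 0" using prime_ge_1_nat[OF prime_seq_prime[of k]] by simp
      from mult_left_mono[OF prime_seq_powr_bound this]
      have "?f k \<le> 2 * (ln (real (prime_seq k)) * real (prime_seq k) powr (- rho))" by (simp add: mult_ac)
      then show ?thesis using pos[of k] by (simp only: real_norm_def abs_of_pos)
    qed
    then show "\<exists>K. \<forall>k\<ge>K. norm (?f k) \<le> 2 * (ln (real (prime_seq k)) * real (prime_seq k) powr (- rho))" by blast
  qed
  then have "suminf ?f > 0" using pos by (rule suminf_pos)
  then show ?thesis by (simp add: a_const_eq)
qed

text \<open>Dominated convergence for series: \<open>ln N / M\<close> is the sum of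
  \<open>\<alpha>\<^sub>p * ln p / M\<close>, whose terms converge by \<open>expo_tendsto\<close>
  and are dominated by a multiple of \<open>p powr (- r) * ln p\<close> with \<open>r > 1\<close>.
  \<open>tannerys_theorem\<close> wants a nontrivial filter, hence the case split.\<close>

lemma ln_over_Mval: "((\<lambda>N. ln (real N) / Mval N) \<longlongrightarrow> 1 / a_const) champions_at_top"
proof (cases "champions_at_top = bot")
  case False
  define r where "r = (1 + rho) / 2"
  have r: "1 < r" using rho by (auto simp: r_def)
  obtain C where C: "C > 0" "eventually (\<lambda>N. \<forall>p::nat. prime p \<longrightarrow> real (multiplicity p N) \<le> C * Mval N * real p powr (- lam N)) champions_at_top"
    using eventually_multiplicity_upper by blast
  let ?a = "\<lambda>k N. real (multiplicity (prime_seq k) N) / Mval N * ln (real (prime_seq k))"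
  let ?b = "\<lambda>k. ln (real (prime_seq k)) / (real (prime_seq k) powr rho - 1)"
  let ?M = "\<lambda>k. C * (ln (real (prime_seq k)) * real (prime_seq k) powr (- r))"
  have bound: "eventually (\<lambda>N. \<forall>k. norm (?a k N) \<le> ?M k) champions_at_top"
    using C(2) eventually_good_champion eventually_lam_ge
  proof eventually_elim
    case (elim N)
    note G = good_championD[OF elim(2)]
    show ?case
    proof
      fix k
      define x where "x = real (prime_seq k)"
      have x: "x \<ge> 1" using prime_ge_1_nat[OF prime_seq_prime[of k]] by (simp add: x_def)
      have "real (multiplicity (prime_seq k) N) / Mval N \<le> C * x powr (- lam N)"
        using elim(1) prime_seq_prime[of k] G(7) by (simp add: pos_divide_le_eq mult_ac x_def)
      also have "\<dots> \<le> C * x powr (- r)"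
        using elim(3) x C(1) by (intro mult_left_mono powr_mono) (auto simp: r_def)
      finally have "real (multiplicity (prime_seq k) N) / Mval N * ln x \<le> C * x powr (- r) * ln x"
        using x by (intro mult_right_mono) auto
      moreover have "real (multiplicity (prime_seq k) N) / Mval N * ln x \<ge> 0" using x G(7) by simp
      ultimately show "norm (?a k N) \<le> ?M k" unfolding x_def[symmetric] by (simp add: mult_ac)
    qed
  qed
  have bound2: "eventually (\<lambda>(k, N). norm (?a k N) \<le> ?M k) (at_top \<times>\<^sub>F champions_at_top)"
    unfolding eventually_prod_filter
    by (rule exI[of _ "\<lambda>_. True"], rule exI[of _ "\<lambda>N. \<forall>k. norm (?a k N) \<le> ?M k"]) (use bound in auto)
  have lim: "((\<lambda>N. ?a k N) \<longlongrightarrow> ?b k) champions_at_top" for k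
  proof -
    have "((\<lambda>N. ?a k N) \<longlongrightarrow> 1 / (real (prime_seq k) powr rho - 1) * ln (real (prime_seq k))) champions_at_top"
      by (intro tendsto_mult expo_tendsto prime_seq_prime tendsto_const)
    then show ?thesis by simp
  qed
  have sM: "summable ?M" using r by (intro summable_mult summable_prime_seq_ln)
  have "((\<lambda>N. \<Sum>k. ?a k N) \<longlongrightarrow> suminf ?b) champions_at_top"
    using tannerys_theorem[OF lim bound2 sM False] by blast
  moreover have "eventually (\<lambda>N. (\<Sum>k. ?a k N) = ln (real N) / Mval N) champions_at_top"
    using eventually_good_champion
  proof eventually_elim
    case (elim N)
    note G = good_championD[OF elim]
    have fin: "finite {k. prime_seq k \<in> prime_factors N}"
      using finite_vimageI[OF _ inj_prime_seq, of "prime_factors N"] by (simp add: vimage_def)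
    have sm: "summable (\<lambda>k. real (multiplicity (prime_seq k) N) * ln (real (prime_seq k)))"
      by (rule summable_finite[OF fin]) (use prime_seq_prime in \<open>auto simp: prime_factors_multiplicity\<close>)
    have "(\<Sum>k. ?a k N) = (\<Sum>k. (real (multiplicity (prime_seq k) N) * ln (real (prime_seq k))) / Mval N)"
      by simp
    also have "\<dots> = ln (real N) / Mval N"
      using suminf_divide[OF sm, of "Mval N"] ln_eq_suminf[OF G(8)] by simp
    finally show ?case .
  qed
  ultimately have "((\<lambda>N. ln (real N) / Mval N) \<longlongrightarrow> suminf ?b) champions_at_top"
    by (rule Lim_transform_eventually)
  then show ?thesis by (simp add: a_const_eq)
qed simp

section \<open>Primes in short intervals\<close>

lemma primepi_scaled:
  assumes c: "c > 0"
  shows "((\<lambda>x. real (primepi (nat \<lfloor>c * x\<rfloor>)) * ln x / x) \<longlongrightarrow> c) at_top"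
proof -
  have fl: "filterlim (\<lambda>x::real. nat \<lfloor>c * x\<rfloor>) at_top at_top"
    using c by real_asymp
  have p: "((\<lambda>x. real (primepi (nat \<lfloor>c * x\<rfloor>)) * ln (real (nat \<lfloor>c * x\<rfloor>)) / real (nat \<lfloor>c * x\<rfloor>)) \<longlongrightarrow> 1) at_top"
    by (rule filterlim_compose[OF prime_number_theorem fl])
  have q: "((\<lambda>x. (real (nat \<lfloor>c * x\<rfloor>) / x) * (ln x / ln (real (nat \<lfloor>c * x\<rfloor>)))) \<longlongrightarrow> c * 1) at_top"
  proof (intro tendsto_mult)
    show "((\<lambda>x::real. real (nat \<lfloor>c * x\<rfloor>) / x) \<longlongrightarrow> c) at_top" using c by real_asymp
    show "((\<lambda>x::real. ln x / ln (real (nat \<lfloor>c * x\<rfloor>))) \<longlongrightarrow> 1) at_top" using c by real_asymp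
  qed
  have "((\<lambda>x. (real (primepi (nat \<lfloor>c * x\<rfloor>)) * ln (real (nat \<lfloor>c * x\<rfloor>)) / real (nat \<lfloor>c * x\<rfloor>))
      * ((real (nat \<lfloor>c * x\<rfloor>) / x) * (ln x / ln (real (nat \<lfloor>c * x\<rfloor>))))) \<longlongrightarrow> 1 * (c * 1)) at_top"
    by (intro tendsto_mult[OF p q])
  moreover have "eventually (\<lambda>x. (real (primepi (nat \<lfloor>c * x\<rfloor>)) * ln (real (nat \<lfloor>c * x\<rfloor>)) / real (nat \<lfloor>c * x\<rfloor>))
      * ((real (nat \<lfloor>c * x\<rfloor>) / x) * (ln x / ln (real (nat \<lfloor>c * x\<rfloor>)))) = real (primepi (nat \<lfloor>c * x\<rfloor>)) * ln x / x) at_top"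
    using filterlim_at_top[THEN iffD1, OF fl, rule_format, of 2]
  proof eventually_elim
    case (elim x)
    define k where "k = nat \<lfloor>c * x\<rfloor>"
    have "ln (real k) > 0" "real k > 0" using elim by (simp_all add: k_def[symmetric])
    then show ?case unfolding k_def[symmetric] by simp
  qed
  ultimately show ?thesis by (simp add: Lim_transform_eventually)
qed

text \<open>By the prime number theorem the interval from \<open>x\<close> to \<open>c * x\<close>
  contains about \<open>(c - 1) * x / ln x\<close> primes, eventually more than any fixed
  \<open>K\<close>.\<close>

lemma eventually_primes_between:
  assumes c: "c > 1"
  shows "eventually (\<lambda>x::real. \<exists>ps. distinct ps \<and> length ps = K \<and> (\<forall>q\<in>set ps. prime q \<and> x \<le> real q \<and> real q \<le> c * x)) at_top"
proof -
  have "((\<lambda>x. real (primepi (nat \<lfloor>c * x\<rfloor>)) * ln x / x - real (primepi (nat \<lfloor>1 * x\<rfloor>)) * ln x / x) \<longlongrightarrow> c - 1) at_top"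
    using c by (intro tendsto_diff primepi_scaled) auto
  then have "eventually (\<lambda>x. real (primepi (nat \<lfloor>c * x\<rfloor>)) * ln x / x - real (primepi (nat \<lfloor>1 * x\<rfloor>)) * ln x / x > (c - 1) / 2) at_top"
    by (rule order_tendstoD) (use c in simp)
  moreover have "eventually (\<lambda>x::real. ln x / x * real K < (c - 1) / 2) at_top" using c by real_asymp
  moreover have "eventually (\<lambda>x::real. x > 1) at_top" by (rule eventually_gt_at_top)
  ultimately show ?thesis
  proof eventually_elim
    case (elim x)
    let ?A = "{p::nat. prime p \<and> p \<le> nat \<lfloor>c * x\<rfloor>}" and ?B = "{p::nat. prime p \<and> p \<le> nat \<lfloor>x\<rfloor>}"
    have lx: "ln x / x > 0" using elim(3) by simp
    have "(c - 1) / 2 < real (card ?A) * ln x / x - real (card ?B) * ln x / x"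
      using elim(1) by (simp only: primepi_def mult_1)
    also have "\<dots> = ln x / x * (real (card ?A) - real (card ?B))"
      by (simp only: right_diff_distrib times_divide_eq_left mult.commute)
    finally have "ln x / x * real K < ln x / x * (real (card ?A) - real (card ?B))"
      using elim(2) by linarith
    then have K: "real K < real (card ?A) - real (card ?B)" using lx by (simp only: mult_less_cancel_left_pos)
    have "card ?A - card ?B \<le> card (?A - ?B)" by (rule diff_card_le_card_Diff[OF finite_primes_le])
    then have "K \<le> card (?A - ?B)" using K by linarith
    then obtain S where S: "S \<subseteq> ?A - ?B" "card S = K" "finite S"
      by (rule obtain_subset_with_card_n)
    obtain ps where ps: "set ps = S" "distinct ps" using finite_distinct_list[OF S(3)] by blast
    have "length ps = K" using ps S distinct_card by metis
    moreover have "prime q \<and> x \<le> real q \<and> real q \<le> c * x" if "q \<in> set ps" for q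
    proof -
      have q: "prime q" "q \<le> nat \<lfloor>c * x\<rfloor>" "\<not> q \<le> nat \<lfloor>x\<rfloor>" using that ps S by auto
      have "c * x > 0" using c elim(3) by simp
      then have "real q \<le> c * x" using q(2) by linarith
      moreover have "x \<le> real q" using q(3) elim(3) by linarith
      ultimately show ?thesis using q by simp
    qed
    ultimately show ?case using ps by blast
  qed
qed

lemma multiplicity_prod_list_distinct:
  assumes "n > 0" "\<forall>q\<in>set ps. prime q" "distinct ps" "q \<in> set ps"
  shows "multiplicity (q::nat) (n * prod_list ps) = multiplicity q n + 1"
  using assms
proof (induction ps arbitrary: n)
  case (Cons p ps)
  have p: "prime p" "p > 0" using Cons.prems prime_gt_0_nat by auto
  have np: "n * p > 0" using Cons.prems p by simp
  show ?case
  proof (cases "q = p")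
    case True
    have "multiplicity q (n * p * prod_list ps) = multiplicity q (n * p)"
      using Cons.prems True np p by (intro multiplicity_prod_list_other) auto
    then show ?thesis using multiplicity_self_mult[OF Cons.prems(1) p(1)] True by (simp add: mult.assoc)
  next
    case False
    have "multiplicity q (n * p * prod_list ps) = multiplicity q (n * p) + 1"
      using Cons.prems False np by (intro Cons.IH) auto
    then show ?thesis using multiplicity_other_mult[OF Cons.prems(1) _ p(1), of q] Cons.prems False
      by (simp add: mult.assoc)
  qed
qed simp

lemma prod_list_distinct_primes_dvd:
  assumes "\<forall>q\<in>set ps. prime q \<and> q dvd N" "distinct ps"
  shows "prod_list ps dvd (N::nat)"
  using assms
proof (induction ps)
  case (Cons p ps)
  have "coprime p (prod_list qs)" if "\<forall>q\<in>set qs. prime q \<and> q \<noteq> p" for qs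
    using that Cons.prems by (induction qs) (auto simp: primes_coprime)
  then have "coprime p (prod_list ps)" using Cons.prems by auto
  then show ?case using Cons by (auto intro: divides_mult)
qed simp

lemma ln_prod_list_bounds:
  assumes "\<forall>q\<in>set ps. lo \<le> real q \<and> real q \<le> hi" "lo > 0"
  shows "real (length ps) * ln lo \<le> ln (real (prod_list ps))" "ln (real (prod_list ps)) \<le> real (length ps) * ln hi"
proof -
  have "real (length ps) * ln lo \<le> ln (real (prod_list ps)) \<and> ln (real (prod_list ps)) \<le> real (length ps) * ln hi \<and> prod_list ps > 0"
    using assms(1)
  proof (induction ps)
    case (Cons q qs)
    have q: "lo \<le> real q" "real q \<le> hi" "real q > 0" using Cons.prems assms(2) by auto
    have ih: "real (length qs) * ln lo \<le> ln (real (prod_list qs))" "ln (real (prod_list qs)) \<le> real (length qs) * ln hi" "prod_list qs > 0"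
      using Cons by auto
    have "ln (real (prod_list (q # qs))) = ln (real q) + ln (real (prod_list qs))"
      using q ih(3) by (simp add: ln_mult)
    moreover have "ln lo \<le> ln (real q)" "ln (real q) \<le> ln hi" using q assms(2) by auto
    moreover have "real (length (q # qs)) * ln lo = real (length qs) * ln lo + ln lo"
        "real (length (q # qs)) * ln hi = real (length qs) * ln hi + ln hi"
      by (simp_all add: algebra_simps)
    moreover have "prod_list (q # qs) > 0" using ih q by simp
    ultimately show ?case using ih(1,2) by (intro conjI) linarith+
  qed simp
  then show "real (length ps) * ln lo \<le> ln (real (prod_list ps))" "ln (real (prod_list ps)) \<le> real (length ps) * ln hi" by auto
qed

section \<open>The thresholds at which the exponents drop below \<open>j\<close>\<close>

text \<open>The size of \<open>p\<close> at which the approximate exponent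
  \<open>M / p powr lam N\<close> equals \<open>j\<close>.\<close>

definition thr :: "nat \<Rightarrow> nat \<Rightarrow> real" where
  "thr j N = (Mval N / real j) powr (1 / lam N)"

lemma thr_facts:
  assumes g: "good_champion N" and j: "j \<ge> 1" "Mval N \<ge> real j"
  shows "thr j N > 0" "lam N * ln (thr j N) = ln (Mval N / real j)" "thr j N \<le> Mval N"
    "thr j N \<ge> (Mval N / real j) powr (1 / 10)"
proof -
  note G = good_championD[OF g]
  define x where "x = Mval N / real j"
  have x: "x \<ge> 1" using j by (simp add: x_def)
  have thr: "thr j N = x powr (1 / lam N)" by (simp add: thr_def x_def)
  show "thr j N > 0" using x by (simp add: thr)
  show "lam N * ln (thr j N) = ln (Mval N / real j)"
    unfolding thr x_def[symmetric] using x G(9) by (simp add: ln_powr)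
  have "thr j N \<le> x powr 1"
    unfolding thr using x G(9) by (intro powr_mono) auto
  also have "\<dots> = x" using x by simp
  also have "\<dots> \<le> Mval N / 1" unfolding x_def using j G(7) by (intro divide_left_mono) auto
  finally show "thr j N \<le> Mval N" by simp
  show "thr j N \<ge> (Mval N / real j) powr (1 / 10)"
    unfolding thr x_def[symmetric] using x G(9,10) by (intro powr_mono divide_left_mono) auto
qed

lemma thr_at_top:
  assumes j: "j \<ge> 1"
  shows "filterlim (thr j) at_top champions_at_top"
proof (rule filterlim_at_top_mono)
  have "filterlim (\<lambda>M::real. (M / real j) powr (1 / 10)) at_top at_top" using j by real_asymp
  from filterlim_compose[OF this Mval_at_top]
  show "filterlim (\<lambda>N. (Mval N / real j) powr (1 / 10)) at_top champions_at_top" .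
  show "eventually (\<lambda>N. (Mval N / real j) powr (1 / 10) \<le> thr j N) champions_at_top"
    using eventually_good_champion eventually_Mval[OF eventually_ge_at_top[of "real j"]]
    by eventually_elim (use j thr_facts(4) in auto)
qed

text \<open>If a prime beyond \<open>(1 + e) * Y\<close>, with \<open>Y\<close> the threshold, had
  exponent at least \<open>j\<close>, so would \<open>K\<close> distinct primes between
  \<open>u * Y\<close> and \<open>(1 + e) * Y\<close>. Removing one copy of each yields
  \<open>K * lam N * ln (u * Y) <= K * ln (M / j) + 3001\<close>, where 1 covers replacing
  \<open>1 + (M + 6 * sqrt M) / j\<close> by \<open>M / j\<close>. As
  \<open>lam N * ln Y = ln (M / j)\<close>, only \<open>K * ln u <= 3001\<close> remains, which the
  choice of \<open>K\<close> refutes.\<close>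

lemma eventually_no_large:
  assumes j: "j \<ge> 1" and e: "0 < e" "e < 1"
  shows "eventually (\<lambda>N. \<forall>p::nat. prime p \<and> (1 + e) * thr j N \<le> real p \<longrightarrow> multiplicity p N < j) champions_at_top"
proof -
  define u where "u = 1 + e / 2"
  define c where "c = (1 + e) / u"
  have u: "u > 1" "c > 1" "c * u = 1 + e" "u < 2" using e by (auto simp: u_def c_def field_simps)
  define K where "K = nat \<lceil>3002 / ln u\<rceil>"
  have lnu: "ln u > 0" using u by simp
  have "3002 / ln u \<le> real K" unfolding K_def by linarith
  then have K: "3002 \<le> real K * ln u" using lnu by (simp add: pos_divide_le_eq)
  then have K0: "K > 0" by (intro Nat.gr0I) auto
  have "filterlim (\<lambda>N. u * thr j N) at_top champions_at_top"
    using u by (intro filterlim_tendsto_pos_mult_at_top[OF tendsto_const _ thr_at_top[OF j]]) auto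
  from eventually_compose_filterlim[OF eventually_primes_between[OF u(2), of K] this]
  have ev1: "eventually (\<lambda>N. \<exists>ps. distinct ps \<and> length ps = K \<and> (\<forall>q\<in>set ps. prime q \<and> u * thr j N \<le> real q \<and> real q \<le> c * (u * thr j N))) champions_at_top" .
  have "eventually (\<lambda>M::real. real K * ln (2 * M) \<le> sqrt M / 4 \<and>
      real K * (ln (1 + (M + 6 * sqrt M) / real j) - ln (M / real j)) \<le> 1 \<and> M \<ge> real j) at_top"
    using j by (intro eventually_conj; real_asymp)
  note ev2 = eventually_Mval[OF this]
  have ev3: "eventually (\<lambda>N. thr j N \<ge> 3) champions_at_top"
    using thr_at_top[OF j] by (simp add: filterlim_at_top)
  show ?thesis using ev1 ev2 ev3 eventually_good_champion
  proof (eventually_elim, intro allI impI)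
    fix N p :: nat
    assume ex: "\<exists>ps. distinct ps \<and> length ps = K \<and> (\<forall>q\<in>set ps. prime q \<and> u * thr j N \<le> real q \<and> real q \<le> c * (u * thr j N))"
      and A: "real K * ln (2 * Mval N) \<le> sqrt (Mval N) / 4 \<and>
      real K * (ln (1 + (Mval N + 6 * sqrt (Mval N)) / real j) - ln (Mval N / real j)) \<le> 1 \<and> real j \<le> Mval N"
      and Y3: "3 \<le> thr j N" and g: "good_champion N" and p: "prime p \<and> (1 + e) * thr j N \<le> real p"
    note G = good_championD[OF g]
    define Y where "Y = thr j N"
    note T = thr_facts[OF g j, folded Y_def]
    have TA: "Y > 0" "lam N * ln Y = ln (Mval N / real j)" "Y \<le> Mval N" using T A by auto
    show "multiplicity p N < j"
    proof (rule ccontr)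
      assume "\<not> multiplicity p N < j"
      then have pj: "j \<le> multiplicity p N" by simp
      obtain ps where ps: "distinct ps" "length ps = K" "\<forall>q\<in>set ps. prime q \<and> u * Y \<le> real q \<and> real q \<le> c * (u * Y)"
        using ex unfolding Y_def by blast
      have cu: "c * (u * Y) = (1 + e) * Y" using u(3) by (metis mult.assoc)
      have qj: "j \<le> multiplicity q N" if "q \<in> set ps" for q
      proof -
        have "real q \<le> c * (u * Y)" using ps(3) that by blast
        also have "\<dots> \<le> real p" using p unfolding cu by (simp add: Y_def)
        finally have "real q \<le> real p" .
        then have "multiplicity p N \<le> multiplicity q N"
          using champion_multiplicity_mono[OF G(1)] p ps(3) that by auto
        then show ?thesis using pj by linarith
      qed
      have dv: "prod_list ps dvd N"
      proof (rule prod_list_distinct_primes_dvd[OF _ ps(1)], intro ballI conjI)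
        fix q assume q: "q \<in> set ps"
        then show "prime q" using ps by auto
        have "multiplicity q N > 0" using qj[OF q] j by simp
        then show "q dvd N" using not_dvd_imp_multiplicity_0 by fastforce
      qed
      then obtain n where "N = prod_list ps * n" by (auto elim: dvdE)
      then have n: "n * prod_list ps = N" by simp
      have n0: "n > 0" using n G(8) by (auto intro: Nat.gr0I)
      have odd: "\<forall>q\<in>set ps. prime q \<and> q \<noteq> 2"
      proof
        fix q assume q: "q \<in> set ps"
        have "1 * 3 \<le> u * Y" using u Y3 by (intro mult_mono) (auto simp: Y_def)
        then have "real q \<ge> 3" using ps(3) q by force
        then show "prime q \<and> q \<noteq> 2" using ps(3) q by auto
      qed
      have bnds: "\<forall>q\<in>set ps. u * Y \<le> real q \<and> real q \<le> (1 + e) * Y" using ps(3) cu by auto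
      have uY: "u * Y > 0" using u TA by simp
      note lb = ln_prod_list_bounds[OF bnds uY, unfolded ps(2)]
      have "(1 + e) * Y \<le> 2 * Mval N" using e TA G(7) by (intro mult_mono) auto
      then have "ln ((1 + e) * Y) \<le> ln (2 * Mval N)" using TA e by (intro ln_mono) auto
      then have "real K * ln ((1 + e) * Y) \<le> real K * ln (2 * Mval N)" by (intro mult_left_mono) auto
      then have len: "ln (real (prod_list ps)) \<le> sqrt (Mval N) / 4" using lb(2) A by linarith
      have "ps \<noteq> []" using ps(2) K0 by auto
      have "lam N * ln (real (prod_list ps)) \<le> real (length ps) * ln (1 + (Mval N + 6 * sqrt (Mval N)) / real j) + 3000"
      proof (rule remove_log[OF g n odd \<open>ps \<noteq> []\<close> len])
        show "\<forall>q\<in>set ps. real j \<le> real (multiplicity q n) + 1"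
        proof
          fix q assume q: "q \<in> set ps"
          have "multiplicity q N = multiplicity q n + 1"
            unfolding n[symmetric] using ps q n0 by (intro multiplicity_prod_list_distinct) auto
          then show "real j \<le> real (multiplicity q n) + 1" using qj[OF q] by linarith
        qed
      qed (use j in auto)
      then have 1: "lam N * ln (real (prod_list ps)) \<le> real K * ln (Mval N / real j) + 3001"
        using A ps(2) by (simp add: right_diff_distrib)
      have lnuY: "ln (u * Y) = ln u + ln Y" using u TA by (simp add: ln_mult)
      have "real K * ln u * 1 \<le> real K * ln u * lam N" using G(9) lnu by (intro mult_left_mono) auto
      moreover have "lam N * (real K * ln (u * Y)) \<le> lam N * ln (real (prod_list ps))"
        using lb(1) G(9) by (intro mult_left_mono) auto
      moreover have "lam N * (real K * ln (u * Y)) = real K * ln u * lam N + real K * (lam N * ln Y)"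
        unfolding lnuY by (simp add: algebra_simps)
      ultimately have "real K * ln u \<le> 3001" using 1 unfolding TA(2) by linarith
      then show False using K by simp
    qed
  qed
qed

text \<open>The mirror image: if a prime below \<open>(1 - e) * Y\<close> had exponent less than
  \<open>j\<close>, then \<open>K\<close> distinct primes between \<open>v * Y\<close> and
  \<open>u * Y\<close> could each receive one more copy without exceeding \<open>j\<close>, and
  inserting them contradicts the choice of \<open>K\<close>.\<close>

lemma eventually_all_small:
  assumes j: "j \<ge> 1" and e: "0 < e" "e < 1"
  shows "eventually (\<lambda>N. \<forall>p::nat. prime p \<and> real p \<le> (1 - e) * thr j N \<longrightarrow> j \<le> multiplicity p N) champions_at_top"
proof -
  define u where "u = 1 - e / 2"
  define v where "v = 1 - e"
  define c where "c = u / v"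
  have u: "0 < v" "0 < u" "u < 1" "c > 1" "c * v = u" using e by (auto simp: u_def v_def c_def field_simps)
  define K where "K = nat \<lceil>3002 / (- ln u)\<rceil>"
  have lnu: "- ln u > 0" using u by simp
  have "3002 / (- ln u) \<le> real K" unfolding K_def by linarith
  then have K: "3002 \<le> real K * (- ln u)" using lnu by (simp only: pos_divide_le_eq)
  then have K0: "K > 0" by (intro Nat.gr0I) auto
  have lim: "filterlim (\<lambda>N. v * thr j N) at_top champions_at_top"
    using u by (intro filterlim_tendsto_pos_mult_at_top[OF tendsto_const _ thr_at_top[OF j]]) auto
  from eventually_compose_filterlim[OF eventually_primes_between[OF u(4), of K] this]
  have ev1: "eventually (\<lambda>N. \<exists>ps. distinct ps \<and> length ps = K \<and> (\<forall>q\<in>set ps. prime q \<and> v * thr j N \<le> real q \<and> real q \<le> c * (v * thr j N))) champions_at_top" .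
  have "eventually (\<lambda>M::real. real K * ln (2 * M) \<le> sqrt M / 4 \<and>
      real K * (ln (M / real j) - ln (1 + (M - 6 * sqrt M) / real j)) \<le> 1 \<and> M \<ge> real j) at_top"
    using j by (intro eventually_conj; real_asymp)
  note ev2 = eventually_Mval[OF this]
  have ev3: "eventually (\<lambda>N. v * thr j N \<ge> 3) champions_at_top"
    using lim by (simp add: filterlim_at_top)
  show ?thesis using ev1 ev2 ev3 eventually_good_champion
  proof (eventually_elim, intro allI impI)
    fix N p :: nat
    assume ex: "\<exists>ps. distinct ps \<and> length ps = K \<and> (\<forall>q\<in>set ps. prime q \<and> v * thr j N \<le> real q \<and> real q \<le> c * (v * thr j N))"
      and A: "real K * ln (2 * Mval N) \<le> sqrt (Mval N) / 4 \<and>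
      real K * (ln (Mval N / real j) - ln (1 + (Mval N - 6 * sqrt (Mval N)) / real j)) \<le> 1 \<and> real j \<le> Mval N"
      and Y3: "3 \<le> v * thr j N" and g: "good_champion N" and p: "prime p \<and> real p \<le> (1 - e) * thr j N"
    note G = good_championD[OF g]
    define Y where "Y = thr j N"
    note T = thr_facts[OF g j, folded Y_def]
    have TA: "Y > 0" "lam N * ln Y = ln (Mval N / real j)" "Y \<le> Mval N" using T A by auto
    show "j \<le> multiplicity p N"
    proof (rule ccontr)
      assume "\<not> j \<le> multiplicity p N"
      then have pj: "multiplicity p N < j" by simp
      obtain ps where ps: "distinct ps" "length ps = K" "\<forall>q\<in>set ps. prime q \<and> v * Y \<le> real q \<and> real q \<le> c * (v * Y)"
        using ex unfolding Y_def by blast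
      have cu: "c * (v * Y) = u * Y" using u(5) by (metis mult.assoc)
      have bnds: "\<forall>q\<in>set ps. v * Y \<le> real q \<and> real q \<le> u * Y" using ps(3) cu by auto
      have qj: "multiplicity q N < j" if "q \<in> set ps" for q
      proof -
        have "real p \<le> v * Y" using p by (simp add: Y_def v_def)
        also have "\<dots> \<le> real q" using ps(3) that by blast
        finally have "real p \<le> real q" .
        then have "multiplicity q N \<le> multiplicity p N"
          using champion_multiplicity_mono[OF G(1)] p ps(3) that by auto
        then show ?thesis using pj by linarith
      qed
      have odd: "\<forall>q\<in>set ps. prime q \<and> q \<noteq> 2"
      proof
        fix q assume q: "q \<in> set ps"
        have "real q \<ge> 3" using ps(3) q Y3 by (force simp: Y_def)
        then show "prime q \<and> q \<noteq> 2" using ps(3) q by auto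
      qed
      have vY: "v * Y > 0" using u TA by simp
      note lb = ln_prod_list_bounds[OF bnds vY, unfolded ps(2)]
      have "u * Y \<le> 2 * Mval N" using u TA G(7) by (intro mult_mono) auto
      then have "ln (u * Y) \<le> ln (2 * Mval N)" using TA u by (intro ln_mono) auto
      then have "real K * ln (u * Y) \<le> real K * ln (2 * Mval N)" by (intro mult_left_mono) auto
      then have len: "ln (real (prod_list ps)) \<le> sqrt (Mval N) / 4" using lb(2) A by linarith
      have "ps \<noteq> []" using ps(2) K0 by auto
      have "real (length ps) * ln (1 + (Mval N - 6 * sqrt (Mval N)) / real j) \<le> lam N * ln (real (prod_list ps)) + 3000"
      proof (rule insert_log[OF g odd \<open>ps \<noteq> []\<close> len])
        show "\<forall>q\<in>set ps. real (multiplicity q (N * prod_list ps)) \<le> real j"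
        proof
          fix q assume q: "q \<in> set ps"
          have "multiplicity q (N * prod_list ps) = multiplicity q N + 1"
            using ps q G(8) by (intro multiplicity_prod_list_distinct) auto
          then show "real (multiplicity q (N * prod_list ps)) \<le> real j" using qj[OF q] by linarith
        qed
      qed (use j in auto)
      then have 1: "real K * ln (Mval N / real j) \<le> lam N * ln (real (prod_list ps)) + 3001"
        using A ps(2) by (simp add: right_diff_distrib)
      have lnuY: "ln (u * Y) = ln u + ln Y" using u TA by (simp add: ln_mult)
      have "real K * (- ln u) * 1 \<le> real K * (- ln u) * lam N" using G(9) lnu by (intro mult_left_mono mult_nonneg_nonneg) auto
      moreover have "lam N * ln (real (prod_list ps)) \<le> lam N * (real K * ln (u * Y))"
        using lb(2) G(9) by (intro mult_left_mono) auto
      moreover have "lam N * (real K * ln (u * Y)) = - (real K * (- ln u) * lam N) + real K * (lam N * ln Y)"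
        unfolding lnuY by (simp add: algebra_simps)
      ultimately have "real K * (- ln u) \<le> 3001" using 1 unfolding TA(2) by linarith
      then show False using K by simp
    qed
  qed
qed

lemma prime_powers_dvd_finite:
  assumes "N > 0" "j \<ge> 1"
  shows "finite {p::nat. prime p \<and> p ^ j dvd N}"
proof (rule finite_subset)
  show "{p::nat. prime p \<and> p ^ j dvd N} \<subseteq> {..N}"
  proof
    fix p assume "p \<in> {p::nat. prime p \<and> p ^ j dvd N}"
    then have "p ^ j dvd N" by simp
    moreover have "p dvd p ^ j" using assms by (intro dvd_power) auto
    ultimately have "p dvd N" by (rule dvd_trans[rotated])
    then show "p \<in> {..N}" using assms dvd_imp_le by auto
  qed
qed simp

lemma prime_power_dvd_iff_multiplicity:
  "N > 0 \<Longrightarrow> prime (p::nat) \<Longrightarrow> p ^ j dvd N \<longleftrightarrow> j \<le> multiplicity p N"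
  using power_dvd_iff_le_multiplicity[of N p j] prime_gt_1_nat[of p] by auto

text \<open>For the lower bound a prime between \<open>(1 - 2 * e) * Y\<close> and
  \<open>(1 - e) * Y\<close> is produced, which \<open>eventually_all_small\<close> puts into the
  set. This also shows that the set is nonempty, so that \<open>Max\<close> has its intended
  meaning.\<close>

lemma largest_prime_pow_over_thr:
  assumes j: "j \<ge> 1"
  shows "((\<lambda>N. real (largest_prime_pow j N) / thr j N) \<longlongrightarrow> 1) champions_at_top"
proof (rule tendstoI)
  fix \<epsilon>' :: real assume "\<epsilon>' > 0"
  define e where "e = min (\<epsilon>' / 4) (1 / 4)"
  have e: "0 < e" "e < 1 / 2" "2 * e < \<epsilon>'" using \<open>\<epsilon>' > 0\<close> by (auto simp: e_def)
  define c where "c = (1 - e) / (1 - 2 * e)"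
  have c: "c > 1" "c * (1 - 2 * e) = 1 - e" "1 - 2 * e > 0" using e by (auto simp: c_def field_simps)
  have lim: "filterlim (\<lambda>N. (1 - 2 * e) * thr j N) at_top champions_at_top"
    using c by (intro filterlim_tendsto_pos_mult_at_top[OF tendsto_const _ thr_at_top[OF j]]) auto
  from eventually_compose_filterlim[OF eventually_primes_between[OF c(1), of 1] this]
  have ev1: "eventually (\<lambda>N. \<exists>ps. distinct ps \<and> length ps = 1 \<and> (\<forall>q\<in>set ps. prime q \<and> (1 - 2 * e) * thr j N \<le> real q
        \<and> real q \<le> c * ((1 - 2 * e) * thr j N))) champions_at_top" .
  have ev2: "eventually (\<lambda>N. thr j N > 0) champions_at_top"
    using thr_at_top[OF j] by (simp add: filterlim_at_top_dense)
  have e1: "e < 1" using e by simp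
  show "eventually (\<lambda>N. dist (real (largest_prime_pow j N) / thr j N) 1 < \<epsilon>') champions_at_top"
    using ev1 ev2 eventually_no_large[OF j e(1) e1] eventually_all_small[OF j e(1) e1] eventually_good_champion
  proof eventually_elim
    case (elim N)
    note G = good_championD[OF elim(5)]
    define Y where "Y = thr j N"
    have Y: "Y > 0" using elim(2) by (simp add: Y_def)
    let ?S = "{p::nat. prime p \<and> p ^ j dvd N}"
    have fin: "finite ?S" by (rule prime_powers_dvd_finite[OF G(8) j])
    obtain ps where ps: "length ps = 1" "\<forall>q\<in>set ps. prime q \<and> (1 - 2 * e) * Y \<le> real q \<and> real q \<le> c * ((1 - 2 * e) * Y)"
      using elim(1) unfolding Y_def by blast
    then obtain q where "ps = [q]" by (auto simp: length_Suc_conv)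
    then have q: "prime q" "(1 - 2 * e) * Y \<le> real q" "real q \<le> c * ((1 - 2 * e) * Y)" using ps by auto
    have "c * ((1 - 2 * e) * Y) = (1 - e) * Y" using c(2) by (metis mult.assoc)
    then have "real q \<le> (1 - e) * thr j N" using q(3) unfolding Y_def by linarith
    then have "j \<le> multiplicity q N" using elim(4) q(1) by blast
    then have qS: "q \<in> ?S" using q prime_power_dvd_iff_multiplicity[OF G(8) q(1)] by simp
    define P where "P = largest_prime_pow j N"
    have PS: "P \<in> ?S" unfolding P_def largest_prime_pow_def using fin qS by (intro Max_in) auto
    have "q \<le> P" unfolding P_def largest_prime_pow_def using fin qS by (rule Max_ge)
    then have lo: "(1 - 2 * e) * Y \<le> real P" using q(2) by linarith
    have "j \<le> multiplicity P N" using PS prime_power_dvd_iff_multiplicity[OF G(8), of P j] by simp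
    then have "\<not> ((1 + e) * Y \<le> real P)" using elim(3) PS by (auto simp: Y_def not_less)
    then have hi: "real P \<le> (1 + e) * Y" by simp
    have "real P / Y \<ge> 1 - 2 * e" "real P / Y \<le> 1 + e" using lo hi Y by (simp_all add: pos_le_divide_eq pos_divide_le_eq)
    then have "\<bar>real P / Y - 1\<bar> < \<epsilon>'" using e by (simp add: abs_less_iff)
    then show ?case by (simp add: dist_real_def P_def Y_def)
  qed
qed

lemma real_N_at_top: "filterlim (\<lambda>N. real N) at_top champions_at_top"
  unfolding champions_at_top_def
  by (rule filterlim_mono[OF filterlim_real_sequentially order_refl inf_le1])

lemma Mval_over_ln: "((\<lambda>N. Mval N / (a_const * ln (real N))) \<longlongrightarrow> 1) champions_at_top"
proof -
  have "((\<lambda>N. inverse (a_const * (ln (real N) / Mval N))) \<longlongrightarrow> inverse (a_const * (1 / a_const))) champions_at_top"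
    using a_const_pos by (intro tendsto_intros ln_over_Mval) auto
  then show ?thesis using a_const_pos by (simp add: divide_inverse mult_ac)
qed

text \<open>The logarithm of the quotient is \<open>- (lam N - rho) * ln M / (lam N * rho)\<close>
  plus terms that vanish because \<open>lam N\<close> tends to \<open>rho\<close> and
  \<open>M\<close> is asymptotic to \<open>a_const * ln N\<close>. The first term is where mere
  convergence of \<open>lam N\<close> would not suffice and \<open>lam_tendsto_rho_fast\<close> is
  used.\<close>

lemma thr_asymp:
  assumes j: "j \<ge> 1"
  shows "((\<lambda>N. thr j N / (a_const * ln (real N) / real j) powr (1 / rho)) \<longlongrightarrow> 1) champions_at_top"
proof -
  let ?A = "\<lambda>N. a_const * ln (real N) / real j"
  have l1: "((\<lambda>N. ln (Mval N / (a_const * ln (real N)))) \<longlongrightarrow> ln 1) champions_at_top"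
    by (intro tendsto_ln Mval_over_ln) simp
  have l0: "((\<lambda>N. lam N - rho) \<longlongrightarrow> rho - rho) champions_at_top"
    by (intro tendsto_intros lam_tendsto_rho)
  have rho0: "rho \<noteq> 0" using rho by simp
  have "((\<lambda>N. (- ((lam N - rho) * ln (Mval N)) + (lam N - rho) * ln (real j)) / (lam N * rho)
       + ln (Mval N / (a_const * ln (real N))) / rho) \<longlongrightarrow>
       (- 0 + (rho - rho) * ln (real j)) / (rho * rho) + ln 1 / rho) champions_at_top"
    using rho0 by (intro tendsto_intros lam_tendsto_rho_fast lam_tendsto_rho l0 l1) auto
  then have "((\<lambda>N. (- ((lam N - rho) * ln (Mval N)) + (lam N - rho) * ln (real j)) / (lam N * rho)
       + ln (Mval N / (a_const * ln (real N))) / rho) \<longlongrightarrow> 0) champions_at_top" by simp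
  then have "((\<lambda>N. exp ((- ((lam N - rho) * ln (Mval N)) + (lam N - rho) * ln (real j)) / (lam N * rho)
       + ln (Mval N / (a_const * ln (real N))) / rho)) \<longlongrightarrow> exp 0) champions_at_top"
    by (rule tendsto_exp)
  then have lim: "((\<lambda>N. exp ((- ((lam N - rho) * ln (Mval N)) + (lam N - rho) * ln (real j)) / (lam N * rho)
       + ln (Mval N / (a_const * ln (real N))) / rho)) \<longlongrightarrow> 1) champions_at_top" by simp
  have "eventually (\<lambda>N. exp ((- ((lam N - rho) * ln (Mval N)) + (lam N - rho) * ln (real j)) / (lam N * rho)
       + ln (Mval N / (a_const * ln (real N))) / rho) = thr j N / ?A N powr (1 / rho)) champions_at_top"
    using eventually_good_champion
  proof eventually_elim
    case (elim N)
    note G = good_championD[OF elim]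
    have pos: "Mval N > 0" "a_const > 0" "ln (real N) > 0" "real j > 0" "lam N > 0" "rho > 0"
      using G a_const_pos j rho by auto
    have "thr j N = exp ((ln (Mval N) - ln (real j)) / lam N)"
      unfolding thr_def using pos by (simp add: powr_def ln_div)
    moreover have "?A N powr (1 / rho) = exp ((ln (a_const * ln (real N)) - ln (real j)) / rho)"
      using pos by (simp add: powr_def ln_div)
    ultimately have "thr j N / ?A N powr (1 / rho) = exp ((ln (Mval N) - ln (real j)) / lam N - (ln (a_const * ln (real N)) - ln (real j)) / rho)"
      by (simp add: exp_diff)
    also have "(ln (Mval N) - ln (real j)) / lam N - (ln (a_const * ln (real N)) - ln (real j)) / rho
      = (- ((lam N - rho) * ln (Mval N)) + (lam N - rho) * ln (real j)) / (lam N * rho) + (ln (Mval N) - ln (a_const * ln (real N))) / rho"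
      using pos by (simp add: field_simps)
    also have "ln (Mval N) - ln (a_const * ln (real N)) = ln (Mval N / (a_const * ln (real N)))"
      using pos by (simp add: ln_div)
    finally show ?case by simp
  qed
  then show ?thesis by (rule Lim_transform_eventually[OF lim])
qed

lemma largest_prime_pow_ratio:
  assumes j: "j \<ge> 1"
  shows "((\<lambda>N. real (largest_prime_pow j N) / (a_const * ln (real N) / real j) powr (1 / rho)) \<longlongrightarrow> 1) champions_at_top"
proof -
  have "((\<lambda>N. (real (largest_prime_pow j N) / thr j N) * (thr j N / (a_const * ln (real N) / real j) powr (1 / rho)))
     \<longlongrightarrow> 1 * 1) champions_at_top"
    by (intro tendsto_mult largest_prime_pow_over_thr thr_asymp j)
  then have lim: "((\<lambda>N. (real (largest_prime_pow j N) / thr j N) * (thr j N / (a_const * ln (real N) / real j) powr (1 / rho)))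
     \<longlongrightarrow> 1) champions_at_top" by simp
  have "eventually (\<lambda>N. thr j N > 0) champions_at_top"
    using thr_at_top[OF j] by (simp add: filterlim_at_top_dense)
  then have "eventually (\<lambda>N. (real (largest_prime_pow j N) / thr j N) * (thr j N / (a_const * ln (real N) / real j) powr (1 / rho))
     = real (largest_prime_pow j N) / (a_const * ln (real N) / real j) powr (1 / rho)) champions_at_top"
    by eventually_elim simp
  then show ?thesis by (rule Lim_transform_eventually[OF lim])
qed

lemma largest_prime_pow_asymp_equiv:
  assumes "j \<ge> 1"
  shows "(\<lambda>N. real (largest_prime_pow j N)) \<sim>[champions_at_top] (\<lambda>N. (a_const * ln (real N) / real j) powr (1 / rho))"
  by (rule asymp_equivI'[OF largest_prime_pow_ratio[OF assms]])

lemma eventually_ln_N_pos: "eventually (\<lambda>N. ln (real N) > 0) champions_at_top"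
  using filterlim_compose[OF ln_at_top real_N_at_top] by (simp add: filterlim_at_top_dense)

lemma scaled_main_term:
  assumes j: "j \<ge> 1" and N: "ln (real N) > 0"
  shows "(a_const * ln (real N) / real j) powr (1 / rho) = real j powr (- 1 / rho) * (a_const * ln (real N) / real 1) powr (1 / rho)"
proof -
  have "real j powr (- 1 / rho) = 1 / real j powr (1 / rho)"
    by (simp add: powr_minus_divide[symmetric])
  then show ?thesis using N a_const_pos j by (simp add: powr_divide)
qed

lemma main_term_asymp_largest_prime:
  assumes j: "j \<ge> 1"
  shows "(\<lambda>N. (a_const * ln (real N) / real j) powr (1 / rho))
            \<sim>[champions_at_top] (\<lambda>N. real j powr (- 1 / rho) * real (largest_prime_pow 1 N))"
proof -
  have A: "(\<lambda>N. real j powr (- 1 / rho) * (a_const * ln (real N) / real 1) powr (1 / rho))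
      \<sim>[champions_at_top] (\<lambda>N. real j powr (- 1 / rho) * real (largest_prime_pow 1 N))"
    by (intro asymp_equiv_intros asymp_equiv_symI[OF largest_prime_pow_asymp_equiv]) simp
  have E: "eventually (\<lambda>N. (a_const * ln (real N) / real j) powr (1 / rho)
      = real j powr (- 1 / rho) * (a_const * ln (real N) / real 1) powr (1 / rho)) champions_at_top"
    using eventually_ln_N_pos by eventually_elim (rule scaled_main_term[OF j])
  show ?thesis by (rule asymp_equiv_trans[OF asymp_equiv_refl_ev[OF E] A])
qed

section \<open>The last exponent and the number of prime factors\<close>

text \<open>The main terms for \<open>j = 2\<close> and \<open>j = 1\<close> differ by the factor
  \<open>c = 2 powr (- 1 / rho) < 1\<close>; the margin \<open>d\<close> satisfies
  \<open>(1 + d) * c <= 1 - d\<close>, so the two relative errors cannot bridge the gap.\<close>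

lemma eventually_largest_prime_pow_2_less:
  "eventually (\<lambda>N. largest_prime_pow 2 N < largest_prime_pow 1 N) champions_at_top"
proof -
  let ?y = "\<lambda>j N. (a_const * ln (real N) / real j) powr (1 / rho)"
  define c where "c = (2::real) powr (- 1 / rho)"
  have c: "0 < c" "c < 1" using rho by (auto simp: c_def powr_less_one)
  define d where "d = (1 - c) / 4"
  have d: "d > 0" using c by (simp add: d_def)
  have r1: "((\<lambda>N. real (largest_prime_pow 1 N) / ?y 1 N) \<longlongrightarrow> 1) champions_at_top"
    by (rule largest_prime_pow_ratio) simp
  have r2: "((\<lambda>N. real (largest_prime_pow 2 N) / ?y 2 N) \<longlongrightarrow> 1) champions_at_top"
    by (rule largest_prime_pow_ratio) simp
  have e1: "eventually (\<lambda>N. real (largest_prime_pow 1 N) / ?y 1 N > 1 - d) champions_at_top"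
    using r1 by (rule order_tendstoD) (use d in simp)
  have e2: "eventually (\<lambda>N. real (largest_prime_pow 2 N) / ?y 2 N < 1 + d) champions_at_top"
    using r2 by (rule order_tendstoD) (use d in simp)
  show ?thesis using e1 e2 eventually_ln_N_pos
  proof eventually_elim
    case (elim N)
    define Y where "Y = ?y 1 N"
    have Y: "Y > 0" using elim(3) a_const_pos by (simp add: Y_def)
    have y2: "?y 2 N = c * Y"
      using scaled_main_term[of 2 N] elim(3) by (simp add: c_def Y_def)
    have cY: "c * Y > 0" using c Y by simp
    have "real (largest_prime_pow 2 N) < (1 + d) * (c * Y)"
      using elim(2) cY unfolding y2 by (simp add: pos_divide_less_eq)
    also have "\<dots> \<le> (1 - d) * Y"
    proof -
      have "(1 + d) * c \<le> 1 - d"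
      proof -
        have "d * c \<le> d * 1" using c d by (intro mult_left_mono) auto
        moreover have "4 * d = 1 - c" by (simp add: d_def)
        moreover have "(1 + d) * c = c + d * c" by (simp add: algebra_simps)
        ultimately show ?thesis using d by linarith
      qed
      then have "((1 + d) * c) * Y \<le> (1 - d) * Y" using Y by (intro mult_right_mono) auto
      then show ?thesis by (simp add: mult.assoc)
    qed
    also have "\<dots> < real (largest_prime_pow 1 N)"
      using elim(1) Y unfolding Y_def[symmetric] by (simp add: pos_less_divide_eq)
    finally show ?case by simp
  qed
qed

lemma nth_prime_prime: "i \<ge> 1 \<Longrightarrow> prime (nth_prime i)"
  using prime_seq_prime[of "i - 1"] by (simp add: prime_seq_def)

lemma nth_prime_mono: "1 \<le> i \<Longrightarrow> i \<le> j \<Longrightarrow> nth_prime i \<le> nth_prime j"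
  unfolding nth_prime_def using enumerate_mono_le_iff[OF primes_infinite, of "i - 1" "j - 1"] by simp

text \<open>Every prime factor of \<open>N\<close> is some \<open>nth_prime i\<close> with
  \<open>i <= k\<close>, so the last prime bounds \<open>largest_prime_pow 1 N\<close> from above;
  if its square divided \<open>N\<close>, it would also be at most
  \<open>largest_prime_pow 2 N\<close>.\<close>

lemma last_exponent_eq_1:
  assumes N: "N > 0" "largest_prime_pow 2 N < largest_prime_pow 1 N"
    and k: "1 \<le> k" "N = (\<Prod>i = 1..k. nth_prime i ^ \<alpha> i)" "1 \<le> \<alpha> k"
  shows "\<alpha> k = 1"
proof (rule ccontr)
  assume "\<alpha> k \<noteq> 1"
  then have a2: "2 \<le> \<alpha> k" using k(3) by simp
  let ?p = "nth_prime k"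
  have pp: "prime ?p" by (rule nth_prime_prime[OF k(1)])
  have "?p ^ \<alpha> k dvd N" unfolding k(2) using k(1) by (intro dvd_prodI) auto
  moreover have "?p ^ 2 dvd ?p ^ \<alpha> k" using a2 by (rule le_imp_power_dvd)
  ultimately have "?p ^ 2 dvd N" by (rule dvd_trans[rotated])
  then have "?p \<le> largest_prime_pow 2 N"
    unfolding largest_prime_pow_def using pp by (intro Max_ge prime_powers_dvd_finite N) auto
  moreover have "largest_prime_pow 1 N \<le> ?p"
    unfolding largest_prime_pow_def
  proof (rule Max.boundedI)
    show "finite {p. prime p \<and> p ^ 1 dvd N}" by (rule prime_powers_dvd_finite[OF N(1)]) simp
    have "?p dvd N" using \<open>?p ^ 2 dvd N\<close> by (auto dest: dvd_trans[OF dvd_power[of 2 ?p]])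
    then show "{p. prime p \<and> p ^ 1 dvd N} \<noteq> {}" using pp by auto
    fix q assume "q \<in> {p. prime p \<and> p ^ 1 dvd N}"
    then have q: "prime q" "q dvd (\<Prod>i = 1..k. nth_prime i ^ \<alpha> i)" using k(2) by auto
    then obtain i where i: "i \<in> {1..k}" "q dvd nth_prime i ^ \<alpha> i"
      using prime_dvd_prod_iff[of "{1..k}" q] by auto
    then have "q dvd nth_prime i" using q(1) prime_dvd_power by blast
    then have "q = nth_prime i" using q(1) nth_prime_prime[of i] i(1) primes_dvd_imp_eq by auto
    then show "q \<le> ?p" using i(1) nth_prime_mono[of i k] by auto
  qed
  ultimately show False using N(2) by simp
qed

text \<open>By monotonicity of the exponents a champion is divisible by every prime up to its
  largest prime factor.\<close>

lemma distinct_prime_count_eq: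
  assumes N: "K_champion N" "N \<ge> 2"
  shows "distinct_prime_count N = primepi (largest_prime_pow 1 N)"
proof -
  have N0: "N > 0" using N by simp
  let ?S = "{p::nat. prime p \<and> p ^ 1 dvd N}"
  have fin: "finite ?S" by (rule prime_powers_dvd_finite[OF N0]) simp
  have "2 \<in> ?S" using champion_even[OF N] prime_power_dvd_iff_multiplicity[OF N0 two_is_prime_nat, of 1] by simp
  define P where "P = largest_prime_pow 1 N"
  have PS: "P \<in> ?S" unfolding P_def largest_prime_pow_def 
    by (rule Max_in[OF fin]) (use \<open>2 \<in> ?S\<close> in blast)
  have "prime_factors N = {p. prime p \<and> p \<le> P}"
  proof (intro equalityI subsetI)
    fix p assume "p \<in> prime_factors N"
    then have "p \<in> ?S" by (auto simp: in_prime_factors_iff)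
    then have "p \<le> P" unfolding P_def largest_prime_pow_def using fin by (intro Max_ge)
    then show "p \<in> {p. prime p \<and> p \<le> P}" using \<open>p \<in> ?S\<close> by simp
  next
    fix p assume p: "p \<in> {p. prime p \<and> p \<le> P}"
    have "1 \<le> multiplicity P N" using PS prime_power_dvd_iff_multiplicity[OF N0, of P 1] by simp
    also have "\<dots> \<le> multiplicity p N" using champion_multiplicity_mono[OF N(1)] PS p by auto
    finally show "p \<in> prime_factors N" using p by (simp add: prime_factors_multiplicity)
  qed
  then show ?thesis by (simp add: distinct_prime_count_def primepi_def P_def)
qed

lemma distinct_prime_count_asymp:
  "(\<lambda>N. real (distinct_prime_count N)) \<sim>[champions_at_top]
     (\<lambda>N. rho * a_const powr (1 / rho) * (ln (real N) powr (1 / rho) / ln (ln (real N))))"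
proof -
  let ?y = "\<lambda>N. (a_const * ln (real N)) powr (1 / rho)"
  let ?P = "\<lambda>N. largest_prime_pow 1 N"
  let ?LL = "\<lambda>N. ln (ln (real N))"
  have r1: "((\<lambda>N. real (?P N) / ?y N) \<longlongrightarrow> 1) champions_at_top"
    using largest_prime_pow_ratio[of 1] by simp
  have lnN: "filterlim (\<lambda>N. ln (real N)) at_top champions_at_top"
    by (rule filterlim_compose[OF ln_at_top real_N_at_top])
  have LL: "filterlim ?LL at_top champions_at_top" by (rule filterlim_compose[OF ln_at_top lnN])
  have ly: "filterlim ?y at_top champions_at_top"
  proof -
    have "filterlim (\<lambda>x::real. (a_const * x) powr (1 / rho)) at_top at_top"
      using a_const_pos rho by real_asymp
    from filterlim_compose[OF this lnN] show ?thesis .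
  qed
  have "filterlim (\<lambda>N. real (?P N) / ?y N * ?y N) at_top champions_at_top"
    by (rule filterlim_tendsto_pos_mult_at_top[OF r1 _ ly]) simp
  moreover have "eventually (\<lambda>N. real (?P N) / ?y N * ?y N = real (?P N)) champions_at_top"
    using ly[unfolded filterlim_at_top_dense, rule_format, of 0] by eventually_elim simp
  ultimately have "filterlim (\<lambda>N. real (?P N)) at_top champions_at_top"
    by (rule filterlim_mono_eventually[OF _ order_refl order_refl])
  then have lP: "filterlim ?P at_top champions_at_top" by (simp add: filterlim_sequentially_iff_filterlim_real)
  have pnt: "((\<lambda>N. real (primepi (?P N)) * ln (real (?P N)) / real (?P N)) \<longlongrightarrow> 1) champions_at_top"
    by (rule filterlim_compose[OF prime_number_theorem lP])
  have inv: "((\<lambda>N. inverse (?LL N)) \<longlongrightarrow> 0) champions_at_top"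
    by (rule tendsto_inverse_0_at_top[OF LL])
  have l1: "((\<lambda>N. ln (real (?P N) / ?y N)) \<longlongrightarrow> ln 1) champions_at_top"
    by (intro tendsto_ln r1) simp
  \<comment> \<open>The expression is \<open>rho * ln P / ln (ln N)\<close> for the largest prime
    factor \<open>P\<close>, written through the convergent quotient of \<open>P\<close> by its main
    term; its limit 1 is the origin of the factor \<open>rho\<close> in the result.\<close>
  have "((\<lambda>N. 1 + (ln a_const + rho * ln (real (?P N) / ?y N)) * inverse (?LL N)) \<longlongrightarrow> 1 + (ln a_const + rho * ln 1) * 0) champions_at_top"
    by (intro tendsto_intros l1 inv)
  then have lnP: "((\<lambda>N. 1 + (ln a_const + rho * ln (real (?P N) / ?y N)) * inverse (?LL N)) \<longlongrightarrow> 1) champions_at_top"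
    by simp
  have lim: "((\<lambda>N. (real (primepi (?P N)) * ln (real (?P N)) / real (?P N)) * (real (?P N) / ?y N)
      * inverse (1 + (ln a_const + rho * ln (real (?P N) / ?y N)) * inverse (?LL N))) \<longlongrightarrow> 1 * 1 * inverse 1) champions_at_top"
    by (intro tendsto_mult pnt r1 tendsto_inverse lnP) simp
  have evP: "eventually (\<lambda>N. ?P N \<ge> 2) champions_at_top" using lP by (simp add: filterlim_at_top)
  have evL: "eventually (\<lambda>N. ?LL N > 0) champions_at_top" using LL by (simp add: filterlim_at_top_dense)
  have "eventually (\<lambda>N. (real (primepi (?P N)) * ln (real (?P N)) / real (?P N)) * (real (?P N) / ?y N)
      * inverse (1 + (ln a_const + rho * ln (real (?P N) / ?y N)) * inverse (?LL N))
      = real (distinct_prime_count N) / (rho * a_const powr (1 / rho) * (ln (real N) powr (1 / rho) / ?LL N))) champions_at_top"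
    using evP evL eventually_ln_N_pos eventually_champions
  proof eventually_elim
    case (elim N)
    define p where "p = real (?P N)"
    define l where "l = ln (real N)"
    have p: "p \<ge> 2" "ln p > 0" using elim(1) by (auto simp: p_def)
    have l: "l > 0" "ln l > 0" using elim by (auto simp: l_def)
    have y: "?y N > 0" using l a_const_pos by (simp add: l_def[symmetric])
    have w: "real (distinct_prime_count N) = real (primepi (?P N))" using distinct_prime_count_eq elim(4) by simp
    have lny: "ln (?y N) = (ln a_const + ln l) / rho"
      using l a_const_pos by (simp add: ln_powr ln_mult l_def)
    have "ln (p / ?y N) = ln p - ln (?y N)" using p y by (intro ln_divide_pos) auto
    then have "rho * ln (p / ?y N) = rho * ln p - (ln a_const + ln l)" using rho unfolding lny by (simp add: right_diff_distrib)
    then have "1 + (ln a_const + rho * ln (p / ?y N)) * inverse (ln l) = rho * ln p / ln l"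
      using l by (simp add: field_simps)
    moreover have "?y N = a_const powr (1 / rho) * l powr (1 / rho)"
      using l a_const_pos by (simp add: powr_mult l_def)
    ultimately show ?case
      unfolding w p_def[symmetric] l_def[symmetric] using p l rho a_const_pos by (simp add: field_simps)
  qed
  from Lim_transform_eventually[OF lim this]
  have "((\<lambda>N. real (distinct_prime_count N) / (rho * a_const powr (1 / rho) * (ln (real N) powr (1 / rho) / ?LL N))) \<longlongrightarrow> 1) champions_at_top"
    by simp
  then show ?thesis by (rule asymp_equivI')
qed

theorem mainTheorem4:
  shows
    "(\<exists>N0. \<forall>N \<ge> N0. \<forall>(k::nat) (\<alpha> :: nat \<Rightarrow> nat).
        K_champion N \<and> 1 \<le> k \<and> N = (\<Prod>i = 1..k. nth_prime i ^ \<alpha> i) \<and>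
        (\<forall>i j. 1 \<le> i \<and> i \<le> j \<and> j \<le> k \<longrightarrow> \<alpha> j \<le> \<alpha> i) \<and> 1 \<le> \<alpha> k
        \<longrightarrow> \<alpha> k = 1)
     \<and> (\<forall>j::nat. 1 \<le> j \<longrightarrow>
          (\<lambda>N. real (largest_prime_pow j N))
            \<sim>[champions_at_top] (\<lambda>N. (a_const * ln (real N) / real j) powr (1 / rho))
        \<and> (\<lambda>N. (a_const * ln (real N) / real j) powr (1 / rho))
            \<sim>[champions_at_top] (\<lambda>N. real j powr (- 1 / rho) * real (largest_prime_pow 1 N)))
     \<and> (\<lambda>N. real (distinct_prime_count N))
          \<sim>[champions_at_top]
            (\<lambda>N. rho * a_const powr (1 / rho) * (ln (real N) powr (1 / rho) / ln (ln (real N))))"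
proof (intro conjI allI impI)
  obtain N0 where N0: "\<And>N. N \<ge> N0 \<Longrightarrow> K_champion N \<Longrightarrow> largest_prime_pow 2 N < largest_prime_pow 1 N"
    using eventually_largest_prime_pow_2_less
    unfolding champions_at_top_def eventually_inf_principal eventually_at_top_linorder by auto
  show "\<exists>N0. \<forall>N \<ge> N0. \<forall>(k::nat) (\<alpha> :: nat \<Rightarrow> nat).
        K_champion N \<and> 1 \<le> k \<and> N = (\<Prod>i = 1..k. nth_prime i ^ \<alpha> i) \<and>
        (\<forall>i j. 1 \<le> i \<and> i \<le> j \<and> j \<le> k \<longrightarrow> \<alpha> j \<le> \<alpha> i) \<and> 1 \<le> \<alpha> k
        \<longrightarrow> \<alpha> k = 1"
  proof (intro exI[of _ N0] allI impI)
    fix N k :: nat and \<alpha> :: "nat \<Rightarrow> nat"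
    assume "N0 \<le> N" and A: "K_champion N \<and> 1 \<le> k \<and> N = (\<Prod>i = 1..k. nth_prime i ^ \<alpha> i) \<and>
        (\<forall>i j. 1 \<le> i \<and> i \<le> j \<and> j \<le> k \<longrightarrow> \<alpha> j \<le> \<alpha> i) \<and> 1 \<le> \<alpha> k"
    show "\<alpha> k = 1"
    proof (rule last_exponent_eq_1[of N k \<alpha>])
      show "N > 0" using A unfolding K_champion_def by blast
      show "largest_prime_pow 2 N < largest_prime_pow 1 N" using N0 \<open>N0 \<le> N\<close> A by blast
      show "1 \<le> k" "N = (\<Prod>i = 1..k. nth_prime i ^ \<alpha> i)" "1 \<le> \<alpha> k" using A by auto
    qed
  qed
qed (simp_all only: largest_prime_pow_asymp_equiv main_term_asymp_largest_prime distinct_prime_count_asymp)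

end
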